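(* Let $0<p<\infty$ and let $\alpha$ be an integer with $\alpha\ge[Q(\frac1p-1)]$. There is a constant $C_{p,n,\alpha}$ depending only on $p,n,\alpha$ such that for every $(p,\infty,\alpha)$-atom $a$ on $\mathscr H^{n-1}$, the function $\mathcal P(a)$ belongs to $H^p(\mathscr U)$ and $$\|\mathcal P(a)\|_{H^p(\mathscr U)}\le C_{p,n,\alpha}.$$
   Context: Let $n\ge2$. $\mathbb H$ denotes the quaternions. The quaternionic Heisenberg group $\mathscr H^{n-1}$ is $\mathbb R^{4n-1}=\mathbb R^3\times\mathbb R^{4n-4}$ with the product $(\bm t,\bm y)\cdot(\bm t',\bm y')=(\bm t+\bm t'+B(\bm y,\bm y'),\bm y+\bm y')$, $B=(B_1,B_2,B_3)$, $B_\alpha(\bm y,\bm y')=2\sum_{l=0}^{n-2}\sum_{j,k=1}^4 b^\alpha_{kj}y_{4l+k}y'_{4l+j}$, where $b^1=\begin{pmatrix}0&1&0&0\\-1&0&0&0\\0&0&0&-1\\0&0&1&0\end{pmatrix}$, $b^2=\begin{pmatrix}0&0&1&0\\0&0&0&1\\-1&0&0&0\\0&-1&0&0\end{pmatrix}$, $b^3=\begin{pmatrix}0&0&0&1\\0&0&-1&0\\0&1&0&0\\-1&0&0&0\end{pmatrix}$. The homogeneous norm is $\|(\bm t,\bm y)\|=(|\bm y|^4+|\bm t|^2)^{1/4}$, $d(g,g')=\|g'^{-1}\cdot g\|$, $B(g,r)=\{g':d(g,g')<r\}$, $Q=4n+2$; $dg$ and $|\cdot|$ denote Lebesgue measure on $\mathbb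 R^{4n-1}$. Left-invariant vector fields: $Y_{4l+j}=\partial_{y_{4l+j}}+2\sum_{\alpha=1}^3\sum_{k=1}^4 b^\alpha_{kj}y_{4l+k}\partial_{t_\alpha}$ ($l=0,\dots,n-2$, $j=1,\dots,4$). Let $\mathscr U=(0,\infty)\times\mathscr H^{n-1}$ with coordinates $(t,\bm t,\bm y)$. A $C^1$ function $f:\mathscr U\to\mathbb H$ is regular if $\overline Q_mf=0$ for $m=0,\dots,n-1$, where $\overline Q_0=\partial_t+\mathbf i\partial_{t_1}+\mathbf j\partial_{t_2}+\mathbf k\partial_{t_3}$ and $\overline Q_{l+1}=Y_{4l+1}+\mathbf iY_{4l+2}+\mathbf jY_{4l+3}+\mathbf kY_{4l+4}$, $l=0,\dots,n-2$. $H^p(\mathscr U)$ is the set of regular $F$ on $\mathscr U$ with $\|F\|_{H^p(\mathscr U)}=\big(\sup_{\varepsilon>0}\int_{\mathscr H^{n-1}}|F(\varepsilon,g)|^pdg\big)^{1/p}<\infty$. Cauchy--Szegő projection: for $\sigma=x_1+x_2\mathbf i+x_3\mathbf j+x_4\mathbf k\in\mathbb H\setminus\{0\}$ put $s(\sigma)=c_{n-1}\dfrac{\partial^{2(n-1)}}{\partial x_1^{2(n-1)}}\dfrac{\overline\sigma}{|\sigma|^4}$, and $S(q,p)=s\big(q_1+\overline p_1-2\sum_{k=2}^n\overline p_kq_k\big)$ for $q,p\in\mathbb H^n$. Identify $\bm t\in\mathbb R^3$ with $t_1\mathbf i+t_2\mathbf j+t_3\mathbf k$ and $\mathbb R^{4n-4}$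 with $\mathbb H^{n-1}$ (consecutive blocks of four real coordinates). For $t>0$, $g=(\bm t,\bm x)$, $g'=(\bm s,\bm y)\in\mathscr H^{n-1}$, $K((t,g),g')=S\big((t+|\bm x|^2+\bm t,\bm x),(|\bm y|^2+\bm s,\bm y)\big)$. For $f\in L^2(\mathscr H^{n-1})$ ($\mathbb H$-valued), $(\mathcal Pf)(t,g)=\int_{\mathscr H^{n-1}}K((t,g),g')f(g')\,dg'$ for $(t,g)\in\mathscr U$. Here $c_{n-1}$ is the nonzero real constant, depending only on $n$, for which $\mathcal P f^b=f$ for every $f\in H^2(\mathscr U)$ with boundary value $f^b$ (so that $\mathcal P$ is the orthogonal projection of $L^2(\mathscr H^{n-1})$ onto boundary values of $H^2(\mathscr U)$). An $\mathbb H$-valued function $a$ on $\mathscr H^{n-1}$ is a $(p,\infty,\alpha)$-atom if (i) there is a ball $B(g_0,r)$ with $\operatorname{supp}a\subset B(g_0,r)$ and $a\in L^\infty$; (ii) $\|a\|_{L^\infty}\le|B(g_0,r)|^{-1/p}$; (iii) $\int P(g)a(g)\,dg=0$ for every quaternion-valued polynomial $P$ of homogeneous degree $\le\alpha$, where the monomial $\prod_j y_j^{i_j}\prod_\beta t_\beta^{i_{4n-4+\beta}}$ has homogeneous degree $\sum_{j\le 4n-4}i_j+2\sum_{\beta=1}^{3}i_{4n-4+\beta}$. *)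

theory Defs
  imports "HOL-Analysis.Analysis" "HOL-Probability.Essential_Supremum"
begin

section \<open>Quaternions\<close>

codatatype quat = Quat (qRe: real) (qIm1: real) (qIm2: real) (qIm3: real)

lemma quat_eqI [intro?]:
  "qRe x = qRe y \<Longrightarrow> qIm1 x = qIm1 y \<Longrightarrow> qIm2 x = qIm2 y \<Longrightarrow> qIm3 x = qIm3 y \<Longrightarrow> x = y"
  by (rule quat.expand) simp

lemma quat_eq_iff:
  "x = y \<longleftrightarrow> qRe x = qRe y \<and> qIm1 x = qIm1 y \<and> qIm2 x = qIm2 y \<and> qIm3 x = qIm3 y"
  by (auto intro: quat.expand)

instantiation quat :: ab_group_add
begin

primcorec zero_quat where
  "qRe 0 = 0" | "qIm1 0 = 0" | "qIm2 0 = 0" | "qIm3 0 = 0"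

primcorec plus_quat where
  "qRe (x + y) = qRe x + qRe y"
| "qIm1 (x + y) = qIm1 x + qIm1 y"
| "qIm2 (x + y) = qIm2 x + qIm2 y"
| "qIm3 (x + y) = qIm3 x + qIm3 y"

primcorec uminus_quat where
  "qRe (- x) = - qRe x"
| "qIm1 (- x) = - qIm1 x"
| "qIm2 (- x) = - qIm2 x"
| "qIm3 (- x) = - qIm3 x"

primcorec minus_quat where
  "qRe (x - y) = qRe x - qRe y"
| "qIm1 (x - y) = qIm1 x - qIm1 y"
| "qIm2 (x - y) = qIm2 x - qIm2 y"
| "qIm3 (x - y) = qIm3 x - qIm3 y"

instance
  by standard (simp_all add: quat_eq_iff)

end

instantiation quat :: ring_1
begin

primcorec one_quat where
  "qRe 1 = 1" | "qIm1 1 = 0" | "qIm2 1 = 0" | "qIm3 1 = 0"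

primcorec times_quat where
  "qRe (x * y) = qRe x * qRe y - qIm1 x * qIm1 y - qIm2 x * qIm2 y - qIm3 x * qIm3 y"
| "qIm1 (x * y) = qRe x * qIm1 y + qIm1 x * qRe y + qIm2 x * qIm3 y - qIm3 x * qIm2 y"
| "qIm2 (x * y) = qRe x * qIm2 y - qIm1 x * qIm3 y + qIm2 x * qRe y + qIm3 x * qIm1 y"
| "qIm3 (x * y) = qRe x * qIm3 y + qIm1 x * qIm2 y - qIm2 x * qIm1 y + qIm3 x * qRe y"

instance
  by standard (simp_all add: quat_eq_iff algebra_simps)

end

primcorec qi :: quat where "qRe qi = 0" | "qIm1 qi = 1" | "qIm2 qi = 0" | "qIm3 qi = 0"
primcorec qj :: quat where "qRe qj = 0" | "qIm1 qj = 0" | "qIm2 qj = 1" | "qIm3 qj = 0"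
primcorec qk :: quat where "qRe qk = 0" | "qIm1 qk = 0" | "qIm2 qk = 0" | "qIm3 qk = 1"

primcorec qcnj :: "quat \<Rightarrow> quat" where
  "qRe (qcnj x) = qRe x"
| "qIm1 (qcnj x) = - qIm1 x"
| "qIm2 (qcnj x) = - qIm2 x"
| "qIm3 (qcnj x) = - qIm3 x"

instantiation quat :: real_algebra_1
begin

primcorec scaleR_quat where
  "qRe (scaleR r x) = r * qRe x"
| "qIm1 (scaleR r x) = r * qIm1 x"
| "qIm2 (scaleR r x) = r * qIm2 x"
| "qIm3 (scaleR r x) = r * qIm3 x"

instance
  by standard (simp_all add: quat_eq_iff algebra_simps)

end

instantiation quat :: real_inner
begin

definition inner_quat :: "quat \<Rightarrow> quat \<Rightarrow> real" where
  "inner_quat x y = qRe x * qRe y + qIm1 x * qIm1 y + qIm2 x * qIm2 y + qIm3 x * qIm3 y"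

definition norm_quat :: "quat \<Rightarrow> real" where
  "norm_quat x = sqrt (inner x x)"

definition sgn_quat :: "quat \<Rightarrow> quat" where
  "sgn_quat x = x /\<^sub>R norm x"

definition dist_quat :: "quat \<Rightarrow> quat \<Rightarrow> real" where
  "dist_quat x y = norm (x - y)"

definition uniformity_quat :: "(quat \<times> quat) filter" where
  "uniformity_quat = (INF e\<in>{0 <..}. principal {(x, y). dist x y < e})"

definition open_quat :: "quat set \<Rightarrow> bool" where
  "open_quat U \<longleftrightarrow> (\<forall>x\<in>U. eventually (\<lambda>(x', y). x' = x \<longrightarrow> y \<in> U) uniformity)"

instance
proof
  fix x y z :: quat and r :: real
  show "inner x y = inner y x"
    by (simp add: inner_quat_def algebra_simps)
  show "inner (x + y) z = inner x z + inner y z"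
    by (simp add: inner_quat_def algebra_simps)
  show "inner (scaleR r x) y = r * inner x y"
    by (simp add: inner_quat_def algebra_simps)
  show "0 \<le> inner x x"
    by (simp add: inner_quat_def)
  show "inner x x = 0 \<longleftrightarrow> x = 0"
    by (simp add: inner_quat_def quat_eq_iff add_nonneg_eq_0_iff)
qed (rule norm_quat_def sgn_quat_def dist_quat_def uniformity_quat_def open_quat_def)+

end

instantiation quat :: real_normed_div_algebra
begin

definition inverse_quat :: "quat \<Rightarrow> quat" where
  "inverse_quat x = qcnj x /\<^sub>R (norm x)\<^sup>2"

definition divide_quat :: "quat \<Rightarrow> quat \<Rightarrow> quat" where
  "divide_quat x y = x * inverse y"

instance
proof
  fix x y :: quat
  show "x \<noteq> 0 \<Longrightarrow> inverse x * x = 1"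
  proof -
    assume "x \<noteq> 0"
    moreover have "qcnj x * x = (norm x)\<^sup>2 *\<^sub>R 1"
      by (simp add: quat_eq_iff power2_norm_eq_inner inner_quat_def)
    ultimately show ?thesis
      by (simp add: inverse_quat_def)
  qed
  show "x \<noteq> 0 \<Longrightarrow> x * inverse x = 1"
  proof -
    assume "x \<noteq> 0"
    moreover have "x * qcnj x = (norm x)\<^sup>2 *\<^sub>R 1"
      by (simp add: quat_eq_iff power2_norm_eq_inner inner_quat_def)
    ultimately show ?thesis
      by (simp add: inverse_quat_def)
  qed
  show "x div y = x * inverse y"
    by (rule divide_quat_def)
  show "inverse (0::quat) = 0"
    by (simp add: inverse_quat_def)
  have "(norm (x * y))\<^sup>2 = (norm x * norm y)\<^sup>2"
    unfolding power_mult_distrib power2_norm_eq_inner inner_quat_def times_quat.sel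
    by (simp add: algebra_simps)
  then show "norm (x * y) = norm x * norm y"
    by (simp add: power2_eq_iff_nonneg)
qed

end

instantiation quat :: euclidean_space
begin

definition Basis_quat :: "quat set" where "Basis_quat = {1, qi, qj, qk}"

instance
proof
  show "(Basis :: quat set) \<noteq> {}" "finite (Basis :: quat set)"
    by (simp_all add: Basis_quat_def)
  show "inner u v = (if u = v then 1 else 0)" if "u \<in> Basis" "v \<in> Basis" for u v :: quat
    using that unfolding Basis_quat_def inner_quat_def quat_eq_iff by auto
  show "(\<forall>u\<in>Basis. inner x u = 0) \<longleftrightarrow> x = 0" for x :: quat
    by (auto simp: Basis_quat_def inner_quat_def intro: quat_eqI)
qed

end


section \<open>The quaternionic Heisenberg group\<close>

text \<open>
  Throughout, \<open>n = CARD('m) + 1 \<ge> 2\<close>.  A point of the group of dimension \<open>4n - 1\<close> is a pair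
  \<open>(t, y)\<close>; the coordinate \<open>y\<^bsub>4l+j\<^esub>\<close> is \<open>y $ l $ j\<close>, where the block index \<open>l\<close> ranges over \<open>'m\<close>
  and \<open>j\<close> over the type \<open>4\<close>, whose elements are \<open>1, 2, 3\<close> and \<open>4 = 0\<close>.
\<close>

type_synonym 'm heis = "(real^3) \<times> (real^4^'m)"

definition bmat :: "3 \<Rightarrow> real^4^4" where
  "bmat \<alpha> =
    (if \<alpha> = 1 then
       vector [vector [ 0,  1,  0,  0],
               vector [-1,  0,  0,  0],
               vector [ 0,  0,  0, -1],
               vector [ 0,  0,  1,  0]]
     else if \<alpha> = 2 then
       vector [vector [ 0,  0,  1,  0],
               vector [ 0,  0,  0,  1],
               vector [-1,  0,  0,  0],
               vector [ 0, -1,  0,  0]]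
     else
       vector [vector [ 0,  0,  0,  1],
               vector [ 0,  0, -1,  0],
               vector [ 0,  1,  0,  0],
               vector [-1,  0,  0,  0]])"

definition hform :: "real^4^'m::finite \<Rightarrow> real^4^'m \<Rightarrow> real^3" where
  "hform y y' = (\<chi> \<alpha>. 2 * (\<Sum>l\<in>UNIV. \<Sum>j\<in>UNIV. \<Sum>k\<in>UNIV. bmat \<alpha> $ k $ j * y $ l $ k * y' $ l $ j))"

definition hmult :: "'m::finite heis \<Rightarrow> 'm heis \<Rightarrow> 'm heis" where
  "hmult g g' = (fst g + fst g' + hform (snd g) (snd g'), snd g + snd g')"

text \<open>The matrices \<open>bmat \<alpha>\<close> are skew-symmetric, so this is the group inverse.\<close>

definition hinv :: "'m::finite heis \<Rightarrow> 'm heis" where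
  "hinv g = (- fst g, - snd g)"

definition hnorm :: "'m::finite heis \<Rightarrow> real" where
  "hnorm g = (norm (snd g) ^ 4 + (norm (fst g))\<^sup>2) powr (1/4)"

definition hdist :: "'m::finite heis \<Rightarrow> 'm heis \<Rightarrow> real" where
  "hdist g g' = hnorm (hmult (hinv g') g)"

definition hball :: "'m::finite heis \<Rightarrow> real \<Rightarrow> 'm heis set" where
  "hball g r = {g'. hdist g g' < r}"


section \<open>Regular functions and Hardy spaces\<close>

type_synonym 'm siegel = "real \<times> 'm heis"

definition siegel :: "'m::finite siegel set" where
  "siegel = {0<..} \<times> UNIV"

definition C1_on :: "('a::real_normed_vector \<Rightarrow> 'b::real_normed_vector) \<Rightarrow> 'a set \<Rightarrow> bool" where
  "C1_on f U \<longleftrightarrow>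
     (\<exists>f'. (\<forall>x\<in>U. (f has_derivative blinfun_apply (f' x)) (at x)) \<and> continuous_on U f')"

definition pd :: "'a::real_normed_vector \<Rightarrow> ('a \<Rightarrow> 'b::real_normed_vector) \<Rightarrow> 'a \<Rightarrow> 'b" where
  "pd v f x = frechet_derivative f (at x) v"

definition pd_t :: "('m::finite siegel \<Rightarrow> quat) \<Rightarrow> 'm siegel \<Rightarrow> quat" where
  "pd_t = pd (1, 0, 0)"

definition pd_tt :: "3 \<Rightarrow> ('m::finite siegel \<Rightarrow> quat) \<Rightarrow> 'm siegel \<Rightarrow> quat" where
  "pd_tt \<alpha> = pd (0, axis \<alpha> 1, 0)"

definition pd_y :: "'m \<Rightarrow> 4 \<Rightarrow> ('m::finite siegel \<Rightarrow> quat) \<Rightarrow> 'm siegel \<Rightarrow> quat" where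
  "pd_y l j = pd (0, 0, axis l (axis j 1))"

definition Yfield :: "'m \<Rightarrow> 4 \<Rightarrow> ('m::finite siegel \<Rightarrow> quat) \<Rightarrow> 'm siegel \<Rightarrow> quat" where
  "Yfield l j f x = pd_y l j f x +
     2 * (\<Sum>\<alpha>\<in>UNIV. \<Sum>k\<in>UNIV. (bmat \<alpha> $ k $ j * snd (snd x) $ l $ k) *\<^sub>R pd_tt \<alpha> f x)"

definition Qbar0 :: "('m::finite siegel \<Rightarrow> quat) \<Rightarrow> 'm siegel \<Rightarrow> quat" where
  "Qbar0 f x = pd_t f x + qi * pd_tt 1 f x + qj * pd_tt 2 f x + qk * pd_tt 3 f x"

definition Qbar :: "'m \<Rightarrow> ('m::finite siegel \<Rightarrow> quat) \<Rightarrow> 'm siegel \<Rightarrow> quat" where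
  "Qbar l f x = Yfield l 1 f x + qi * Yfield l 2 f x + qj * Yfield l 3 f x + qk * Yfield l 4 f x"

definition regular :: "('m::finite siegel \<Rightarrow> quat) \<Rightarrow> bool" where
  "regular f \<longleftrightarrow> C1_on f siegel \<and> (\<forall>x\<in>siegel. Qbar0 f x = 0 \<and> (\<forall>l. Qbar l f x = 0))"

text \<open>The \<open>p\<close>-th power of the Hardy norm, before it is known to be finite.\<close>

definition hardy_sup :: "real \<Rightarrow> ('m::finite siegel \<Rightarrow> quat) \<Rightarrow> ennreal" where
  "hardy_sup p f = (SUP \<epsilon>\<in>{0<..}. \<integral>\<^sup>+g. ennreal (norm (f (\<epsilon>, g)) powr p) \<partial>lebesgue)"

definition hardy_space :: "real \<Rightarrow> ('m::finite siegel \<Rightarrow> quat) set" where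
  "hardy_space p = {f. regular f \<and> hardy_sup p f < \<infinity>}"

definition hardy_norm :: "real \<Rightarrow> ('m::finite siegel \<Rightarrow> quat) \<Rightarrow> real" where
  "hardy_norm p f = enn2real (hardy_sup p f) powr (1/p)"


section \<open>The Cauchy--Szego projection\<close>

definition quat_of_t :: "real^3 \<Rightarrow> quat" where
  "quat_of_t t = Quat 0 (t $ 1) (t $ 2) (t $ 3)"

definition quat_of_y :: "real^4^'m::finite \<Rightarrow> quat^'m" where
  "quat_of_y y = (\<chi> l. Quat (y $ l $ 1) (y $ l $ 2) (y $ l $ 3) (y $ l $ 4))"

text \<open>
  The constructions below are parametrised by the normalising constant \<open>c\<close>, which is only
  determined afterwards, by the reproducing property.  The type argument carries \<open>n\<close>, and
  \<open>pd 1\<close> is the partial derivative with respect to the real part of the quaternion variable.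
\<close>

definition szego_s :: "'m::finite itself \<Rightarrow> real \<Rightarrow> quat \<Rightarrow> quat" where
  "szego_s m c \<sigma> = c *\<^sub>R (pd 1 ^^ (2 * CARD('m))) (\<lambda>\<tau>. qcnj \<tau> /\<^sub>R norm \<tau> ^ 4) \<sigma>"

text \<open>A point of \<open>\<H>\<^sup>n\<close> is given as its first component together with the remaining ones.\<close>

definition szego_S :: "real \<Rightarrow> quat \<times> (quat^'m) \<Rightarrow> quat \<times> (quat^'m::finite) \<Rightarrow> quat" where
  "szego_S c q p =
     szego_s TYPE('m) c (fst q + qcnj (fst p) - 2 * (\<Sum>k\<in>UNIV. qcnj (snd p $ k) * snd q $ k))"

definition szego_K :: "real \<Rightarrow> 'm::finite siegel \<Rightarrow> 'm heis \<Rightarrow> quat" where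
  "szego_K c = (\<lambda>(t, \<tau>, x) (\<rho>, y).
     szego_S c (of_real (t + (norm x)\<^sup>2) + quat_of_t \<tau>, quat_of_y x)
               (of_real ((norm y)\<^sup>2) + quat_of_t \<rho>, quat_of_y y))"

definition szego_op :: "real \<Rightarrow> ('m::finite heis \<Rightarrow> quat) \<Rightarrow> 'm siegel \<Rightarrow> quat" where
  "szego_op c f x = (LINT g'|lebesgue. szego_K c x g' * f g')"

definition L2 :: "('m::finite heis \<Rightarrow> quat) set" where
  "L2 = {f \<in> borel_measurable lebesgue. integrable lebesgue (\<lambda>g. (norm (f g))\<^sup>2)}"

text \<open>The boundary value is the limit of the slices \<open>f (\<epsilon>, \<cdot>)\<close> in the \<open>L\<^sup>2\<close> norm.\<close>

definition boundary_value :: "('m::finite siegel \<Rightarrow> quat) \<Rightarrow> ('m heis \<Rightarrow> quat) \<Rightarrow> bool" where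
  "boundary_value f fb \<longleftrightarrow> fb \<in> L2 \<and>
     ((\<lambda>\<epsilon>. \<integral>\<^sup>+g. ennreal ((norm (f (\<epsilon>, g) - fb g))\<^sup>2) \<partial>lebesgue) \<longlongrightarrow> 0) (at_right 0)"

definition szego_const :: "'m::finite itself \<Rightarrow> real" where
  "szego_const m = (THE c. c \<noteq> 0 \<and>
     (\<forall>(f :: 'm siegel \<Rightarrow> quat) fb. f \<in> hardy_space 2 \<and> boundary_value f fb \<longrightarrow>
        (\<forall>x\<in>siegel. szego_op c fb x = f x)))"

definition cauchy_szego :: "('m::finite heis \<Rightarrow> quat) \<Rightarrow> 'm siegel \<Rightarrow> quat" where
  "cauchy_szego = szego_op (szego_const TYPE('m))"


section \<open>Atoms\<close>

text \<open>
  A monomial is given by the exponents \<open>i\<close> of the coordinates \<open>y\<close> and \<open>j\<close> of the coordinates \<open>t\<close>.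
\<close>

definition hmonom :: "('m::finite \<Rightarrow> 4 \<Rightarrow> nat) \<times> (3 \<Rightarrow> nat) \<Rightarrow> 'm heis \<Rightarrow> real" where
  "hmonom = (\<lambda>(i, j) (t, y).
     (\<Prod>l\<in>UNIV. \<Prod>k\<in>UNIV. (y $ l $ k) ^ i l k) * (\<Prod>\<beta>\<in>UNIV. (t $ \<beta>) ^ j \<beta>))"

definition hdeg :: "('m::finite \<Rightarrow> 4 \<Rightarrow> nat) \<times> (3 \<Rightarrow> nat) \<Rightarrow> nat" where
  "hdeg = (\<lambda>(i, j). (\<Sum>l\<in>UNIV. \<Sum>k\<in>UNIV. i l k) + 2 * (\<Sum>\<beta>\<in>UNIV. j \<beta>))"

text \<open>For \<open>\<alpha> < 0\<close> the zero polynomial is the only element.\<close>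

definition hpolys :: "int \<Rightarrow> ('m::finite heis \<Rightarrow> quat) set" where
  "hpolys \<alpha> = {P. \<exists>I c. finite I \<and> (\<forall>i\<in>I. int (hdeg i) \<le> \<alpha>) \<and>
                        P = (\<lambda>g. \<Sum>i\<in>I. hmonom i g *\<^sub>R c i)}"

definition Linf_norm :: "('m::finite heis \<Rightarrow> quat) \<Rightarrow> ennreal" where
  "Linf_norm a = esssup lebesgue (\<lambda>g. ennreal (norm (a g)))"

definition Linf :: "('m::finite heis \<Rightarrow> quat) set" where
  "Linf = {a \<in> borel_measurable lebesgue. Linf_norm a < \<infinity>}"

definition atom :: "real \<Rightarrow> int \<Rightarrow> ('m::finite heis \<Rightarrow> quat) \<Rightarrow> bool" where
  "atom p \<alpha> a \<longleftrightarrow>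
     (\<exists>g0 r. 0 < r \<and> closure {g. a g \<noteq> 0} \<subseteq> hball g0 r \<and> a \<in> Linf \<and>
             Linf_norm a \<le> ennreal (measure lebesgue (hball g0 r) powr (- 1 / p))) \<and>
     (\<forall>P\<in>hpolys \<alpha>. (LINT g|lebesgue. P g * a g) = 0)"

end

theory Submission
  imports Defs
begin

text \<open>
  On the slice at height \<open>\<epsilon>\<close> the Cauchy--Szego operator is, up to a real factor, right convolution
  with a kernel \<open>ker \<epsilon>\<close> on the group; the value of the factor does not matter for the estimate.

  Near the support of the atom: integrating the kernel over the centre and then over the horizontal
  variables gives the semigroup law \<open>ker \<epsilon> * ker \<epsilon>' = c ker (\<epsilon> + \<epsilon>')\<close>. Since the operator at height
  \<open>\<epsilon>\<close> is self-adjoint, this bounds it on \<open>L\<^sup>2\<close> uniformly in \<open>\<epsilon>\<close> without any almost orthogonality. A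
  Vitali covering of the set where the function is large then yields bounds on the ball for every
  exponent.

  Far from the support: the kernel is a noncommutative polynomial in inverses of quaternions, so it has
  an explicit expansion in homogeneous polynomials, and the vanishing moments remove all terms of
  degree at most \<open>\<alpha>\<close>. What remains decays with an exponent whose product with \<open>p\<close> exceeds the
  homogeneous dimension.
\<close>

section \<open>Quaternions\<close>

text \<open>Two obstacles shape the argument. An L2 bound controls only exponents up to 2 on the
  ball, whereas p is arbitrary; the remedy is a self-improving inequality that halves the constant
  of any local bound up to a fixed additive term, so that a bound with a bad constant suffices to
  start. And the quaternions do not commute: the kernel multiplies from the left, so every identity
  has to keep the order of its factors, and moments are taken with the polynomial on the left of the
  atom. The semigroup law rests on Cauchy's formula. The kernel of order 0 is the Cauchy-Fueter
  kernel, regular from both sides, so a convolution over the centre is a Cauchy integral over a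
  hyperplane; harmonicity then removes a Hermitian cross term, and the remaining horizontal integral
  is radial. The threshold for \<alpha> is exactly what the far region asks for: for
  \<open>\<alpha> \<ge> 0\<close> and \<open>N = \<alpha> + 1\<close> it says
  \<open>p * (Q + N) > Q\<close>, where \<open>Q + N\<close> is the decay exponent left by
  \<open>N\<close> cancelled orders.\<close>

lemma qcnj_add [simp]: "qcnj (x + y) = qcnj x + qcnj y"
  and qcnj_diff [simp]: "qcnj (x - y) = qcnj x - qcnj y"
  and qcnj_minus [simp]: "qcnj (- x) = - qcnj x"
  and qcnj_mult [simp]: "qcnj (x * y) = qcnj y * qcnj x"
  and qcnj_scaleR [simp]: "qcnj (r *\<^sub>R x) = r *\<^sub>R qcnj x"
  and qcnj_qcnj [simp]: "qcnj (qcnj x) = x"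
  and qcnj_0 [simp]: "qcnj 0 = 0"
  and qcnj_1 [simp]: "qcnj 1 = 1"
  by (simp_all add: quat_eq_iff algebra_simps)

lemma of_real_quat_sel [simp]:
  "qRe (of_real r) = r" "qIm1 (of_real r) = 0" "qIm2 (of_real r) = 0" "qIm3 (of_real r) = 0"
  by (simp_all add: of_real_def)

lemma norm_quat_sq: "(norm x)\<^sup>2 = (qRe x)\<^sup>2 + (qIm1 x)\<^sup>2 + (qIm2 x)\<^sup>2 + (qIm3 x)\<^sup>2" for x :: quat
  unfolding power2_norm_eq_inner inner_quat_def by (simp add: power2_eq_square)

lemma norm_quat_mult_self:
  "norm x * norm x = qRe x * qRe x + qIm1 x * qIm1 x + qIm2 x * qIm2 x + qIm3 x * qIm3 x" for x :: quat
  using norm_quat_sq[of x] by (simp add: power2_eq_square)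

lemma norm_qcnj [simp]: "norm (qcnj x) = norm x"
proof -
  have "(norm (qcnj x))\<^sup>2 = (norm x)\<^sup>2" by (simp add: norm_quat_sq)
  then show ?thesis by (simp add: power2_eq_iff_nonneg)
qed

lemma qcnj_eq_0_iff [simp]: "qcnj x = 0 \<longleftrightarrow> x = 0"
  by (simp add: quat_eq_iff)

lemma bounded_linear_qcnj: "bounded_linear qcnj"
  by (rule bounded_linear_intro[where K = 1]) simp_all

lemmas has_derivative_qcnj [derivative_intros] = bounded_linear.has_derivative[OF bounded_linear_qcnj]
lemmas continuous_on_qcnj [continuous_intros] = bounded_linear.continuous_on[OF bounded_linear_qcnj]

lemma inner_mult_left_quat: "inner (a * b) c = inner b (qcnj a * c)" for a b c :: quat
  by (simp add: inner_quat_def algebra_simps)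

lemma qRe_le_norm: "\<bar>qRe x\<bar> \<le> norm x"
proof -
  have "(qRe x)\<^sup>2 \<le> (norm x)\<^sup>2" by (simp add: norm_quat_sq)
  then show ?thesis using abs_le_square_iff by force
qed

lemma qcnj_mult_self: "qcnj x * x = of_real ((norm x)\<^sup>2)" "x * qcnj x = of_real ((norm x)\<^sup>2)"
  by (simp_all add: quat_eq_iff power2_eq_square norm_quat_mult_self)

lemma Basis_quat: "(Basis :: quat set) = {1, qi, qj, qk}"
  by (simp add: Basis_quat_def)

lemma norm_quat_units [simp]: "norm qi = 1" "norm qj = 1" "norm qk = 1"
  by (auto intro!: norm_Basis simp: Basis_quat)

lemma quat_expand: "v = qRe v *\<^sub>R 1 + qIm1 v *\<^sub>R qi + qIm2 v *\<^sub>R qj + qIm3 v *\<^sub>R qk"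
  by (simp add: quat_eq_iff)

lemma linear_quat_expand:
  assumes "linear f"
  shows "f v = qRe v *\<^sub>R f 1 + qIm1 v *\<^sub>R f qi + qIm2 v *\<^sub>R f qj + qIm3 v *\<^sub>R f qk"
  by (subst quat_expand[of v]) (simp only: linear_add[OF assms] linear_scale[OF assms])

section \<open>Rational functions of a quaternion variable\<close>

text \<open>
  Noncommutative polynomials in the inverses of \<open>\<sigma>\<close> and of its conjugate; this class is closed
  under directional derivatives, which makes all estimates on the Cauchy--Szego kernel algebraic.
\<close>

datatype rx = RC quat | RI | RJ | RM rx rx | RA rx rx

primrec ev :: "rx \<Rightarrow> quat \<Rightarrow> quat" where
  "ev (RC c) \<sigma> = c"
| "ev RI \<sigma> = inverse \<sigma>"
| "ev RJ \<sigma> = inverse (qcnj \<sigma>)"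
| "ev (RM a b) \<sigma> = ev a \<sigma> * ev b \<sigma>"
| "ev (RA a b) \<sigma> = ev a \<sigma> + ev b \<sigma>"

text \<open>In the derivative of an inverse the direction stands between two inverses, since factors
  do not commute. It enters as the constant \<open>RC v\<close>, so it is not differentiated
  again.\<close>

primrec rd :: "quat \<Rightarrow> rx \<Rightarrow> rx" where
  "rd v (RC c) = RC 0"
| "rd v RI = RM (RC (-1)) (RM RI (RM (RC v) RI))"
| "rd v RJ = RM (RC (-1)) (RM RJ (RM (RC (qcnj v)) RJ))"
| "rd v (RM a b) = RA (RM (rd v a) b) (RM a (rd v b))"
| "rd v (RA a b) = RA (rd v a) (rd v b)"

text \<open>A syntactic certificate of homogeneity of degree \<open>- d\<close> under positive
  scaling. The constant 0 has every degree, since \<open>rd\<close> produces it from constants and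
  \<open>hom_rd\<close> must raise the degree there too.\<close>

primrec hom :: "rx \<Rightarrow> nat \<Rightarrow> bool" where
  "hom (RC c) d \<longleftrightarrow> d = 0 \<or> c = 0"
| "hom RI d \<longleftrightarrow> d = 1"
| "hom RJ d \<longleftrightarrow> d = 1"
| "hom (RM a b) d \<longleftrightarrow> (\<exists>i j. d = i + j \<and> hom a i \<and> hom b j)"
| "hom (RA a b) d \<longleftrightarrow> hom a d \<and> hom b d"

lemma hom_RM: "hom a i \<Longrightarrow> hom b j \<Longrightarrow> hom (RM a b) (i + j)"
  by auto

lemma hom_rd: "hom e d \<Longrightarrow> hom (rd v e) (Suc d)"
proof (induction e arbitrary: d)
  case RI
  have "hom (RM (RC (-1)) (RM RI (RM (RC v) RI))) (0 + (1 + (0 + 1)))"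
    by (intro hom_RM) auto
  with RI show ?case by simp
next
  case RJ
  have "hom (RM (RC (-1)) (RM RJ (RM (RC (qcnj v)) RJ))) (0 + (1 + (0 + 1)))"
    by (intro hom_RM) auto
  with RJ show ?case by simp
next
  case (RM a b)
  then obtain i j where "d = i + j" "hom a i" "hom b j" by auto
  with RM.IH hom_RM[of "rd v a" "Suc i" b j] hom_RM[of a i "rd v b" "Suc j"]
  show ?case by (simp only: rd.simps hom.simps(5)) simp
qed auto

lemma has_derivative_ev:
  assumes "\<sigma> \<noteq> 0"
  shows "(ev e has_derivative (\<lambda>v. ev (rd v e) \<sigma>)) (at \<sigma> within S)"
proof (induction e)
  case RI
  have "((\<lambda>x. inverse x) has_derivative (\<lambda>h. - (inverse \<sigma> * h * inverse \<sigma>))) (at \<sigma> within S)"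
    using assms by (intro derivative_eq_intros) auto
  then show ?case by (simp add: mult.assoc)
next
  case RJ
  have "((\<lambda>x. inverse (qcnj x)) has_derivative (\<lambda>h. - (inverse (qcnj \<sigma>) * qcnj h * inverse (qcnj \<sigma>)))) (at \<sigma> within S)"
    using assms by (auto intro!: derivative_eq_intros)
  then show ?case by (simp add: mult.assoc)
next
  case (RM a b)
  have "((\<lambda>x. ev a x * ev b x) has_derivative (\<lambda>v. ev a \<sigma> * ev (rd v b) \<sigma> + ev (rd v a) \<sigma> * ev b \<sigma>)) (at \<sigma> within S)"
    by (rule has_derivative_mult[OF RM.IH])
  then show ?case by (simp add: add.commute)
next
  case (RA a b)
  from has_derivative_add[OF RA.IH] show ?case by simp
qed simp

lemma continuous_on_ev: "continuous_on (- {0}) (ev e)"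
  by (induction e) (auto intro!: continuous_intros simp: continuous_on_const)

lemma linear_ev_rd: "linear (\<lambda>v. ev (rd v e) \<sigma>)" if "\<sigma> \<noteq> 0"
  using has_derivative_ev[OF that, of e UNIV] has_derivative_linear by blast

text \<open>Second derivatives of the formal calculus commute by induction alone, at every point.
  This moves the real derivatives contained in \<open>Ex\<close> past derivatives in the other
  directions.\<close>

lemma ev_rd_commute: "ev (rd v (rd w e)) \<sigma> = ev (rd w (rd v e)) \<sigma>"
  by (induction e) (simp_all add: algebra_simps)

text \<open>The formal derivative is the derivative of the represented function, so away from 0 it
  depends only on that function. This permits differentiating identities such as regularity, which
  hold between values and not between expressions.\<close>

lemma ev_rd_cong:
  assumes "\<And>\<sigma>. \<sigma> \<noteq> 0 \<Longrightarrow> ev a \<sigma> = ev b \<sigma>" and "\<sigma> \<noteq> 0"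
  shows "ev (rd v a) \<sigma> = ev (rd v b) \<sigma>"
proof -
  have "(ev b has_derivative (\<lambda>v. ev (rd v a) \<sigma>)) (at \<sigma>)"
    by (rule has_derivative_transform_within_open[OF has_derivative_ev[OF assms(2)] open_Compl[OF closed_singleton[of 0]]])
       (use assms in auto)
  from has_derivative_unique[OF this has_derivative_ev[OF assms(2)]] show ?thesis by metis
qed

lemma hom_bound:
  "hom e d \<Longrightarrow> \<exists>C>0. \<forall>\<sigma>. \<sigma> \<noteq> 0 \<longrightarrow> norm (ev e \<sigma>) \<le> C * inverse (norm \<sigma>) ^ d"
proof (induction e arbitrary: d)
  case (RC c)
  then show ?case by (intro exI[of _ "norm c + 1"]) (auto intro: add_nonneg_pos)
next
  case (RM a b)
  then obtain i j where d: "d = i + j" "hom a i" "hom b j" by auto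
  obtain C C' where C: "C > 0" "C' > 0" "\<And>\<sigma>. \<sigma> \<noteq> 0 \<Longrightarrow> norm (ev a \<sigma>) \<le> C * inverse (norm \<sigma>) ^ i"
    "\<And>\<sigma>. \<sigma> \<noteq> 0 \<Longrightarrow> norm (ev b \<sigma>) \<le> C' * inverse (norm \<sigma>) ^ j"
    using RM.IH(1)[OF d(2)] RM.IH(2)[OF d(3)] by blast
  have "norm (ev (RM a b) \<sigma>) \<le> (C * C') * inverse (norm \<sigma>) ^ d" if "\<sigma> \<noteq> 0" for \<sigma>
    using mult_mono[OF C(3,4)[OF that]] C(1,2) by (simp add: norm_mult d power_add mult_ac)
  with C show ?case by (intro exI[of _ "C * C'"]) auto
next
  case (RA a b)
  obtain C C' where C: "C > 0" "C' > 0" "\<And>\<sigma>. \<sigma> \<noteq> 0 \<Longrightarrow> norm (ev a \<sigma>) \<le> C * inverse (norm \<sigma>) ^ d"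
    "\<And>\<sigma>. \<sigma> \<noteq> 0 \<Longrightarrow> norm (ev b \<sigma>) \<le> C' * inverse (norm \<sigma>) ^ d"
    using RA.IH(1)[of d] RA.IH(2)[of d] RA.prems by auto
  have "norm (ev (RA a b) \<sigma>) \<le> (C + C') * inverse (norm \<sigma>) ^ d" if "\<sigma> \<noteq> 0" for \<sigma>
    using C(3,4)[OF that] norm_triangle_ineq[of "ev a \<sigma>" "ev b \<sigma>"] by (simp add: algebra_simps)
  with C show ?case by (intro exI[of _ "C + C'"]) auto
qed (auto intro!: exI[of _ 1] simp: norm_inverse)

text \<open>\<open>hom_bound\<close> gives one constant per direction; linearity in the direction
  reduces to the four basis vectors and makes the constant uniform in \<open>v\<close>.\<close>

lemma hom_derivative_bound:
  assumes "hom e d"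
  shows "\<exists>C>0. \<forall>\<sigma> v. \<sigma> \<noteq> 0 \<longrightarrow> norm (ev (rd v e) \<sigma>) \<le> C * norm v * inverse (norm \<sigma>) ^ Suc d"
proof -
  have "\<exists>C>0. \<forall>\<sigma>. \<sigma> \<noteq> 0 \<longrightarrow> norm (ev (rd v e) \<sigma>) \<le> C * inverse (norm \<sigma>) ^ Suc d" for v
    by (rule hom_bound[OF hom_rd[OF assms]])
  then obtain C where C: "\<And>v. C v > 0"
    "\<And>v \<sigma>. \<sigma> \<noteq> 0 \<Longrightarrow> norm (ev (rd v e) \<sigma>) \<le> C v * inverse (norm \<sigma>) ^ Suc d" by metis
  show ?thesis
  proof (intro exI[of _ "\<Sum>b\<in>Basis. C b"] conjI allI impI)
    show "0 < (\<Sum>b\<in>(Basis::quat set). C b)" by (intro sum_pos C) auto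
    fix \<sigma> v :: quat assume \<sigma>: "\<sigma> \<noteq> 0"
    have "ev (rd v e) \<sigma> = (\<Sum>b\<in>Basis. inner v b *\<^sub>R ev (rd b e) \<sigma>)"
      by (subst (1) euclidean_representation[of v, symmetric])
         (simp add: linear_sum[OF linear_ev_rd[OF \<sigma>]] linear_scale[OF linear_ev_rd[OF \<sigma>]])
    also have "norm \<dots> \<le> (\<Sum>b\<in>Basis. norm v * (C b * inverse (norm \<sigma>) ^ Suc d))"
    proof (intro sum_norm_le)
      fix b :: quat assume "b \<in> Basis"
      then have "\<bar>inner v b\<bar> \<le> norm v" using Basis_le_norm by blast
      then show "norm (inner v b *\<^sub>R ev (rd b e) \<sigma>) \<le> norm v * (C b * inverse (norm \<sigma>) ^ Suc d)"
        using C(2)[OF \<sigma>, of b] by (simp only: norm_scaleR) (intro mult_mono, auto)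
    qed
    finally show "norm (ev (rd v e) \<sigma>) \<le> (\<Sum>b\<in>Basis. C b) * norm v * inverse (norm \<sigma>) ^ Suc d"
      by (simp add: sum_distrib_left sum_distrib_right mult_ac)
  qed
qed

section \<open>The kernel and its derivatives in the real direction\<close>

text \<open>\<open>qcnj \<sigma> /\<^sub>R norm \<sigma> ^ 4\<close> is the product of the inverse of \<open>qcnj \<sigma>\<close> and of the squared inverse of \<open>\<sigma>\<close>.\<close>

definition Ex :: "nat \<Rightarrow> rx" where
  "Ex k = (rd 1 ^^ k) (RM RJ (RM RI RI))"

definition kE :: "nat \<Rightarrow> quat \<Rightarrow> quat" where
  "kE k \<sigma> = ev (Ex k) \<sigma>"

definition dE :: "nat \<Rightarrow> quat \<Rightarrow> quat \<Rightarrow> quat" where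
  "dE k v \<sigma> = ev (rd v (Ex k)) \<sigma>"

lemma Ex_Suc: "Ex (Suc k) = rd 1 (Ex k)"
  by (simp add: Ex_def)

lemma dE_1: "dE k 1 \<sigma> = kE (Suc k) \<sigma>"
  by (simp add: dE_def kE_def Ex_Suc)

lemma hom_Ex: "hom (Ex k) (3 + k)"
proof (induction k)
  case 0
  have "hom (RM RJ (RM RI RI)) (1 + (1 + 1))" by (intro hom_RM) auto
  then show ?case by (simp add: Ex_def numeral_3_eq_3)
next
  case (Suc k)
  from hom_rd[OF this] show ?case by (simp add: Ex_Suc)
qed

lemma kE_0: "kE 0 \<sigma> = qcnj \<sigma> /\<^sub>R norm \<sigma> ^ 4"
proof (cases "\<sigma> = 0")
  case False
  have "inverse (qcnj \<sigma>) * (inverse \<sigma> * inverse \<sigma>) = (\<sigma> * qcnj \<sigma> * qcnj \<sigma>) /\<^sub>R norm \<sigma> ^ 6"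
    by (simp add: inverse_quat_def mult.assoc power_add[symmetric] flip: power_mult power_inverse)
  also have "\<dots> = qcnj \<sigma> /\<^sub>R norm \<sigma> ^ 4"
    using False by (simp add: qcnj_mult_self of_real_def field_simps flip: power_add)
  finally show ?thesis by (simp add: kE_def Ex_def)
qed (simp add: kE_def Ex_def)

lemma kE_has_derivative: "\<sigma> \<noteq> 0 \<Longrightarrow> (kE k has_derivative (\<lambda>v. dE k v \<sigma>)) (at \<sigma> within S)"
  unfolding kE_def[abs_def] dE_def by (rule has_derivative_ev)

lemma dE_has_derivative:
  "\<sigma> \<noteq> 0 \<Longrightarrow> (dE k v has_derivative (\<lambda>w. ev (rd w (rd v (Ex k))) \<sigma>)) (at \<sigma> within S)"
  unfolding dE_def[abs_def] by (rule has_derivative_ev)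

lemma linear_dE: "\<sigma> \<noteq> 0 \<Longrightarrow> linear (\<lambda>v. dE k v \<sigma>)"
  unfolding dE_def by (rule linear_ev_rd)

lemma continuous_on_kE: "continuous_on (- {0}) (kE k)" and continuous_on_dE: "continuous_on (- {0}) (dE k v)"
  unfolding kE_def[abs_def] dE_def[abs_def] by (rule continuous_on_ev)+

lemma kE_bound: "\<exists>C>0. \<forall>\<sigma>. \<sigma> \<noteq> 0 \<longrightarrow> norm (kE k \<sigma>) \<le> C * inverse (norm \<sigma>) ^ (3 + k)"
  unfolding kE_def by (rule hom_bound[OF hom_Ex])

lemma dE_bound: "\<exists>C>0. \<forall>\<sigma> v. \<sigma> \<noteq> 0 \<longrightarrow> norm (dE k v \<sigma>) \<le> C * norm v * inverse (norm \<sigma>) ^ (4 + k)"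
  using hom_derivative_bound[OF hom_Ex[of k]] by (simp add: dE_def add.commute)

lemma szego_s_eq:
  assumes "\<sigma> \<noteq> 0"
  shows "szego_s TYPE('m::finite) c \<sigma> = c *\<^sub>R kE (2 * CARD('m)) \<sigma>"
proof -
  have "\<forall>\<sigma>. \<sigma> \<noteq> 0 \<longrightarrow> (pd 1 ^^ k) (\<lambda>\<tau>. qcnj \<tau> /\<^sub>R norm \<tau> ^ 4) \<sigma> = kE k \<sigma>" for k
  proof (induction k)
    case (Suc k)
    show ?case
    proof (intro allI impI)
      fix \<sigma> :: quat assume \<sigma>: "\<sigma> \<noteq> 0"
      have "((pd 1 ^^ k) (\<lambda>\<tau>. qcnj \<tau> /\<^sub>R norm \<tau> ^ 4) has_derivative (\<lambda>v. dE k v \<sigma>)) (at \<sigma>)"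
        by (rule has_derivative_transform_within_open[OF kE_has_derivative[OF \<sigma>] open_Compl[OF closed_singleton[of 0]]])
           (use \<sigma> Suc in auto)
      then show "(pd 1 ^^ Suc k) (\<lambda>\<tau>. qcnj \<tau> /\<^sub>R norm \<tau> ^ 4) \<sigma> = kE (Suc k) \<sigma>"
        by (simp add: pd_def frechet_derivative_at[symmetric] dE_1)
    qed
  qed (simp add: kE_0)
  with assms show ?thesis by (simp add: szego_s_def)
qed

section \<open>Two-sided Cauchy-Fueter regularity and harmonicity of the kernel\<close>

lemma Ex_regular_0:
  assumes "\<sigma> \<noteq> 0"
  shows "dE 0 1 \<sigma> + qi * dE 0 qi \<sigma> + qj * dE 0 qj \<sigma> + qk * dE 0 qk \<sigma> = 0"
    and "dE 0 1 \<sigma> + dE 0 qi \<sigma> * qi + dE 0 qj \<sigma> * qj + dE 0 qk \<sigma> * qk = 0"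
proof -
  define N where "N = (norm \<sigma>)\<^sup>2"
  have N: "N = qRe \<sigma> * qRe \<sigma> + qIm1 \<sigma> * qIm1 \<sigma> + qIm2 \<sigma> * qIm2 \<sigma> + qIm3 \<sigma> * qIm3 \<sigma>" "N \<noteq> 0"
    using assms by (simp_all add: N_def power2_eq_square norm_quat_mult_self)
       (metis norm_quat_mult_self no_zero_divisors norm_eq_zero)
  have inv: "inverse \<sigma> = inverse N *\<^sub>R qcnj \<sigma>" "inverse (qcnj \<sigma>) = inverse N *\<^sub>R \<sigma>"
    by (simp_all add: inverse_quat_def N_def)
  have eq: "dE 0 v \<sigma> = - (inverse N ^ 4) *\<^sub>R (\<sigma> * qcnj v * \<sigma> * qcnj \<sigma> * qcnj \<sigma>
      + \<sigma> * qcnj \<sigma> * v * qcnj \<sigma> * qcnj \<sigma> + \<sigma> * qcnj \<sigma> * qcnj \<sigma> * v * qcnj \<sigma>)" for v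
    by (simp add: dE_def Ex_def inv power4_eq_xxxx algebra_simps)
  have c: "\<sigma> * qcnj \<sigma> = N *\<^sub>R 1" by (simp add: qcnj_mult_self N_def of_real_def)
  \<comment> \<open>Cancelling one factor \<open>\<sigma> * qcnj \<sigma> = N\<close> leaves a
    quadratic polynomial in \<open>\<sigma>\<close> and its conjugate over \<open>N ^ 3\<close>;
    both regularity equations are then identities between coordinates.\<close>
  have eq: "dE 0 v \<sigma> = - (inverse N ^ 3) *\<^sub>R (\<sigma> * qcnj v * qcnj \<sigma> + v * qcnj \<sigma> * qcnj \<sigma> + qcnj \<sigma> * v * qcnj \<sigma>)" for v
  proof -
    have "\<sigma> * qcnj v * \<sigma> * qcnj \<sigma> * qcnj \<sigma> = N *\<^sub>R (\<sigma> * qcnj v * qcnj \<sigma>)"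
      using c by (simp add: mult.assoc)
    moreover have "\<sigma> * qcnj \<sigma> * v * qcnj \<sigma> * qcnj \<sigma> = N *\<^sub>R (v * qcnj \<sigma> * qcnj \<sigma>)"
      "\<sigma> * qcnj \<sigma> * qcnj \<sigma> * v * qcnj \<sigma> = N *\<^sub>R (qcnj \<sigma> * v * qcnj \<sigma>)"
      by (simp_all add: c mult.assoc)
    moreover have "inverse N ^ 4 * N = inverse N ^ 3"
      using N(2) by (simp add: field_simps power4_eq_xxxx power3_eq_cube)
    ultimately show ?thesis
      by (simp only: eq scaleR_add_right[symmetric] scaleR_scaleR mult_minus_left)
  qed
  have s: "x *\<^sub>R a + b * x *\<^sub>R c + d * x *\<^sub>R e + f * x *\<^sub>R g = x *\<^sub>R (a + b * c + d * e + f * g)"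
      "x *\<^sub>R a + x *\<^sub>R c * b + x *\<^sub>R e * d + x *\<^sub>R g * f = x *\<^sub>R (a + c * b + e * d + g * f)"
    for x and a b c d e f g :: quat by (simp_all add: algebra_simps)
  show "dE 0 1 \<sigma> + qi * dE 0 qi \<sigma> + qj * dE 0 qj \<sigma> + qk * dE 0 qk \<sigma> = 0"
    unfolding eq s by (simp add: quat_eq_iff algebra_simps)
  show "dE 0 1 \<sigma> + dE 0 qi \<sigma> * qi + dE 0 qj \<sigma> * qj + dE 0 qk \<sigma> * qk = 0"
    unfolding eq s by (simp add: quat_eq_iff algebra_simps)
qed

text \<open>Differentiating the identity for \<open>k\<close> in the real direction and exchanging
  derivatives gives the one for \<open>Suc k\<close>; the units on the left are constants.\<close>

lemma kE_left_regular:
  "\<sigma> \<noteq> 0 \<Longrightarrow> dE k 1 \<sigma> + qi * dE k qi \<sigma> + qj * dE k qj \<sigma> + qk * dE k qk \<sigma> = 0"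
proof (induction k arbitrary: \<sigma>)
  case (Suc k)
  let ?D = "\<lambda>e. RA (rd 1 e) (RA (RM (RC qi) (rd qi e)) (RA (RM (RC qj) (rd qj e)) (RM (RC qk) (rd qk e))))"
  have "ev (rd 1 (?D (Ex k))) \<sigma> = ev (rd 1 (RC 0)) \<sigma>"
    by (rule ev_rd_cong[OF _ Suc.prems]) (use Suc.IH in \<open>simp add: dE_def add.assoc\<close>)
  then show ?case
    by (simp add: dE_def Ex_Suc add.assoc ev_rd_commute[of qi 1] ev_rd_commute[of qj 1] ev_rd_commute[of qk 1])
qed (rule Ex_regular_0)

lemma kE_right_regular:
  "\<sigma> \<noteq> 0 \<Longrightarrow> dE k 1 \<sigma> + dE k qi \<sigma> * qi + dE k qj \<sigma> * qj + dE k qk \<sigma> * qk = 0"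
proof (induction k arbitrary: \<sigma>)
  case (Suc k)
  let ?D = "\<lambda>e. RA (rd 1 e) (RA (RM (rd qi e) (RC qi)) (RA (RM (rd qj e) (RC qj)) (RM (rd qk e) (RC qk))))"
  have "ev (rd 1 (?D (Ex k))) \<sigma> = ev (rd 1 (RC 0)) \<sigma>"
    by (rule ev_rd_cong[OF _ Suc.prems]) (use Suc.IH in \<open>simp add: dE_def add.assoc\<close>)
  then show ?case
    by (simp add: dE_def Ex_Suc add.assoc ev_rd_commute[of qi 1] ev_rd_commute[of qj 1] ev_rd_commute[of qk 1])
qed (rule Ex_regular_0)

text \<open>The conjugate Cauchy-Fueter operator composed with the Cauchy-Fueter operator is the
  Laplacian, as the mixed second derivatives cancel by symmetry.\<close>

lemma kE_harmonic:
  assumes "\<sigma> \<noteq> 0"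
  shows "ev (rd 1 (rd 1 (Ex k))) \<sigma> + ev (rd qi (rd qi (Ex k))) \<sigma>
    + ev (rd qj (rd qj (Ex k))) \<sigma> + ev (rd qk (rd qk (Ex k))) \<sigma> = 0"
proof -
  let ?D = "\<lambda>e. RA (rd 1 e) (RA (RM (RC qi) (rd qi e)) (RA (RM (RC qj) (rd qj e)) (RM (RC qk) (rd qk e))))"
  have D: "ev (rd v (?D (Ex k))) \<sigma> = ev (rd v (RC 0)) \<sigma>" for v
    by (rule ev_rd_cong[OF _ assms]) (use kE_left_regular in \<open>simp add: dE_def add.assoc\<close>)
  define H where "H v w = ev (rd v (rd w (Ex k))) \<sigma>" for v w
  have sym: "H qi 1 = H 1 qi" "H qj 1 = H 1 qj" "H qk 1 = H 1 qk" "H qj qi = H qi qj" "H qk qi = H qi qk" "H qk qj = H qj qk"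
    by (simp_all add: H_def ev_rd_commute)
  have E: "H v 1 + qi * H v qi + qj * H v qj + qk * H v qk = 0" for v
    using D[of v] by (simp add: H_def add.assoc)
  have "(H 1 1 + qi * H 1 qi + qj * H 1 qj + qk * H 1 qk) - qi * (H qi 1 + qi * H qi qi + qj * H qi qj + qk * H qi qk)
     - qj * (H qj 1 + qi * H qj qi + qj * H qj qj + qk * H qj qk) - qk * (H qk 1 + qi * H qk qi + qj * H qk qj + qk * H qk qk) = 0"
    by (simp add: E)
  then have "H 1 1 + H qi qi + H qj qj + H qk qk = 0"
    unfolding sym by (simp add: quat_eq_iff algebra_simps)
  then show ?thesis by (simp add: H_def)
qed

section \<open>Integration lemmas\<close>

lemma integral_lborel_translation:
  fixes f :: "'a::euclidean_space \<Rightarrow> 'b::{banach, second_countable_topology}"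
  assumes "f \<in> borel_measurable borel"
  shows "(\<integral>x. f (c + x) \<partial>lborel) = (\<integral>x. f x \<partial>lborel)"
  using integral_distr[of "(+) c" lborel borel f] assms by (simp add: lborel_distr_plus)

lemma integrable_lborel_translation:
  fixes f :: "'a::euclidean_space \<Rightarrow> 'b::{banach, second_countable_topology}"
  assumes "integrable lborel f"
  shows "integrable lborel (\<lambda>x. f (c + x))"
  using integrable_distr[of "(+) c" lborel borel f] assms by (simp add: lborel_distr_plus)

text \<open>A divergence theorem on the whole space with integrability as the condition at infinity:
  along a unit segment the derivative integrates to \<open>f (x + e) - f x\<close>, and by
  translation invariance this difference has integral 0.\<close>

lemma integral_directional_derivative_eq_0:
  fixes f :: "'a::euclidean_space \<Rightarrow> 'b::euclidean_space"
  assumes f: "integrable lborel f" and g: "integrable lborel (\<lambda>x. f' x e)"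
    and cont: "continuous_on UNIV (\<lambda>x. f' x e)"
    and der: "\<And>x. (f has_derivative f' x) (at x)"
  shows "(\<integral>x. f' x e \<partial>lborel) = 0"
proof -
  define g where "g x = f' x e" for x
  have [measurable]: "g \<in> borel_measurable borel" "f \<in> borel_measurable borel"
    using f g by (auto simp: g_def[abs_def])
  have gi: "integrable lborel g" using g by (simp add: g_def[abs_def])
  have der': "((\<lambda>s. f (x + s *\<^sub>R e)) has_vector_derivative g (x + s *\<^sub>R e)) (at s within S)" for x s S
  proof -
    have "((\<lambda>s. f (x + s *\<^sub>R e)) has_derivative (\<lambda>h. f' (x + s *\<^sub>R e) (h *\<^sub>R e))) (at s within S)"
      by (rule has_derivative_compose[OF _ der]) (auto intro!: derivative_eq_intros)
    moreover have "linear (f' (x + s *\<^sub>R e))" by (rule has_derivative_linear[OF der])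
    ultimately show ?thesis by (simp add: has_vector_derivative_def linear_scale g_def)
  qed
  have contg: "continuous_on S (\<lambda>s. g (x + s *\<^sub>R e))" for x S
    by (rule continuous_on_compose2[OF cont[folded g_def]]) (auto intro!: continuous_intros)
  have ftc: "(\<integral>s. indicator {0..1} s *\<^sub>R g (x + s *\<^sub>R e) \<partial>lborel) = f (x + e) - f x" for x
    using has_bochner_integral_FTC_Icc[of 0 1 "\<lambda>s. f (x + s *\<^sub>R e)" "\<lambda>s. g (x + s *\<^sub>R e)"] der' contg
    by (simp add: has_bochner_integral_iff)
  have tr: "(\<integral>x. norm (g (x + s *\<^sub>R e)) \<partial>lborel) = (\<integral>x. norm (g x) \<partial>lborel)"
    "(\<integral>x. g (x + s *\<^sub>R e) \<partial>lborel) = (\<integral>x. g x \<partial>lborel)"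
    "integrable lborel (\<lambda>x. g (x + s *\<^sub>R e))" for s
    using integral_lborel_translation[of "\<lambda>x. norm (g x)" "s *\<^sub>R e"] integral_lborel_translation[of g "s *\<^sub>R e"]
       integrable_lborel_translation[OF gi, of "s *\<^sub>R e"] by (simp_all add: add.commute)
  have int: "integrable (lborel \<Otimes>\<^sub>M lborel) (\<lambda>(s, x). indicator {0..1::real} s *\<^sub>R g (x + s *\<^sub>R e))"
    by (rule lborel_pair.Fubini_integrable) (use tr in \<open>auto simp: abs_mult\<close>)
  have "0 = (\<integral>x. f (x + e) - f x \<partial>lborel)"
    using integral_lborel_translation[of f e] integrable_lborel_translation[OF f, of e] f
    by (simp add: add.commute)
  also have "\<dots> = (\<integral>x. (\<integral>s. indicator {0..1} s *\<^sub>R g (x + s *\<^sub>R e) \<partial>lborel) \<partial>lborel)"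
    by (simp add: ftc)
  also have "\<dots> = (\<integral>s. (\<integral>x. indicator {0..1} s *\<^sub>R g (x + s *\<^sub>R e) \<partial>lborel) \<partial>lborel)"
    by (rule lborel_pair.Fubini_integral[OF int])
  also have "\<dots> = (\<integral>s. indicator {0..1::real} s *\<^sub>R (\<integral>x. g x \<partial>lborel) \<partial>lborel)"
    by (simp add: tr)
  also have "\<dots> = (\<integral>x. g x \<partial>lborel)" by simp
  finally show ?thesis by (simp add: g_def)
qed

text \<open>The mean value inequality on the convex set dominates the normalised linearisation error
  by \<open>2 * G\<close>, so dominated convergence applies along every sequence.\<close>

lemma has_derivative_integral_param:
  fixes f :: "'a::real_normed_vector \<Rightarrow> 'b \<Rightarrow> 'c::euclidean_space"
  assumes S: "convex S" "x0 \<in> S"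
    and int: "\<And>x. x \<in> S \<Longrightarrow> integrable M (f x)" and G: "integrable M G"
    and der: "\<And>x y. x \<in> S \<Longrightarrow> y \<in> space M \<Longrightarrow> ((\<lambda>x. f x y) has_derivative f' x y) (at x within S)"
    and int': "\<And>v. integrable M (\<lambda>y. f' x0 y v)"
    and bound: "\<And>x y v. x \<in> S \<Longrightarrow> y \<in> space M \<Longrightarrow> norm (f' x y v) \<le> G y * norm v"
  shows "((\<lambda>x. \<integral>y. f x y \<partial>M) has_derivative (\<lambda>v. \<integral>y. f' x0 y v \<partial>M)) (at x0 within S)"
proof (rule has_derivativeI)
  have lin: "linear (f' x0 y)" if "y \<in> space M" for y
    using der[OF S(2) that] by (rule has_derivative_linear)
  show "bounded_linear (\<lambda>v. \<integral>y. f' x0 y v \<partial>M)"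
  proof (rule bounded_linear_intro)
    show "(\<integral>y. f' x0 y (v + w) \<partial>M) = (\<integral>y. f' x0 y v \<partial>M) + (\<integral>y. f' x0 y w \<partial>M)" for v w
      by (subst Bochner_Integration.integral_add[symmetric, OF int' int'], rule Bochner_Integration.integral_cong)
         (auto simp: linear_add[OF lin])
    show "(\<integral>y. f' x0 y (r *\<^sub>R v) \<partial>M) = r *\<^sub>R (\<integral>y. f' x0 y v \<partial>M)" for r v
      by (subst integral_scaleR_right[symmetric], rule Bochner_Integration.integral_cong)
         (auto simp: linear_scale[OF lin])
    show "norm (\<integral>y. f' x0 y v \<partial>M) \<le> norm v * (\<integral>y. G y \<partial>M)" for v
    proof -
      have "norm (\<integral>y. f' x0 y v \<partial>M) \<le> (\<integral>y. norm (f' x0 y v) \<partial>M)"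
        by (rule integral_norm_bound)
      also have "\<dots> \<le> (\<integral>y. norm v * G y \<partial>M)"
        by (rule integral_mono) (use int' G bound[OF S(2)] in \<open>auto simp: mult.commute\<close>)
      finally have "norm (\<integral>y. f' x0 y v \<partial>M) \<le> (\<integral>y. norm v * G y \<partial>M)" .
      then show ?thesis by simp
    qed
  qed
  show "((\<lambda>x. ((\<integral>y. f x y \<partial>M) - (\<integral>y. f x0 y \<partial>M) - (\<integral>y. f' x0 y (x - x0) \<partial>M)) /\<^sub>R norm (x - x0)) \<longlongrightarrow> 0) (at x0 within S)"
    unfolding tendsto_at_iff_sequentially
  proof (intro allI impI)
    fix X :: "nat \<Rightarrow> 'a" assume X: "\<forall>i. X i \<in> S - {x0}" "X \<longlonglongrightarrow> x0"
    define q where "q i y = (f (X i) y - f x0 y - f' x0 y (X i - x0)) /\<^sub>R norm (X i - x0)" for i y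
    have iq: "integrable M (q i)" for i
      unfolding q_def[abs_def] using X(1) S(2) by (intro integrable_scaleR_right Bochner_Integration.integrable_diff int int') auto
    have "(\<lambda>i. \<integral>y. q i y \<partial>M) \<longlonglongrightarrow> (\<integral>y. 0 \<partial>M)"
    proof (rule integral_dominated_convergence[where w = "\<lambda>y. 2 * G y"])
      show "AE y in M. (\<lambda>i. q i y) \<longlonglongrightarrow> 0"
      proof (rule AE_I2)
        fix y assume y: "y \<in> space M"
        have "((\<lambda>x. (f x y - f x0 y - f' x0 y (x - x0)) /\<^sub>R norm (x - x0)) \<longlongrightarrow> 0) (at x0 within S)"
          using der[OF S(2) y] by (simp add: has_derivative_at_within)
        with X show "(\<lambda>i. q i y) \<longlonglongrightarrow> 0"
          unfolding tendsto_at_iff_sequentially q_def comp_def by blast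
      qed
      show "AE y in M. norm (q i y) \<le> 2 * G y" for i
      proof (rule AE_I2)
        fix y assume y: "y \<in> space M"
        have xi: "X i \<in> S" "X i \<noteq> x0" using X(1) by auto
        have "norm (f (X i) y - f x0 y) \<le> G y * norm (X i - x0)"
        proof (rule differentiable_bound[OF S(1) der[OF _ y]])
          have "0 \<le> G y * norm (X i - x0)"
            using bound[OF S(2) y] norm_ge_zero order_trans by blast
          then have "0 \<le> G y" using xi by (simp add: zero_le_mult_iff)
          then show "onorm (f' x y) \<le> G y" if "x \<in> S" for x
            using bound[OF that y] by (intro onorm_bound) auto
        qed (use xi S in auto)
        moreover have "norm (f' x0 y (X i - x0)) \<le> G y * norm (X i - x0)" by (rule bound[OF S(2) y])
        ultimately have "norm (f (X i) y - f x0 y - f' x0 y (X i - x0)) \<le> 2 * G y * norm (X i - x0)"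
          using norm_triangle_ineq4[of "f (X i) y - f x0 y" "f' x0 y (X i - x0)"] by linarith
        then show "norm (q i y) \<le> 2 * G y"
          using xi by (simp add: q_def pos_divide_le_eq flip: divide_inverse_commute)
      qed
    qed (use iq G in auto)
    moreover have "(\<integral>y. q i y \<partial>M) = ((\<integral>y. f (X i) y \<partial>M) - (\<integral>y. f x0 y \<partial>M) - (\<integral>y. f' x0 y (X i - x0) \<partial>M)) /\<^sub>R norm (X i - x0)" for i
      unfolding q_def using X(1) S(2) int int' by (subst integral_scaleR_right) (auto intro!: arg_cong2[where f = scaleR])
    ultimately show "((\<lambda>x. ((\<integral>y. f x y \<partial>M) - (\<integral>y. f x0 y \<partial>M) - (\<integral>y. f' x0 y (x - x0) \<partial>M)) /\<^sub>R norm (x - x0)) \<circ> X) \<longlonglongrightarrow> 0"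
      by (simp add: comp_def)
  qed
qed

lemma integral_FTC_Ici:
  fixes F f :: "real \<Rightarrow> 'a::euclidean_space"
  assumes der: "\<And>u. u \<ge> 0 \<Longrightarrow> (F has_vector_derivative f u) (at u within {0..})"
    and cont: "continuous_on {0..} f" and int: "integrable lborel (\<lambda>u. indicator {0..} u *\<^sub>R f u)"
    and lim: "(F \<longlongrightarrow> 0) at_top"
  shows "(\<integral>u. indicator {0..} u *\<^sub>R f u \<partial>lborel) = - F 0"
proof -
  have 1: "has_bochner_integral lborel (\<lambda>u. indicator {0..real n} u *\<^sub>R f u) (F (real n) - F 0)" for n
    by (rule has_bochner_integral_FTC_Icc)
       (auto intro: has_vector_derivative_within_subset[OF der] continuous_on_subset[OF cont])
  have "(\<lambda>n. \<integral>u. indicator {0..real n} u *\<^sub>R f u \<partial>lborel) \<longlonglongrightarrow> (\<integral>u. indicator {0..} u *\<^sub>R f u \<partial>lborel)"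
  proof (rule integral_dominated_convergence[where w = "\<lambda>u. norm (indicator {0..} u *\<^sub>R f u)"])
    show "AE u in lborel. (\<lambda>n. indicator {0..real n} u *\<^sub>R f u) \<longlonglongrightarrow> indicator {0..} u *\<^sub>R f u"
    proof (rule AE_I2, rule tendsto_eventually)
      fix u :: real
      obtain N where "u \<le> real N" using real_arch_simple by blast
      then show "\<forall>\<^sub>F n in sequentially. indicator {0..real n} u *\<^sub>R f u = indicator {0..} u *\<^sub>R f u"
        by (intro eventually_sequentiallyI[of N]) (auto simp: indicator_def)
    qed
    show "AE u in lborel. norm (indicator {0..real n} u *\<^sub>R f u) \<le> norm (indicator {0..} u *\<^sub>R f u)" for n
      by (auto simp: indicator_def)
  qed (use 1 int in \<open>auto simp only: has_bochner_integral_iff intro!: integrable_norm borel_measurable_integrable\<close>)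
  moreover have "(\<lambda>n. F (real n) - F 0) \<longlonglongrightarrow> 0 - F 0"
    by (intro tendsto_intros filterlim_compose[OF lim filterlim_real_sequentially])
  ultimately show ?thesis
    using 1 by (auto simp: has_bochner_integral_iff intro: LIMSEQ_unique)
qed

text \<open>Dyadic decomposition: on the shell ending at radius \<open>2 ^ k * \<rho>\<close> the
  integrand is at most \<open>c k\<close>, and volume growth of order \<open>D\<close> leaves a
  geometric series of ratio \<open>2 powr (- \<delta>)\<close>. The function \<open>N\<close> is
  abstract because the lemma serves the Euclidean norm and the homogeneous distance.\<close>

lemma nn_integral_decay_le:
  fixes N :: "'a \<Rightarrow> real" and C D \<delta> \<rho> :: real
  assumes [measurable]: "N \<in> borel_measurable M" and N: "\<And>x. N x \<ge> 0"
    and vol: "\<And>r. r > 0 \<Longrightarrow> emeasure M {x \<in> space M. N x \<le> r} \<le> ennreal (C * r powr D)"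
    and "C \<ge> 0" "D \<ge> 0" "\<delta> > 0" "\<rho> > 0"
  shows "(\<integral>\<^sup>+x. ennreal ((\<rho> + N x) powr (-(D + \<delta>))) \<partial>M)
    \<le> ennreal (C * (2 powr (D + \<delta>) / (1 - 2 powr (- \<delta>))) * \<rho> powr (- \<delta>))"
proof -
  define A where "A k = {x \<in> space M. N x \<le> 2 ^ k * \<rho>}" for k :: nat
  define c where "c k = (2 ^ k * \<rho> / 2) powr (-(D + \<delta>))" for k :: nat
  have [measurable]: "A k \<in> sets M" for k unfolding A_def by measurable
  have pt: "ennreal ((\<rho> + N x) powr (-(D + \<delta>))) \<le> (\<Sum>k. ennreal (c k) * indicator (A k) x)"
    if x: "x \<in> space M" for x
  proof -
    \<comment> \<open>The least such index. If it is positive, \<open>N x\<close> exceeds the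
      previous radius \<open>2 ^ k * \<rho> / 2\<close>; if it is 0, the summand
      \<open>\<rho>\<close> alone suffices.\<close>
    obtain k where k: "x \<in> A k" "\<And>j. j < k \<Longrightarrow> x \<notin> A j"
    proof -
      obtain k where "N x / \<rho> < 2 ^ k" using real_arch_pow[of 2 "N x / \<rho>"] by auto
      then have "x \<in> A k" using x \<open>\<rho> > 0\<close> by (simp add: A_def field_simps)
      then show ?thesis using that exists_least_iff[of "\<lambda>k. x \<in> A k"] by blast
    qed
    have "2 ^ k * \<rho> / 2 \<le> \<rho> + N x"
    proof (cases k)
      case (Suc j)
      then have "N x > 2 ^ j * \<rho>" using k(2)[of j] x by (auto simp: A_def)
      with Suc \<open>\<rho> > 0\<close> show ?thesis by simp
    qed (use N[of x] \<open>\<rho> > 0\<close> in auto)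
    then have "(\<rho> + N x) powr (-(D + \<delta>)) \<le> c k"
      unfolding c_def using assms by (intro powr_mono2') auto
    then have "ennreal ((\<rho> + N x) powr (-(D + \<delta>))) \<le> ennreal (c k) * indicator (A k) x"
      using k(1) by (simp add: ennreal_leI)
    also have "\<dots> = (\<Sum>j\<in>{k}. ennreal (c j) * indicator (A j) x)"
      by (simp only: sum.insert sum.empty finite.emptyI empty_iff not_False_eq_True add_0_right)
    also have "\<dots> \<le> (\<Sum>k. ennreal (c k) * indicator (A k) x)"
      by (rule sum_le_suminf) auto
    finally show ?thesis .
  qed
  define q where "q = 2 powr (- \<delta>)"
  have q: "0 < q" "q < 1" using \<open>\<delta> > 0\<close> by (simp_all add: q_def powr_minus field_simps)
  define L where "L = C * 2 powr (D + \<delta>) * \<rho> powr (- \<delta>)"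
  have L: "L \<ge> 0" using assms by (simp add: L_def)
  have ck: "c k * (C * (2 ^ k * \<rho>) powr D) = L * q ^ k" for k
  proof -
    have p: "(2 ^ k * \<rho>) powr a = (2 powr a) ^ k * \<rho> powr a" for a
      using \<open>\<rho> > 0\<close> by (simp add: powr_mult powr_realpow[symmetric] powr_powr mult.commute)
    have "c k = (2 ^ k * \<rho>) powr (-(D + \<delta>)) * 2 powr (D + \<delta>)"
      using \<open>\<rho> > 0\<close> powr_minus_divide[of 2 "D + \<delta>"] by (simp add: c_def powr_divide)
    then have "c k * (C * (2 ^ k * \<rho>) powr D)
        = C * 2 powr (D + \<delta>) * ((2 ^ k * \<rho>) powr (-(D + \<delta>)) * (2 ^ k * \<rho>) powr D)" by simp
    also have "(2 ^ k * \<rho>) powr (-(D + \<delta>)) * (2 ^ k * \<rho>) powr D = (2 ^ k * \<rho>) powr (- \<delta>)"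
      by (simp flip: powr_add)
    finally have eq: "c k * (C * (2 ^ k * \<rho>) powr D) = C * 2 powr (D + \<delta>) * (2 ^ k * \<rho>) powr (- \<delta>)" .
    show ?thesis unfolding eq p[of "- \<delta>"] L_def q_def by (simp only: mult_ac)
  qed
  have "(\<integral>\<^sup>+x. ennreal ((\<rho> + N x) powr (-(D + \<delta>))) \<partial>M)
      \<le> (\<integral>\<^sup>+x. (\<Sum>k. ennreal (c k) * indicator (A k) x) \<partial>M)"
    by (intro nn_integral_mono pt)
  also have "\<dots> = (\<Sum>k. ennreal (c k) * emeasure M (A k))"
    by (subst nn_integral_suminf) (auto simp: nn_integral_cmult)
  also have "\<dots> \<le> (\<Sum>k. ennreal (L * q ^ k))"
  proof (intro suminf_le)
    fix k
    have "ennreal (c k) * emeasure M (A k) \<le> ennreal (c k) * ennreal (C * (2 ^ k * \<rho>) powr D)"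
      unfolding A_def by (intro mult_left_mono vol) (use \<open>\<rho> > 0\<close> in auto)
    also have "\<dots> = ennreal (L * q ^ k)"
      using assms(4) ck[of k] by (subst ennreal_mult[symmetric]) (simp_all add: c_def)
    finally show "ennreal (c k) * emeasure M (A k) \<le> ennreal (L * q ^ k)" .
  qed auto
  also have "\<dots> = ennreal (L * (1 / (1 - q)))"
    using L q by (subst suminf_ennreal2) (auto simp: suminf_mult suminf_geometric summable_geometric intro!: summable_mult)
  finally show ?thesis by (simp add: L_def q_def field_simps)
qed

lemma integral_lborel_scale:
  fixes f :: "'a::euclidean_space \<Rightarrow> 'b::{banach, second_countable_topology}"
  assumes "c > 0" and [measurable]: "f \<in> borel_measurable borel"
  shows "(\<integral>x. f x \<partial>lborel) = c ^ DIM('a) *\<^sub>R (\<integral>x. f (c *\<^sub>R x) \<partial>lborel)"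
proof -
  have "(\<integral>x. f x \<partial>lborel) = (\<integral>x. f x \<partial>density (distr lborel borel (\<lambda>x. 0 + c *\<^sub>R x)) (\<lambda>_. ennreal (\<bar>c\<bar> ^ DIM('a))))"
    using lborel_affine[of c "0::'a"] assms(1) by simp
  also have "\<dots> = c ^ DIM('a) *\<^sub>R (\<integral>x. f (c *\<^sub>R x) \<partial>lborel)"
    using assms(1) by (subst integral_density) (auto simp: integral_distr)
  finally show ?thesis .
qed

lemma integrable_decay:
  assumes "p > real DIM('a)"
  shows "integrable lborel (\<lambda>x::'a::euclidean_space. (1 + norm x) powr (- p))"
proof (rule integrableI_bounded)
  have "(\<integral>\<^sup>+x. ennreal ((1 + norm x) powr (-(real DIM('a) + (p - DIM('a))))) \<partial>(lborel :: 'a measure))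
    \<le> ennreal (unit_ball_vol DIM('a) * (2 powr (DIM('a) + (p - DIM('a))) / (1 - 2 powr (- (p - DIM('a))))) * 1 powr (- (p - DIM('a))))"
  proof (rule nn_integral_decay_le)
    fix r :: real assume "r > 0"
    moreover have "{x \<in> space lborel. norm x \<le> r} = cball (0::'a) r" by auto
    ultimately show "emeasure lborel {x::'a \<in> space lborel. norm x \<le> r} \<le> ennreal (unit_ball_vol DIM('a) * r powr DIM('a))"
      using emeasure_cball[of r "0::'a"] by (simp add: powr_realpow)
  qed (use assms in auto)
  then show "(\<integral>\<^sup>+x. ennreal (norm ((1 + norm x) powr (- p))) \<partial>(lborel :: 'a measure)) < \<infinity>"
    by (simp add: le_less_trans ennreal_less_top)
qed simp

lemma integrable_if_decay:
  fixes f :: "'a::euclidean_space \<Rightarrow> 'b::euclidean_space"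
  assumes "continuous_on UNIV f" "\<And>x. norm (f x) \<le> C * (1 + norm x) powr (- p)" "p > real DIM('a)"
  shows "integrable lborel f"
proof (rule Bochner_Integration.integrable_bound)
  show "integrable lborel (\<lambda>x::'a. C * (1 + norm x) powr (- p))"
    by (intro integrable_mult_right integrable_decay assms)
  show "f \<in> borel_measurable lborel"
    using borel_measurable_continuous_onI[OF assms(1)] by simp
  show "AE x in lborel. norm (f x) \<le> norm (C * (1 + norm x) powr (- p))"
    using assms(2) by (intro AE_I2) (metis abs_ge_self order_trans real_norm_def)
qed

section \<open>Convolution over the centre\<close>

lemma quat_of_t_simps [simp]:
  "quat_of_t (x + y) = quat_of_t x + quat_of_t y" "quat_of_t (x - y) = quat_of_t x - quat_of_t y"
  "quat_of_t (- x) = - quat_of_t x" "quat_of_t (r *\<^sub>R x) = r *\<^sub>R quat_of_t x" "quat_of_t 0 = 0"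
  "qRe (quat_of_t x) = 0" "qcnj (quat_of_t x) = - quat_of_t x"
  by (simp_all add: quat_of_t_def quat_eq_iff)

lemma norm_quat_of_t [simp]: "norm (quat_of_t x) = norm x"
proof -
  have "(norm (quat_of_t x))\<^sup>2 = (norm x)\<^sup>2"
    by (simp add: norm_quat_sq quat_of_t_def norm_vec_def L2_set_def sum_3)
  then show ?thesis by (simp add: power2_eq_iff_nonneg)
qed

lemma quat_of_t_axis [simp]: "quat_of_t (axis 1 1) = qi" "quat_of_t (axis 2 1) = qj" "quat_of_t (axis 3 1) = qk"
  by (simp_all add: quat_of_t_def quat_eq_iff axis_def)

lemma bounded_linear_quat_of_t: "bounded_linear quat_of_t"
  by (rule bounded_linear_intro[where K = 1]) simp_all

lemmas has_derivative_quat_of_t [derivative_intros] = bounded_linear.has_derivative[OF bounded_linear_quat_of_t]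
lemmas continuous_on_quat_of_t [continuous_intros] = bounded_linear.continuous_on[OF bounded_linear_quat_of_t]

text \<open>Adding an imaginary quaternion leaves the real part, so the sum stays away from 0, and
  far out its norm is comparable to that of \<open>\<tau>\<close>. The constants depend only on
  \<open>R\<close> and \<open>A\<close>, because differentiation under the integral asks for bounds
  uniform in \<open>a\<close>.\<close>

lemma add_quat_of_t_lower:
  assumes "R > 0" "R \<le> \<bar>qRe a\<bar>" "norm a \<le> A"
  shows "1 + norm \<tau> \<le> (1 + (1 + A) / R) * norm (a + quat_of_t \<tau>)" and "a + quat_of_t \<tau> \<noteq> 0"
proof -
  let ?n = "norm (a + quat_of_t \<tau>)"
  have A: "A \<ge> 0" using assms(3) norm_ge_zero order_trans by blast
  have n: "R \<le> ?n" using qRe_le_norm[of "a + quat_of_t \<tau>"] assms by simp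
  have "norm (quat_of_t \<tau>) \<le> ?n + norm a"
    by (metis add_diff_cancel_left' norm_triangle_ineq4)
  then have "1 + norm \<tau> \<le> ?n + (1 + A)" using assms by simp
  also have "1 + A \<le> ((1 + A) / R) * ?n"
    using n assms(1) A mult_left_mono[OF n, of "(1 + A) / R"] by simp
  finally show "1 + norm \<tau> \<le> (1 + (1 + A) / R) * ?n" by (simp add: algebra_simps)
  show "a + quat_of_t \<tau> \<noteq> 0" using n assms(1) by auto
qed

lemma ev_decay:
  assumes "hom e d" "R > 0"
  shows "\<exists>C>0. \<forall>a \<tau>. R \<le> \<bar>qRe a\<bar> \<longrightarrow> norm a \<le> A \<longrightarrow> norm (ev e (a + quat_of_t \<tau>)) \<le> C * (1 + norm \<tau>) powr (- real d)"
proof -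
  obtain C where C: "C > 0" "\<And>\<sigma>. \<sigma> \<noteq> 0 \<Longrightarrow> norm (ev e \<sigma>) \<le> C * inverse (norm \<sigma>) ^ d"
    using hom_bound[OF assms(1)] by blast
  define L where "L = max 1 (1 + (1 + A) / R)"
  show ?thesis
  proof (intro exI[of _ "C * L ^ d"] conjI allI impI)
    show "C * L ^ d > 0" using C by (simp add: L_def)
    fix a \<tau> assume a: "R \<le> \<bar>qRe a\<bar>" "norm a \<le> A"
    let ?n = "norm (a + quat_of_t \<tau>)"
    note low = add_quat_of_t_lower[OF assms(2) a, of \<tau>]
    have n: "?n > 0" using low by simp
    have "1 + norm \<tau> \<le> L * ?n"
      using low(1) mult_right_mono[of "1 + (1 + A) / R" L ?n] by (simp add: L_def)
    moreover have "inverse y \<le> L * inverse x" if "x \<le> L * y" "0 < y" "0 < x" for x y :: real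
      using that by (simp add: field_simps)
    ultimately have "inverse ?n \<le> L * inverse (1 + norm \<tau>)"
      using n by (auto simp: add_pos_nonneg)
    then have "inverse ?n ^ d \<le> (L * inverse (1 + norm \<tau>)) ^ d"
      by (intro power_mono) auto
    also have "\<dots> = L ^ d * (1 + norm \<tau>) powr (- real d)"
      by (simp add: power_mult_distrib powr_minus powr_realpow add_pos_nonneg power_inverse)
    finally have "C * inverse ?n ^ d \<le> C * (L ^ d * (1 + norm \<tau>) powr (- real d))"
      using C(1) by (intro mult_left_mono) auto
    with C(2)[OF low(2)] show "norm (ev e (a + quat_of_t \<tau>)) \<le> C * L ^ d * (1 + norm \<tau>) powr (- real d)"
      by (simp only: mult.assoc)
  qed
qed

lemmas kE_decay = ev_decay[OF hom_Ex, folded kE_def]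
lemmas dE_decay = ev_decay[OF hom_rd[OF hom_Ex], folded dE_def]

lemma continuous_on_kE_comp [continuous_intros]:
  assumes "continuous_on S f" "\<And>x. x \<in> S \<Longrightarrow> f x \<noteq> 0"
  shows "continuous_on S (\<lambda>x. kE k (f x))" and "continuous_on S (\<lambda>x. dE k v (f x))"
proof -
  have "f ` S \<subseteq> - {0}" using assms(2) by auto
  then show "continuous_on S (\<lambda>x. kE k (f x))" "continuous_on S (\<lambda>x. dE k v (f x))"
    by (rule continuous_on_compose2[OF continuous_on_kE assms(1)] continuous_on_compose2[OF continuous_on_dE assms(1)])+
qed

lemma kE_compose_derivative:
  assumes "(f has_derivative f') (at x within S)" "f x \<noteq> 0"
  shows "((\<lambda>x. kE k (f x)) has_derivative (\<lambda>h. dE k (f' h) (f x))) (at x within S)"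
  using has_derivative_compose[OF assms(1), of "kE k" "\<lambda>v. dE k v (f x)"] kE_has_derivative[OF assms(2)] by simp

lemma minus_quat_of_t_nonzero: "qRe a \<noteq> 0 \<Longrightarrow> a - quat_of_t \<tau> \<noteq> 0" "qRe a \<noteq> 0 \<Longrightarrow> a + quat_of_t \<tau> \<noteq> 0"
  by (auto simp: quat_eq_iff)

lemma prod_decay:
  assumes "hom e d" "hom e' d'" "R > 0"
  shows "\<exists>C>0. \<forall>a b \<tau>. R \<le> \<bar>qRe a\<bar> \<longrightarrow> norm a \<le> A \<longrightarrow> R \<le> \<bar>qRe b\<bar> \<longrightarrow> norm b \<le> A \<longrightarrow>
     norm (ev e (a - quat_of_t \<tau>)) * norm (ev e' (b + quat_of_t \<tau>)) \<le> C * (1 + norm \<tau>) powr (- real (d + d'))"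
proof -
  obtain C1 where C1: "C1 > 0" "\<And>a \<tau>. R \<le> \<bar>qRe a\<bar> \<Longrightarrow> norm a \<le> A \<Longrightarrow> norm (ev e (a + quat_of_t \<tau>)) \<le> C1 * (1 + norm \<tau>) powr (- real d)"
    using ev_decay[OF assms(1,3)] by blast
  obtain C2 where C2: "C2 > 0" "\<And>a \<tau>. R \<le> \<bar>qRe a\<bar> \<Longrightarrow> norm a \<le> A \<Longrightarrow> norm (ev e' (a + quat_of_t \<tau>)) \<le> C2 * (1 + norm \<tau>) powr (- real d')"
    using ev_decay[OF assms(2,3)] by blast
  show ?thesis
  proof (intro exI[of _ "C1 * C2"] conjI allI impI)
    fix a b \<tau> assume h: "R \<le> \<bar>qRe a\<bar>" "norm a \<le> A" "R \<le> \<bar>qRe b\<bar>" "norm b \<le> A"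
    have "norm (ev e (a - quat_of_t \<tau>)) * norm (ev e' (b + quat_of_t \<tau>))
      \<le> (C1 * (1 + norm \<tau>) powr (- real d)) * (C2 * (1 + norm \<tau>) powr (- real d'))"
      using C1(2)[OF h(1,2), of "- \<tau>"] C2(2)[OF h(3,4), of \<tau>] C1(1) C2(1) by (intro mult_mono) auto
    also have "\<dots> = C1 * C2 * (1 + norm \<tau>) powr (- real (d + d'))"
      by (simp add: powr_add[symmetric])
    finally show "norm (ev e (a - quat_of_t \<tau>)) * norm (ev e' (b + quat_of_t \<tau>)) \<le> C1 * C2 * (1 + norm \<tau>) powr (- real (d + d'))" .
  qed (use C1 C2 in auto)
qed

lemma integrable_prod:
  assumes "hom e d" "hom e' d'" "d + d' > 3" "qRe a \<noteq> 0" "qRe b \<noteq> 0"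
  shows "integrable lborel (\<lambda>\<tau>. ev e (a - quat_of_t \<tau>) * v * ev e' (b + quat_of_t \<tau>))"
proof -
  define R where "R = min \<bar>qRe a\<bar> \<bar>qRe b\<bar>"
  define A where "A = max (norm a) (norm b)"
  have "R > 0" using assms by (simp add: R_def)
  then obtain C where C: "C > 0" "\<And>\<tau>. norm (ev e (a - quat_of_t \<tau>)) * norm (ev e' (b + quat_of_t \<tau>)) \<le> C * (1 + norm \<tau>) powr (- real (d + d'))"
    using prod_decay[OF assms(1,2), of R A] unfolding R_def A_def
    by (metis max.cobounded1 max.cobounded2 min.cobounded1 min.cobounded2)
  show ?thesis
  proof (rule integrable_if_decay)
    show "continuous_on UNIV (\<lambda>\<tau>. ev e (a - quat_of_t \<tau>) * v * ev e' (b + quat_of_t \<tau>))"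
      using assms minus_quat_of_t_nonzero
      by (intro continuous_intros continuous_on_compose2[OF continuous_on_ev]) auto
    show "norm (ev e (a - quat_of_t \<tau>) * v * ev e' (b + quat_of_t \<tau>)) \<le> (norm v * C) * (1 + norm \<tau>) powr (- real (d + d'))" for \<tau>
      using mult_left_mono[OF C(2)[of \<tau>], of "norm v"] by (simp add: norm_mult mult_ac)
    show "real DIM(real^3) < real (d + d')" using assms(3) by simp
  qed
qed

lemma kE_prod_integrable:
  assumes "qRe a \<noteq> 0" "qRe b \<noteq> 0"
  shows "integrable lborel (\<lambda>\<tau>. kE j (a - quat_of_t \<tau>) * kE k (b + quat_of_t \<tau>))"
  using integrable_prod[OF hom_Ex[of j] hom_Ex[of k] _ assms, of 1] by (simp add: kE_def)

text \<open>By two-sided regularity the difference of the two integrands is a divergence.\<close>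

lemma kE_convolution_shift:
  assumes a: "qRe a \<noteq> 0" and b: "qRe b \<noteq> 0"
  shows "(\<integral>\<tau>. kE (Suc j) (a - quat_of_t \<tau>) * kE k (b + quat_of_t \<tau>) \<partial>lborel)
       = (\<integral>\<tau>. kE j (a - quat_of_t \<tau>) * kE (Suc k) (b + quat_of_t \<tau>) \<partial>lborel)"
proof -
  note nz = minus_quat_of_t_nonzero(1)[OF a] minus_quat_of_t_nonzero(2)[OF b]
  \<comment> \<open>The derivative of \<open>kE j * v * kE k\<close> in the imaginary direction
    \<open>v\<close>. Since \<open>v\<close> stands between the kernels, the sum over the three
    units meets right regularity of the left factor and left regularity of the right one.\<close>
  define D where "D v \<tau> = kE j (a - quat_of_t \<tau>) * v * dE k v (b + quat_of_t \<tau>) - dE j v (a - quat_of_t \<tau>) * v * kE k (b + quat_of_t \<tau>)" for v \<tau>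
  have iD: "integrable lborel (D v)" for v
    unfolding D_def[abs_def] kE_def dE_def
    by (intro Bochner_Integration.integrable_diff integrable_prod[OF hom_Ex hom_rd[OF hom_Ex]] integrable_prod[OF hom_rd[OF hom_Ex] hom_Ex] a b) auto
  have z: "(\<integral>\<tau>. D v \<tau> \<partial>lborel) = 0" if v: "quat_of_t e = v" for v e
  proof -
    let ?f = "\<lambda>\<tau>. kE j (a - quat_of_t \<tau>) * v * kE k (b + quat_of_t \<tau>)"
    let ?f' = "\<lambda>\<tau> h. kE j (a - quat_of_t \<tau>) * v * dE k (quat_of_t h) (b + quat_of_t \<tau>)
        + dE j (- quat_of_t h) (a - quat_of_t \<tau>) * v * kE k (b + quat_of_t \<tau>)"
    have eq: "?f' \<tau> e = D v \<tau>" for \<tau>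
      using linear_neg[OF linear_dE[OF nz(1)], of j v \<tau>] by (simp add: v D_def)
    have "(\<integral>\<tau>. ?f' \<tau> e \<partial>lborel) = 0"
    proof (rule integral_directional_derivative_eq_0)
      show "integrable lborel ?f" unfolding kE_def
        by (intro integrable_prod[OF hom_Ex hom_Ex] a b) auto
      show "integrable lborel (\<lambda>\<tau>. ?f' \<tau> e)" using iD by (simp add: eq)
      show "continuous_on UNIV (\<lambda>\<tau>. ?f' \<tau> e)" unfolding eq D_def using nz by (intro continuous_intros) auto
      show "(?f has_derivative ?f' \<tau>) (at \<tau>)" for \<tau>
      proof -
        have 1: "((\<lambda>\<tau>. kE j (a - quat_of_t \<tau>)) has_derivative (\<lambda>h. dE j (- quat_of_t h) (a - quat_of_t \<tau>))) (at \<tau>)"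
          by (intro kE_compose_derivative nz) (auto intro!: derivative_eq_intros)
        have 2: "((\<lambda>\<tau>. kE k (b + quat_of_t \<tau>)) has_derivative (\<lambda>h. dE k (quat_of_t h) (b + quat_of_t \<tau>))) (at \<tau>)"
          by (intro kE_compose_derivative nz) (auto intro!: derivative_eq_intros)
        from has_derivative_mult[OF has_derivative_mult[OF 1 has_derivative_const[of v]] 2] show ?thesis
          by simp
      qed
    qed
    then show ?thesis by (simp add: eq)
  qed
  have sum: "D qi \<tau> + D qj \<tau> + D qk \<tau>
      = kE (Suc j) (a - quat_of_t \<tau>) * kE k (b + quat_of_t \<tau>) - kE j (a - quat_of_t \<tau>) * kE (Suc k) (b + quat_of_t \<tau>)" for \<tau>
  proof -
    have "dE j qi (a - quat_of_t \<tau>) * qi + dE j qj (a - quat_of_t \<tau>) * qj + dE j qk (a - quat_of_t \<tau>) * qk = - kE (Suc j) (a - quat_of_t \<tau>)"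
      using kE_right_regular[OF nz(1), of j \<tau>] by (simp add: dE_1 add_eq_0_iff add.assoc)
    moreover have "qi * dE k qi (b + quat_of_t \<tau>) + qj * dE k qj (b + quat_of_t \<tau>) + qk * dE k qk (b + quat_of_t \<tau>) = - kE (Suc k) (b + quat_of_t \<tau>)"
      using kE_left_regular[OF nz(2), of k \<tau>] by (simp add: dE_1 add_eq_0_iff add.assoc)
    moreover have "D qi \<tau> + D qj \<tau> + D qk \<tau>
      = kE j (a - quat_of_t \<tau>) * (qi * dE k qi (b + quat_of_t \<tau>) + qj * dE k qj (b + quat_of_t \<tau>) + qk * dE k qk (b + quat_of_t \<tau>))
       - (dE j qi (a - quat_of_t \<tau>) * qi + dE j qj (a - quat_of_t \<tau>) * qj + dE j qk (a - quat_of_t \<tau>) * qk) * kE k (b + quat_of_t \<tau>)"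
      by (simp add: D_def algebra_simps)
    ultimately show ?thesis by simp
  qed
  have "0 = (\<integral>\<tau>. D qi \<tau> + D qj \<tau> + D qk \<tau> \<partial>lborel)"
    using z[OF quat_of_t_axis(1)] z[OF quat_of_t_axis(2)] z[OF quat_of_t_axis(3)] iD by simp
  then show ?thesis
    unfolding sum using kE_prod_integrable[OF a b] by (subst (asm) Bochner_Integration.integral_diff) auto
qed

section \<open>The Cauchy integral over hyperplanes and its jump at the pole\<close>

definition J :: "nat \<Rightarrow> quat \<Rightarrow> real \<Rightarrow> quat" where
  "J K q x = (\<integral>\<tau>. kE 0 (of_real x - quat_of_t \<tau>) * kE K (q - of_real x + quat_of_t \<tau>) \<partial>lborel)"

text \<open>In terms of z = x - \<tau> the integral runs over the hyperplane of real part
  \<open>x\<close>, with integrand \<open>kE 0 z * kE K (q - z)\<close> and poles at 0 and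
  \<open>q\<close>. Moving the hyperplane changes nothing until it meets a pole: the derivative in
  \<open>x\<close> is the difference of the two sides of
  \<open>kE_convolution_shift\<close>.\<close>

lemma J_constant:
  assumes "x1 \<le> x2" "x2 < qRe q" "0 < x1 \<or> x2 < 0"
  shows "J K q x1 = J K q x2"
proof -
  define S where "S = {x1..x2}"
  define R where "R = min (qRe q - x2) (min \<bar>x1\<bar> \<bar>x2\<bar>)"
  define A where "A = norm q + \<bar>x1\<bar> + \<bar>x2\<bar>"
  have R: "R > 0" using assms by (auto simp: R_def)
  have S: "R \<le> \<bar>qRe (of_real x)\<bar>" "norm (of_real x :: quat) \<le> A" "R \<le> \<bar>qRe (q - of_real x)\<bar>" "norm (q - of_real x) \<le> A"
    "x \<noteq> 0" "qRe (of_real x) \<noteq> 0" "qRe (q - of_real x) \<noteq> 0" if "x \<in> S" for x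
    using that assms norm_triangle_ineq4[of q "of_real x"] norm_ge_zero[of q]
    by (auto simp: S_def R_def A_def simp del: norm_ge_zero)
  obtain C1 where C1: "C1 > 0" "\<And>a b \<tau>. R \<le> \<bar>qRe a\<bar> \<Longrightarrow> norm a \<le> A \<Longrightarrow> R \<le> \<bar>qRe b\<bar> \<Longrightarrow> norm b \<le> A \<Longrightarrow>
     norm (kE 0 (a - quat_of_t \<tau>)) * norm (kE (Suc K) (b + quat_of_t \<tau>)) \<le> C1 * (1 + norm \<tau>) powr (- real (3 + 0 + (3 + Suc K)))"
    using prod_decay[OF hom_Ex[of 0] hom_Ex[of "Suc K"] R, of A] unfolding kE_def by blast
  obtain C2 where C2: "C2 > 0" "\<And>a b \<tau>. R \<le> \<bar>qRe a\<bar> \<Longrightarrow> norm a \<le> A \<Longrightarrow> R \<le> \<bar>qRe b\<bar> \<Longrightarrow> norm b \<le> A \<Longrightarrow>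
     norm (kE (Suc 0) (a - quat_of_t \<tau>)) * norm (kE K (b + quat_of_t \<tau>)) \<le> C2 * (1 + norm \<tau>) powr (- real (3 + Suc 0 + (3 + K)))"
    using prod_decay[OF hom_Ex[of "Suc 0"] hom_Ex[of K] R, of A] unfolding kE_def by blast
  define f' where "f' x \<tau> h = h *\<^sub>R (kE (Suc 0) (of_real x - quat_of_t \<tau>) * kE K (q - of_real x + quat_of_t \<tau>)
      - kE 0 (of_real x - quat_of_t \<tau>) * kE (Suc K) (q - of_real x + quat_of_t \<tau>))" for x \<tau> and h :: real
  have "(J K q has_derivative (\<lambda>h. 0)) (at x within S)" if x: "x \<in> S" for x
  proof -
    have "((\<lambda>x. \<integral>\<tau>. kE 0 (of_real x - quat_of_t \<tau>) * kE K (q - of_real x + quat_of_t \<tau>) \<partial>lborel) has_derivative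
       (\<lambda>h. \<integral>\<tau>. f' x \<tau> h \<partial>lborel)) (at x within S)"
    proof (rule has_derivative_integral_param)
      show "convex S" by (simp add: S_def)
      show "integrable lborel (\<lambda>\<tau>. kE 0 (of_real x - quat_of_t \<tau>) * kE K (q - of_real x + quat_of_t \<tau>))" if "x \<in> S" for x
        using S[OF that] by (intro kE_prod_integrable) auto
      show "integrable lborel (\<lambda>\<tau>::real^3. (C1 + C2) * (1 + norm \<tau>) powr (- real (7 + K)))"
        by (intro integrable_mult_right integrable_decay) simp
      show "integrable lborel (\<lambda>\<tau>. f' x \<tau> h)" for h
        unfolding f'_def using S[OF x] by (intro integrable_scaleR_right Bochner_Integration.integrable_diff kE_prod_integrable) auto
      show "norm (f' x \<tau> h) \<le> (C1 + C2) * (1 + norm \<tau>) powr (- real (7 + K)) * norm h" if "x \<in> S" for x \<tau> h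
      proof -
        have "norm (kE (Suc 0) (of_real x - quat_of_t \<tau>) * kE K (q - of_real x + quat_of_t \<tau>)
          - kE 0 (of_real x - quat_of_t \<tau>) * kE (Suc K) (q - of_real x + quat_of_t \<tau>))
          \<le> (C1 + C2) * (1 + norm \<tau>) powr (- real (7 + K))"
          using C1(2)[OF S(1-4)[OF that], of \<tau>] C2(2)[OF S(1-4)[OF that], of \<tau>]
          by (intro order_trans[OF norm_triangle_ineq4]) (simp add: norm_mult algebra_simps)
        from mult_right_mono[OF this, of "norm h"] show ?thesis by (simp add: f'_def mult_ac)
      qed
      fix x \<tau> assume x: "x \<in> S"
      note nz = minus_quat_of_t_nonzero(1)[OF S(6)[OF x]] minus_quat_of_t_nonzero(2)[OF S(7)[OF x]]
      have 1: "((\<lambda>x. kE 0 (of_real x - quat_of_t \<tau>)) has_derivative (\<lambda>h. dE 0 (of_real h) (of_real x - quat_of_t \<tau>))) (at x within S)"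
        by (intro kE_compose_derivative nz) (auto intro!: derivative_eq_intros simp: of_real_def)
      have 2: "((\<lambda>x. kE K (q - of_real x + quat_of_t \<tau>)) has_derivative (\<lambda>h. dE K (- of_real h) (q - of_real x + quat_of_t \<tau>))) (at x within S)"
        by (intro kE_compose_derivative nz) (auto intro!: derivative_eq_intros simp: of_real_def)
      have dd: "dE 0 (of_real h) (of_real x - quat_of_t \<tau>) = h *\<^sub>R kE (Suc 0) (of_real x - quat_of_t \<tau>)"
         "dE K (- of_real h) (q - of_real x + quat_of_t \<tau>) = - h *\<^sub>R kE (Suc K) (q - of_real x + quat_of_t \<tau>)" for h
        using linear_scale[OF linear_dE[OF nz(1)], of 0 h 1 \<tau>] linear_scale[OF linear_dE[OF nz(2)], of K "-h" 1 \<tau>]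
        by (simp_all add: of_real_def dE_1)
      show "((\<lambda>x. kE 0 (of_real x - quat_of_t \<tau>) * kE K (q - of_real x + quat_of_t \<tau>)) has_derivative f' x \<tau>) (at x within S)"
        using has_derivative_mult[OF 1 2] by (rule has_derivative_eq_rhs) (simp only: dd f'_def fun_eq_iff, simp add: algebra_simps)
    qed (use x in auto)
    moreover have "(\<integral>\<tau>. f' x \<tau> h \<partial>lborel) = 0" for h
      unfolding f'_def integral_scaleR_right using S[OF x] kE_convolution_shift[of "of_real x" "q - of_real x" 0 K]
      by (subst Bochner_Integration.integral_diff) (auto intro!: kE_prod_integrable)
    ultimately show ?thesis by (simp add: J_def[abs_def])
  qed
  then obtain c where "\<And>x. x \<in> S \<Longrightarrow> J K q x = c"
    using has_derivative_zero_constant[of S "J K q"] by (auto simp: S_def)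
  then show ?thesis using assms(1) by (simp add: S_def)
qed

text \<open>A larger real part means a larger norm, so the bound is free of \<open>x\<close> and
  serves as a majorant while the hyperplane moves to infinity.\<close>

lemma norm_kE_shift_le:
  assumes "0 \<le> x" "0 < qRe q"
    and C: "\<And>\<sigma>. \<sigma> \<noteq> 0 \<Longrightarrow> norm (kE K \<sigma>) \<le> C * inverse (norm \<sigma>) ^ (3 + K)" "C > 0"
  shows "norm (kE K (q + of_real x + quat_of_t \<tau>)) \<le> C * inverse (norm (q + quat_of_t \<tau>)) ^ (3 + K)"
proof -
  have nz: "q + quat_of_t \<tau> \<noteq> 0" "q + of_real x + quat_of_t \<tau> \<noteq> 0"
    using assms(1,2) by (auto simp: quat_eq_iff)
  have "(norm (q + quat_of_t \<tau>))\<^sup>2 \<le> (norm (q + of_real x + quat_of_t \<tau>))\<^sup>2"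
    using assms(1,2) by (simp add: norm_quat_sq power_mono)
  then have "norm (q + quat_of_t \<tau>) \<le> norm (q + of_real x + quat_of_t \<tau>)"
    by (rule power2_le_imp_le) simp
  then have "inverse (norm (q + of_real x + quat_of_t \<tau>)) ^ (3 + K) \<le> inverse (norm (q + quat_of_t \<tau>)) ^ (3 + K)"
    using nz by (intro power_mono le_imp_inverse_le) auto
  with C(1)[OF nz(2)] C(2) show ?thesis by (meson mult_left_mono less_imp_le order_trans)
qed

text \<open>The value is constant for negative \<open>x\<close>, and pushing the hyperplane to
  infinity makes it vanish: the Cauchy kernel is of order -3 in the distance, and the other factor
  has a majorant that is integrable because \<open>3 + K\<close> exceeds the dimension 3 of the
  centre.\<close>

lemma J_negative:
  assumes "x < 0" "0 < qRe q" "K \<ge> 1"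
  shows "J K q x = 0"
proof -
  obtain C0 where C0: "C0 > 0" "\<And>\<sigma>. \<sigma> \<noteq> 0 \<Longrightarrow> norm (kE 0 \<sigma>) \<le> C0 * inverse (norm \<sigma>) ^ (3 + 0)"
    using kE_bound by blast
  obtain C where C: "C > 0" "\<And>\<sigma>. \<sigma> \<noteq> 0 \<Longrightarrow> norm (kE K \<sigma>) \<le> C * inverse (norm \<sigma>) ^ (3 + K)"
    using kE_bound by blast
  define w where "w \<tau> = C * inverse (norm (q + quat_of_t \<tau>)) ^ (3 + K)" for \<tau>
  have w: "integrable lborel w"
  proof -
    define L where "L = max 1 (1 + (1 + norm q) / qRe q)"
    show ?thesis
    proof (rule integrable_if_decay)
      show "continuous_on UNIV w" unfolding w_def using minus_quat_of_t_nonzero(2)[of q] assms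
        by (intro continuous_intros) auto
      show "real DIM(real^3) < real (3 + K)" using assms by simp
      fix \<tau> :: "real^3"
      note low = add_quat_of_t_lower[OF assms(2), of q "norm q" \<tau>, simplified]
      have n: "norm (q + quat_of_t \<tau>) > 0" using low assms by simp
      have "1 + norm \<tau> \<le> L * norm (q + quat_of_t \<tau>)"
        using low(1) mult_right_mono[of "1 + (1 + norm q) / qRe q" L "norm (q + quat_of_t \<tau>)"] assms by (simp add: L_def)
      moreover have "inverse y \<le> L * inverse x" if "x \<le> L * y" "0 < y" "0 < x" for x y :: real
        using that by (simp add: field_simps)
      ultimately have "inverse (norm (q + quat_of_t \<tau>)) \<le> L * inverse (1 + norm \<tau>)"
        using n by (auto simp: add_pos_nonneg)
      then have "inverse (norm (q + quat_of_t \<tau>)) ^ (3 + K) \<le> (L * inverse (1 + norm \<tau>)) ^ (3 + K)"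
        by (intro power_mono) auto
      also have "\<dots> = L ^ (3 + K) * (1 + norm \<tau>) powr (- real (3 + K))"
        by (simp only: power_mult_distrib powr_minus powr_realpow[of "1 + norm \<tau>"] add_pos_nonneg zero_less_one norm_ge_zero power_inverse)
      finally have "C * inverse (norm (q + quat_of_t \<tau>)) ^ (3 + K) \<le> C * (L ^ (3 + K) * (1 + norm \<tau>) powr (- real (3 + K)))"
        using C(1) by (intro mult_left_mono) auto
      then show "norm (w \<tau>) \<le> (C * L ^ (3 + K)) * (1 + norm \<tau>) powr (- real (3 + K))"
        using C(1) by (simp add: w_def abs_mult)
    qed
  qed
  have bound: "norm (J K q (- y)) \<le> C0 * inverse y ^ 3 * (\<integral>\<tau>. w \<tau> \<partial>lborel)" if y: "y > 0" for y
  proof -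
    have "norm (J K q (- y)) \<le> (\<integral>\<tau>. norm (kE 0 (of_real (- y) - quat_of_t \<tau>) * kE K (q - of_real (- y) + quat_of_t \<tau>)) \<partial>lborel)"
      unfolding J_def by (rule integral_norm_bound)
    also have "\<dots> \<le> (\<integral>\<tau>. (C0 * inverse y ^ 3) * w \<tau> \<partial>lborel)"
    proof (rule integral_mono)
      show "integrable lborel (\<lambda>\<tau>. norm (kE 0 (of_real (- y) - quat_of_t \<tau>) * kE K (q - of_real (- y) + quat_of_t \<tau>)))"
        using assms y by (intro integrable_norm kE_prod_integrable) auto
      show "integrable lborel (\<lambda>\<tau>. (C0 * inverse y ^ 3) * w \<tau>)" using w by simp
      fix \<tau>
      have nz: "of_real (- y) - quat_of_t \<tau> \<noteq> 0" using y by (intro minus_quat_of_t_nonzero) simp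
      have "y \<le> norm (of_real (- y) - quat_of_t \<tau>)" using qRe_le_norm[of "of_real (- y) - quat_of_t \<tau>"] y by simp
      then have "inverse (norm (of_real (- y) - quat_of_t \<tau>)) ^ 3 \<le> inverse y ^ 3"
        using y by (intro power_mono le_imp_inverse_le) auto
      then have "norm (kE 0 (of_real (- y) - quat_of_t \<tau>)) \<le> C0 * inverse y ^ 3"
        using C0(2)[OF nz] C0(1) mult_left_mono[of _ _ C0] by (simp only: add_0_right) (meson less_imp_le order_trans)
      moreover have "norm (kE K (q - of_real (- y) + quat_of_t \<tau>)) \<le> w \<tau>"
        unfolding w_def using norm_kE_shift_le[OF _ assms(2) C(2,1), of y \<tau>] y by simp
      ultimately show "norm (kE 0 (of_real (- y) - quat_of_t \<tau>) * kE K (q - of_real (- y) + quat_of_t \<tau>)) \<le> (C0 * inverse y ^ 3) * w \<tau>"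
        unfolding norm_mult by (intro mult_mono) (use C0(1) y in auto)
    qed
    finally show ?thesis by simp
  qed
  have "norm (J K q x) \<le> C0 * inverse (- x + real n) ^ 3 * (\<integral>\<tau>. w \<tau> \<partial>lborel)" for n
    using bound[of "- x + real n"] J_constant[of "x - real n" x q K] assms by (simp add: algebra_simps)
  moreover have "(\<lambda>n. C0 * inverse (- x + real n) ^ 3 * (\<integral>\<tau>. w \<tau> \<partial>lborel)) \<longlonglongrightarrow> C0 * 0 ^ 3 * (\<integral>\<tau>. w \<tau> \<partial>lborel)"
    by (intro tendsto_intros tendsto_inverse_0_at_top filterlim_tendsto_add_at_top[OF tendsto_const] filterlim_real_sequentially)
  ultimately have "norm (J K q x) \<le> 0"
    by (intro Lim_bounded2[where N = 0]) (auto simp: power3_eq_cube)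
  then show ?thesis by simp
qed

text \<open>The jump of the Cauchy integral across the boundary: a Poisson integral plus a vanishing term.\<close>

lemma J_jump:
  assumes x: "0 < x" "x < qRe q"
  shows "J K q x - J K q (- x) = (\<integral>\<tau>. ((1 + (norm \<tau>)\<^sup>2) powr (-2)) *\<^sub>R
     ((kE K (q - of_real x + quat_of_t (x *\<^sub>R \<tau>)) + kE K (q + of_real x + quat_of_t (x *\<^sub>R \<tau>)))
     + quat_of_t \<tau> * (kE K (q - of_real x + quat_of_t (x *\<^sub>R \<tau>)) - kE K (q + of_real x + quat_of_t (x *\<^sub>R \<tau>)))) \<partial>lborel)"
proof -
  define F where "F \<tau> = kE 0 (of_real x - quat_of_t \<tau>) * kE K (q - of_real x + quat_of_t \<tau>)
     - kE 0 (of_real (-x) - quat_of_t \<tau>) * kE K (q - of_real (-x) + quat_of_t \<tau>)" for \<tau>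
  have i: "integrable lborel (\<lambda>\<tau>. kE 0 (of_real x - quat_of_t \<tau>) * kE K (q - of_real x + quat_of_t \<tau>))"
    "integrable lborel (\<lambda>\<tau>. kE 0 (of_real (-x) - quat_of_t \<tau>) * kE K (q - of_real (-x) + quat_of_t \<tau>))"
    using x by (intro kE_prod_integrable; simp)+
  then have iF: "integrable lborel F" by (simp add: F_def[abs_def])
  have "J K q x - J K q (- x) = (\<integral>\<tau>. F \<tau> \<partial>lborel)"
    unfolding J_def F_def using i by simp
  also have "\<dots> = x ^ 3 *\<^sub>R (\<integral>\<tau>. F (x *\<^sub>R \<tau>) \<partial>lborel)"
    using integral_lborel_scale[OF x(1), of F] borel_measurable_integrable[OF iF] by simp
  also have "\<dots> = (\<integral>\<tau>. x ^ 3 *\<^sub>R F (x *\<^sub>R \<tau>) \<partial>lborel)" by simp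
  also have "(\<lambda>\<tau>. x ^ 3 *\<^sub>R F (x *\<^sub>R \<tau>)) = (\<lambda>\<tau>. ((1 + (norm \<tau>)\<^sup>2) powr (-2)) *\<^sub>R
     ((kE K (q - of_real x + quat_of_t (x *\<^sub>R \<tau>)) + kE K (q + of_real x + quat_of_t (x *\<^sub>R \<tau>)))
     + quat_of_t \<tau> * (kE K (q - of_real x + quat_of_t (x *\<^sub>R \<tau>)) - kE K (q + of_real x + quat_of_t (x *\<^sub>R \<tau>)))))"
  proof
    fix \<tau> :: "real^3"
    define P where "P = (1 + (norm \<tau>)\<^sup>2) powr (-2)"
    have n4: "norm (of_real y - quat_of_t (x *\<^sub>R \<tau>)) ^ 4 = x ^ 4 * (1 + (norm \<tau>)\<^sup>2)\<^sup>2" if "y = x \<or> y = - x" for y :: real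
    proof -
      have "(norm (of_real y - quat_of_t (x *\<^sub>R \<tau>)))\<^sup>2 = y\<^sup>2 + (norm (quat_of_t (x *\<^sub>R \<tau>)))\<^sup>2"
        unfolding norm_quat_sq by simp
      also have "\<dots> = x\<^sup>2 * (1 + (norm \<tau>)\<^sup>2)"
        using that by (auto simp: power_mult_distrib algebra_simps)
      finally have "((norm (of_real y - quat_of_t (x *\<^sub>R \<tau>)))\<^sup>2)\<^sup>2 = (x\<^sup>2 * (1 + (norm \<tau>)\<^sup>2))\<^sup>2" by simp
      then show ?thesis by (simp add: power_mult_distrib flip: power_mult)
    qed
    have P: "P = inverse ((1 + (norm \<tau>)\<^sup>2)\<^sup>2)"
      using add_pos_nonneg[of 1 "(norm \<tau>)\<^sup>2"] by (simp add: P_def powr_minus powr_realpow[of _ 2, simplified])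
    have E: "x ^ 3 *\<^sub>R kE 0 (of_real x - quat_of_t (x *\<^sub>R \<tau>)) = P *\<^sub>R (1 + quat_of_t \<tau>)"
      "x ^ 3 *\<^sub>R kE 0 (of_real (-x) - quat_of_t (x *\<^sub>R \<tau>)) = P *\<^sub>R (- 1 + quat_of_t \<tau>)"
    proof -
      have k: "x ^ 3 *\<^sub>R (inverse (x ^ 4 * (1 + (norm \<tau>)\<^sup>2)\<^sup>2) *\<^sub>R x *\<^sub>R z) = P *\<^sub>R z" for z :: quat
      proof -
        have "x ^ 3 * (inverse (x ^ 4 * (1 + (norm \<tau>)\<^sup>2)\<^sup>2) * x) = P"
        proof -
          have "x ^ 3 * (inverse (x ^ 4 * N) * x) = inverse N" for N
            using x(1) by (simp add: field_simps power4_eq_xxxx power3_eq_cube)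
          then show ?thesis unfolding P .
        qed
        then show ?thesis by (simp add: mult.assoc)
      qed
      have c: "qcnj (of_real x - quat_of_t (x *\<^sub>R \<tau>)) = x *\<^sub>R (1 + quat_of_t \<tau>)"
        "qcnj (of_real (-x) - quat_of_t (x *\<^sub>R \<tau>)) = x *\<^sub>R (- 1 + quat_of_t \<tau>)"
        by (simp_all add: of_real_def algebra_simps)
      show "x ^ 3 *\<^sub>R kE 0 (of_real x - quat_of_t (x *\<^sub>R \<tau>)) = P *\<^sub>R (1 + quat_of_t \<tau>)"
        unfolding kE_0 c n4[OF disjI1[OF refl]] by (rule k)
      show "x ^ 3 *\<^sub>R kE 0 (of_real (-x) - quat_of_t (x *\<^sub>R \<tau>)) = P *\<^sub>R (- 1 + quat_of_t \<tau>)"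
        unfolding kE_0 c n4[OF disjI2[OF refl]] by (rule k)
    qed
    have "x ^ 3 *\<^sub>R F (x *\<^sub>R \<tau>) = (x ^ 3 *\<^sub>R kE 0 (of_real x - quat_of_t (x *\<^sub>R \<tau>))) * kE K (q - of_real x + quat_of_t (x *\<^sub>R \<tau>))
     - (x ^ 3 *\<^sub>R kE 0 (of_real (-x) - quat_of_t (x *\<^sub>R \<tau>))) * kE K (q + of_real x + quat_of_t (x *\<^sub>R \<tau>))"
      by (simp add: F_def scaleR_diff_right)
    then show "x ^ 3 *\<^sub>R F (x *\<^sub>R \<tau>) = ((1 + (norm \<tau>)\<^sup>2) powr (-2)) *\<^sub>R
     ((kE K (q - of_real x + quat_of_t (x *\<^sub>R \<tau>)) + kE K (q + of_real x + quat_of_t (x *\<^sub>R \<tau>)))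
     + quat_of_t \<tau> * (kE K (q - of_real x + quat_of_t (x *\<^sub>R \<tau>)) - kE K (q + of_real x + quat_of_t (x *\<^sub>R \<tau>))))"
      unfolding E P_def[symmetric] by (simp only: mult_scaleR_left) (simp add: algebra_simps)
  qed
  finally show ?thesis .
qed

text \<open>Twice the mass of the unnormalised Poisson kernel of the half space over R^3. It equals
  2 pi^2, the area of the unit sphere of the quaternions, which is the constant of Cauchy's
  formula.\<close>

definition cauchy_const :: real where
  "cauchy_const = 2 * (\<integral>\<tau>. (1 + (norm (\<tau>::real^3))\<^sup>2) powr (-2) \<partial>lborel)"

lemma integrable_poisson: "integrable lborel (\<lambda>\<tau>::real^3. (1 + (norm \<tau>)\<^sup>2) powr (-2))"
proof (rule integrable_if_decay)
  show "continuous_on UNIV (\<lambda>\<tau>::real^3. (1 + (norm \<tau>)\<^sup>2) powr (-2))"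
    by (intro continuous_intros) (auto simp: add_nonneg_eq_0_iff)
  show "real DIM(real^3) < 4" by simp
  fix \<tau> :: "real^3"
  have "(1 + norm \<tau>)\<^sup>2 / 2 \<le> 1 + (norm \<tau>)\<^sup>2"
    using sum_squares_bound[of 1 "norm \<tau>"] by (simp add: power2_sum)
  then have "(1 + (norm \<tau>)\<^sup>2) powr (-2) \<le> ((1 + norm \<tau>)\<^sup>2 / 2) powr (-2)"
    using add_pos_nonneg[of 1 "norm \<tau>"] by (intro powr_mono2') (auto simp: zero_less_power)
  also have "\<dots> = 4 * (1 + norm \<tau>) powr (-4)"
  proof -
    have pos: "1 + norm \<tau> > 0" by (rule add_pos_nonneg) auto
    have "((1 + norm \<tau>)\<^sup>2 / 2) powr (-2) = ((1 + norm \<tau>) powr 2) powr (-2) / 2 powr (-2)"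
      using pos by (simp add: powr_divide)
    also have "\<dots> = 4 * (1 + norm \<tau>) powr (-4)"
      unfolding powr_powr by (simp add: powr_minus_divide)
    finally show ?thesis .
  qed
  finally show "norm ((1 + (norm \<tau>)\<^sup>2) powr (-2)) \<le> 4 * (1 + norm \<tau>) powr - 4" by simp
qed

text \<open>On the other side of the pole the value is 0, so \<open>J K q x\<close> is the jump
  across 0. The jump may be computed at every \<open>X n\<close> and hence in the limit, where the
  Poisson part reproduces \<open>kE K q\<close> and the other part disappears.\<close>

lemma J_positive:
  assumes x: "0 < x" "x < qRe q" and K: "K \<ge> 1"
  shows "J K q x = cauchy_const *\<^sub>R kE K q"
proof -
  \<comment> \<open>The 2 keeps \<open>X n\<close> at most half of the real part of
    \<open>q\<close>, so that all arguments stay away from 0 uniformly in \<open>n\<close>.\<close>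
  define X where "X n = qRe q / (2 + real n)" for n
  have q: "qRe q > 0" using x by simp
  have X: "0 < X n" "X n \<le> qRe q / 2" "X n < qRe q" for n
    using q by (auto simp: X_def pos_divide_less_eq divide_left_mono add_nonneg_pos) (simp add: field_simps mult_nonneg_nonneg)?
  have X0: "X \<longlonglongrightarrow> 0" unfolding X_def
    by (rule real_tendsto_divide_at_top[OF tendsto_const filterlim_tendsto_add_at_top[OF tendsto_const filterlim_real_sequentially]])
  have JX: "J K q (X n) - J K q (- X n) = J K q x" for n
  proof -
    have "J K q (- X n) = 0" using X(1)[of n] q K by (intro J_negative) auto
    moreover have "J K q (X n) = J K q x"
    proof (cases "X n \<le> x")
      case True
      from J_constant[OF this x(2) disjI1[OF X(1)]] show ?thesis .
    next
      case False
      from J_constant[OF _ X(3) disjI1[OF x(1)], of n K] False show ?thesis by simp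
    qed
    ultimately show ?thesis by simp
  qed
  define R where "R = qRe q / 2"
  define A where "A = 2 * norm q"
  have R: "R > 0" using q by (simp add: R_def)
  have RA: "R \<le> \<bar>qRe (q + of_real y)\<bar>" "norm (q + of_real y) \<le> A" if "\<bar>y\<bar> \<le> qRe q / 2" for y
  proof -
    have "- (qRe q / 2) \<le> y" using that by linarith
    then have "R \<le> qRe (q + of_real y)" by (simp add: R_def)
    then show "R \<le> \<bar>qRe (q + of_real y)\<bar>" by linarith
    have "norm (q + of_real y) \<le> norm q + \<bar>y\<bar>" using norm_triangle_ineq[of q "of_real y"] by simp
    moreover have "\<bar>y\<bar> \<le> norm q" using that qRe_le_norm[of q] q by linarith
    ultimately show "norm (q + of_real y) \<le> A" by (simp add: A_def)
  qed
  obtain C1 where C1: "C1 > 0" "\<And>a \<tau>. R \<le> \<bar>qRe a\<bar> \<Longrightarrow> norm a \<le> A \<Longrightarrow> norm (kE K (a + quat_of_t \<tau>)) \<le> C1 * (1 + norm \<tau>) powr (- real (3 + K))"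
    using kE_decay[OF R, of A K] by blast
  obtain C2 where C2: "C2 > 0" "\<And>a \<tau>. R \<le> \<bar>qRe a\<bar> \<Longrightarrow> norm a \<le> A \<Longrightarrow> norm (dE K 1 (a + quat_of_t \<tau>)) \<le> C2 * (1 + norm \<tau>) powr (- real (Suc (3 + K)))"
    using dE_decay[OF R, of A K 1] by blast
  define B where "B s n \<tau> = kE K (q + of_real (s * X n) + quat_of_t (X n *\<^sub>R \<tau>))" for s n \<tau>
  have bB: "norm (B s n \<tau>) \<le> C1" if "\<bar>s\<bar> \<le> 1" for s n \<tau>
  proof -
    have "\<bar>s * X n\<bar> \<le> qRe q / 2" using that X[of n] mult_mono[of "\<bar>s\<bar>" 1 "X n" "qRe q / 2"] by (simp add: abs_mult)
    then have "norm (B s n \<tau>) \<le> C1 * (1 + norm (X n *\<^sub>R \<tau>)) powr (- real (3 + K))"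
      unfolding B_def by (intro C1(2) RA)
    also have "\<dots> \<le> C1 * 1"
      using C1(1) powr_mono2'[of "- real (3 + K)" 1 "1 + norm (X n *\<^sub>R \<tau>)"] by (intro mult_left_mono) auto
    finally show ?thesis by simp
  qed
  \<comment> \<open>The factor \<open>quat_of_t \<tau>\<close> spoils integrability, since the
    Poisson weight decays only with exponent -4 in dimension 3. The difference of the kernels
    repairs this: by the mean value inequality it is at most a multiple of
    \<open>X n / (1 + X n * norm \<tau>)\<close>, so the product with \<open>norm \<tau>\<close> is
    bounded.\<close>
  have dB: "norm \<tau> * norm (B (-1) n \<tau> - B 1 n \<tau>) \<le> 2 * C2" for n \<tau>
  proof -
    define z where "z = X n * norm \<tau>"
    have z: "z \<ge> 0" using X[of n] by (simp add: z_def)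
    let ?f = "\<lambda>y. kE K (q + of_real y + quat_of_t (X n *\<^sub>R \<tau>))"
    have nz: "q + of_real y + quat_of_t (X n *\<^sub>R \<tau>) \<noteq> 0" if "y \<in> {- X n..X n}" for y
      using that X[of n] q by (intro minus_quat_of_t_nonzero) auto
    have "norm (?f (- X n) - ?f (X n)) \<le> C2 * inverse (1 + z) * norm (- X n - X n)"
    proof (rule differentiable_bound[of "{- X n..X n}" ?f "\<lambda>y h. dE K (of_real h) (q + of_real y + quat_of_t (X n *\<^sub>R \<tau>))"])
      fix y assume y: "y \<in> {- X n..X n}"
      then have y': "\<bar>y\<bar> \<le> qRe q / 2" using X[of n] by auto
      show "(?f has_derivative (\<lambda>h. dE K (of_real h) (q + of_real y + quat_of_t (X n *\<^sub>R \<tau>)))) (at y within {- X n..X n})"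
        by (intro kE_compose_derivative nz y) (auto intro!: derivative_eq_intros simp: of_real_def)
      show "onorm (\<lambda>h. dE K (of_real h) (q + of_real y + quat_of_t (X n *\<^sub>R \<tau>))) \<le> C2 * inverse (1 + z)"
      proof (rule onorm_bound)
        fix h :: real
        have e: "dE K (of_real h) (q + of_real y + quat_of_t (X n *\<^sub>R \<tau>)) = h *\<^sub>R dE K 1 (q + of_real y + quat_of_t (X n *\<^sub>R \<tau>))"
          using linear_scale[OF linear_dE[OF nz[OF y]], of K h 1] by (simp add: of_real_def)
        have "norm (dE K 1 (q + of_real y + quat_of_t (X n *\<^sub>R \<tau>))) \<le> C2 * (1 + norm (X n *\<^sub>R \<tau>)) powr (- real (Suc (3 + K)))"
          by (intro C2(2) RA y')
        also have "\<dots> \<le> C2 * (1 + z) powr (- 1)"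
        proof (rule mult_left_mono)
          have nz: "norm (X n *\<^sub>R \<tau>) = z" using X(1)[of n] by (simp add: z_def)
          show "(1 + norm (X n *\<^sub>R \<tau>)) powr (- real (Suc (3 + K))) \<le> (1 + z) powr (- 1)"
            unfolding nz by (rule powr_mono) (use z in auto)
        qed (use C2 in simp)
        also have "(1 + z) powr (- 1) = inverse (1 + z)"
          using z by (simp add: powr_minus)
        finally have "norm (dE K (of_real h) (q + of_real y + quat_of_t (X n *\<^sub>R \<tau>))) \<le> \<bar>h\<bar> * (C2 * inverse (1 + z))"
          unfolding e by (simp add: mult_left_mono)
        then show "norm (dE K (of_real h) (q + of_real y + quat_of_t (X n *\<^sub>R \<tau>))) \<le> C2 * inverse (1 + z) * norm h"
          by (simp add: mult_ac)
      qed (use C2 z in auto)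
    qed (use X[of n] in auto)
    then have "norm (B (-1) n \<tau> - B 1 n \<tau>) \<le> C2 * inverse (1 + z) * (2 * X n)"
      using X[of n] by (simp add: B_def)
    then have "norm \<tau> * norm (B (-1) n \<tau> - B 1 n \<tau>) \<le> norm \<tau> * (C2 * inverse (1 + z) * (2 * X n))"
      by (rule mult_left_mono) simp
    also have "\<dots> = 2 * C2 * (z * inverse (1 + z))" by (simp add: z_def)
    also have "\<dots> \<le> 2 * C2 * 1"
      using C2(1) z by (intro mult_left_mono) (auto simp: field_simps)
    finally show ?thesis by simp
  qed
  define P where "P \<tau> = (1 + (norm \<tau>)\<^sup>2) powr (-2)" for \<tau> :: "real^3"
  define h where "h n \<tau> = P \<tau> *\<^sub>R ((B (-1) n \<tau> + B 1 n \<tau>) + quat_of_t \<tau> * (B (-1) n \<tau> - B 1 n \<tau>))" for n \<tau>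
  have Jh: "J K q x = (\<integral>\<tau>. h n \<tau> \<partial>lborel)" for n
    using J_jump[OF X(1,3), of K n] unfolding JX h_def B_def P_def by simp
  have "(\<lambda>n. \<integral>\<tau>. h n \<tau> \<partial>lborel) \<longlonglongrightarrow> (\<integral>\<tau>. P \<tau> *\<^sub>R (kE K q + kE K q) \<partial>lborel)"
  proof (rule integral_dominated_convergence[where w = "\<lambda>\<tau>. P \<tau> * (2 * C1 + 2 * C2)"])
    show "integrable lborel (\<lambda>\<tau>. P \<tau> * (2 * C1 + 2 * C2))"
      using integrable_poisson by (simp add: P_def)
    show "(\<lambda>\<tau>. P \<tau> *\<^sub>R (kE K q + kE K q)) \<in> borel_measurable lborel" by (simp add: P_def)
    show "h n \<in> borel_measurable lborel" for n
    proof -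
      have "continuous_on UNIV (B s n)" if "\<bar>s\<bar> \<le> 1" for s
      proof -
        have "\<bar>s * X n\<bar> \<le> qRe q / 2" using that X[of n] mult_mono[of "\<bar>s\<bar>" 1 "X n" "qRe q / 2"] by (simp add: abs_mult)
        then have "qRe (q + of_real (s * X n)) \<noteq> 0" using q by auto
        then show ?thesis unfolding B_def by (intro continuous_intros minus_quat_of_t_nonzero(2))
      qed
      then have "continuous_on UNIV (h n)"
        unfolding h_def P_def by (intro continuous_intros) (auto simp: add_nonneg_eq_0_iff)
      then show ?thesis using borel_measurable_continuous_onI by simp
    qed
    show "AE \<tau> in lborel. (\<lambda>n. h n \<tau>) \<longlonglongrightarrow> P \<tau> *\<^sub>R (kE K q + kE K q)"
    proof (rule AE_I2)
      fix \<tau> :: "real^3"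
      have Bl: "(\<lambda>n. B s n \<tau>) \<longlonglongrightarrow> kE K q" for s
      proof -
        have "(\<lambda>n. q + of_real (s * X n) + quat_of_t (X n *\<^sub>R \<tau>)) \<longlonglongrightarrow> q + of_real (s * 0) + quat_of_t (0 *\<^sub>R \<tau>)"
          unfolding quat_of_t_simps by (intro tendsto_intros X0)
        moreover have "q \<noteq> 0" using q by auto
        then have "isCont (kE K) q" using kE_has_derivative has_derivative_continuous by blast
        ultimately show ?thesis unfolding B_def by (intro isCont_tendsto_compose[of q "kE K"]) auto
      qed
      have "(\<lambda>n. h n \<tau>) \<longlonglongrightarrow> P \<tau> *\<^sub>R ((kE K q + kE K q) + quat_of_t \<tau> * (kE K q - kE K q))"
        unfolding h_def by (intro tendsto_intros Bl)
      then show "(\<lambda>n. h n \<tau>) \<longlonglongrightarrow> P \<tau> *\<^sub>R (kE K q + kE K q)" by simp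
    qed
    show "AE \<tau> in lborel. norm (h n \<tau>) \<le> P \<tau> * (2 * C1 + 2 * C2)" for n
    proof (rule AE_I2)
      fix \<tau> :: "real^3"
      have "norm ((B (-1) n \<tau> + B 1 n \<tau>) + quat_of_t \<tau> * (B (-1) n \<tau> - B 1 n \<tau>)) \<le> (C1 + C1) + 2 * C2"
        using bB[of "-1" n \<tau>] bB[of 1 n \<tau>] dB[of \<tau> n]
        by (intro order_trans[OF norm_triangle_ineq] add_mono) (auto simp: norm_mult intro: order_trans[OF norm_triangle_ineq])
      then show "norm (h n \<tau>) \<le> P \<tau> * (2 * C1 + 2 * C2)"
        by (simp add: h_def P_def mult_left_mono)
    qed
  qed
  then have "J K q x = (\<integral>\<tau>. P \<tau> *\<^sub>R (kE K q + kE K q) \<partial>lborel)"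
    unfolding Jh[symmetric] by (simp add: LIMSEQ_const_iff)
  also have "\<dots> = (\<integral>\<tau>. P \<tau> \<partial>lborel) *\<^sub>R (kE K q + kE K q)"
    using integrable_poisson by (intro integral_scaleR_left) (simp add: P_def)
  finally show ?thesis by (simp add: cauchy_const_def P_def scaleR_2[symmetric] mult.commute)
qed

text \<open>All derivatives are shifted to the second factor; a translation in \<open>\<tau>\<close>
  then makes \<open>a\<close> real and leaves the Cauchy integral \<open>J\<close>.\<close>

lemma kE_convolution:
  assumes a: "qRe a > 0" and b: "qRe b > 0" and jk: "j + k \<ge> 1"
  shows "(\<integral>\<tau>. kE j (a - quat_of_t \<tau>) * kE k (b + quat_of_t \<tau>) \<partial>lborel) = cauchy_const *\<^sub>R kE (j + k) (a + b)"
  using jk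
proof (induction j arbitrary: k)
  case (Suc j)
  have "(\<integral>\<tau>. kE (Suc j) (a - quat_of_t \<tau>) * kE k (b + quat_of_t \<tau>) \<partial>lborel)
      = (\<integral>\<tau>. kE j (a - quat_of_t \<tau>) * kE (Suc k) (b + quat_of_t \<tau>) \<partial>lborel)"
    using a b by (intro kE_convolution_shift) auto
  then show ?case using Suc.IH[of "Suc k"] by simp
next
  case 0
  define t :: "real^3" where "t = vector [qIm1 a, qIm2 a, qIm3 a]"
  have t: "quat_of_t t = a - of_real (qRe a)" by (simp add: t_def quat_of_t_def quat_eq_iff)
  let ?f = "\<lambda>\<tau>. kE 0 (a - quat_of_t \<tau>) * kE k (b + quat_of_t \<tau>)"
  have "?f \<in> borel_measurable borel"
    using borel_measurable_integrable[OF kE_prod_integrable[of a b 0 k]] a b by simp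
  from integral_lborel_translation[OF this, of t]
  have "(\<integral>\<tau>. ?f \<tau> \<partial>lborel) = (\<integral>\<tau>. ?f (t + \<tau>) \<partial>lborel)" ..
  also have "(\<lambda>\<tau>. ?f (t + \<tau>)) = (\<lambda>\<tau>. kE 0 (of_real (qRe a) - quat_of_t \<tau>) * kE k (a + b - of_real (qRe a) + quat_of_t \<tau>))"
    by (simp add: t algebra_simps)
  also have "(\<integral>\<tau>. kE 0 (of_real (qRe a) - quat_of_t \<tau>) * kE k (a + b - of_real (qRe a) + quat_of_t \<tau>) \<partial>lborel) = J k (a + b) (qRe a)"
    by (simp add: J_def)
  also have "\<dots> = cauchy_const *\<^sub>R kE k (a + b)"
    using 0 a b by (intro J_positive) auto
  finally show ?case by simp
qed

section \<open>Integration over the horizontal variables\<close>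

definition quat_of_vec :: "real^4 \<Rightarrow> quat" where
  "quat_of_vec v = Quat (v $ 1) (v $ 2) (v $ 3) (v $ 4)"

lemma quat_of_vec_simps [simp]:
  "quat_of_vec (x + y) = quat_of_vec x + quat_of_vec y" "quat_of_vec (x - y) = quat_of_vec x - quat_of_vec y"
  "quat_of_vec (- x) = - quat_of_vec x" "quat_of_vec (r *\<^sub>R x) = r *\<^sub>R quat_of_vec x" "quat_of_vec 0 = 0"
  by (simp_all add: quat_of_vec_def quat_eq_iff)

lemma quat_of_vec_axis [simp]:
  "quat_of_vec (axis 1 1) = 1" "quat_of_vec (axis 2 1) = qi" "quat_of_vec (axis 3 1) = qj" "quat_of_vec (axis 4 1) = qk"
  by (simp_all add: quat_of_vec_def quat_eq_iff axis_def)

lemma inner_quat_of_vec [simp]: "inner (quat_of_vec x) (quat_of_vec y) = inner x y"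
  by (simp add: inner_quat_def quat_of_vec_def inner_vec_def sum_4)

lemma norm_quat_of_vec [simp]: "norm (quat_of_vec x) = norm x"
  by (simp add: norm_eq_sqrt_inner)

lemma quat_of_y_nth [simp]: "quat_of_y y $ l = quat_of_vec (y $ l)"
  by (simp add: quat_of_y_def quat_of_vec_def)

text \<open>The quaternionic Hermitian product, conjugate in the first argument. Its real part is
  the Euclidean inner product and twice its imaginary part is the twist \<open>hform\<close> of the
  group law.\<close>

definition hip :: "real^4^'m::finite \<Rightarrow> real^4^'m \<Rightarrow> quat" where
  "hip y x = (\<Sum>l\<in>UNIV. qcnj (quat_of_vec (y $ l)) * quat_of_vec (x $ l))"

lemma hip_add_left: "hip (y + z) x = hip y x + hip z x" and hip_add_right: "hip x (y + z) = hip x y + hip x z"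
  and hip_diff_left: "hip (y - z) x = hip y x - hip z x" and hip_diff_right: "hip x (y - z) = hip x y - hip x z"
  and hip_minus_left [simp]: "hip (- y) x = - hip y x" and hip_minus_right [simp]: "hip x (- y) = - hip x y"
  and hip_scaleR_left [simp]: "hip (r *\<^sub>R y) x = r *\<^sub>R hip y x" and hip_scaleR_right [simp]: "hip x (r *\<^sub>R y) = r *\<^sub>R hip x y"
  and hip_0_left [simp]: "hip 0 x = 0" and hip_0_right [simp]: "hip x 0 = 0"
  by (simp_all add: hip_def algebra_simps sum.distrib sum_subtractf sum_negf scaleR_sum_right)

lemma norm_hip_le: "norm (hip y x) \<le> norm y * norm x"
proof -
  have "norm (hip y x) \<le> (\<Sum>l\<in>UNIV. \<bar>norm (y $ l)\<bar> * \<bar>norm (x $ l)\<bar>)"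
    unfolding hip_def by (intro sum_norm_le) (simp add: norm_mult)
  also have "\<dots> \<le> norm y * norm x"
    unfolding norm_vec_def by (rule L2_set_mult_ineq)
  finally show ?thesis .
qed

lemma qRe_sum: "qRe (sum f A) = (\<Sum>i\<in>A. qRe (f i))"
  by (induction A rule: infinite_finite_induct) auto

lemma qRe_hip: "qRe (hip y x) = inner y x"
proof -
  have "qRe (qcnj a * b) = inner a b" for a b by (simp add: inner_quat_def)
  then show ?thesis by (simp add: hip_def qRe_sum inner_vec_def[of y])
qed

lemma hip_self: "hip y y = of_real ((norm y)\<^sup>2)"
proof -
  have "(norm y)\<^sup>2 = (\<Sum>l\<in>UNIV. (norm (y $ l))\<^sup>2)"
    by (simp add: power2_norm_eq_inner inner_vec_def[of y])
  then show ?thesis by (simp add: hip_def qcnj_mult_self)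
qed

lemma qcnj_sum: "qcnj (sum f A) = (\<Sum>i\<in>A. qcnj (f i))"
  by (induction A rule: infinite_finite_induct) auto

lemma qcnj_hip: "qcnj (hip y x) = hip x y"
  by (simp add: hip_def qcnj_sum)

lemma bounded_linear_hip_left: "bounded_linear (\<lambda>y. hip y x)"
  by (rule bounded_linear_intro[where K = "norm x"]) (simp_all add: hip_add_left norm_hip_le)

lemma bounded_linear_hip_right: "bounded_linear (\<lambda>y. hip x y)"
  by (rule bounded_linear_intro[where K = "norm x"]) (use norm_hip_le[of x] in \<open>simp_all add: hip_add_right mult.commute\<close>)

lemmas has_derivative_hip_left [derivative_intros] = bounded_linear.has_derivative[OF bounded_linear_hip_left]
lemmas has_derivative_hip_right [derivative_intros] = bounded_linear.has_derivative[OF bounded_linear_hip_right]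
lemmas continuous_on_hip_left [continuous_intros] = bounded_linear.continuous_on[OF bounded_linear_hip_left]

section \<open>Removal of the Hermitian cross term by harmonicity\<close>

definition ybasis :: "'m::finite \<Rightarrow> 4 \<Rightarrow> real^4^'m" where
  "ybasis l j = axis l (axis j 1)"

lemma ybasis_expand: "y = (\<Sum>l\<in>UNIV. \<Sum>j\<in>UNIV. (y $ l $ j) *\<^sub>R ybasis l j)"
proof -
  have "(\<Sum>l\<in>UNIV. \<Sum>j\<in>UNIV. (y $ l $ j) *\<^sub>R ybasis l j) $ a $ b = y $ a $ b" for a b
  proof -
    have "(\<Sum>l\<in>UNIV. \<Sum>j\<in>UNIV. (y $ l $ j) *\<^sub>R ybasis l j) $ a $ b
        = (\<Sum>l\<in>UNIV. \<Sum>j\<in>UNIV. if l = a then (if j = b then y $ l $ j else 0) else 0)"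
      by (auto simp: sum_component ybasis_def axis_def intro!: sum.cong)
    also have "\<dots> = (\<Sum>l\<in>UNIV. if l = a then y $ l $ b else 0)"
      by (intro sum.cong) (auto simp: sum.delta)
    also have "\<dots> = y $ a $ b" by (simp add: sum.delta)
    finally show ?thesis .
  qed
  then show ?thesis by (simp add: vec_eq_iff)
qed

lemma hip_ybasis: "hip (ybasis l j) x = qcnj (quat_of_vec (axis j 1)) * quat_of_vec (x $ l)"
proof -
  have "hip (ybasis l j) x = (\<Sum>i\<in>UNIV. if i = l then qcnj (quat_of_vec (axis j 1)) * quat_of_vec (x $ l) else 0)"
    unfolding hip_def by (intro sum.cong) (auto simp: ybasis_def axis_def)
  then show ?thesis by (simp add: sum.delta)
qed

lemma inner_ybasis: "inner y (ybasis l j) = y $ l $ j"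
  by (simp add: ybasis_def inner_axis)

text \<open>The vectors \<open>qcnj e * p\<close>, with \<open>e\<close> among the four units, are
  orthogonal and of length \<open>norm p\<close>, so the sum is \<open>(norm p)^2\<close> times the
  trace of the form, and the trace is the Laplacian.\<close>

lemma sum_rotated_hessian:
  fixes H :: "quat \<Rightarrow> quat \<Rightarrow> quat"
  assumes lin: "\<And>w. linear (\<lambda>v. H v w)" and sym: "\<And>v w. H v w = H w v"
    and lap: "H 1 1 + H qi qi + H qj qj + H qk qk = 0"
  shows "(\<Sum>j\<in>UNIV. H (qcnj (quat_of_vec (axis j 1)) * p) (qcnj (quat_of_vec (axis j 1)) * p)) = 0"
proof -
  have H1: "H v w = qRe v *\<^sub>R H 1 w + qIm1 v *\<^sub>R H qi w + qIm2 v *\<^sub>R H qj w + qIm3 v *\<^sub>R H qk w" for v w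
    by (rule linear_quat_expand[OF lin])
  have H2: "H v w = qRe w *\<^sub>R H v 1 + qIm1 w *\<^sub>R H v qi + qIm2 w *\<^sub>R H v qj + qIm3 w *\<^sub>R H v qk" for v w
    using H1[of w v] by (simp add: sym)
  have s: "H qi 1 = H 1 qi" "H qj 1 = H 1 qj" "H qk 1 = H 1 qk" "H qj qi = H qi qj" "H qk qi = H qi qk" "H qk qj = H qj qk"
    by (simp_all add: sym)
  have e: "H v v = (qRe v * qRe v) *\<^sub>R H 1 1 + (qIm1 v * qIm1 v) *\<^sub>R H qi qi + (qIm2 v * qIm2 v) *\<^sub>R H qj qj + (qIm3 v * qIm3 v) *\<^sub>R H qk qk
    + (2 * (qRe v * qIm1 v)) *\<^sub>R H 1 qi + (2 * (qRe v * qIm2 v)) *\<^sub>R H 1 qj + (2 * (qRe v * qIm3 v)) *\<^sub>R H 1 qk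
    + (2 * (qIm1 v * qIm2 v)) *\<^sub>R H qi qj + (2 * (qIm1 v * qIm3 v)) *\<^sub>R H qi qk + (2 * (qIm2 v * qIm3 v)) *\<^sub>R H qj qk" for v
    unfolding H1[of v v] unfolding H2[of _ v] s by (simp add: quat_eq_iff algebra_simps)
  define N where "N = qRe p * qRe p + qIm1 p * qIm1 p + qIm2 p * qIm2 p + qIm3 p * qIm3 p"
  have "(\<Sum>j\<in>UNIV. H (qcnj (quat_of_vec (axis j 1)) * p) (qcnj (quat_of_vec (axis j 1)) * p))
      = H p p + H (qcnj qi * p) (qcnj qi * p) + H (qcnj qj * p) (qcnj qj * p) + H (qcnj qk * p) (qcnj qk * p)"
    by (simp add: sum_4)
  also have "\<dots> = N *\<^sub>R (H 1 1 + H qi qi + H qj qj + H qk qk)"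
    unfolding e[of p] e[of "qcnj _ * p"] by (simp add: quat_eq_iff N_def algebra_simps)
  finally show ?thesis by (simp add: lap)
qed

lemma ev_decay_square:
  assumes "hom e d" "c > 0"
  shows "\<exists>C>0. \<forall>z (y :: 'a::real_normed_vector). c * (1 + norm y)\<^sup>2 \<le> norm z \<longrightarrow> norm (ev e z) \<le> C * (1 + norm y) powr (- real (2 * d))"
proof -
  obtain C where C: "C > 0" "\<And>\<sigma>. \<sigma> \<noteq> 0 \<Longrightarrow> norm (ev e \<sigma>) \<le> C * inverse (norm \<sigma>) ^ d"
    using hom_bound[OF assms(1)] by blast
  show ?thesis
  proof (intro exI[of _ "C * inverse c ^ d"] conjI allI impI)
    fix z :: quat and y :: 'a assume z: "c * (1 + norm y)\<^sup>2 \<le> norm z"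
    have y: "1 + norm y > 0" by (rule add_pos_nonneg) auto
    then have p: "c * (1 + norm y)\<^sup>2 > 0" using assms(2) by simp
    then have "inverse (norm z) ^ d \<le> inverse (c * (1 + norm y)\<^sup>2) ^ d"
      using z by (intro power_mono le_imp_inverse_le) auto
    also have "\<dots> = inverse c ^ d * (1 + norm y) powr (- real (2 * d))"
      using y by (simp only: powr_minus powr_realpow power_inverse power_mult_distrib power_mult inverse_mult_distrib)
    finally have "C * inverse (norm z) ^ d \<le> C * (inverse c ^ d * (1 + norm y) powr (- real (2 * d)))"
      using C by (intro mult_left_mono) auto
    moreover have "z \<noteq> 0" using p z by auto
    ultimately show "norm (ev e z) \<le> C * inverse c ^ d * (1 + norm y) powr (- real (2 * d))"
      using C(2)[of z] by (simp add: mult.assoc)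
  qed (use C assms in auto)
qed

text \<open>For \<open>\<theta> = 1\<close> this is the argument that the convolution of two kernels
  produces after integration over the centre; for \<open>\<theta> = 0\<close> it is radial in
  \<open>y\<close>. The parameter joins the two.\<close>

definition zarg :: "quat \<Rightarrow> real^4^'m::finite \<Rightarrow> real \<Rightarrow> real^4^'m \<Rightarrow> quat" where
  "zarg s x \<theta> y = s + (2 * (norm y)\<^sup>2) *\<^sub>R 1 - (2 * \<theta>) *\<^sub>R hip y x"

text \<open>The hypothesis on \<open>s\<close> supplies the \<open>(norm x)^2\<close> that, with one
  of the two copies of \<open>(norm y)^2\<close>, absorbs the cross term; the other copy
  remains.\<close>

lemma zarg_lower:
  assumes "\<epsilon> > 0" "qRe s \<ge> \<epsilon> + (norm x)\<^sup>2" "\<theta> \<in> {0..1}"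
  shows "min \<epsilon> 1 / 2 * (1 + norm y)\<^sup>2 \<le> norm (zarg s x \<theta> y)" "zarg s x \<theta> y \<noteq> 0"
proof -
  have "\<theta> * inner y x \<le> \<bar>\<theta>\<bar> * \<bar>inner y x\<bar>" by (metis abs_ge_self abs_mult)
  also have "\<dots> \<le> 1 * (norm y * norm x)"
    using assms(3) Cauchy_Schwarz_ineq2[of y x] by (intro mult_mono) auto
  finally have "2 * \<theta> * inner y x \<le> (norm y)\<^sup>2 + (norm x)\<^sup>2"
    using sum_squares_bound[of "norm y" "norm x"] by linarith
  then have "\<epsilon> + (norm y)\<^sup>2 \<le> qRe (zarg s x \<theta> y)"
    using assms(2) by (simp add: zarg_def qRe_hip)
  also have "\<dots> \<le> norm (zarg s x \<theta> y)" using qRe_le_norm[of "zarg s x \<theta> y"] by simp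
  finally have le: "\<epsilon> + (norm y)\<^sup>2 \<le> norm (zarg s x \<theta> y)" .
  have "min \<epsilon> 1 / 2 * (1 + norm y)\<^sup>2 \<le> min \<epsilon> 1 / 2 * (2 + 2 * (norm y)\<^sup>2)"
    using assms(1) sum_squares_bound[of 1 "norm y"] by (intro mult_left_mono) (auto simp: power2_sum)
  also have "\<dots> = min \<epsilon> 1 + min \<epsilon> 1 * (norm y)\<^sup>2" by (simp add: algebra_simps)
  also have "\<dots> \<le> \<epsilon> + 1 * (norm y)\<^sup>2" by (intro add_mono mult_right_mono) auto
  finally show "min \<epsilon> 1 / 2 * (1 + norm y)\<^sup>2 \<le> norm (zarg s x \<theta> y)" using le by simp
  show "zarg s x \<theta> y \<noteq> 0" using order_less_le_trans[OF add_pos_nonneg[OF assms(1) zero_le_power2[of "norm y"]] le] by auto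
qed

lemma zarg_has_derivative:
  "(zarg s x \<theta> has_derivative (\<lambda>h. (4 * inner y h) *\<^sub>R 1 - (2 * \<theta>) *\<^sub>R hip h x)) (at y)"
proof -
  have "((\<lambda>y. s + (2 * inner y y) *\<^sub>R (1::quat) - (2 * \<theta>) *\<^sub>R hip y x) has_derivative (\<lambda>h. (4 * inner y h) *\<^sub>R 1 - (2 * \<theta>) *\<^sub>R hip h x)) (at y)"
    by (auto intro!: derivative_eq_intros simp: inner_commute algebra_simps)
  then show ?thesis by (simp add: zarg_def[abs_def] power2_norm_eq_inner)
qed

lemma continuous_on_zarg: "continuous_on S (zarg s x \<theta>)"
  unfolding zarg_def by (intro continuous_intros)

lemma integrable_ev_zarg:
  fixes x :: "real^4^'m::finite"
  assumes "\<epsilon> > 0" "qRe s \<ge> \<epsilon> + (norm x)\<^sup>2" "\<theta> \<in> {0..1}" "hom e d" "4 * CARD('m) < 2 * d"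
  shows "integrable lborel (\<lambda>y. ev e (zarg s x \<theta> y))"
proof -
  have "min \<epsilon> 1 / 2 > 0" using assms by simp
  from ev_decay_square[OF assms(4) this, where 'a = "real^4^'m"] obtain C where C: "C > 0"
    "\<And>z (y::real^4^'m). min \<epsilon> 1 / 2 * (1 + norm y)\<^sup>2 \<le> norm z \<Longrightarrow> norm (ev e z) \<le> C * (1 + norm y) powr (- real (2 * d))" by blast
  show ?thesis
  proof (rule integrable_if_decay)
    show "continuous_on UNIV (\<lambda>y. ev e (zarg s x \<theta> y))"
      using zarg_lower(2)[OF assms(1-3)] by (intro continuous_on_compose2[OF continuous_on_ev continuous_on_zarg]) auto
    show "norm (ev e (zarg s x \<theta> y)) \<le> C * (1 + norm y) powr (- real (2 * d))" for y
      by (rule C(2)[OF zarg_lower(1)[OF assms(1-3)]])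
    show "real DIM(real^4^'m) < real (2 * d)" using assms(5) by simp
  qed
qed

text \<open>
  Harmonicity turns the derivative in \<open>\<theta>\<close> into a divergence: this replaces the mean value
  property over the spheres \<open>y \<cdot> Sp(1)\<close>.
\<close>

lemma zarg_derivative_integral_0:
  fixes x :: "real^4^'m::finite"
  assumes a: "\<epsilon> > 0" "qRe s \<ge> \<epsilon> + (norm x)\<^sup>2" "\<theta> \<in> {0..1}" and k: "4 * CARD('m) < 2 * (4 + k)"
  shows "(\<integral>y. dE (Suc k) (hip y x) (zarg s x \<theta> y) \<partial>lborel) = 0"
    and "integrable lborel (\<lambda>y. dE (Suc k) (hip y x) (zarg s x \<theta> y))"
proof -
  note nz = zarg_lower(2)[OF a]
  define H where "H z v w = ev (rd v (rd w (Ex k))) z" for z v w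
  have linH: "linear (\<lambda>v. H z v w)" if "z \<noteq> 0" for z w
    unfolding H_def by (rule linear_ev_rd[OF that])
  have symH: "H z v w = H z w v" for z v w unfolding H_def by (rule ev_rd_commute)
  \<comment> \<open>The derivative along \<open>h\<close> of \<open>dE k (hip \<eta> x)\<close> at
    the moving argument. In the trace over \<open>\<eta> = h\<close> the part coming from
    \<open>2 * (norm y)^2\<close> gives \<open>4 * dE (Suc k) (hip y x)\<close>, while the part
    coming from the cross term is a rotated Laplacian and vanishes.\<close>
  define D where "D \<eta> y h = H (zarg s x \<theta> y) ((4 * inner y h) *\<^sub>R 1 - (2 * \<theta>) *\<^sub>R hip h x) (hip \<eta> x)" for \<eta> y h
  have homH: "hom (rd v (rd w (Ex k))) (5 + k)" for v w
    using hom_rd[OF hom_rd[OF hom_Ex[of k]]] by (simp add: numeral_eq_Suc)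
  have expand: "D \<eta> y h = (4 * inner y h) *\<^sub>R H (zarg s x \<theta> y) 1 (hip \<eta> x) - (2 * \<theta>) *\<^sub>R H (zarg s x \<theta> y) (hip h x) (hip \<eta> x)" for \<eta> y h
    unfolding D_def by (simp only: linear_diff[OF linH[OF nz]] linear_scale[OF linH[OF nz]])
  have cont: "continuous_on UNIV (\<lambda>y. H (zarg s x \<theta> y) v w)" for v w
    unfolding H_def using nz by (intro continuous_on_compose2[OF continuous_on_ev continuous_on_zarg]) auto
  have cpos: "min \<epsilon> 1 / 2 > 0" using a by simp
  have int: "integrable lborel (\<lambda>y. D \<eta> y h)" for \<eta> h
  proof -
    obtain C where C: "C > 0" "\<And>z (y::real^4^'m). min \<epsilon> 1 / 2 * (1 + norm y)\<^sup>2 \<le> norm z \<Longrightarrow> norm (H z 1 (hip \<eta> x)) \<le> C * (1 + norm y) powr (- real (2 * (5 + k)))"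
      using ev_decay_square[OF homH cpos, where 'a = "real^4^'m"] unfolding H_def by blast
    have "integrable lborel (\<lambda>y. (4 * inner y h) *\<^sub>R H (zarg s x \<theta> y) 1 (hip \<eta> x))"
    proof (rule integrable_if_decay)
      show "continuous_on UNIV (\<lambda>y. (4 * inner y h) *\<^sub>R H (zarg s x \<theta> y) 1 (hip \<eta> x))"
        by (intro continuous_intros cont)
      show "real DIM(real^4^'m) < real (2 * (4 + k))" using k by simp
      fix y :: "real^4^'m"
      have y: "1 + norm y > 0" by (rule add_pos_nonneg) auto
      have "\<bar>4 * inner y h\<bar> \<le> 4 * norm h * (1 + norm y)"
        using Cauchy_Schwarz_ineq2[of y h] by (simp add: abs_mult algebra_simps add_increasing)
      then have "norm ((4 * inner y h) *\<^sub>R H (zarg s x \<theta> y) 1 (hip \<eta> x)) \<le> (4 * norm h * (1 + norm y)) * (C * (1 + norm y) powr (- real (2 * (5 + k))))"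
        using C(2)[OF zarg_lower(1)[OF a], of y] unfolding norm_scaleR by (intro mult_mono) auto
      also have "\<dots> = (4 * norm h * C) * ((1 + norm y) powr 1 * (1 + norm y) powr (- real (2 * (5 + k))))"
        using y by simp
      also have "\<dots> \<le> (4 * norm h * C) * (1 + norm y) powr (- real (2 * (4 + k)))"
        unfolding powr_add[symmetric] using C(1) by (intro mult_left_mono powr_mono) auto
      finally show "norm ((4 * inner y h) *\<^sub>R H (zarg s x \<theta> y) 1 (hip \<eta> x)) \<le> (4 * norm h * C) * (1 + norm y) powr (- real (2 * (4 + k)))" .
    qed
    moreover have "integrable lborel (\<lambda>y. (2 * \<theta>) *\<^sub>R H (zarg s x \<theta> y) (hip h x) (hip \<eta> x))"
      unfolding H_def using k by (intro integrable_scaleR_right integrable_ev_zarg[OF a homH]) auto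
    ultimately show ?thesis unfolding expand by (rule Bochner_Integration.integrable_diff)
  qed
  have z: "(\<integral>y. D \<eta> y h \<partial>lborel) = 0" for \<eta> h
  proof (rule integral_directional_derivative_eq_0)
    show "integrable lborel (\<lambda>y. dE k (hip \<eta> x) (zarg s x \<theta> y))"
      unfolding dE_def using k by (intro integrable_ev_zarg[OF a hom_rd[OF hom_Ex]]) auto
    show "continuous_on UNIV (\<lambda>y. D \<eta> y h)" unfolding expand by (intro continuous_intros cont)
    show "((\<lambda>y. dE k (hip \<eta> x) (zarg s x \<theta> y)) has_derivative D \<eta> y) (at y)" for y
      using has_derivative_compose[OF zarg_has_derivative[of s x \<theta> y] dE_has_derivative[OF nz]]
      by (simp add: D_def[abs_def] H_def)
  qed (rule int)
  have sum: "(\<Sum>l\<in>UNIV. \<Sum>j\<in>UNIV. D (ybasis l j) y (ybasis l j)) = 4 *\<^sub>R dE (Suc k) (hip y x) (zarg s x \<theta> y)" for y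
  proof -
    let ?z = "zarg s x \<theta> y"
    have "(\<Sum>j\<in>UNIV. H ?z (hip (ybasis l j) x) (hip (ybasis l j) x)) = 0" for l
      unfolding hip_ybasis
      by (rule sum_rotated_hessian[OF linH[OF nz] symH]) (use kE_harmonic[OF nz] in \<open>simp add: H_def\<close>)
    moreover have "(\<Sum>l\<in>UNIV. \<Sum>j\<in>UNIV. inner y (ybasis l j) *\<^sub>R H ?z 1 (hip (ybasis l j) x)) = H ?z 1 (hip y x)"
    proof -
      have "linear (\<lambda>w. H ?z 1 (hip w x))"
        unfolding symH[of ?z 1] by (rule linear_compose[OF bounded_linear.linear[OF bounded_linear_hip_left] linH[OF nz], unfolded comp_def])
      note lin = this
      have "H ?z 1 (hip y x) = H ?z 1 (hip (\<Sum>l\<in>UNIV. \<Sum>j\<in>UNIV. (y $ l $ j) *\<^sub>R ybasis l j) x)"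
        by (rule arg_cong[OF ybasis_expand])
      also have "\<dots> = (\<Sum>l\<in>UNIV. \<Sum>j\<in>UNIV. (y $ l $ j) *\<^sub>R H ?z 1 (hip (ybasis l j) x))"
        by (simp only: linear_sum[OF lin] linear_scale[OF lin])
      finally show ?thesis by (simp add: inner_ybasis)
    qed
    moreover have "(\<Sum>l\<in>UNIV. \<Sum>j\<in>UNIV. D (ybasis l j) y (ybasis l j))
      = 4 *\<^sub>R (\<Sum>l\<in>UNIV. \<Sum>j\<in>UNIV. inner y (ybasis l j) *\<^sub>R H ?z 1 (hip (ybasis l j) x))
        - (2 * \<theta>) *\<^sub>R (\<Sum>l\<in>UNIV. \<Sum>j\<in>UNIV. H ?z (hip (ybasis l j) x) (hip (ybasis l j) x))"
      unfolding expand by (simp add: sum_subtractf scaleR_sum_right)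
    moreover have "H ?z 1 (hip y x) = dE (Suc k) (hip y x) ?z"
      by (simp add: H_def dE_def Ex_Suc ev_rd_commute)
    ultimately show ?thesis by simp
  qed
  have eq: "dE (Suc k) (hip y x) (zarg s x \<theta> y) = (1/4) *\<^sub>R (\<Sum>l\<in>UNIV. \<Sum>j\<in>UNIV. D (ybasis l j) y (ybasis l j))" for y
    unfolding sum by simp
  show "integrable lborel (\<lambda>y. dE (Suc k) (hip y x) (zarg s x \<theta> y))"
    unfolding eq by (intro integrable_scaleR_right Bochner_Integration.integrable_sum int)
  show "(\<integral>y. dE (Suc k) (hip y x) (zarg s x \<theta> y) \<partial>lborel) = 0"
    unfolding eq integral_scaleR_right
    by (simp add: Bochner_Integration.integral_sum Bochner_Integration.integrable_sum int z)
qed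

text \<open>The derivative in \<open>\<theta>\<close> is -2 times the integral that
  \<open>zarg_derivative_integral_0\<close> shows to vanish.\<close>

lemma zarg_integral_constant:
  fixes x :: "real^4^'m::finite"
  assumes a: "\<epsilon> > 0" "qRe s \<ge> \<epsilon> + (norm x)\<^sup>2" and k: "4 * CARD('m) < 2 * (4 + k)"
  shows "(\<integral>y. kE (Suc k) (zarg s x 1 y) \<partial>lborel) = (\<integral>y. kE (Suc k) (zarg s x 0 y) \<partial>lborel)"
proof -
  define I where "I \<theta> = (\<integral>y. kE (Suc k) (zarg s x \<theta> y) \<partial>lborel)" for \<theta>
  define f' where "f' \<theta> y h = (- 2 * h) *\<^sub>R dE (Suc k) (hip y x) (zarg s x \<theta> y)" for \<theta> y and h :: real
  have cpos: "min \<epsilon> 1 / 2 > 0" using a by simp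
  obtain C0 where C0: "C0 > 0" "\<And>\<sigma> v. \<sigma> \<noteq> 0 \<Longrightarrow> norm (dE (Suc k) v \<sigma>) \<le> C0 * norm v * inverse (norm \<sigma>) ^ (4 + Suc k)"
    using dE_bound[of "Suc k"] by blast
  define c where "c = min \<epsilon> 1 / 2"
  have "(I has_derivative (\<lambda>h. 0)) (at \<theta> within {0..1})" if \<theta>: "\<theta> \<in> {0..1}" for \<theta>
  proof -
    have "(I has_derivative (\<lambda>h. \<integral>y. f' \<theta> y h \<partial>lborel)) (at \<theta> within {0..1})"
      unfolding I_def
    proof (rule has_derivative_integral_param)
      show "integrable lborel (\<lambda>y. kE (Suc k) (zarg s x \<theta> y))" if "\<theta> \<in> {0..1}" for \<theta>
        unfolding kE_def using k by (intro integrable_ev_zarg[OF a that hom_Ex]) auto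
      show "integrable lborel (\<lambda>y::real^4^'m. (2 * C0 * norm x * inverse c ^ (5 + k)) * (1 + norm y) powr (- real (2 * (4 + k))))"
        using k by (intro integrable_mult_right integrable_decay) simp
      show "integrable lborel (\<lambda>y. f' \<theta> y h)" for h
        unfolding f'_def by (intro integrable_scaleR_right zarg_derivative_integral_0(2)[OF a \<theta> k])
      fix \<theta> :: real and y :: "real^4^'m" assume \<theta>: "\<theta> \<in> {0..1}"
      note nz = zarg_lower(2)[OF a \<theta>]
      have "((\<lambda>\<theta>. zarg s x \<theta> y) has_derivative (\<lambda>h. - (2 * h) *\<^sub>R hip y x)) (at \<theta> within {0..1})"
        unfolding zarg_def by (auto intro!: derivative_eq_intros)
      from kE_compose_derivative[OF this nz, of "Suc k"]
      show "((\<lambda>\<theta>. kE (Suc k) (zarg s x \<theta> y)) has_derivative f' \<theta> y) (at \<theta> within {0..1})"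
        by (simp add: f'_def[abs_def] linear_scale[OF linear_dE[OF nz]] linear_neg[OF linear_dE[OF nz]])
      show "norm (f' \<theta> y h) \<le> (2 * C0 * norm x * inverse c ^ (5 + k)) * (1 + norm y) powr (- real (2 * (4 + k))) * norm h" for h
      proof -
        have y: "1 + norm y > 0" by (rule add_pos_nonneg) auto
        have "inverse (norm (zarg s x \<theta> y)) ^ (5 + k) \<le> inverse (c * (1 + norm y)\<^sup>2) ^ (5 + k)"
          using zarg_lower(1)[OF a \<theta>, of y] cpos y by (intro power_mono le_imp_inverse_le) (auto simp: c_def)
        also have "\<dots> = inverse c ^ (5 + k) * (1 + norm y) powr (- real (2 * (5 + k)))"
          using y by (simp only: powr_minus powr_realpow power_inverse power_mult_distrib power_mult inverse_mult_distrib)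
        finally have i: "inverse (norm (zarg s x \<theta> y)) ^ (5 + k) \<le> inverse c ^ (5 + k) * (1 + norm y) powr (- real (2 * (5 + k)))" .
        have "norm (hip y x) \<le> (1 + norm y) * norm x"
          using norm_hip_le[of y x] by (simp add: algebra_simps add_increasing)
        then have "C0 * norm (hip y x) \<le> C0 * ((1 + norm y) * norm x)" using C0(1) by simp
        with i have "C0 * norm (hip y x) * inverse (norm (zarg s x \<theta> y)) ^ (5 + k)
           \<le> C0 * ((1 + norm y) * norm x) * (inverse c ^ (5 + k) * (1 + norm y) powr (- real (2 * (5 + k))))"
          using C0(1) y by (intro mult_mono) auto
        also have "\<dots> = (C0 * norm x * inverse c ^ (5 + k)) * ((1 + norm y) powr 1 * (1 + norm y) powr (- real (2 * (5 + k))))"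
          using y by simp
        also have "\<dots> \<le> (C0 * norm x * inverse c ^ (5 + k)) * (1 + norm y) powr (- real (2 * (4 + k)))"
          unfolding powr_add[symmetric] using C0(1) cpos by (intro mult_left_mono powr_mono) (auto simp: c_def)
        finally have "norm (dE (Suc k) (hip y x) (zarg s x \<theta> y)) \<le> (C0 * norm x * inverse c ^ (5 + k)) * (1 + norm y) powr (- real (2 * (4 + k)))"
          using C0(2)[OF nz, of "hip y x" y] by simp
        from mult_left_mono[OF this, of "2 * \<bar>h\<bar>"] show ?thesis
          unfolding f'_def by (simp add: abs_mult mult_ac)
      qed
    qed (use \<theta> in auto)
    moreover have "(\<integral>y. f' \<theta> y h \<partial>lborel) = 0" for h
      unfolding f'_def integral_scaleR_right by (simp add: zarg_derivative_integral_0(1)[OF a \<theta> k])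
    ultimately show ?thesis by simp
  qed
  then obtain b where "\<And>\<theta>. \<theta> \<in> {0..1} \<Longrightarrow> I \<theta> = b"
    using has_derivative_zero_constant[of "{0..1}" I] by auto
  then show ?thesis by (simp add: I_def)
qed

section \<open>Radial integration over the horizontal variables\<close>

lemma ev_real_decay:
  assumes "hom e d" "qRe s > 0"
  shows "\<exists>C>0. \<forall>u\<ge>0. norm (ev e (s + of_real u)) \<le> C * inverse (1 + u) ^ d"
proof -
  obtain C where C: "C > 0" "\<And>\<sigma>. \<sigma> \<noteq> 0 \<Longrightarrow> norm (ev e \<sigma>) \<le> C * inverse (norm \<sigma>) ^ d"
    using hom_bound[OF assms(1)] by blast
  define c where "c = min (qRe s) 1"
  have c: "c > 0" using assms by (simp add: c_def)
  show ?thesis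
  proof (intro exI[of _ "C * inverse c ^ d"] conjI allI impI)
    fix u :: real assume u: "u \<ge> 0"
    have "c + c * u \<le> qRe s + 1 * u" using u by (intro add_mono mult_right_mono) (auto simp: c_def)
    then have "c * (1 + u) \<le> norm (s + of_real u)"
      using qRe_le_norm[of "s + of_real u"] by (simp add: algebra_simps)
    moreover have "c * (1 + u) > 0" using c u by simp
    ultimately have "inverse (norm (s + of_real u)) ^ d \<le> inverse (c * (1 + u)) ^ d" and nz: "s + of_real u \<noteq> 0"
      by (intro power_mono le_imp_inverse_le, auto)
    then have "C * inverse (norm (s + of_real u)) ^ d \<le> C * (inverse c ^ d * inverse (1 + u) ^ d)"
      using C(1) by (simp add: power_mult_distrib)
    with C(2)[OF nz] show "norm (ev e (s + of_real u)) \<le> C * inverse c ^ d * inverse (1 + u) ^ d"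
      by (simp add: mult.assoc)
  qed (use C c in auto)
qed

lemma continuous_on_ev_real:
  assumes "qRe s > 0"
  shows "continuous_on {0..} (\<lambda>u. ev e (s + of_real u))"
proof (rule continuous_on_compose2[OF continuous_on_ev])
  show "(\<lambda>u. s + of_real u) ` {0..} \<subseteq> - {0}" using assms by (auto simp: quat_eq_iff)
qed (intro continuous_intros)

lemma integrable_power_ev:
  assumes "hom e d" "qRe s > 0" "d \<ge> j + 2"
  shows "integrable lborel (\<lambda>u. indicator {0..} u *\<^sub>R (u ^ j *\<^sub>R ev e (s + of_real u)))"
proof -
  obtain C where C: "C > 0" "\<And>u. u \<ge> 0 \<Longrightarrow> norm (ev e (s + of_real u)) \<le> C * inverse (1 + u) ^ d"
    using ev_real_decay[OF assms(1,2)] by blast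
  show ?thesis
  proof (rule Bochner_Integration.integrable_bound)
    show "integrable lborel (\<lambda>u::real. C * (1 + norm u) powr (- 2))"
      by (intro integrable_mult_right integrable_decay) simp
    have "continuous_on {0..} (\<lambda>u. u ^ j *\<^sub>R ev e (s + of_real u))"
      by (intro continuous_intros continuous_on_ev_real assms)
    then show "(\<lambda>u. indicator {0..} u *\<^sub>R (u ^ j *\<^sub>R ev e (s + of_real u))) \<in> borel_measurable lborel"
      unfolding measurable_lborel2 by (rule borel_measurable_continuous_on_indicator[rotated]) simp
    show "AE u in lborel. norm (indicator {0..} u *\<^sub>R (u ^ j *\<^sub>R ev e (s + of_real u))) \<le> norm (C * (1 + norm u) powr (- 2))"
    proof (rule AE_I2)
      fix u :: real
      show "norm (indicator {0..} u *\<^sub>R (u ^ j *\<^sub>R ev e (s + of_real u))) \<le> norm (C * (1 + norm u) powr (- 2))"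
      proof (cases "u \<ge> 0")
        case True
        have "u ^ j * inverse (1 + u) ^ d \<le> (1 + u) ^ j * inverse (1 + u) ^ (j + 2)"
          using True assms(3) by (intro mult_mono power_mono power_decreasing) (auto simp: inverse_le_1_iff)
        also have "\<dots> = inverse (1 + u) ^ 2"
        proof -
          have "x ^ j * inverse x ^ (j + 2) = inverse x ^ 2" if "x \<noteq> 0" for x :: real
            using that by (simp add: power_add power_inverse power2_eq_square field_simps)
          then show ?thesis using True by simp
        qed
        also have "\<dots> = (1 + norm u) powr (- 2)"
          using True powr_realpow[of "1 + u" 2] by (simp add: powr_minus power_inverse)
        finally have le: "C * (u ^ j * inverse (1 + u) ^ d) \<le> C * (1 + norm u) powr (- 2)"
          using C(1) by (intro mult_left_mono) auto
        have "u ^ j * norm (ev e (s + of_real u)) \<le> u ^ j * (C * inverse (1 + u) ^ d)"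
          using C(2)[OF True] True by (intro mult_left_mono) auto
        also have "\<dots> \<le> C * (1 + norm u) powr (- 2)" using le by (simp only: mult.left_commute)
        finally show ?thesis using True C(1) by simp
      qed (use C in auto)
    qed
  qed
qed

lemma kE_real_vector_derivative:
  assumes "qRe s > 0" "u \<ge> 0"
  shows "((\<lambda>u. kE k (s + of_real u)) has_vector_derivative kE (Suc k) (s + of_real u)) (at u within S)"
proof -
  have nz: "s + of_real u \<noteq> 0" using assms by (auto simp: quat_eq_iff)
  have "((\<lambda>u. s + of_real u) has_derivative (\<lambda>h. of_real h)) (at u within S)"
    by (auto intro!: derivative_eq_intros simp: of_real_def)
  from kE_compose_derivative[OF this nz, of k] show ?thesis
    using linear_scale[OF linear_dE[OF nz], of k _ 1] by (simp add: has_vector_derivative_def of_real_def dE_1)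
qed

text \<open>Integration by parts along the real ray from \<open>s\<close>: each step lowers the
  power of \<open>u\<close> and the order of the kernel by one with no boundary term, and the last
  integration leaves \<open>- kE (L - 1) s\<close>.\<close>

lemma kE_real_integral:
  assumes s: "qRe s > 0" and L: "L \<ge> 1"
  shows "(\<integral>u. indicator {0..} u *\<^sub>R (u ^ j *\<^sub>R kE (j + L) (s + of_real u)) \<partial>lborel) = ((- 1) ^ Suc j * fact j) *\<^sub>R kE (L - 1) s"
proof (induction j)
  case 0
  have "(\<integral>u. indicator {0..} u *\<^sub>R kE L (s + of_real u) \<partial>lborel) = - kE (L - 1) (s + of_real 0)"
  proof (rule integral_FTC_Ici)
    show "((\<lambda>u. kE (L - 1) (s + of_real u)) has_vector_derivative kE L (s + of_real u)) (at u within {0..})" if "u \<ge> 0" for u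
      using kE_real_vector_derivative[OF s that, of "L - 1"] L by simp
    show "continuous_on {0..} (\<lambda>u. kE L (s + of_real u))"
      unfolding kE_def by (rule continuous_on_ev_real[OF s])
    show "integrable lborel (\<lambda>u. indicator {0..} u *\<^sub>R kE L (s + of_real u))"
      using integrable_power_ev[OF hom_Ex s, of 0 L] by (simp add: kE_def)
    obtain C where C: "C > 0" "\<And>u. u \<ge> 0 \<Longrightarrow> norm (kE (L - 1) (s + of_real u)) \<le> C * inverse (1 + u) ^ (3 + (L - 1))"
      using ev_real_decay[OF hom_Ex s, of "L - 1"] unfolding kE_def by blast
    show "((\<lambda>u. kE (L - 1) (s + of_real u)) \<longlongrightarrow> 0) at_top"
    proof (rule Lim_null_comparison)
      show "\<forall>\<^sub>F u in at_top. norm (kE (L - 1) (s + of_real u)) \<le> C * inverse (1 + u) ^ (3 + (L - 1))"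
        using eventually_ge_at_top[of 0] by eventually_elim (rule C(2))
      have "((\<lambda>u. C * inverse (1 + u) ^ (3 + (L - 1))) \<longlongrightarrow> C * 0 ^ (3 + (L - 1))) at_top"
        by (intro tendsto_intros tendsto_inverse_0_at_top filterlim_tendsto_add_at_top[OF tendsto_const] filterlim_ident)
      then show "((\<lambda>u. C * inverse (1 + u) ^ (3 + (L - 1))) \<longlongrightarrow> 0) at_top" by (simp add: power_add)
    qed
  qed
  then show ?case by simp
next
  case (Suc j)
  define A where "A u = real (Suc j) *\<^sub>R (u ^ j *\<^sub>R kE (j + L) (s + of_real u))" for u
  define B where "B u = u ^ Suc j *\<^sub>R kE (Suc j + L) (s + of_real u)" for u
  have iA: "integrable lborel (\<lambda>u. indicator {0..} u *\<^sub>R A u)"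
    using integrable_scaleR_right[OF integrable_power_ev[OF hom_Ex s, of j "j + L"], of "real (Suc j)"] by (simp add: kE_def A_def mult_ac)
  have iB: "integrable lborel (\<lambda>u. indicator {0..} u *\<^sub>R B u)"
    using integrable_power_ev[OF hom_Ex s, of "Suc j" "Suc j + L"] by (simp add: kE_def B_def)
  have "(\<integral>u. indicator {0..} u *\<^sub>R (A u + B u) \<partial>lborel) = - (0 ^ Suc j *\<^sub>R kE (j + L) (s + of_real 0))"
  proof (rule integral_FTC_Ici)
    show "((\<lambda>u. u ^ Suc j *\<^sub>R kE (j + L) (s + of_real u)) has_vector_derivative A u + B u) (at u within {0..})" if "u \<ge> 0" for u
    proof -
      have "((\<lambda>u::real. u ^ Suc j) has_real_derivative real (Suc j) * u ^ j) (at u within {0..})"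
        using DERIV_pow[of "Suc j" u] by simp
      from has_vector_derivative_scaleR[OF this kE_real_vector_derivative[OF s that, of "j + L" "{0..}"]]
      show ?thesis by (simp add: A_def B_def add.commute)
    qed
    show "continuous_on {0..} (\<lambda>u. A u + B u)"
      unfolding A_def B_def kE_def by (intro continuous_intros continuous_on_ev_real[OF s])
    show "integrable lborel (\<lambda>u. indicator {0..} u *\<^sub>R (A u + B u))"
      using iA iB by (simp add: scaleR_add_right)
    obtain C where C: "C > 0" "\<And>u. u \<ge> 0 \<Longrightarrow> norm (kE (j + L) (s + of_real u)) \<le> C * inverse (1 + u) ^ (3 + (j + L))"
      using ev_real_decay[OF hom_Ex s, of "j + L"] unfolding kE_def by blast
    show "((\<lambda>u. u ^ Suc j *\<^sub>R kE (j + L) (s + of_real u)) \<longlongrightarrow> 0) at_top"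
    proof (rule Lim_null_comparison)
      show "\<forall>\<^sub>F u in at_top. norm (u ^ Suc j *\<^sub>R kE (j + L) (s + of_real u)) \<le> C * inverse (1 + u)"
        using eventually_ge_at_top[of 0]
      proof eventually_elim
        case (elim u)
        have "u ^ Suc j * inverse (1 + u) ^ (3 + (j + L)) \<le> (1 + u) ^ Suc j * inverse (1 + u) ^ (Suc j + 1)"
          using elim L by (intro mult_mono power_mono power_decreasing) (auto simp: inverse_le_1_iff)
        also have "\<dots> = inverse (1 + u)"
        proof -
          have "x ^ Suc j * inverse x ^ (Suc j + 1) = inverse x" if "x \<noteq> 0" for x :: real
            using that by (simp add: power_add power_inverse power2_eq_square field_simps)
          then show ?thesis using elim by simp
        qed
        finally have "C * (u ^ Suc j * inverse (1 + u) ^ (3 + (j + L))) \<le> C * inverse (1 + u)"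
          using C(1) by (intro mult_left_mono) auto
        moreover have "u ^ Suc j * norm (kE (j + L) (s + of_real u)) \<le> u ^ Suc j * (C * inverse (1 + u) ^ (3 + (j + L)))"
          using C(2)[OF elim] elim by (intro mult_left_mono) auto
        ultimately show ?case using elim by (simp only: norm_scaleR) (simp add: mult_ac)
      qed
      have "((\<lambda>u. C * inverse (1 + u)) \<longlongrightarrow> C * 0) at_top"
        by (intro tendsto_intros tendsto_inverse_0_at_top filterlim_tendsto_add_at_top[OF tendsto_const] filterlim_ident)
      then show "((\<lambda>u. C * inverse (1 + u)) \<longlongrightarrow> 0) at_top" by simp
    qed
  qed
  then have "(\<integral>u. indicator {0..} u *\<^sub>R A u \<partial>lborel) + (\<integral>u. indicator {0..} u *\<^sub>R B u \<partial>lborel) = 0"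
    using iA iB by (simp add: scaleR_add_right)
  moreover have "(\<integral>u. indicator {0..} u *\<^sub>R A u \<partial>lborel) = real (Suc j) *\<^sub>R (((- 1) ^ Suc j * fact j) *\<^sub>R kE (L - 1) s)"
    unfolding Suc.IH[symmetric] integral_scaleR_right[symmetric] by (simp add: A_def mult_ac)
  ultimately have "(\<integral>u. indicator {0..} u *\<^sub>R B u \<partial>lborel) = - (real (Suc j) *\<^sub>R (((- 1) ^ Suc j * fact j) *\<^sub>R kE (L - 1) s))"
    by (simp only: add_eq_0_iff)
  then show ?case by (simp add: B_def algebra_simps)
qed

lemma measure_paraboloid:
  assumes "u \<ge> 0"
  shows "measure lborel {y::real^4^'m::finite. 2 * (norm y)\<^sup>2 \<le> u} = unit_ball_vol (4 * CARD('m)) / 4 ^ CARD('m) * u ^ (2 * CARD('m))"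
    and "{y::real^4^'m. 2 * (norm y)\<^sup>2 \<le> u} \<in> fmeasurable lborel"
proof -
  have eq: "{y::real^4^'m. 2 * (norm y)\<^sup>2 \<le> u} = cball 0 (sqrt (u / 2))"
    using assms by (auto simp: real_le_rsqrt real_sqrt_le_iff' dest: real_le_rsqrt)
       (metis (no_types) mult.commute norm_ge_zero pos_le_divide_eq power2_eq_square real_le_rsqrt real_sqrt_le_iff real_sqrt_pow2 zero_less_numeral real_sqrt_ge_0_iff order_trans power_mono divide_nonneg_nonneg zero_le_numeral)
  have "measure lborel {y::real^4^'m. 2 * (norm y)\<^sup>2 \<le> u} = unit_ball_vol (4 * CARD('m)) * sqrt (u / 2) ^ (4 * CARD('m))"
    unfolding eq using assms content_cball[of "sqrt (u / 2)" "0::real^4^'m"] by (simp add: mult.commute)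
  also have "sqrt (u / 2) ^ (4 * CARD('m)) = ((sqrt (u / 2))\<^sup>2) ^ (2 * CARD('m))"
    by (simp flip: power_mult)
  also have "\<dots> = u ^ (2 * CARD('m)) / 4 ^ CARD('m)"
    using assms by (simp add: power_divide power_mult[of 2 2])
  finally show "measure lborel {y::real^4^'m. 2 * (norm y)\<^sup>2 \<le> u} = unit_ball_vol (4 * CARD('m)) / 4 ^ CARD('m) * u ^ (2 * CARD('m))" by simp
  show "{y::real^4^'m. 2 * (norm y)\<^sup>2 \<le> u} \<in> fmeasurable lborel"
    unfolding eq by (intro fmeasurableI) (use emeasure_cball[of "sqrt (u / 2)" "0::real^4^'m"] assms in simp_all)
qed

text \<open>Layer cake, with m blocks: \<open>- kE (4m)\<close> at \<open>s + 2|y|^2\<close> is the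
  integral of the next derivative over \<open>u \<ge> 2|y|^2\<close>. After the exchange of
  integrals the ball of those \<open>y\<close> has volume proportional to \<open>u ^ (2m)\<close>,
  and \<open>2m\<close> integrations by parts followed by one integration bring the order from
  \<open>4m + 1\<close> down to \<open>2m\<close>.\<close>

lemma kE_horizontal_integral:
  fixes s :: quat
  assumes s: "qRe s > 0"
  shows "(\<integral>y. kE (4 * CARD('m)) (s + (2 * (norm (y::real^4^'m::finite))\<^sup>2) *\<^sub>R 1) \<partial>lborel)
     = (unit_ball_vol (4 * CARD('m)) / 4 ^ CARD('m) * fact (2 * CARD('m))) *\<^sub>R kE (2 * CARD('m)) s"
proof -
  define m where "m = CARD('m)"
  define V where "V = unit_ball_vol (4 * CARD('m)) / 4 ^ CARD('m)"
  define h where "h u = indicator {0..} u *\<^sub>R kE (Suc (4 * m)) (s + of_real u)" for u :: real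
  have [measurable]: "h \<in> borel_measurable borel"
    using borel_measurable_continuous_on_indicator[OF _ continuous_on_ev_real[OF s, of "Ex (Suc (4 * m))"]]
    by (simp add: h_def[abs_def] kE_def)
  define g where "g u y = indicator {y::real^4^'m. 2 * (norm y)\<^sup>2 \<le> u} y *\<^sub>R h u" for u y
  have g_ind: "g u y = indicator {(u, y). 2 * (norm y)\<^sup>2 \<le> u} (u, y) *\<^sub>R h u" for u y by (simp add: g_def indicator_def)
  have gm: "(\<lambda>(u, y). g u y) \<in> borel_measurable (lborel \<Otimes>\<^sub>M lborel)"
    unfolding g_ind by measurable
  have iy: "(\<integral>y. norm (g u y) \<partial>lborel) = V * norm (u ^ (2 * m) *\<^sub>R h u)" "(\<integral>y. g u y \<partial>lborel) = V *\<^sub>R (u ^ (2 * m) *\<^sub>R h u)"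
     "integrable lborel (g u)" for u
  proof -
    have b: "has_bochner_integral lborel (g u) (V *\<^sub>R (u ^ (2 * m) *\<^sub>R h u))"
    proof (cases "u \<ge> 0")
      case True
      have "has_bochner_integral lborel (g u) (measure lborel {y::real^4^'m. 2 * (norm y)\<^sup>2 \<le> u} *\<^sub>R h u)"
        unfolding g_def using measure_paraboloid(2)[OF True, where 'm = 'm]
        by (intro has_bochner_integral_indicator) (auto simp: fmeasurable_def)
      then show ?thesis using measure_paraboloid(1)[OF True, where 'm = 'm] by (simp add: V_def m_def)
    next
      case False
      then have "h u = 0" by (simp add: h_def)
      then show ?thesis by (simp add: g_def[abs_def] has_bochner_integral_zero)
    qed
    then show "(\<integral>y. g u y \<partial>lborel) = V *\<^sub>R (u ^ (2 * m) *\<^sub>R h u)" "integrable lborel (g u)"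
      by (auto simp: has_bochner_integral_iff)
    show "(\<integral>y. norm (g u y) \<partial>lborel) = V * norm (u ^ (2 * m) *\<^sub>R h u)"
    proof (cases "u \<ge> 0")
      case True
      have "has_bochner_integral lborel (\<lambda>y. indicator {y::real^4^'m. 2 * (norm y)\<^sup>2 \<le> u} y *\<^sub>R norm (h u))
          (measure lborel {y::real^4^'m. 2 * (norm y)\<^sup>2 \<le> u} *\<^sub>R norm (h u))"
        using measure_paraboloid(2)[OF True, where 'm = 'm]
        by (intro has_bochner_integral_indicator) (auto simp: fmeasurable_def)
      then show ?thesis using measure_paraboloid(1)[OF True, where 'm = 'm] True
        by (simp add: g_def V_def m_def has_bochner_integral_iff)
    next
      case False
      then have "h u = 0" by (simp add: h_def)
      then show ?thesis by (simp add: g_def)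
    qed
  qed
  have hi: "integrable lborel (\<lambda>u. u ^ (2 * m) *\<^sub>R h u)"
    using integrable_power_ev[OF hom_Ex s, of "2 * m" "Suc (4 * m)"] by (simp add: h_def kE_def mult.commute)
  have int: "integrable (lborel \<Otimes>\<^sub>M lborel) (\<lambda>(u, y). g u y)"
    by (rule lborel_pair.Fubini_integrable[OF gm]) (use integrable_norm[OF hi] iy in auto)
  have layer: "(\<integral>u. g u y \<partial>lborel) = - kE (4 * m) (s + (2 * (norm y)\<^sup>2) *\<^sub>R 1)" for y
  proof -
    define r where "r = 2 * (norm y)\<^sup>2"
    have r: "r \<ge> 0" by (simp add: r_def)
    have sr: "qRe (s + of_real r) > 0" using s r by simp
    have "(\<integral>u. g u y \<partial>lborel) = (\<integral>v. g (r + v) y \<partial>lborel)"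
      by (rule integral_lborel_translation[symmetric]) (simp add: g_def r_def[symmetric])
    also have "(\<lambda>v. g (r + v) y) = (\<lambda>v. indicator {0..} v *\<^sub>R (v ^ 0 *\<^sub>R kE (0 + Suc (4 * m)) (s + of_real r + of_real v)))"
      using r by (auto simp: g_def h_def r_def[symmetric] indicator_def fun_eq_iff add.assoc)
    also have "(\<integral>v. indicator {0..} v *\<^sub>R (v ^ 0 *\<^sub>R kE (0 + Suc (4 * m)) (s + of_real r + of_real v)) \<partial>lborel) = - kE (4 * m) (s + of_real r)"
      using kE_real_integral[OF sr, of "Suc (4 * m)" 0] by simp
    finally show ?thesis by (simp add: r_def of_real_def)
  qed
  have "(\<integral>y. kE (4 * m) (s + (2 * (norm (y::real^4^'m))\<^sup>2) *\<^sub>R 1) \<partial>lborel) = - (\<integral>y. (\<integral>u. g u y \<partial>lborel) \<partial>lborel)"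
    by (simp add: layer)
  also have "(\<integral>y. (\<integral>u. g u y \<partial>lborel) \<partial>lborel) = (\<integral>u. (\<integral>y. g u y \<partial>lborel) \<partial>lborel)"
    by (rule lborel_pair.Fubini_integral[OF int])
  also have "\<dots> = V *\<^sub>R (\<integral>u. indicator {0..} u *\<^sub>R (u ^ (2 * m) *\<^sub>R kE (2 * m + Suc (2 * m)) (s + of_real u)) \<partial>lborel)"
    unfolding iy integral_scaleR_right[symmetric] by (simp add: h_def mult.commute flip: mult_2 add_mult_distrib)
  also have "\<dots> = V *\<^sub>R (- fact (2 * m) *\<^sub>R kE (2 * m) s)"
    using kE_real_integral[OF s, of "Suc (2 * m)" "2 * m"] by simp
  finally show ?thesis by (simp add: m_def V_def)
qed

section \<open>The group, its metric and its Haar measure\<close>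

text \<open>With \<open>n = CARD('m) + 1\<close> this is \<open>Q = 4 * n + 2\<close>:
  \<open>4 * CARD('m)\<close> directions of weight 1 and three of weight 2.\<close>

definition qdim :: "'m::finite itself \<Rightarrow> nat" where
  "qdim _ = 4 * CARD('m) + 6"

text \<open>The norm of this quaternion is the square of the homogeneous norm, and the Cauchy-Szego
  kernel depends on its group arguments only through
  \<open>\<epsilon> + wq (hmult (hinv h) g)\<close>.\<close>

definition wq :: "'m::finite heis \<Rightarrow> quat" where
  "wq h = ((norm (snd h))\<^sup>2) *\<^sub>R 1 + quat_of_t (fst h)"

lemma vector_4_nth:
  "(vector [a, b, c, d] :: ('a::zero)^4) $ 1 = a" "(vector [a, b, c, d] :: 'a^4) $ 2 = b"
  "(vector [a, b, c, d] :: 'a^4) $ 3 = c" "(vector [a, b, c, d] :: 'a^4) $ 4 = d"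
  by (simp_all add: vector_def)

lemma quat_of_t_hform: "quat_of_t (hform y x) = hip y x - hip x y"
proof -
  have s: "qIm1 (sum f A) = (\<Sum>i\<in>A. qIm1 (f i))" "qIm2 (sum f A) = (\<Sum>i\<in>A. qIm2 (f i))" "qIm3 (sum f A) = (\<Sum>i\<in>A. qIm3 (f i))"
    for f :: "'b \<Rightarrow> quat" and A by (induction A rule: infinite_finite_induct; simp)+
  have "quat_of_t (hform y x) = (\<Sum>l\<in>UNIV. qcnj (quat_of_vec (y $ l)) * quat_of_vec (x $ l) - qcnj (quat_of_vec (x $ l)) * quat_of_vec (y $ l))"
    unfolding quat_eq_iff s qRe_sum quat_of_t_def hform_def sum_distrib_left
    by (simp add: sum_4 bmat_def vector_4_nth quat_of_vec_def) (intro conjI sum.cong refl; simp add: algebra_simps)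
  then show ?thesis by (simp add: hip_def sum_subtractf)
qed

lemma quat_of_t_inject: "quat_of_t x = quat_of_t y \<longleftrightarrow> x = y"
proof -
  have "quat_of_t x = quat_of_t y \<longleftrightarrow> norm (quat_of_t (x - y)) = 0" by simp
  then show ?thesis unfolding norm_quat_of_t by simp
qed

lemma hform_add_left: "hform (x + y) z = hform x z + hform y z"
  and hform_add_right: "hform z (x + y) = hform z x + hform z y"
  and hform_minus_left [simp]: "hform (- x) z = - hform x z"
  and hform_minus_right [simp]: "hform z (- x) = - hform z x"
  and hform_diff_left: "hform (x - y) z = hform x z - hform y z"
  and hform_diff_right: "hform z (x - y) = hform z x - hform z y"
  and hform_self [simp]: "hform x x = 0"
  by (simp_all add: quat_of_t_hform hip_add_left hip_add_right hip_diff_left hip_diff_right flip: quat_of_t_inject)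

lemma hmult_assoc: "hmult (hmult a b) c = hmult a (hmult b c)"
  by (simp add: hmult_def hform_add_left hform_add_right)

lemma hmult_inverse [simp]: "hmult (hinv a) (hmult a b) = b" "hmult a (hmult (hinv a) b) = b"
  "hmult (hinv a) a = 0" "hmult a (hinv a) = 0"
  by (simp_all add: hmult_def hinv_def hform_add_right hform_diff_right prod_eq_iff)

lemma hform_0 [simp]: "hform 0 x = 0" "hform x 0 = 0"
  using hform_add_left[of 0 0 x] hform_add_right[of x 0 0] by simp_all

lemma hmult_0 [simp]: "hmult 0 a = a" "hmult a 0 = a"
  by (simp_all add: hmult_def prod_eq_iff)

lemma hinv_hmult: "hinv (hmult a b) = hmult (hinv b) (hinv a)"
proof -
  have "hform (snd a) (snd b) = - hform (snd b) (snd a)"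
    by (simp add: quat_of_t_hform flip: quat_of_t_inject)
  then show ?thesis by (simp add: hmult_def hinv_def prod_eq_iff)
qed

lemma hinv_hinv [simp]: "hinv (hinv a) = a" by (simp add: hinv_def)

lemma hinv_0 [simp]: "hinv 0 = 0" by (simp add: hinv_def prod_eq_iff)

text \<open>Polarising the squared norm gives the real part of the cross term and the twist of the
  group law gives its imaginary part; together they form a single Hermitian product. This is why the
  kernel is a convolution kernel.\<close>

lemma wq_hmult: "wq (hmult h k) = wq h + wq k + 2 *\<^sub>R hip (snd h) (snd k)"
proof -
  have "(2 * inner (snd h) (snd k)) *\<^sub>R 1 = hip (snd h) (snd k) + hip (snd k) (snd h)"
  proof -
    have "q + qcnj q = (2 * qRe q) *\<^sub>R 1" for q by (simp add: quat_eq_iff)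
    from this[of "hip (snd h) (snd k)"] show ?thesis by (simp add: qcnj_hip qRe_hip)
  qed
  moreover have "(norm (snd h + snd k))\<^sup>2 = (norm (snd h))\<^sup>2 + (norm (snd k))\<^sup>2 + 2 * inner (snd h) (snd k)"
    by (simp add: power2_norm_eq_inner inner_add_left inner_add_right inner_commute)
  ultimately show ?thesis
    by (simp add: wq_def hmult_def quat_of_t_hform scaleR_2 algebra_simps)
qed

lemma wq_hinv [simp]: "wq (hinv h) = qcnj (wq h)"
  by (simp add: wq_def hinv_def)

lemma qRe_wq: "qRe (wq h) = (norm (snd h))\<^sup>2"
  by (simp add: wq_def)

lemma norm_wq: "norm (wq h) = (hnorm h)\<^sup>2"
proof -
  define a where "a = norm (snd h) ^ 4 + (norm (fst h))\<^sup>2"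
  have a: "a \<ge> 0" by (simp add: a_def)
  have "(norm (wq h))\<^sup>2 = ((norm (snd h))\<^sup>2)\<^sup>2 + (norm (quat_of_t (fst h)))\<^sup>2"
    unfolding norm_quat_sq wq_def by simp
  then have "(norm (wq h))\<^sup>2 = a" by (simp add: a_def flip: power_mult)
  moreover have "((hnorm h)\<^sup>2)\<^sup>2 = a"
  proof (cases "a = 0")
    case False
    then have "(a powr (1/4)) ^ 4 = a"
      using a by (simp add: powr_powr flip: powr_realpow)
    then show ?thesis by (simp add: hnorm_def a_def flip: power_mult)
  qed (simp add: hnorm_def a_def)
  ultimately have "norm (wq h) ^ 2 = ((hnorm h)\<^sup>2) ^ 2" by (simp only:)
  then show ?thesis by (rule power2_eq_imp_eq) auto
qed

lemma hnorm_nonneg [simp]: "hnorm h \<ge> 0"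
  by (simp add: hnorm_def)

lemma hnorm_hinv [simp]: "hnorm (hinv h) = hnorm h"
  by (simp add: hnorm_def hinv_def)

lemma hnorm_0 [simp]: "hnorm 0 = 0"
  by (simp add: hnorm_def)

lemma norm_snd_le_hnorm: "norm (snd h) \<le> hnorm h"
proof -
  have "(norm (snd h))\<^sup>2 \<le> norm (wq h)" using qRe_le_norm[of "wq h"] by (simp add: qRe_wq)
  then show ?thesis unfolding norm_wq by (rule power2_le_imp_le) simp
qed

lemma norm_fst_le_hnorm: "norm (fst h) \<le> (hnorm h)\<^sup>2"
proof -
  have "(norm (quat_of_t (fst h)))\<^sup>2 \<le> (norm (wq h))\<^sup>2"
    unfolding norm_quat_sq[of "wq h"] norm_quat_sq[of "quat_of_t (fst h)"] by (simp add: wq_def)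
  then have "norm (fst h) \<le> norm (wq h)" using power2_le_imp_le by fastforce
  then show ?thesis by (simp add: norm_wq)
qed

text \<open>In the product formula for \<open>wq\<close> the cross term is at most
  \<open>2 * hnorm h * hnorm k\<close> by Cauchy-Schwarz, which completes the square; hence the
  constant 1 in the triangle inequality.\<close>

lemma hnorm_hmult_le: "hnorm (hmult h k) \<le> hnorm h + hnorm k"
proof -
  have "norm (2 *\<^sub>R hip (snd h) (snd k)) \<le> 2 * (hnorm h * hnorm k)"
    using norm_hip_le[of "snd h" "snd k"] mult_mono[OF norm_snd_le_hnorm[of h] norm_snd_le_hnorm[of k]] by simp
  then have "norm (wq (hmult h k)) \<le> (hnorm h)\<^sup>2 + (hnorm k)\<^sup>2 + 2 * (hnorm h * hnorm k)"
    unfolding wq_hmult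
    by (intro order_trans[OF norm_triangle_ineq] add_mono order_trans[OF norm_triangle_ineq]) (simp_all add: norm_wq)
  then have "(hnorm (hmult h k))\<^sup>2 \<le> (hnorm h + hnorm k)\<^sup>2"
    by (simp add: norm_wq power2_sum)
  then show ?thesis by (rule power2_le_imp_le) simp
qed

lemma hdist_nonneg [simp]: "hdist a b \<ge> 0"
  by (simp add: hdist_def)

lemma hdist_commute: "hdist a b = hdist b a"
  by (metis hdist_def hinv_hinv hinv_hmult hnorm_hinv)

lemma hdist_self [simp]: "hdist a a = 0"
  by (simp add: hdist_def)

lemma hdist_triangle: "hdist a c \<le> hdist a b + hdist b c"
  using hnorm_hmult_le[of "hmult (hinv c) b" "hmult (hinv b) a"]
  by (simp add: hdist_def hmult_assoc add.commute)

lemma hdist_0_right [simp]: "hdist a 0 = hnorm a"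
  by (simp add: hdist_def)

section \<open>Continuity and measurability of the group operations\<close>

lemma continuous_on_hform [continuous_intros]:
  "continuous_on S f \<Longrightarrow> continuous_on S g \<Longrightarrow> continuous_on S (\<lambda>x. hform (f x) (g x))"
  unfolding hform_def by (intro continuous_intros)

lemma continuous_on_hmult [continuous_intros]:
  "continuous_on S f \<Longrightarrow> continuous_on S g \<Longrightarrow> continuous_on S (\<lambda>x. hmult (f x) (g x))"
  unfolding hmult_def by (intro continuous_intros)

lemma continuous_on_hinv [continuous_intros]:
  "continuous_on S f \<Longrightarrow> continuous_on S (\<lambda>x. hinv (f x))"
  unfolding hinv_def by (intro continuous_intros)

lemma continuous_on_wq [continuous_intros]:
  "continuous_on S f \<Longrightarrow> continuous_on S (\<lambda>x. wq (f x))"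
  unfolding wq_def by (intro continuous_intros)

lemma continuous_on_hnorm [continuous_intros]:
  assumes "continuous_on S f"
  shows "continuous_on S (\<lambda>x. hnorm (f x))"
proof -
  have "hnorm h = sqrt (norm (wq h))" for h :: "'b heis" by (simp add: norm_wq)
  then show ?thesis by (simp only:) (intro continuous_intros assms)
qed

lemma continuous_on_hdist [continuous_intros]:
  "continuous_on S f \<Longrightarrow> continuous_on S g \<Longrightarrow> continuous_on S (\<lambda>x. hdist (f x) (g x))"
  unfolding hdist_def by (intro continuous_intros)

lemma borel_measurable_hmult [measurable]: "(\<lambda>(g, h). hmult g h) \<in> borel_measurable (borel \<Otimes>\<^sub>M borel)"
  and borel_measurable_hinv [measurable]: "hinv \<in> borel_measurable borel"
  and borel_measurable_hnorm [measurable]: "hnorm \<in> borel_measurable borel"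
proof -
  have "(\<lambda>p :: 'a heis \<times> 'a heis. hmult (fst p) (snd p)) \<in> borel_measurable borel"
    by (intro borel_measurable_continuous_onI continuous_intros)
  then show "(\<lambda>(g, h). hmult g h) \<in> borel_measurable (borel \<Otimes>\<^sub>M (borel :: 'a heis measure))"
    by (simp add: borel_prod case_prod_beta')
qed (intro borel_measurable_continuous_onI continuous_intros; fail)+

lemma borel_measurable_hdist [measurable (raw)]:
  assumes [measurable]: "f \<in> borel_measurable M" "g \<in> borel_measurable M"
  shows "(\<lambda>x. hdist (f x) (g x)) \<in> borel_measurable M"
  unfolding hdist_def by measurable

section \<open>Haar measure and the volume of balls\<close>

lemma nn_integral_lborel_translation:
  fixes f :: "'a::euclidean_space \<Rightarrow> ennreal"
  assumes "f \<in> borel_measurable borel"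
  shows "(\<integral>\<^sup>+x. f (c + x) \<partial>lborel) = (\<integral>\<^sup>+x. f x \<partial>lborel)"
  using nn_integral_distr[of "(+) c" lborel borel f] assms by (simp add: lborel_distr_plus)

text \<open>For a fixed horizontal part, left multiplication is a translation of the centre by an
  amount depending on that part; Fubini then leaves a translation of the horizontal
  variables.\<close>

lemma nn_integral_hmult:
  fixes f :: "'m::finite heis \<Rightarrow> ennreal"
  assumes [measurable]: "f \<in> borel_measurable borel"
  shows "(\<integral>\<^sup>+g. f (hmult h g) \<partial>lborel) = (\<integral>\<^sup>+g. f g \<partial>lborel)"
proof -
  have fm: "f \<in> borel_measurable (lborel \<Otimes>\<^sub>M lborel)" "(\<lambda>g. f (hmult h g)) \<in> borel_measurable (lborel \<Otimes>\<^sub>M lborel)"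
    unfolding lborel_prod by measurable
  have [measurable]: "(\<lambda>t. f (t, y)) \<in> borel_measurable borel" for y
    by (rule measurable_compose[OF _ assms]) (auto simp flip: borel_prod)
  have "(\<integral>\<^sup>+g. f (hmult h g) \<partial>lborel) = (\<integral>\<^sup>+y. (\<integral>\<^sup>+t. f (hmult h (t, y)) \<partial>lborel) \<partial>lborel)"
    using lborel_pair.nn_integral_snd[OF fm(2)] by (simp add: lborel_prod)
  also have "\<dots> = (\<integral>\<^sup>+y. (\<integral>\<^sup>+t. f ((fst h + hform (snd h) y) + t, snd h + y) \<partial>lborel) \<partial>lborel)"
    by (simp add: hmult_def algebra_simps)
  also have "\<dots> = (\<integral>\<^sup>+y. (\<integral>\<^sup>+t. f (t, snd h + y) \<partial>lborel) \<partial>lborel)"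
    by (subst nn_integral_lborel_translation) auto
  also have "\<dots> = (\<integral>\<^sup>+y. (\<integral>\<^sup>+t. f (t, y) \<partial>lborel) \<partial>lborel)"
  proof (rule nn_integral_lborel_translation)
    have "(\<lambda>(y, t). f (t, y)) \<in> borel_measurable (borel \<Otimes>\<^sub>M lborel)"
      unfolding split_beta' by (rule measurable_compose[OF _ assms]) (simp flip: borel_prod)
    from lborel.borel_measurable_nn_integral[OF this]
    show "(\<lambda>y. \<integral>\<^sup>+t. f (t, y) \<partial>lborel) \<in> borel_measurable borel" .
  qed
  also have "\<dots> = (\<integral>\<^sup>+g. f g \<partial>lborel)"
    using lborel_pair.nn_integral_snd[OF fm(1)] by (simp add: lborel_prod)
  finally show ?thesis .
qed

lemma distr_hmult: "distr lborel borel (hmult h) = lborel" for h :: "'m::finite heis"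
proof (rule measure_eqI)
  fix A assume "A \<in> sets (distr lborel borel (hmult h))"
  then have [measurable]: "A \<in> sets borel" by simp
  have "emeasure (distr lborel borel (hmult h)) A = (\<integral>\<^sup>+g. indicator A (hmult h g) \<partial>lborel)"
    by (subst nn_integral_indicator[symmetric], simp, subst nn_integral_distr) auto
  also have "\<dots> = emeasure lborel A" by (subst nn_integral_hmult) auto
  finally show "emeasure (distr lborel borel (hmult h)) A = emeasure lborel A" .
qed simp

lemma integral_hmult:
  fixes f :: "'m::finite heis \<Rightarrow> 'b::{banach, second_countable_topology}"
  assumes "f \<in> borel_measurable borel"
  shows "(\<integral>g. f (hmult h g) \<partial>lborel) = (\<integral>g. f g \<partial>lborel)"
  using integral_distr[of "hmult h" lborel borel f] assms by (simp add: distr_hmult)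

lemma integrable_hmult:
  fixes f :: "'m::finite heis \<Rightarrow> 'b::{banach, second_countable_topology}"
  assumes "integrable lborel f"
  shows "integrable lborel (\<lambda>g. f (hmult h g))"
  using integrable_distr[of "hmult h" lborel borel f] assms by (simp add: distr_hmult)

definition vball :: "'m::finite itself \<Rightarrow> real" where
  "vball _ = unit_ball_vol 3 * unit_ball_vol (4 * CARD('m))"

lemma vball_pos: "vball m > 0"
  by (simp add: vball_def)

lemma emeasure_lborel_Times_heis:
  fixes A :: "(real^3) set" and B :: "(real^4^'m::finite) set"
  assumes "A \<in> sets borel" "B \<in> sets borel"
  shows "emeasure lborel (A \<times> B) = emeasure lborel A * emeasure lborel B"
  using lborel.emeasure_pair_measure_Times[of A lborel B] assms by (simp add: lborel_prod)

text \<open>After moving the centre to 0, the ball lies between products of Euclidean balls: of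
  radii \<open>r^2\<close> and \<open>r\<close> outside, of radii \<open>(r/2)^2\<close> and
  \<open>r/2\<close> inside.\<close>

lemma emeasure_hdist_ball:
  fixes x :: "'m::finite heis"
  assumes r: "r > 0"
  shows "emeasure lborel {g. hdist x g \<le> r} \<le> ennreal (vball TYPE('m) * r ^ qdim TYPE('m))"
    and "ennreal (vball TYPE('m) / 2 ^ qdim TYPE('m) * r ^ qdim TYPE('m)) \<le> emeasure lborel {g. hdist x g < r}"
proof -
  have P: "emeasure lborel {g. P (hdist x g)} = emeasure lborel {g :: 'm heis. P (hnorm g)}"
    if [measurable]: "Measurable.pred borel P" for P
  proof -
    have "{g. P (hdist x g)} = hmult (hinv x) -` {g. P (hnorm g)} \<inter> space lborel"
      unfolding hdist_commute[of x] unfolding hdist_def by auto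
    then have "emeasure lborel {g. P (hdist x g)} = emeasure (distr lborel borel (hmult (hinv x))) {g. P (hnorm g)}"
      by (subst emeasure_distr) auto
    then show ?thesis by (simp add: distr_hmult)
  qed
  have vol: "emeasure lborel (cball 0 (s\<^sup>2) \<times> cball 0 s :: 'm heis set) = ennreal (vball TYPE('m) * s ^ qdim TYPE('m))" if "s > 0" for s
    using that by (subst emeasure_lborel_Times_heis)
      (simp_all add: emeasure_cball vball_def qdim_def ennreal_mult[symmetric] power_add mult_ac flip: power_mult)
  have "emeasure lborel {g. hdist x g \<le> r} = emeasure lborel {g :: 'm heis. hnorm g \<le> r}" by (rule P) simp
  also have "\<dots> \<le> emeasure lborel (cball 0 (r\<^sup>2) \<times> cball 0 r :: 'm heis set)"
  proof (rule emeasure_mono)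
    show "{g :: 'm heis. hnorm g \<le> r} \<subseteq> cball 0 (r\<^sup>2) \<times> cball 0 r"
    proof
      fix g :: "'m heis" assume "g \<in> {g. hnorm g \<le> r}"
      then have "hnorm g \<le> r" "(hnorm g)\<^sup>2 \<le> r\<^sup>2" by (auto intro: power_mono)
      with norm_snd_le_hnorm[of g] norm_fst_le_hnorm[of g] show "g \<in> cball 0 (r\<^sup>2) \<times> cball 0 r"
        by (auto simp: mem_Times_iff)
    qed
  qed (simp add: borel_closed closed_Times)
  finally show "emeasure lborel {g. hdist x g \<le> r} \<le> ennreal (vball TYPE('m) * r ^ qdim TYPE('m))"
    using vol[OF r] by simp
  have "ennreal (vball TYPE('m) / 2 ^ qdim TYPE('m) * r ^ qdim TYPE('m)) = emeasure lborel (cball 0 ((r/2)\<^sup>2) \<times> cball 0 (r/2) :: 'm heis set)"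
    using vol[of "r/2"] r by (simp add: power_divide mult.commute)
  also have "\<dots> \<le> emeasure lborel {g :: 'm heis. hnorm g < r}"
  proof (rule emeasure_mono)
    show "cball 0 ((r/2)\<^sup>2) \<times> cball 0 (r/2) \<subseteq> {g :: 'm heis. hnorm g < r}"
    proof safe
      fix t :: "real^3" and y :: "real^4^'m" assume h: "t \<in> cball 0 ((r/2)\<^sup>2)" "y \<in> cball 0 (r/2)"
      have "(hnorm (t, y))\<^sup>2 = norm (wq (t, y))" by (simp add: norm_wq)
      also have "\<dots> \<le> (norm y)\<^sup>2 + norm t"
        unfolding wq_def using norm_triangle_ineq[of "((norm y)\<^sup>2) *\<^sub>R 1" "quat_of_t t"] by simp
      also have "\<dots> \<le> (r/2)\<^sup>2 + (r/2)\<^sup>2" using h by (intro add_mono power_mono) auto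
      also have "\<dots> < r\<^sup>2" using r by (simp add: power2_eq_square)
      finally show "hnorm (t, y) < r" using r by (simp add: power_less_imp_less_base)
    qed
  qed measurable
  also have "\<dots> = emeasure lborel {g. hdist x g < r}" by (rule P[symmetric]) simp
  finally show "ennreal (vball TYPE('m) / 2 ^ qdim TYPE('m) * r ^ qdim TYPE('m)) \<le> emeasure lborel {g. hdist x g < r}" .
qed

section \<open>The Cauchy--Szego kernel as a convolution kernel\<close>

text \<open>The order \<open>2 * CARD('m)\<close> is the number \<open>2 * (n - 1)\<close> of real
  derivatives in the Cauchy-Szego kernel; the normalising constant is left out.\<close>

definition ker :: "real \<Rightarrow> 'm::finite heis \<Rightarrow> quat" where
  "ker \<epsilon> h = kE (2 * CARD('m)) (\<epsilon> *\<^sub>R 1 + wq h)"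

text \<open>The cross term in the squared norm is \<open>2 * \<epsilon> * qRe (wq h)\<close>, which
  is nonnegative because the real part of \<open>wq h\<close> is a square.\<close>

lemma eps_wq_lower:
  assumes "\<epsilon> > 0"
  shows "(\<epsilon> + (hnorm h)\<^sup>2) / 2 \<le> norm (\<epsilon> *\<^sub>R 1 + wq h)" and "\<epsilon> *\<^sub>R 1 + wq h \<noteq> 0"
proof -
  have "(\<epsilon> *\<^sub>R 1 + wq h) \<bullet> (\<epsilon> *\<^sub>R 1 + wq h) = \<epsilon>\<^sup>2 + (norm (wq h))\<^sup>2 + 2 * (\<epsilon> * qRe (wq h))"
    by (simp add: inner_quat_def power2_eq_square norm_quat_mult_self algebra_simps)
  then have "(norm (\<epsilon> *\<^sub>R 1 + wq h))\<^sup>2 \<ge> \<epsilon>\<^sup>2 + ((hnorm h)\<^sup>2)\<^sup>2"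
    using assms by (simp add: power2_norm_eq_inner[of "\<epsilon> *\<^sub>R 1 + wq h"] qRe_wq norm_wq)
  moreover have "((\<epsilon> + (hnorm h)\<^sup>2) / 2)\<^sup>2 \<le> \<epsilon>\<^sup>2 + ((hnorm h)\<^sup>2)\<^sup>2"
  proof -
    have "((a + b) / 2)\<^sup>2 \<le> a\<^sup>2 + b\<^sup>2" for a b :: real
    proof -
      have "a\<^sup>2 + b\<^sup>2 - ((a + b) / 2)\<^sup>2 = (a\<^sup>2 + b\<^sup>2) / 2 + ((a - b) / 2)\<^sup>2"
        by (simp add: power2_eq_square field_simps)
      also have "\<dots> \<ge> 0" by simp
      finally show ?thesis by simp
    qed
    then show ?thesis .
  qed
  ultimately show "(\<epsilon> + (hnorm h)\<^sup>2) / 2 \<le> norm (\<epsilon> *\<^sub>R 1 + wq h)"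
    by (meson norm_ge_zero order_trans power2_le_imp_le)
  show "\<epsilon> *\<^sub>R 1 + wq h \<noteq> 0"
  proof -
    have "qRe (\<epsilon> *\<^sub>R 1 + wq h) > 0" using assms by (simp add: qRe_wq add_pos_nonneg)
    then show ?thesis by (metis less_irrefl zero_quat.sel(1))
  qed
qed

text \<open>The kernel has degree \<open>-(3 + 2 * CARD('m))\<close> in an argument comparable to
  the square of \<open>sqrt \<epsilon> + hnorm h\<close>, and twice \<open>3 + 2 * CARD('m)\<close>
  is the homogeneous dimension.\<close>

lemma ker_bound:
  "\<exists>C>0. \<forall>\<epsilon>>0. \<forall>h::'m::finite heis. norm (ker \<epsilon> h) \<le> C * (sqrt \<epsilon> + hnorm h) powr (- real (qdim TYPE('m)))"
proof -
  obtain C where C: "C > 0" "\<And>\<sigma>. \<sigma> \<noteq> 0 \<Longrightarrow> norm (kE (2 * CARD('m)) \<sigma>) \<le> C * inverse (norm \<sigma>) ^ (3 + 2 * CARD('m))"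
    using kE_bound by blast
  define d where "d = 3 + 2 * CARD('m)"
  show ?thesis
  proof (intro exI[of _ "C * 4 ^ d"] conjI allI impI)
    fix \<epsilon> :: real and h :: "'m heis" assume e: "\<epsilon> > 0"
    define a where "a = sqrt \<epsilon> + hnorm h"
    have a: "a > 0" using e by (simp add: a_def add_pos_nonneg)
    have "a\<^sup>2 \<le> 2 * (\<epsilon> + (hnorm h)\<^sup>2)"
    proof -
      have "(u + v)\<^sup>2 \<le> 2 * (u\<^sup>2 + v\<^sup>2)" for u v :: real
        using sum_squares_bound[of u v] by (simp add: power2_sum)
      from this[of "sqrt \<epsilon>" "hnorm h"] show ?thesis using e by (simp add: a_def)
    qed
    then have "a\<^sup>2 / 4 \<le> norm (\<epsilon> *\<^sub>R 1 + wq h)" using eps_wq_lower(1)[OF e, of h] by simp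
    then have "inverse (norm (\<epsilon> *\<^sub>R 1 + wq h)) ^ d \<le> inverse (a\<^sup>2 / 4) ^ d"
      using a by (intro power_mono le_imp_inverse_le) auto
    also have "\<dots> = 4 ^ d * a powr (- real (2 * d))"
    proof -
      have "inverse (a\<^sup>2 / 4) = 4 * (inverse a)\<^sup>2" using a by (simp add: field_simps)
      then have "inverse (a\<^sup>2 / 4) ^ d = 4 ^ d * inverse a ^ (2 * d)"
        by (simp only: power_mult_distrib power_mult)
      also have "inverse a ^ (2 * d) = a powr (- real (2 * d))"
        by (simp only: powr_minus powr_realpow[OF a] power_inverse)
      finally show ?thesis .
    qed
    also have "2 * d = qdim TYPE('m)" by (simp add: d_def qdim_def)
    finally have "C * inverse (norm (\<epsilon> *\<^sub>R 1 + wq h)) ^ d \<le> C * (4 ^ d * a powr (- real (qdim TYPE('m))))"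
      using C by (intro mult_left_mono) auto
    with C(2)[OF eps_wq_lower(2)[OF e, of h]] show "norm (ker \<epsilon> h) \<le> C * 4 ^ d * (sqrt \<epsilon> + hnorm h) powr (- real (qdim TYPE('m)))"
      unfolding ker_def d_def[symmetric] a_def[symmetric] mult.assoc[of C] by (rule order_trans)
  qed (use C in auto)
qed

lemma continuous_on_ker: "\<epsilon> > 0 \<Longrightarrow> continuous_on S f \<Longrightarrow> continuous_on S (\<lambda>x. ker \<epsilon> (f x))"
  unfolding ker_def using eps_wq_lower(2) by (intro continuous_on_kE_comp(1) continuous_intros) blast+

lemma borel_measurable_ker: "\<epsilon> > 0 \<Longrightarrow> ker \<epsilon> \<in> borel_measurable borel"
  by (intro borel_measurable_continuous_onI continuous_on_ker continuous_on_id)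

lemma qcnj_kE: "qcnj (kE k \<sigma>) = kE k (qcnj \<sigma>)" if "\<sigma> \<noteq> 0"
proof -
  have "\<forall>\<sigma>. \<sigma> \<noteq> 0 \<longrightarrow> qcnj (kE k \<sigma>) = kE k (qcnj \<sigma>)"
  proof (induction k)
    case 0
    show ?case by (simp add: kE_0)
  next
    case (Suc k)
    show ?case
    proof (intro allI impI)
      fix \<sigma> :: quat assume nz: "\<sigma> \<noteq> 0"
      have "((\<lambda>\<sigma>. kE k (qcnj \<sigma>)) has_derivative (\<lambda>h. dE k (qcnj h) (qcnj \<sigma>))) (at \<sigma>)"
        using nz by (intro kE_compose_derivative) (auto intro!: derivative_eq_intros)
      moreover have "((\<lambda>\<sigma>. qcnj (kE k \<sigma>)) has_derivative (\<lambda>h. qcnj (dE k h \<sigma>))) (at \<sigma>)"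
        by (intro has_derivative_qcnj kE_has_derivative nz)
      then have "((\<lambda>\<sigma>. kE k (qcnj \<sigma>)) has_derivative (\<lambda>h. qcnj (dE k h \<sigma>))) (at \<sigma>)"
        by (rule has_derivative_transform_within_open[OF _ open_Compl[OF closed_singleton[of 0]]]) (use nz Suc in auto)
      ultimately have "(\<lambda>h. dE k (qcnj h) (qcnj \<sigma>)) = (\<lambda>h. qcnj (dE k h \<sigma>))" by (rule has_derivative_unique)
      from fun_cong[OF this, of 1] show "qcnj (kE (Suc k) \<sigma>) = kE (Suc k) (qcnj \<sigma>)" by (simp add: dE_1)
    qed
  qed
  with that show ?thesis by blast
qed

text \<open>Conjugation commutes with real derivatives and with the Cauchy-Fueter kernel, and group
  inversion conjugates \<open>wq\<close>. This is the source of the self-adjointness of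
  \<open>Top\<close>.\<close>

lemma ker_hinv: "\<epsilon> > 0 \<Longrightarrow> ker \<epsilon> (hinv h) = qcnj (ker \<epsilon> h)"
  unfolding ker_def by (subst qcnj_kE[OF eps_wq_lower(2)]) simp_all

lemma qcnj_ker_swap: "\<epsilon> > 0 \<Longrightarrow> qcnj (ker \<epsilon> (hmult (hinv a) b)) = ker \<epsilon> (hmult (hinv b) a)"
  by (simp add: ker_hinv[symmetric] hinv_hmult)

lemma nn_integral_hnorm_decay:
  assumes "\<delta> > 0"
  shows "\<exists>C>0. \<forall>x::'m::finite heis. \<forall>\<rho>>0. (\<integral>\<^sup>+g. ennreal ((\<rho> + hdist x g) powr (-(real (qdim TYPE('m)) + \<delta>))) \<partial>lborel) \<le> ennreal (C * \<rho> powr (- \<delta>))"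
proof (intro exI conjI allI impI)
  define Q where "Q = real (qdim TYPE('m))"
  have "1 - 2 powr (- \<delta>) > 0" using assms by (simp add: powr_minus field_simps)
  then show "0 < vball TYPE('m) * (2 powr (Q + \<delta>) / (1 - 2 powr (- \<delta>)))"
    using vball_pos by (intro mult_pos_pos divide_pos_pos) auto
  fix x :: "'m heis" and \<rho> :: real assume "\<rho> > 0"
  show "(\<integral>\<^sup>+g. ennreal ((\<rho> + hdist x g) powr (-(real (qdim TYPE('m)) + \<delta>))) \<partial>lborel)
    \<le> ennreal (vball TYPE('m) * (2 powr (Q + \<delta>) / (1 - 2 powr (- \<delta>))) * \<rho> powr (- \<delta>))"
    unfolding Q_def
  proof (rule nn_integral_decay_le)
    fix r :: real assume "r > 0"
    then show "emeasure lborel {g \<in> space lborel. hdist x g \<le> r} \<le> ennreal (vball TYPE('m) * r powr real (qdim TYPE('m)))"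
      using emeasure_hdist_ball(1)[of r x] by (simp add: powr_realpow)
  qed (use assms \<open>\<rho> > 0\<close> vball_pos[of "TYPE('m)"] in \<open>auto intro: less_imp_le\<close>)
qed

text \<open>The bound decreases in \<open>\<epsilon>\<close>; this keeps the norms of
  \<open>Top\<close> bounded along the doublings in \<open>Top_L2_bound\<close>.\<close>

lemma ker_square_integral:
  "\<exists>C>0. \<forall>\<epsilon>>0. integrable lborel (\<lambda>h::'m::finite heis. (norm (ker \<epsilon> h))\<^sup>2) \<and>
     (\<integral>h. (norm (ker \<epsilon> (h::'m heis)))\<^sup>2 \<partial>lborel) \<le> C * \<epsilon> powr (- real (qdim TYPE('m)) / 2)"
proof -
  define Q where "Q = real (qdim TYPE('m))"
  have Q: "Q > 0" by (simp add: Q_def qdim_def)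
  obtain C where C: "C > 0" "\<And>\<epsilon> (h::'m heis). \<epsilon> > 0 \<Longrightarrow> norm (ker \<epsilon> h) \<le> C * (sqrt \<epsilon> + hnorm h) powr (- Q)"
    using ker_bound[where 'm = 'm] unfolding Q_def by blast
  obtain K where K: "K > 0" "\<And>(x::'m heis) \<rho>. \<rho> > 0 \<Longrightarrow> (\<integral>\<^sup>+g. ennreal ((\<rho> + hdist x g) powr (-(Q + Q))) \<partial>lborel) \<le> ennreal (K * \<rho> powr (- Q))"
    using nn_integral_hnorm_decay[OF Q, where 'm = 'm] unfolding Q_def by blast
  show ?thesis
  proof (intro exI[of _ "C\<^sup>2 * K"] conjI allI impI)
    fix \<epsilon> :: real assume e: "\<epsilon> > 0"
    have le: "(norm (ker \<epsilon> h))\<^sup>2 \<le> C\<^sup>2 * (sqrt \<epsilon> + hdist 0 h) powr (-(Q + Q))" for h :: "'m heis"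
    proof -
      have "(norm (ker \<epsilon> h))\<^sup>2 \<le> (C * (sqrt \<epsilon> + hnorm h) powr (- Q))\<^sup>2"
        using C(2)[OF e] by (intro power_mono) auto
      also have "\<dots> = C\<^sup>2 * (sqrt \<epsilon> + hdist 0 h) powr (-(Q + Q))"
        by (simp add: power_mult_distrib power2_eq_square hdist_commute[of 0] flip: powr_add)
      finally show ?thesis .
    qed
    have "(\<integral>\<^sup>+h. ennreal ((norm (ker \<epsilon> (h::'m heis)))\<^sup>2) \<partial>lborel)
      \<le> (\<integral>\<^sup>+h. ennreal (C\<^sup>2) * ennreal ((sqrt \<epsilon> + hdist 0 (h::'m heis)) powr (-(Q + Q))) \<partial>lborel)"
      using le by (intro nn_integral_mono) (simp add: ennreal_mult[symmetric] ennreal_leI)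
    also have "\<dots> = ennreal (C\<^sup>2) * (\<integral>\<^sup>+h. ennreal ((sqrt \<epsilon> + hdist 0 (h::'m heis)) powr (-(Q + Q))) \<partial>lborel)"
      by (intro nn_integral_cmult) measurable
    also have "\<dots> \<le> ennreal (C\<^sup>2) * ennreal (K * sqrt \<epsilon> powr (- Q))"
      using e by (intro mult_left_mono K) auto
    also have "\<dots> = ennreal (C\<^sup>2 * K * \<epsilon> powr (- Q / 2))"
      using e K(1) by (subst ennreal_mult[symmetric]) (auto simp: powr_half_sqrt[symmetric] powr_powr mult.assoc)
    finally have nn: "(\<integral>\<^sup>+h. ennreal ((norm (ker \<epsilon> (h::'m heis)))\<^sup>2) \<partial>lborel) \<le> ennreal (C\<^sup>2 * K * \<epsilon> powr (- Q / 2))" .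
    show i: "integrable lborel (\<lambda>h::'m heis. (norm (ker \<epsilon> h))\<^sup>2)"
    proof (rule integrableI_bounded)
      show "(\<lambda>h::'m heis. (norm (ker \<epsilon> h))\<^sup>2) \<in> borel_measurable lborel"
        using borel_measurable_ker[OF e] by measurable
      show "(\<integral>\<^sup>+h. ennreal (norm ((norm (ker \<epsilon> (h::'m heis)))\<^sup>2)) \<partial>lborel) < \<infinity>"
        using nn by (simp add: le_less_trans)
    qed
    show "(\<integral>h. (norm (ker \<epsilon> (h::'m heis)))\<^sup>2 \<partial>lborel) \<le> C\<^sup>2 * K * \<epsilon> powr (- real (qdim TYPE('m)) / 2)"
      using nn K(1) by (subst (asm) nn_integral_eq_integral[OF i]) (auto simp: Q_def)
  qed (use C K in auto)
qed

definition conv_const :: "'m::finite itself \<Rightarrow> real" where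
  "conv_const _ = cauchy_const * (unit_ball_vol (4 * CARD('m)) / 4 ^ CARD('m) * fact (2 * CARD('m)))"

lemma mult_norm_le_squares: "a * b \<le> a\<^sup>2 + b\<^sup>2" if "a \<ge> 0" "b \<ge> 0" for a b :: real
proof -
  have "0 \<le> a * b" using that by simp
  with sum_squares_bound[of a b] show ?thesis by linarith
qed

lemma integrable_ker_product:
  fixes h :: "'m::finite heis"
  assumes e: "\<epsilon> > 0" "\<epsilon>' > 0"
  shows "integrable lborel (\<lambda>g. ker \<epsilon> (hmult (hinv g) h) * ker \<epsilon>' g)"
proof (rule Bochner_Integration.integrable_bound)
  have 1: "integrable lborel (\<lambda>h::'m heis. (norm (ker \<epsilon> h))\<^sup>2)" if "\<epsilon> > 0" for \<epsilon>
    using ker_square_integral[where 'm = 'm] that by blast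
  have "integrable lborel (\<lambda>g. (norm (ker \<epsilon> (hmult (hinv h) g)))\<^sup>2)"
    using integrable_hmult[OF 1[OF e(1)], of "hinv h"] .
  moreover have "norm (ker \<epsilon> (hmult (hinv h) g)) = norm (ker \<epsilon> (hmult (hinv g) h))" for g
    using arg_cong[OF qcnj_ker_swap[OF e(1), of h g], of norm] by simp
  ultimately show "integrable lborel (\<lambda>g. (norm (ker \<epsilon> (hmult (hinv g) h)))\<^sup>2 + (norm (ker \<epsilon>' g))\<^sup>2)"
    using 1[OF e(2)] by simp
  have [measurable]: "ker \<epsilon> \<in> borel_measurable borel" "ker \<epsilon>' \<in> borel_measurable (borel :: 'm heis measure)"
    using e by (auto intro: borel_measurable_ker)
  show "(\<lambda>g. ker \<epsilon> (hmult (hinv g) h) * ker \<epsilon>' g) \<in> borel_measurable lborel" by measurable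
  show "AE g in lborel. norm (ker \<epsilon> (hmult (hinv g) h) * ker \<epsilon>' g) \<le> norm ((norm (ker \<epsilon> (hmult (hinv g) h)))\<^sup>2 + (norm (ker \<epsilon>' g))\<^sup>2)"
    using mult_norm_le_squares by (intro AE_I2) (simp add: norm_mult)
qed

text \<open>Over the centre the integrand is a product of kernels at \<open>a y - t\<close> and
  \<open>b y + t\<close>, so \<open>kE_convolution\<close> gives order \<open>4 * m\<close> at
  \<open>a y + b y = zarg s x 1 y\<close>. The cross term is removed by passing to
  \<open>\<theta> = 0\<close>, and the radial integral lowers the order back to
  \<open>2 * m\<close>.\<close>

lemma ker_convolution:
  fixes h :: "'m::finite heis"
  assumes e: "\<epsilon> > 0" "\<epsilon>' > 0"
  shows "(\<integral>g. ker \<epsilon> (hmult (hinv g) h) * ker \<epsilon>' g \<partial>lborel) = conv_const TYPE('m) *\<^sub>R ker (\<epsilon> + \<epsilon>') h"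
proof -
  define m where "m = CARD('m)"
  have m: "m > 0" by (simp add: m_def)
  define x where "x = snd h"
  define s where "s = (\<epsilon> + \<epsilon>') *\<^sub>R 1 + wq h"
  define a where "a y = \<epsilon> *\<^sub>R 1 + ((norm y)\<^sup>2) *\<^sub>R 1 + wq h - 2 *\<^sub>R hip y x" for y
  define b where "b y = \<epsilon>' *\<^sub>R (1::quat) + ((norm (y::real^4^'m))\<^sup>2) *\<^sub>R 1" for y
  have Rs: "qRe s \<ge> (\<epsilon> + \<epsilon>') + (norm x)\<^sup>2" by (simp add: s_def qRe_wq x_def)
  have Rb: "qRe (b y) > 0" for y using e by (simp add: b_def add_pos_nonneg)
  \<comment> \<open>This real part is \<open>\<epsilon> + (norm (y - x))^2\<close>.\<close>
  have Ra: "qRe (a y) > 0" for y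
  proof -
    have "2 * inner y x \<le> 2 * (norm y * norm x)" using norm_cauchy_schwarz[of y x] by simp
    also have "\<dots> \<le> (norm y)\<^sup>2 + (norm x)\<^sup>2" using sum_squares_bound[of "norm y" "norm x"] by simp
    finally show ?thesis using e by (simp add: a_def qRe_hip qRe_wq x_def)
  qed
  have ker1: "ker \<epsilon> (hmult (hinv (t, y)) h) = kE (2 * m) (a y - quat_of_t t)" for t y
  proof -
    have eq: "wq (hmult (hinv (t, y)) h) = ((norm y)\<^sup>2) *\<^sub>R 1 - quat_of_t t + wq h - 2 *\<^sub>R hip y x"
      unfolding wq_hmult wq_hinv by (simp add: wq_def hinv_def x_def)
    show ?thesis unfolding ker_def m_def a_def eq by (simp add: algebra_simps)
  qed
  have ker2: "ker \<epsilon>' (t, y) = kE (2 * m) (b y + quat_of_t t)" for t and y :: "real^4^'m"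
    by (simp add: ker_def m_def b_def wq_def algebra_simps)
  define f where "f = (\<lambda>(t, y). ker \<epsilon> (hmult (hinv (t, y)) h) * ker \<epsilon>' (t, y))"
  have fi: "integrable (lborel \<Otimes>\<^sub>M lborel) (\<lambda>(t, y). f (t, y))"
    using integrable_ker_product[OF e, of h] unfolding lborel_prod f_def by (simp add: case_prod_beta')
  have "(\<integral>g. ker \<epsilon> (hmult (hinv g) h) * ker \<epsilon>' g \<partial>lborel) = (\<integral>y. (\<integral>t. f (t, y) \<partial>lborel) \<partial>lborel)"
    using lborel_pair.integral_snd[OF fi] unfolding lborel_prod f_def by (simp add: case_prod_beta')
  also have "\<dots> = (\<integral>y. cauchy_const *\<^sub>R kE (4 * m) (a y + b y) \<partial>lborel)"
    unfolding f_def prod.case ker1 ker2 using m by (subst kE_convolution[OF Ra Rb]) auto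
  also have "\<dots> = cauchy_const *\<^sub>R (\<integral>y. kE (Suc (4 * m - 1)) (zarg s x 1 y) \<partial>lborel)"
  proof -
    have "a y + b y = zarg s x 1 y" for y
      by (simp add: quat_eq_iff a_def b_def s_def zarg_def)
    then show ?thesis using m by simp
  qed
  also have "\<dots> = cauchy_const *\<^sub>R (\<integral>y. kE (4 * m) (s + (2 * (norm (y::real^4^'m))\<^sup>2) *\<^sub>R 1) \<partial>lborel)"
  proof -
    have "(\<integral>y. kE (Suc (4 * m - 1)) (zarg s x 1 y) \<partial>lborel) = (\<integral>y. kE (Suc (4 * m - 1)) (zarg s x 0 y) \<partial>lborel)"
      using e m by (intro zarg_integral_constant[OF _ Rs]) (auto simp: m_def)
    moreover have "Suc (4 * m - 1) = 4 * m" using m by simp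
    moreover have "zarg s x 0 = (\<lambda>y. s + (2 * (norm y)\<^sup>2) *\<^sub>R 1)" by (simp add: zarg_def fun_eq_iff)
    ultimately show ?thesis by (simp only:)
  qed
  also have "\<dots> = conv_const TYPE('m) *\<^sub>R kE (2 * m) s"
  proof -
    have "qRe s > 0" using Rs e zero_le_power2[of "norm x"] by linarith
    then show ?thesis unfolding m_def by (simp only: kE_horizontal_integral conv_const_def scaleR_scaleR)
  qed
  finally show ?thesis by (simp add: ker_def s_def m_def)
qed

section \<open>The uniform L2 bound\<close>

definition Top :: "real \<Rightarrow> ('m::finite heis \<Rightarrow> quat) \<Rightarrow> 'm heis \<Rightarrow> quat" where
  "Top \<epsilon> f g = (\<integral>h. ker \<epsilon> (hmult (hinv h) g) * f h \<partial>lborel)"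

text \<open>Bounded Borel functions of bounded support: a class in which the exchanges of integrals
  below converge absolutely, and which contains every atom after a change on a null set.\<close>

definition bbs :: "('m::finite heis \<Rightarrow> quat) \<Rightarrow> bool" where
  "bbs f \<longleftrightarrow> f \<in> borel_measurable borel \<and> (\<exists>M. \<forall>g. norm (f g) \<le> M) \<and> (\<exists>R. \<forall>g. f g \<noteq> 0 \<longrightarrow> hnorm g \<le> R)"

lemma bbs_measurable [measurable_dest]: "bbs f \<Longrightarrow> f \<in> borel_measurable borel"
  by (simp add: bbs_def)

lemma bbs_integrable:
  fixes f :: "'m::finite heis \<Rightarrow> quat"
  assumes "bbs f"
  shows "integrable lborel f" and "integrable lborel (\<lambda>g. (norm (f g))\<^sup>2)"
proof -
  obtain M R where M: "\<And>g. norm (f g) \<le> M" and R: "\<And>g. f g \<noteq> 0 \<Longrightarrow> hnorm g \<le> R"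
    using assms unfolding bbs_def by blast
  define A where "A = {g :: 'm heis. hdist 0 g \<le> max R 1}"
  have Rd: "g \<in> A" if "f g \<noteq> 0" for g
    using R[OF that] by (simp add: A_def hdist_commute[of 0])
  have [measurable]: "A \<in> sets borel" unfolding A_def by measurable
  have fin: "emeasure lborel A < \<infinity>"
    unfolding A_def by (rule le_less_trans[OF emeasure_hdist_ball(1)[of "max R 1" "0::'m heis"]]) auto
  have i: "integrable lborel (\<lambda>g. indicator A g *\<^sub>R c)" for c :: real
    using fin by (intro integrable_scaleR_left) (simp add: integrable_indicator_iff)
  have [measurable]: "f \<in> borel_measurable borel" using assms by measurable
  show "integrable lborel f"
    by (rule Bochner_Integration.integrable_bound[OF i[of M]])
       (use M Rd in \<open>auto simp: indicator_def intro!: AE_I2 intro: order_trans[OF M]\<close>)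
  have sq: "(norm (f g))\<^sup>2 \<le> M\<^sup>2" for g using M by (intro power_mono) auto
  show "integrable lborel (\<lambda>g. (norm (f g))\<^sup>2)"
    by (rule Bochner_Integration.integrable_bound[OF i[of "M\<^sup>2"]]) (use sq Rd in \<open>auto simp: indicator_def intro!: AE_I2\<close>)
qed

lemma ker_const_bound:
  assumes "\<epsilon> > 0"
  obtains C where "C > 0" "\<And>h::'m::finite heis. norm (ker \<epsilon> h) \<le> C"
proof -
  obtain C where C: "C > 0" "\<And>h::'m heis. norm (ker \<epsilon> h) \<le> C * (sqrt \<epsilon> + hnorm h) powr (- real (qdim TYPE('m)))"
    using ker_bound[where 'm = 'm] assms by blast
  have "norm (ker \<epsilon> h) \<le> C * sqrt \<epsilon> powr (- real (qdim TYPE('m)))" for h :: "'m heis"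
    using C(2)[of h] C(1) assms by (elim order_trans) (intro mult_left_mono powr_mono2', auto)
  moreover have "C * sqrt \<epsilon> powr (- real (qdim TYPE('m))) > 0" using C assms by simp
  ultimately show ?thesis using that by blast
qed

lemma ker_pair_measurable [measurable]:
  assumes "\<epsilon> > 0" "f \<in> borel_measurable M" "g \<in> borel_measurable M"
  shows "(\<lambda>x. ker \<epsilon> (hmult (hinv (f x)) (g x))) \<in> borel_measurable M"
  by (rule measurable_compose[OF _ borel_measurable_ker[OF assms(1)]]) (use assms(2,3) in measurable)

lemma Top_integrable:
  assumes f: "bbs f" and e: "\<epsilon> > 0"
  shows "integrable lborel (\<lambda>h. ker \<epsilon> (hmult (hinv h) g) * f h)"
proof -
  obtain C where C: "C > 0" "\<And>h. norm (ker \<epsilon> (hmult (hinv h) g)) \<le> C" using ker_const_bound[OF e] by metis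
  have [measurable]: "f \<in> borel_measurable borel" using f by measurable
  show ?thesis
  proof (rule Bochner_Integration.integrable_bound)
    show "integrable lborel (\<lambda>h. C * norm (f h))" using bbs_integrable(1)[OF f] by simp
    show "(\<lambda>h. ker \<epsilon> (hmult (hinv h) g) * f h) \<in> borel_measurable lborel" using e by measurable
    show "AE h in lborel. norm (ker \<epsilon> (hmult (hinv h) g) * f h) \<le> norm (C * norm (f h))"
      using C by (intro AE_I2) (simp add: norm_mult mult_right_mono)
  qed
qed

lemma Top_measurable [measurable]:
  assumes f: "bbs f" and e: "\<epsilon> > 0"
  shows "Top \<epsilon> f \<in> borel_measurable borel"
proof -
  have [measurable]: "f \<in> borel_measurable borel" using f by measurable
  have "(\<lambda>(g, h). ker \<epsilon> (hmult (hinv h) g) * f h) \<in> borel_measurable (borel \<Otimes>\<^sub>M lborel)"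
    using e by measurable
  from lborel.borel_measurable_lebesgue_integral[OF this] show ?thesis by (simp add: Top_def[abs_def])
qed

lemma ker_sq_swap: "\<epsilon> > 0 \<Longrightarrow> norm (ker \<epsilon> (hmult (hinv a) b)) = norm (ker \<epsilon> (hmult (hinv b) a))"
  using arg_cong[OF qcnj_ker_swap[of \<epsilon> a b], of norm] by simp

lemma ker_sq_integrable:
  fixes a :: "'m::finite heis"
  assumes "\<epsilon> > 0"
  shows "integrable lborel (\<lambda>g. (norm (ker \<epsilon> (hmult (hinv a) g)))\<^sup>2)" "integrable lborel (\<lambda>g. (norm (ker \<epsilon> (hmult (hinv g) a)))\<^sup>2)"
    and "(\<integral>g. (norm (ker \<epsilon> (hmult (hinv a) g)))\<^sup>2 \<partial>lborel) = (\<integral>g. (norm (ker \<epsilon> (g :: 'm heis)))\<^sup>2 \<partial>lborel)"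
proof -
  have i: "integrable lborel (\<lambda>g::'m heis. (norm (ker \<epsilon> g))\<^sup>2)" using ker_square_integral assms by blast
  show "integrable lborel (\<lambda>g. (norm (ker \<epsilon> (hmult (hinv a) g)))\<^sup>2)" using integrable_hmult[OF i] .
  then show "integrable lborel (\<lambda>g. (norm (ker \<epsilon> (hmult (hinv g) a)))\<^sup>2)"
    using ker_sq_swap[OF assms, of a] by simp
  show "(\<integral>g. (norm (ker \<epsilon> (hmult (hinv a) g)))\<^sup>2 \<partial>lborel) = (\<integral>g. (norm (ker \<epsilon> (g :: 'm heis)))\<^sup>2 \<partial>lborel)"
    by (rule integral_hmult) (use i in auto)
qed

lemma pair_integrable_product:
  fixes u :: "'a::euclidean_space \<Rightarrow> real" and v :: "'b::euclidean_space \<Rightarrow> real"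
  assumes "integrable lborel u" "integrable lborel v"
  shows "integrable (lborel \<Otimes>\<^sub>M lborel) (\<lambda>(x, y). u x * v y)"
  by (rule lborel_pair.Fubini_integrable) (use assms in \<open>auto simp: abs_mult\<close>)

lemma ker_sq_pair_integrable:
  assumes f: "bbs f" and e: "\<epsilon> > 0"
  shows "integrable (lborel \<Otimes>\<^sub>M lborel) (\<lambda>(h, g). (norm (ker \<epsilon> (hmult (hinv h) g)))\<^sup>2 * norm (f h))"
proof (rule lborel_pair.Fubini_integrable)
  have [measurable]: "f \<in> borel_measurable borel" using f by measurable
  show "(\<lambda>(h, g). (norm (ker \<epsilon> (hmult (hinv h) g)))\<^sup>2 * norm (f h)) \<in> borel_measurable (lborel \<Otimes>\<^sub>M lborel)"
    using e by measurable
  show "integrable lborel (\<lambda>h. \<integral>g. norm (case (h, g) of (h, g) \<Rightarrow> (norm (ker \<epsilon> (hmult (hinv h) g)))\<^sup>2 * norm (f h)) \<partial>lborel)"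
    using bbs_integrable(1)[OF f] by (simp add: ker_sq_integrable(3)[OF e])
  show "AE h in lborel. integrable lborel (\<lambda>g. case (h, g) of (h, g) \<Rightarrow> (norm (ker \<epsilon> (hmult (hinv h) g)))\<^sup>2 * norm (f h))"
    by (rule AE_I2) (simp add: ker_sq_integrable(1)[OF e])
qed

text \<open>The integral of \<open>(u - c)^2 * v\<close> is nonnegative for all \<open>c\<close>.
  The minimising \<open>c\<close> is \<open>B / b\<close>; for \<open>b = 0\<close> a suitable
  \<open>c\<close> shows that \<open>B\<close> vanishes.\<close>

lemma weighted_Cauchy_Schwarz:
  fixes u v :: "'a \<Rightarrow> real"
  assumes v: "\<And>x. v x \<ge> 0" and i: "integrable M v" "integrable M (\<lambda>x. u x * v x)" "integrable M (\<lambda>x. (u x)\<^sup>2 * v x)"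
  shows "(\<integral>x. u x * v x \<partial>M)\<^sup>2 \<le> (\<integral>x. v x \<partial>M) * (\<integral>x. (u x)\<^sup>2 * v x \<partial>M)"
proof -
  define A B b where "A = (\<integral>x. (u x)\<^sup>2 * v x \<partial>M)" and "B = (\<integral>x. u x * v x \<partial>M)" and "b = (\<integral>x. v x \<partial>M)"
  have q: "0 \<le> A - 2 * c * B + c\<^sup>2 * b" for c
  proof -
    have "0 \<le> (\<integral>x. (u x - c)\<^sup>2 * v x \<partial>M)" using v by (intro integral_nonneg_AE) auto
    also have "(\<lambda>x. (u x - c)\<^sup>2 * v x) = (\<lambda>x. (u x)\<^sup>2 * v x - (2 * c) * (u x * v x) + c\<^sup>2 * v x)"
      by (simp add: power2_eq_square algebra_simps)
    also have "(\<integral>x. (u x)\<^sup>2 * v x - (2 * c) * (u x * v x) + c\<^sup>2 * v x \<partial>M) = A - 2 * c * B + c\<^sup>2 * b"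
      using i by (simp add: A_def B_def b_def)
    finally show ?thesis .
  qed
  have "b \<ge> 0" unfolding b_def using v by (intro integral_nonneg_AE) auto
  then consider "b > 0" | "b = 0" by linarith
  then have "B\<^sup>2 \<le> b * A"
  proof cases
    case 1
    have "0 \<le> (A - 2 * (B / b) * B + (B / b)\<^sup>2 * b) * b" using q[of "B / b"] 1 by (intro mult_nonneg_nonneg) auto
    also have "\<dots> = b * A - B\<^sup>2" using 1 by (simp add: power2_eq_square field_simps)
    finally show ?thesis by simp
  next
    case 2
    have "B = 0"
    proof (rule ccontr)
      assume "B \<noteq> 0"
      then show False using q[of "(A + 1) / (2 * B)"] 2 by simp
    qed
    with 2 show ?thesis by simp
  qed
  then show ?thesis by (simp add: A_def B_def b_def)
qed

text \<open>Cauchy-Schwarz with weight \<open>norm (f h)\<close>, followed by Fubini. The constant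
  depends on \<open>\<epsilon>\<close>: the lemma supplies finiteness of the norms and their control
  for large \<open>\<epsilon>\<close>.\<close>

lemma Top_square_integrable:
  fixes f :: "'m::finite heis \<Rightarrow> quat"
  assumes f: "bbs f" and e: "\<epsilon> > 0"
  shows "integrable lborel (\<lambda>g. (norm (Top \<epsilon> f g))\<^sup>2)"
    and "(\<integral>g. (norm (Top \<epsilon> f g))\<^sup>2 \<partial>lborel) \<le> (\<integral>h. norm (f h) \<partial>lborel)\<^sup>2 * (\<integral>g. (norm (ker \<epsilon> (g :: 'm heis)))\<^sup>2 \<partial>lborel)"
proof -
  have [measurable]: "f \<in> borel_measurable borel" using f by measurable
  have [measurable]: "Top \<epsilon> f \<in> borel_measurable borel" by (rule Top_measurable[OF f e])
  define F where "F = (\<integral>h. norm (f h) \<partial>lborel)"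
  define S where "S = (\<integral>g. (norm (ker \<epsilon> (g :: 'm heis)))\<^sup>2 \<partial>lborel)"
  have F: "F \<ge> 0" unfolding F_def by simp
  define w where "w g = (\<integral>h. (norm (ker \<epsilon> (hmult (hinv h) g)))\<^sup>2 * norm (f h) \<partial>lborel)" for g
  note pi = ker_sq_pair_integrable[OF f e]
  have wi: "integrable lborel w"
    using lborel_pair.integrable_snd[OF pi] unfolding w_def .
  have wS: "(\<integral>g. w g \<partial>lborel) = S * F"
  proof -
    have "(\<integral>g. w g \<partial>lborel) = (\<integral>h. (\<integral>g. (norm (ker \<epsilon> (hmult (hinv h) g)))\<^sup>2 * norm (f h) \<partial>lborel) \<partial>lborel)"
      unfolding w_def by (rule lborel_pair.Fubini_integral[OF pi])
    then show ?thesis by (simp add: ker_sq_integrable(3)[OF e] S_def F_def)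
  qed
  have le: "(norm (Top \<epsilon> f g))\<^sup>2 \<le> F * w g" for g
  proof -
    obtain C where C: "C > 0" "\<And>h::'m heis. norm (ker \<epsilon> h) \<le> C" using ker_const_bound[OF e] by metis
    have i1: "integrable lborel (\<lambda>h. norm (ker \<epsilon> (hmult (hinv h) g)) * norm (f h))"
      using integrable_norm[OF Top_integrable[OF f e, of g]] by (simp add: norm_mult)
    have i2: "integrable lborel (\<lambda>h. (norm (ker \<epsilon> (hmult (hinv h) g)))\<^sup>2 * norm (f h))"
    proof (rule Bochner_Integration.integrable_bound)
      show "integrable lborel (\<lambda>h. C\<^sup>2 * norm (f h))" using bbs_integrable(1)[OF f] by simp
      show "(\<lambda>h. (norm (ker \<epsilon> (hmult (hinv h) g)))\<^sup>2 * norm (f h)) \<in> borel_measurable lborel" using e by measurable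
      show "AE h in lborel. norm ((norm (ker \<epsilon> (hmult (hinv h) g)))\<^sup>2 * norm (f h)) \<le> norm (C\<^sup>2 * norm (f h))"
        unfolding real_norm_def abs_mult abs_power2 abs_norm_cancel
        by (intro AE_I2 mult_right_mono power_mono C(2)) auto
    qed
    have "norm (Top \<epsilon> f g) \<le> (\<integral>h. norm (ker \<epsilon> (hmult (hinv h) g)) * norm (f h) \<partial>lborel)"
      unfolding Top_def using integral_norm_bound[of lborel "\<lambda>h. ker \<epsilon> (hmult (hinv h) g) * f h"] by (simp add: norm_mult)
    then have "(norm (Top \<epsilon> f g))\<^sup>2 \<le> (\<integral>h. norm (ker \<epsilon> (hmult (hinv h) g)) * norm (f h) \<partial>lborel)\<^sup>2"
      by (intro power_mono) auto
    also have "\<dots> \<le> F * w g"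
      unfolding F_def w_def using bbs_integrable(1)[OF f] by (intro weighted_Cauchy_Schwarz i1 i2) auto
    finally show ?thesis .
  qed
  show i: "integrable lborel (\<lambda>g. (norm (Top \<epsilon> f g))\<^sup>2)"
  proof (rule Bochner_Integration.integrable_bound)
    show "integrable lborel (\<lambda>g. F * w g)" using wi by simp
    show "AE g in lborel. norm ((norm (Top \<epsilon> f g))\<^sup>2) \<le> norm (F * w g)"
      using le by (intro AE_I2) (auto intro: order_trans[OF _ abs_ge_self])
  qed measurable
  have "(\<integral>g. (norm (Top \<epsilon> f g))\<^sup>2 \<partial>lborel) \<le> (\<integral>g. F * w g \<partial>lborel)"
    using i wi le by (intro integral_mono) auto
  also have "\<dots> = F\<^sup>2 * S" by (simp add: wS power2_eq_square)
  finally show "(\<integral>g. (norm (Top \<epsilon> f g))\<^sup>2 \<partial>lborel) \<le> (\<integral>h. norm (f h) \<partial>lborel)\<^sup>2 * (\<integral>g. (norm (ker \<epsilon> (g :: 'm heis)))\<^sup>2 \<partial>lborel)"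
    by (simp add: F_def S_def)
qed

lemma Top_Top:
  fixes f :: "'m::finite heis \<Rightarrow> quat"
  assumes f: "bbs f" and e: "\<epsilon> > 0"
  shows "integrable lborel (\<lambda>g. ker \<epsilon> (hmult (hinv g) h) * Top \<epsilon> f g)"
    and "(\<integral>g. ker \<epsilon> (hmult (hinv g) h) * Top \<epsilon> f g \<partial>lborel) = conv_const TYPE('m) *\<^sub>R Top (2 * \<epsilon>) f h"
proof -
  have [measurable]: "f \<in> borel_measurable borel" using f by measurable
  have [measurable]: "Top \<epsilon> f \<in> borel_measurable borel" by (rule Top_measurable[OF f e])
  show "integrable lborel (\<lambda>g. ker \<epsilon> (hmult (hinv g) h) * Top \<epsilon> f g)"
  proof (rule Bochner_Integration.integrable_bound)
    show "integrable lborel (\<lambda>g. (norm (ker \<epsilon> (hmult (hinv g) h)))\<^sup>2 + (norm (Top \<epsilon> f g))\<^sup>2)"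
      by (intro Bochner_Integration.integrable_add ker_sq_integrable(2)[OF e] Top_square_integrable(1)[OF f e])
    show "(\<lambda>g. ker \<epsilon> (hmult (hinv g) h) * Top \<epsilon> f g) \<in> borel_measurable lborel" using e by measurable
    show "AE g in lborel. norm (ker \<epsilon> (hmult (hinv g) h) * Top \<epsilon> f g) \<le> norm ((norm (ker \<epsilon> (hmult (hinv g) h)))\<^sup>2 + (norm (Top \<epsilon> f g))\<^sup>2)"
      using mult_norm_le_squares by (intro AE_I2) (simp add: norm_mult)
  qed
  have pi: "integrable (lborel \<Otimes>\<^sub>M lborel) (\<lambda>(h', g). ker \<epsilon> (hmult (hinv g) h) * (ker \<epsilon> (hmult (hinv h') g) * f h'))"
  proof (rule Bochner_Integration.integrable_bound)
    show "integrable (lborel \<Otimes>\<^sub>M lborel) (\<lambda>p. (case p of (h', g) \<Rightarrow> norm (f h') * (norm (ker \<epsilon> (hmult (hinv g) h)))\<^sup>2)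
        + (case p of (h', g) \<Rightarrow> (norm (ker \<epsilon> (hmult (hinv h') g)))\<^sup>2 * norm (f h')))"
      using bbs_integrable(1)[OF f]
      by (intro Bochner_Integration.integrable_add pair_integrable_product integrable_norm ker_sq_integrable(2)[OF e] ker_sq_pair_integrable[OF f e])
    show "(\<lambda>(h', g). ker \<epsilon> (hmult (hinv g) h) * (ker \<epsilon> (hmult (hinv h') g) * f h')) \<in> borel_measurable (lborel \<Otimes>\<^sub>M lborel)"
      using e by measurable
    show "AE p in lborel \<Otimes>\<^sub>M lborel. norm (case p of (h', g) \<Rightarrow> ker \<epsilon> (hmult (hinv g) h) * (ker \<epsilon> (hmult (hinv h') g) * f h'))
      \<le> norm ((case p of (h', g) \<Rightarrow> norm (f h') * (norm (ker \<epsilon> (hmult (hinv g) h)))\<^sup>2)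
        + (case p of (h', g) \<Rightarrow> (norm (ker \<epsilon> (hmult (hinv h') g)))\<^sup>2 * norm (f h')))"
    proof (rule AE_I2, clarify)
      fix h' g :: "'m heis"
      have "norm (ker \<epsilon> (hmult (hinv g) h)) * norm (ker \<epsilon> (hmult (hinv h') g)) * norm (f h')
        \<le> ((norm (ker \<epsilon> (hmult (hinv g) h)))\<^sup>2 + (norm (ker \<epsilon> (hmult (hinv h') g)))\<^sup>2) * norm (f h')"
        by (intro mult_right_mono mult_norm_le_squares) auto
      then show "norm (ker \<epsilon> (hmult (hinv g) h) * (ker \<epsilon> (hmult (hinv h') g) * f h'))
        \<le> norm (norm (f h') * (norm (ker \<epsilon> (hmult (hinv g) h)))\<^sup>2 + (norm (ker \<epsilon> (hmult (hinv h') g)))\<^sup>2 * norm (f h'))"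
        by (simp add: norm_mult algebra_simps)
    qed
  qed
  \<comment> \<open>Left translation by \<open>h'\<close> turns the inner integral into a
    convolution of two kernels; by associativity \<open>f h'\<close> can stay on the right of
    both.\<close>
  have inner_conv: "(\<integral>g. ker \<epsilon> (hmult (hinv g) h) * (ker \<epsilon> (hmult (hinv h') g) * f h') \<partial>lborel)
     = (conv_const TYPE('m) *\<^sub>R ker (2 * \<epsilon>) (hmult (hinv h') h)) * f h'" for h'
  proof -
    let ?F = "\<lambda>g. ker \<epsilon> (hmult (hinv g) h) * ker \<epsilon> (hmult (hinv h') g)"
    have m: "?F \<in> borel_measurable borel" using e by measurable
    have eq: "?F (hmult h' u) = ker \<epsilon> (hmult (hinv u) (hmult (hinv h') h)) * ker \<epsilon> u" for u
      by (simp add: hinv_hmult hmult_assoc)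
    have i: "integrable lborel (\<lambda>u. ?F (hmult h' u))"
      unfolding eq by (rule integrable_ker_product[OF e e])
    have iF: "integrable lborel ?F"
      using integrable_hmult[OF i, of "hinv h'"] by simp
    have "(\<integral>g. ?F g \<partial>lborel) = conv_const TYPE('m) *\<^sub>R ker (2 * \<epsilon>) (hmult (hinv h') h)"
      using integral_hmult[OF m, of h', symmetric] unfolding eq ker_convolution[OF e e] by simp
    moreover have "(\<integral>g. ?F g * f h' \<partial>lborel) = (\<integral>g. ?F g \<partial>lborel) * f h'"
      by (rule integral_bounded_linear[OF bounded_linear_mult_left iF])
    ultimately show ?thesis by (simp add: mult.assoc)
  qed
  have "(\<integral>g. ker \<epsilon> (hmult (hinv g) h) * Top \<epsilon> f g \<partial>lborel)
     = (\<integral>g. (\<integral>h'. ker \<epsilon> (hmult (hinv g) h) * (ker \<epsilon> (hmult (hinv h') g) * f h') \<partial>lborel) \<partial>lborel)"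
    unfolding Top_def by (subst integral_bounded_linear[OF bounded_linear_mult_right Top_integrable[OF f e]]) simp
  also have "\<dots> = (\<integral>h'. (\<integral>g. ker \<epsilon> (hmult (hinv g) h) * (ker \<epsilon> (hmult (hinv h') g) * f h') \<partial>lborel) \<partial>lborel)"
    by (rule lborel_pair.Fubini_integral[OF pi])
  also have "\<dots> = conv_const TYPE('m) *\<^sub>R Top (2 * \<epsilon>) f h"
    unfolding inner_conv Top_def by (simp flip: integral_scaleR_right)
  finally show "(\<integral>g. ker \<epsilon> (hmult (hinv g) h) * Top \<epsilon> f g \<partial>lborel) = conv_const TYPE('m) *\<^sub>R Top (2 * \<epsilon>) f h" .
qed

text \<open>Moving the kernel across the inner product conjugates it, which by
  \<open>qcnj_ker_swap\<close> exchanges its two points. The operator is thereby applied twice, and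
  \<open>Top_Top\<close> evaluates the result.\<close>

lemma Top_square_identity:
  fixes f :: "'m::finite heis \<Rightarrow> quat"
  assumes f: "bbs f" and e: "\<epsilon> > 0"
  shows "(\<integral>g. (norm (Top \<epsilon> f g))\<^sup>2 \<partial>lborel) = (\<integral>h. inner (f h) (conv_const TYPE('m) *\<^sub>R Top (2 * \<epsilon>) f h) \<partial>lborel)"
proof -
  have [measurable]: "f \<in> borel_measurable borel" using f by measurable
  have [measurable]: "Top \<epsilon> f \<in> borel_measurable borel" by (rule Top_measurable[OF f e])
  have pi: "integrable (lborel \<Otimes>\<^sub>M lborel) (\<lambda>(h, g). inner (ker \<epsilon> (hmult (hinv h) g) * f h) (Top \<epsilon> f g))"
  proof (rule Bochner_Integration.integrable_bound)
    show "integrable (lborel \<Otimes>\<^sub>M lborel) (\<lambda>p. (case p of (h, g) \<Rightarrow> norm (f h) * (norm (Top \<epsilon> f g))\<^sup>2)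
        + (case p of (h, g) \<Rightarrow> (norm (ker \<epsilon> (hmult (hinv h) g)))\<^sup>2 * norm (f h)))"
      using bbs_integrable(1)[OF f]
      by (intro Bochner_Integration.integrable_add pair_integrable_product integrable_norm Top_square_integrable(1)[OF f e] ker_sq_pair_integrable[OF f e])
    show "(\<lambda>(h, g). inner (ker \<epsilon> (hmult (hinv h) g) * f h) (Top \<epsilon> f g)) \<in> borel_measurable (lborel \<Otimes>\<^sub>M lborel)"
      using e by measurable
    show "AE p in lborel \<Otimes>\<^sub>M lborel. norm (case p of (h, g) \<Rightarrow> inner (ker \<epsilon> (hmult (hinv h) g) * f h) (Top \<epsilon> f g))
      \<le> norm ((case p of (h, g) \<Rightarrow> norm (f h) * (norm (Top \<epsilon> f g))\<^sup>2)
        + (case p of (h, g) \<Rightarrow> (norm (ker \<epsilon> (hmult (hinv h) g)))\<^sup>2 * norm (f h)))"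
    proof (rule AE_I2, clarify)
      fix h g :: "'m heis"
      have "\<bar>inner (ker \<epsilon> (hmult (hinv h) g) * f h) (Top \<epsilon> f g)\<bar> \<le> (norm (Top \<epsilon> f g) * norm (ker \<epsilon> (hmult (hinv h) g))) * norm (f h)"
        using Cauchy_Schwarz_ineq2[of "ker \<epsilon> (hmult (hinv h) g) * f h" "Top \<epsilon> f g"] by (simp add: norm_mult mult_ac)
      also have "\<dots> \<le> ((norm (Top \<epsilon> f g))\<^sup>2 + (norm (ker \<epsilon> (hmult (hinv h) g)))\<^sup>2) * norm (f h)"
        by (intro mult_right_mono mult_norm_le_squares) auto
      finally show "norm (inner (ker \<epsilon> (hmult (hinv h) g) * f h) (Top \<epsilon> f g))
        \<le> norm (norm (f h) * (norm (Top \<epsilon> f g))\<^sup>2 + (norm (ker \<epsilon> (hmult (hinv h) g)))\<^sup>2 * norm (f h))"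
        by (simp add: algebra_simps)
    qed
  qed
  have "(\<integral>g. (norm (Top \<epsilon> f g))\<^sup>2 \<partial>lborel) = (\<integral>g. (\<integral>h. inner (ker \<epsilon> (hmult (hinv h) g) * f h) (Top \<epsilon> f g) \<partial>lborel) \<partial>lborel)"
  proof (rule Bochner_Integration.integral_cong[OF refl])
    fix g
    have "(\<integral>h. inner (ker \<epsilon> (hmult (hinv h) g) * f h) (Top \<epsilon> f g) \<partial>lborel) = inner (\<integral>h. ker \<epsilon> (hmult (hinv h) g) * f h \<partial>lborel) (Top \<epsilon> f g)"
      by (rule integral_inner_left) (rule Top_integrable[OF f e])
    then show "(norm (Top \<epsilon> f g))\<^sup>2 = (\<integral>h. inner (ker \<epsilon> (hmult (hinv h) g) * f h) (Top \<epsilon> f g) \<partial>lborel)"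
      by (simp add: power2_norm_eq_inner Top_def)
  qed
  also have "\<dots> = (\<integral>h. (\<integral>g. inner (ker \<epsilon> (hmult (hinv h) g) * f h) (Top \<epsilon> f g) \<partial>lborel) \<partial>lborel)"
    by (rule lborel_pair.Fubini_integral[OF pi])
  also have "\<dots> = (\<integral>h. inner (f h) (conv_const TYPE('m) *\<^sub>R Top (2 * \<epsilon>) f h) \<partial>lborel)"
  proof (rule Bochner_Integration.integral_cong[OF refl])
    fix h
    have "(\<integral>g. inner (ker \<epsilon> (hmult (hinv h) g) * f h) (Top \<epsilon> f g) \<partial>lborel) = (\<integral>g. inner (f h) (ker \<epsilon> (hmult (hinv g) h) * Top \<epsilon> f g) \<partial>lborel)"
      by (simp add: inner_mult_left_quat qcnj_ker_swap[OF e])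
    also have "\<dots> = inner (f h) (\<integral>g. ker \<epsilon> (hmult (hinv g) h) * Top \<epsilon> f g \<partial>lborel)"
      by (rule integral_inner_right) (rule Top_Top(1)[OF f e])
    finally show "(\<integral>g. inner (ker \<epsilon> (hmult (hinv h) g) * f h) (Top \<epsilon> f g) \<partial>lborel) = inner (f h) (conv_const TYPE('m) *\<^sub>R Top (2 * \<epsilon>) f h)"
      by (simp add: Top_Top(2)[OF f e])
  qed
  finally show ?thesis .
qed

text \<open>
  Since \<open>Top \<epsilon>\<close> is self-adjoint and its square is a multiple of \<open>Top (2 \<epsilon>)\<close>, doubling \<open>\<epsilon>\<close> halves the
  excess of the squared norm over the claimed bound, and the squared norms are bounded as \<open>\<epsilon>\<close> grows.
\<close>

lemma Top_L2_bound:
  fixes f :: "'m::finite heis \<Rightarrow> quat"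
  assumes f: "bbs f" and e: "\<epsilon> > 0"
  shows "(\<integral>g. (norm (Top \<epsilon> f g))\<^sup>2 \<partial>lborel) \<le> (conv_const TYPE('m))\<^sup>2 * (\<integral>h. (norm (f h))\<^sup>2 \<partial>lborel)"
proof -
  define A where "A \<epsilon> = (\<integral>g. (norm (Top \<epsilon> f g))\<^sup>2 \<partial>lborel)" for \<epsilon>
  define c where "c = conv_const TYPE('m)"
  define D where "D = c\<^sup>2 * (\<integral>h. (norm (f h))\<^sup>2 \<partial>lborel)"
  have step: "A \<epsilon> - D \<le> (A (2 * \<epsilon>) - D) / 2" if e: "\<epsilon> > 0" for \<epsilon>
  proof -
    have e2: "2 * \<epsilon> > 0" using e by simp
    have pt: "inner (f h) (c *\<^sub>R Top (2 * \<epsilon>) f h) \<le> (c\<^sup>2 * (norm (f h))\<^sup>2 + (norm (Top (2 * \<epsilon>) f h))\<^sup>2) / 2" for h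
    proof -
      have "inner (f h) (c *\<^sub>R Top (2 * \<epsilon>) f h) = inner (c *\<^sub>R f h) (Top (2 * \<epsilon>) f h)" by simp
      also have "\<dots> \<le> norm (c *\<^sub>R f h) * norm (Top (2 * \<epsilon>) f h)" by (rule norm_cauchy_schwarz)
      also have "\<dots> \<le> ((norm (c *\<^sub>R f h))\<^sup>2 + (norm (Top (2 * \<epsilon>) f h))\<^sup>2) / 2"
        using sum_squares_bound[of "norm (c *\<^sub>R f h)" "norm (Top (2 * \<epsilon>) f h)"] by simp
      finally show ?thesis by (simp add: power_mult_distrib)
    qed
    have i: "integrable lborel (\<lambda>h. (c\<^sup>2 * (norm (f h))\<^sup>2 + (norm (Top (2 * \<epsilon>) f h))\<^sup>2) / 2)"
      using bbs_integrable(2)[OF f] Top_square_integrable(1)[OF f e2] by simp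
    have "A \<epsilon> = (\<integral>h. inner (f h) (c *\<^sub>R Top (2 * \<epsilon>) f h) \<partial>lborel)"
      unfolding A_def c_def by (rule Top_square_identity[OF f e])
    also have "\<dots> \<le> (\<integral>h. (c\<^sup>2 * (norm (f h))\<^sup>2 + (norm (Top (2 * \<epsilon>) f h))\<^sup>2) / 2 \<partial>lborel)"
    proof (rule integral_mono')
      show "0 \<le> (c\<^sup>2 * (norm (f h))\<^sup>2 + (norm (Top (2 * \<epsilon>) f h))\<^sup>2) / 2" for h by simp
    qed (use i pt in auto)
    also have "\<dots> = (D + A (2 * \<epsilon>)) / 2"
      using bbs_integrable(2)[OF f] Top_square_integrable(1)[OF f e2] by (simp add: A_def D_def)
    finally show ?thesis by (simp add: field_simps)
  qed
  obtain C where C: "C > 0" "\<And>\<epsilon>. \<epsilon> > 0 \<Longrightarrow> (\<integral>h. (norm (ker \<epsilon> (h::'m heis)))\<^sup>2 \<partial>lborel) \<le> C * \<epsilon> powr (- real (qdim TYPE('m)) / 2)"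
    using ker_square_integral[where 'm = 'm] by blast
  define M where "M = (\<integral>h. norm (f h) \<partial>lborel)\<^sup>2 * (C * \<epsilon> powr (- real (qdim TYPE('m)) / 2))"
  have M: "A \<epsilon>' \<le> M" if "\<epsilon>' \<ge> \<epsilon>" for \<epsilon>'
  proof -
    have "A \<epsilon>' \<le> (\<integral>h. norm (f h) \<partial>lborel)\<^sup>2 * (\<integral>g. (norm (ker \<epsilon>' (g :: 'm heis)))\<^sup>2 \<partial>lborel)"
      unfolding A_def using that e by (intro Top_square_integrable(2)[OF f]) auto
    also have "\<dots> \<le> (\<integral>h. norm (f h) \<partial>lborel)\<^sup>2 * (C * \<epsilon>' powr (- real (qdim TYPE('m)) / 2))"
      using that e by (intro mult_left_mono C(2)) auto
    also have "\<dots> \<le> M"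
      unfolding M_def using that e C(1) by (intro mult_left_mono powr_mono2') auto
    finally show ?thesis .
  qed
  have iter: "A \<epsilon> - D \<le> (A (2 ^ n * \<epsilon>) - D) / 2 ^ n" for n
  proof (induction n)
    case (Suc n)
    have "(A (2 ^ n * \<epsilon>) - D) / 2 ^ n \<le> ((A (2 * (2 ^ n * \<epsilon>)) - D) / 2) / 2 ^ n"
      using e by (intro divide_right_mono step) auto
    with Suc show ?case by (simp add: mult_ac)
  qed simp
  have "A \<epsilon> - D \<le> (M - D) * (1 / 2) ^ n" for n
  proof -
    have "1 * \<epsilon> \<le> 2 ^ n * \<epsilon>" using e by (intro mult_right_mono) auto
    then have "(A (2 ^ n * \<epsilon>) - D) / 2 ^ n \<le> (M - D) / 2 ^ n"
      by (intro divide_right_mono diff_right_mono M) auto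
    with iter[of n] show ?thesis by (simp add: power_divide)
  qed
  moreover have "(\<lambda>n. (M - D) * (1 / 2) ^ n) \<longlonglongrightarrow> (M - D) * 0"
    by (intro tendsto_intros LIMSEQ_power_zero) simp
  ultimately have "A \<epsilon> - D \<le> (M - D) * 0"
    by (intro Lim_bounded2[where N = 0]) auto
  then show ?thesis by (simp add: A_def D_def c_def)
qed

section \<open>Bounded functions: local Lp bounds for all exponents\<close>

lemma hball_eq: "hball x r = {g. hdist x g < r}"
  by (simp add: hball_def)

lemma hball_sets [measurable]: "hball x r \<in> sets borel" for x :: "'m::finite heis"
  unfolding hball_eq by measurable

lemma hball_measure:
  fixes x :: "'m::finite heis"
  assumes r: "r > 0"
  shows "hball x r \<in> fmeasurable lborel"
    and "measure lborel (hball x r) \<le> vball TYPE('m) * r ^ qdim TYPE('m)"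
    and "vball TYPE('m) / 2 ^ qdim TYPE('m) * r ^ qdim TYPE('m) \<le> measure lborel (hball x r)"
proof -
  have "emeasure lborel (hball x r) \<le> emeasure lborel {g. hdist x g \<le> r}"
    unfolding hball_eq by (rule emeasure_mono) (auto, measurable)
  also have "\<dots> \<le> ennreal (vball TYPE('m) * r ^ qdim TYPE('m))" by (rule emeasure_hdist_ball(1)[OF r])
  finally have u: "emeasure lborel (hball x r) \<le> ennreal (vball TYPE('m) * r ^ qdim TYPE('m))" .
  show fm: "hball x r \<in> fmeasurable lborel"
    by (intro fmeasurableI) (use u in \<open>auto intro: le_less_trans\<close>)
  have e: "emeasure lborel (hball x r) = ennreal (measure lborel (hball x r))"
    using fm by (simp add: emeasure_eq_measure2)
  have v: "vball TYPE('m) > 0" by (rule vball_pos)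
  show "measure lborel (hball x r) \<le> vball TYPE('m) * r ^ qdim TYPE('m)"
    using u v r unfolding e by (subst (asm) ennreal_le_iff) auto
  have "ennreal (vball TYPE('m) / 2 ^ qdim TYPE('m) * r ^ qdim TYPE('m)) \<le> emeasure lborel (hball x r)"
    unfolding hball_eq by (rule emeasure_hdist_ball(2)[OF r])
  then show "vball TYPE('m) / 2 ^ qdim TYPE('m) * r ^ qdim TYPE('m) \<le> measure lborel (hball x r)"
    unfolding e by (subst (asm) ennreal_le_iff) auto
qed

text \<open>The mean value inequality on a segment that stays at distance at least
  \<open>norm \<sigma> / 2\<close> from 0.\<close>

lemma kE_lipschitz:
  "\<exists>C>0. \<forall>\<sigma> \<eta>. \<sigma> \<noteq> 0 \<longrightarrow> norm \<eta> \<le> norm \<sigma> / 2 \<longrightarrow> norm (kE k (\<sigma> + \<eta>) - kE k \<sigma>) \<le> C * norm \<eta> * inverse (norm \<sigma>) ^ (4 + k)"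
proof -
  obtain C where C: "C > 0" "\<And>\<sigma> v. \<sigma> \<noteq> 0 \<Longrightarrow> norm (dE k v \<sigma>) \<le> C * norm v * inverse (norm \<sigma>) ^ (4 + k)"
    using dE_bound[of k] by blast
  show ?thesis
  proof (intro exI[of _ "C * 2 ^ (4 + k)"] conjI allI impI)
    fix \<sigma> \<eta> :: quat assume nz: "\<sigma> \<noteq> 0" and le: "norm \<eta> \<le> norm \<sigma> / 2"
    have low: "norm \<sigma> / 2 \<le> norm (\<sigma> + t *\<^sub>R \<eta>)" if "t \<in> {0..1}" for t
    proof -
      have "norm (t *\<^sub>R \<eta>) \<le> 1 * norm \<eta>" unfolding norm_scaleR using that by (intro mult_right_mono) auto
      moreover have "norm \<sigma> \<le> norm (\<sigma> + t *\<^sub>R \<eta>) + norm (t *\<^sub>R \<eta>)"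
        using norm_triangle_ineq4[of "\<sigma> + t *\<^sub>R \<eta>" "t *\<^sub>R \<eta>"] by simp
      ultimately show ?thesis using le by linarith
    qed
    have "norm (kE k (\<sigma> + 1 *\<^sub>R \<eta>) - kE k (\<sigma> + 0 *\<^sub>R \<eta>)) \<le> (C * 2 ^ (4 + k) * norm \<eta> * inverse (norm \<sigma>) ^ (4 + k)) * norm (1 - 0 :: real)"
    proof (rule differentiable_bound[of "{0..1}" "\<lambda>t. kE k (\<sigma> + t *\<^sub>R \<eta>)" "\<lambda>t h. dE k (h *\<^sub>R \<eta>) (\<sigma> + t *\<^sub>R \<eta>)"])
      fix t :: real assume t: "t \<in> {0..1}"
      have nzt: "\<sigma> + t *\<^sub>R \<eta> \<noteq> 0" using low[OF t] nz by auto
      show "((\<lambda>t. kE k (\<sigma> + t *\<^sub>R \<eta>)) has_derivative (\<lambda>h. dE k (h *\<^sub>R \<eta>) (\<sigma> + t *\<^sub>R \<eta>))) (at t within {0..1})"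
        by (intro kE_compose_derivative nzt) (auto intro!: derivative_eq_intros)
      show "onorm (\<lambda>h. dE k (h *\<^sub>R \<eta>) (\<sigma> + t *\<^sub>R \<eta>)) \<le> C * 2 ^ (4 + k) * norm \<eta> * inverse (norm \<sigma>) ^ (4 + k)"
      proof (rule onorm_bound)
        fix h :: real
        have "inverse (norm (\<sigma> + t *\<^sub>R \<eta>)) ^ (4 + k) \<le> inverse (norm \<sigma> / 2) ^ (4 + k)"
          using low[OF t] nz by (intro power_mono le_imp_inverse_le) auto
        also have "\<dots> = 2 ^ (4 + k) * inverse (norm \<sigma>) ^ (4 + k)"
        proof -
          have eq: "inverse (norm \<sigma> / 2) = 2 * inverse (norm \<sigma>)"
            using inverse_divide[of "norm \<sigma>" 2] by (simp only: divide_inverse[of 2 "norm \<sigma>"])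
          show ?thesis unfolding eq by (rule power_mult_distrib)
        qed
        finally have i: "inverse (norm (\<sigma> + t *\<^sub>R \<eta>)) ^ (4 + k) \<le> 2 ^ (4 + k) * inverse (norm \<sigma>) ^ (4 + k)" .
        have "norm (dE k (h *\<^sub>R \<eta>) (\<sigma> + t *\<^sub>R \<eta>)) \<le> C * norm (h *\<^sub>R \<eta>) * inverse (norm (\<sigma> + t *\<^sub>R \<eta>)) ^ (4 + k)"
          by (rule C(2)[OF nzt])
        also have "\<dots> \<le> C * norm (h *\<^sub>R \<eta>) * (2 ^ (4 + k) * inverse (norm \<sigma>) ^ (4 + k))"
          using C(1) by (intro mult_left_mono i) auto
        finally show "norm (dE k (h *\<^sub>R \<eta>) (\<sigma> + t *\<^sub>R \<eta>)) \<le> C * 2 ^ (4 + k) * norm \<eta> * inverse (norm \<sigma>) ^ (4 + k) * norm h"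
          by (simp only: norm_scaleR real_norm_def mult_ac)
      qed (use C(1) in auto)
    qed auto
    then show "norm (kE k (\<sigma> + \<eta>) - kE k \<sigma>) \<le> C * 2 ^ (4 + k) * norm \<eta> * inverse (norm \<sigma>) ^ (4 + k)"
      by (simp only: scaleR_one scaleR_zero_left add_0_right diff_0_right norm_one mult_1_right)
  qed (use C(1) in simp)
qed

text \<open>Right multiplication by \<open>b\<close> changes \<open>wq a\<close> by at most
  \<open>3 * hnorm a * hnorm b\<close>. The 12 makes this at most a quarter of
  \<open>(hnorm a)^2\<close>, hence at most half the norm of the argument, as
  \<open>kE_lipschitz\<close> requires. The gain over \<open>ker_bound\<close> is a factor
  \<open>hnorm b / hnorm a\<close>.\<close>

lemma ker_lipschitz:
  "\<exists>C>0. \<forall>\<epsilon>>0. \<forall>a b :: 'm::finite heis. hnorm b \<le> hnorm a / 12 \<longrightarrow> hnorm a > 0 \<longrightarrow>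
     norm (ker \<epsilon> (hmult a b) - ker \<epsilon> a) \<le> C * hnorm b * hnorm a powr (- real (qdim TYPE('m) + 1))"
proof -
  define k where "k = 2 * CARD('m)"
  obtain C where C: "C > 0" "\<And>\<sigma> \<eta>. \<sigma> \<noteq> 0 \<Longrightarrow> norm \<eta> \<le> norm \<sigma> / 2 \<Longrightarrow> norm (kE k (\<sigma> + \<eta>) - kE k \<sigma>) \<le> C * norm \<eta> * inverse (norm \<sigma>) ^ (4 + k)"
    using kE_lipschitz by blast
  show ?thesis
  proof (intro exI[of _ "C * 3 * 2 ^ (4 + k)"] conjI allI impI)
    fix \<epsilon> :: real and a b :: "'m heis" assume e: "\<epsilon> > 0" and ab: "hnorm b \<le> hnorm a / 12" "hnorm a > 0"
    define \<sigma> where "\<sigma> = \<epsilon> *\<^sub>R 1 + wq a"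
    define \<eta> where "\<eta> = wq b + 2 *\<^sub>R hip (snd a) (snd b)"
    have "norm \<eta> \<le> norm (wq b) + norm (2 *\<^sub>R hip (snd a) (snd b))" unfolding \<eta>_def by (rule norm_triangle_ineq)
    also have "\<dots> \<le> (hnorm b)\<^sup>2 + 2 * (hnorm a * hnorm b)"
      using norm_hip_le[of "snd a" "snd b"] mult_mono[OF norm_snd_le_hnorm[of a] norm_snd_le_hnorm[of b]] by (simp add: norm_wq)
    also have "(hnorm b)\<^sup>2 \<le> hnorm a * hnorm b" unfolding power2_eq_square using ab by (intro mult_right_mono) auto
    finally have eta: "norm \<eta> \<le> 3 * (hnorm a * hnorm b)" by simp
    have s: "(hnorm a)\<^sup>2 / 2 \<le> norm \<sigma>" using eps_wq_lower(1)[OF e, of a] e by (simp add: \<sigma>_def)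
    have "3 * (hnorm a * hnorm b) \<le> 3 * (hnorm a * (hnorm a / 12))" using ab by (intro mult_left_mono) auto
    then have "norm \<eta> \<le> norm \<sigma> / 2" using eta s by (simp add: power2_eq_square)
    then have "norm (kE k (\<sigma> + \<eta>) - kE k \<sigma>) \<le> C * norm \<eta> * inverse (norm \<sigma>) ^ (4 + k)"
      by (intro C(2)) (simp_all add: \<sigma>_def eps_wq_lower(2)[OF e])
    also have "\<dots> \<le> C * (3 * (hnorm a * hnorm b)) * inverse ((hnorm a)\<^sup>2 / 2) ^ (4 + k)"
      using C(1) eta s ab by (intro mult_mono power_mono le_imp_inverse_le) auto
    also have "\<dots> = C * 3 * 2 ^ (4 + k) * hnorm b * (hnorm a * inverse (hnorm a) ^ (2 * (4 + k)))"
    proof -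
      have eq: "inverse ((hnorm a)\<^sup>2 / 2) = 2 * (inverse (hnorm a))\<^sup>2" using ab by (simp add: field_simps)
      show ?thesis unfolding eq power_mult_distrib power_mult by (simp only: mult_ac)
    qed
    also have "hnorm a * inverse (hnorm a) ^ (2 * (4 + k)) = inverse (hnorm a) ^ (qdim TYPE('m) + 1)"
    proof -
      have eq: "2 * (4 + k) = Suc (qdim TYPE('m) + 1)" by (simp add: k_def qdim_def)
      have "x * inverse x ^ Suc n = inverse x ^ n" if "x > 0" for x :: real and n using that by simp
      from this[OF ab(2)] show ?thesis unfolding eq .
    qed
    also have "\<dots> = hnorm a powr (- real (qdim TYPE('m) + 1))"
      by (simp only: powr_minus powr_realpow[OF ab(2)] power_inverse)
    finally show "norm (ker \<epsilon> (hmult a b) - ker \<epsilon> a) \<le> C * 3 * 2 ^ (4 + k) * hnorm b * hnorm a powr (- real (qdim TYPE('m) + 1))"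
      by (simp add: ker_def wq_hmult \<sigma>_def \<eta>_def k_def add.assoc)
  qed (use C in auto)
qed

text \<open>The difference of two kernel values gains a factor of order \<open>R\<close> over the
  distance, which makes the integral over the complement of the large ball converge to a bound free
  of \<open>R\<close> and \<open>\<epsilon>\<close>. The 30 leaves a distance of at least
  \<open>29 * R\<close> from \<open>h\<close> to \<open>v\<close>, against at most
  \<open>2 * R\<close> from \<open>u\<close> to \<open>v\<close>; the ratio has to be at least the
  12 of \<open>ker_lipschitz\<close>.\<close>

lemma Top_oscillation:
  "\<exists>K>0. \<forall>\<epsilon>>0. \<forall>R>0. \<forall>x u v. \<forall>f :: 'm::finite heis \<Rightarrow> quat. bbs f \<longrightarrow> (\<forall>g. norm (f g) \<le> 1) \<longrightarrow>
     (\<forall>g. hdist x g < 30 * R \<longrightarrow> f g = 0) \<longrightarrow> hdist x u < R \<longrightarrow> hdist x v < R \<longrightarrow> norm (Top \<epsilon> f u - Top \<epsilon> f v) \<le> K"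
proof -
  define Q where "Q = real (qdim TYPE('m))"
  obtain C where C: "C > 0" "\<And>\<epsilon> (a :: 'm heis) b. \<epsilon> > 0 \<Longrightarrow> hnorm b \<le> hnorm a / 12 \<Longrightarrow> hnorm a > 0 \<Longrightarrow>
     norm (ker \<epsilon> (hmult a b) - ker \<epsilon> a) \<le> C * hnorm b * hnorm a powr (- real (qdim TYPE('m) + 1))"
    using ker_lipschitz[where 'm = 'm] by blast
  obtain L where L: "L > 0" "\<And>(x::'m heis) \<rho>. \<rho> > 0 \<Longrightarrow> (\<integral>\<^sup>+g. ennreal ((\<rho> + hdist x g) powr (-(Q + 1))) \<partial>lborel) \<le> ennreal (L * \<rho> powr (- 1))"
    using nn_integral_hnorm_decay[of 1, where 'm = 'm] unfolding Q_def by auto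
  define C' where "C' = C * 2 * 2 powr (Q + 1)"
  have C': "C' > 0" using C by (simp add: C'_def)
  show ?thesis
  proof (intro exI[of _ "C' * L"] conjI allI impI)
    fix \<epsilon> R :: real and x u v :: "'m heis" and f :: "'m heis \<Rightarrow> quat"
    assume e: "\<epsilon> > 0" and R: "R > 0" and f: "bbs f" and f1: "\<forall>g. norm (f g) \<le> 1" and supp: "\<forall>g. hdist x g < 30 * R \<longrightarrow> f g = 0"
      and u: "hdist x u < R" and v: "hdist x v < R"
    have pt: "norm ((ker \<epsilon> (hmult (hinv h) u) - ker \<epsilon> (hmult (hinv h) v)) * f h) \<le> C' * R * (R + hdist x h) powr (-(Q + 1))" for h
    proof (cases "hdist x h < 30 * R")
      case False
      define a where "a = hmult (hinv h) v"
      define b where "b = hmult (hinv v) u"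
      have ab: "hmult a b = hmult (hinv h) u" by (simp add: a_def b_def hmult_assoc)
      have na: "hnorm a = hdist v h" and nb: "hnorm b = hdist u v" by (simp_all add: a_def b_def hdist_def)
      have 1: "hdist x h \<le> hnorm a + R" using hdist_triangle[of x h v] v by (simp add: na)
      have 2: "hnorm b \<le> 2 * R" using hdist_triangle[of u v x] u v by (simp add: nb hdist_commute[of u x])
      have 3: "29 * R \<le> hnorm a" using 1 False by simp
      have "norm (ker \<epsilon> (hmult a b) - ker \<epsilon> a) \<le> C * hnorm b * hnorm a powr (- real (qdim TYPE('m) + 1))"
        using 2 3 R by (intro C(2) e) auto
      also have "\<dots> \<le> C * (2 * R) * ((R + hdist x h) / 2) powr (-(Q + 1))"
      proof (intro mult_mono)
        show "hnorm a powr (- real (qdim TYPE('m) + 1)) \<le> ((R + hdist x h) / 2) powr (-(Q + 1))"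
        proof -
          have "2 * R \<le> hnorm a" using 3 R by simp
          then have "(R + hdist x h) / 2 \<le> hnorm a" using 1 by simp
          moreover have "0 < (R + hdist x h) / 2" using R by (simp add: add_pos_nonneg)
          ultimately show ?thesis unfolding Q_def of_nat_add of_nat_1 by (intro powr_mono2') auto
        qed
      qed (use 2 R C(1) in auto)
      also have "\<dots> = C' * R * (R + hdist x h) powr (-(Q + 1))"
      proof -
        have "((R + hdist x h) / 2) powr (-(Q + 1)) = (R + hdist x h) powr (-(Q + 1)) / 2 powr (-(Q + 1))"
          using R by (intro powr_divide)
        also have "\<dots> = (R + hdist x h) powr (-(Q + 1)) * 2 powr (Q + 1)" by (simp add: powr_minus_divide[of 2 "Q + 1", simplified])
        finally show ?thesis by (simp add: C'_def)
      qed
      finally have "norm (ker \<epsilon> (hmult (hinv h) u) - ker \<epsilon> (hmult (hinv h) v)) \<le> C' * R * (R + hdist x h) powr (-(Q + 1))"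
        unfolding ab a_def[symmetric] .
      then have "norm (ker \<epsilon> (hmult (hinv h) u) - ker \<epsilon> (hmult (hinv h) v)) * norm (f h) \<le> (C' * R * (R + hdist x h) powr (-(Q + 1))) * 1"
        using f1[rule_format, of h] C' R by (intro mult_mono) auto
      then show ?thesis by (simp add: norm_mult)
    next
      case True
      then have "f h = 0" using supp by blast
      then show ?thesis using C' R by simp
    qed
    have i: "integrable lborel (\<lambda>h. (ker \<epsilon> (hmult (hinv h) u) - ker \<epsilon> (hmult (hinv h) v)) * f h)"
      unfolding left_diff_distrib by (intro Bochner_Integration.integrable_diff Top_integrable f e)
    have "Top \<epsilon> f u - Top \<epsilon> f v = (\<integral>h. (ker \<epsilon> (hmult (hinv h) u) - ker \<epsilon> (hmult (hinv h) v)) * f h \<partial>lborel)"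
      unfolding Top_def left_diff_distrib by (rule Bochner_Integration.integral_diff[symmetric]) (intro Top_integrable f e)+
    then have "ennreal (norm (Top \<epsilon> f u - Top \<epsilon> f v)) \<le> (\<integral>\<^sup>+h. norm ((ker \<epsilon> (hmult (hinv h) u) - ker \<epsilon> (hmult (hinv h) v)) * f h) \<partial>lborel)"
      using integral_norm_bound_ennreal[OF i] by simp
    also have "\<dots> \<le> (\<integral>\<^sup>+h. ennreal (C' * R) * ennreal ((R + hdist x h) powr (-(Q + 1))) \<partial>lborel)"
      using pt C' R by (intro nn_integral_mono) (auto simp: ennreal_mult[symmetric] intro!: ennreal_leI)
    also have "\<dots> = ennreal (C' * R) * (\<integral>\<^sup>+h. ennreal ((R + hdist x h) powr (-(Q + 1))) \<partial>lborel)"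
      by (intro nn_integral_cmult) measurable
    also have "\<dots> \<le> ennreal (C' * R) * ennreal (L * R powr (- 1))"
      by (intro mult_left_mono L R) auto
    also have "\<dots> = ennreal (C' * L)"
      using R C' L by (subst ennreal_mult[symmetric]) (auto simp: powr_minus)
    finally show "norm (Top \<epsilon> f u - Top \<epsilon> f v) \<le> C' * L"
      using C' L by (subst (asm) ennreal_le_iff) auto
  qed (use C' L in auto)
qed

text \<open>An atom divided by its height. The bounds are imposed everywhere and not only almost
  everywhere, so that no null sets have to be carried along.\<close>

definition unitf :: "'m::finite heis \<Rightarrow> real \<Rightarrow> ('m heis \<Rightarrow> quat) \<Rightarrow> bool" where
  "unitf x r f \<longleftrightarrow> f \<in> borel_measurable borel \<and> (\<forall>g. norm (f g) \<le> 1) \<and> (\<forall>g. f g \<noteq> 0 \<longrightarrow> g \<in> hball x r)"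

lemma unitf_bbs: "unitf x r f \<Longrightarrow> bbs f"
proof -
  assume f: "unitf x r f"
  have "hnorm g \<le> hnorm x + r" if "f g \<noteq> 0" for g
  proof -
    have "hdist x g < r" using f that unfolding unitf_def hball_eq by blast
    then show ?thesis using hdist_triangle[of g 0 x] by (simp add: hdist_commute[of g x])
  qed
  with f show "bbs f" unfolding bbs_def unitf_def by blast
qed

text \<open>Makes strict level sets open, for the choice of radii, and the closed ones compact
  inside a ball, for the extraction of a finite covering.\<close>

lemma Top_continuous:
  fixes f :: "'m::finite heis \<Rightarrow> quat"
  assumes f: "bbs f" and e: "\<epsilon> > 0"
  shows "continuous_on UNIV (Top \<epsilon> f)"
  unfolding continuous_on_sequentially
proof (intro allI ballI impI)
  fix X :: "nat \<Rightarrow> 'm heis" and a assume X: "(\<forall>n. X n \<in> UNIV) \<and> X \<longlonglongrightarrow> a"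
  obtain C where C: "C > 0" "\<And>h::'m heis. norm (ker \<epsilon> h) \<le> C" using ker_const_bound[OF e] by metis
  have "(\<lambda>n. \<integral>h. ker \<epsilon> (hmult (hinv h) (X n)) * f h \<partial>lborel) \<longlonglongrightarrow> (\<integral>h. ker \<epsilon> (hmult (hinv h) a) * f h \<partial>lborel)"
  proof (rule integral_dominated_convergence[where w = "\<lambda>h. C * norm (f h)"])
    show "integrable lborel (\<lambda>h. C * norm (f h))" using bbs_integrable(1)[OF f] by simp
    show "AE h in lborel. (\<lambda>n. ker \<epsilon> (hmult (hinv h) (X n)) * f h) \<longlonglongrightarrow> ker \<epsilon> (hmult (hinv h) a) * f h"
    proof (rule AE_I2)
      fix h
      have "continuous_on UNIV (\<lambda>g. ker \<epsilon> (hmult (hinv h) g) * f h)"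
        by (intro continuous_intros continuous_on_ker e)
      then show "(\<lambda>n. ker \<epsilon> (hmult (hinv h) (X n)) * f h) \<longlonglongrightarrow> ker \<epsilon> (hmult (hinv h) a) * f h"
        using X unfolding continuous_on_sequentially comp_def by blast
    qed
    show "AE h in lborel. norm (ker \<epsilon> (hmult (hinv h) (X n)) * f h) \<le> C * norm (f h)" for n
      unfolding norm_mult by (intro AE_I2 mult_right_mono C) auto
  qed (use Top_integrable[OF f e] in auto)
  then show "(Top \<epsilon> f \<circ> X) \<longlonglongrightarrow> Top \<epsilon> f a" by (simp add: Top_def comp_def)
qed

lemma compact_hdist_ball: "compact {g :: 'm::finite heis. hdist x g \<le> r}"
  unfolding compact_eq_bounded_closed
proof
  show "closed {g. hdist x g \<le> r}"
    by (intro closed_Collect_le continuous_intros)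
  show "bounded {g. hdist x g \<le> r}"
    unfolding bounded_iff
  proof (intro exI ballI)
    fix g assume "g \<in> {g. hdist x g \<le> r}"
    then have "hnorm g \<le> r + hnorm x" using hdist_triangle[of g 0 x] by (simp add: hdist_commute[of g x])
    moreover have "norm g \<le> norm (fst g) + norm (snd g)" by (metis norm_Pair_le prod.collapse)
    moreover have "norm (fst g) \<le> (hnorm g)\<^sup>2" "norm (snd g) \<le> hnorm g" by (rule norm_fst_le_hnorm norm_snd_le_hnorm)+
    moreover have "(hnorm g)\<^sup>2 \<le> (r + hnorm x)\<^sup>2" using calculation(1) by (intro power_mono) auto
    ultimately show "norm g \<le> (r + hnorm x)\<^sup>2 + (r + hnorm x)" by linarith
  qed
qed

section \<open>Coverings by balls of the group\<close>

lemma open_contains_hball: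
  fixes V :: "'m::finite heis set"
  assumes "open V" "x \<in> V"
  shows "\<exists>s>0. hball x s \<subseteq> V"
proof -
  have "open ((\<lambda>h. hmult x h) -` V)"
    by (rule open_vimage[OF assms(1)]) (intro continuous_intros)
  moreover have "0 \<in> (\<lambda>h. hmult x h) -` V" using assms by simp
  ultimately obtain e where e: "e > 0" "ball 0 e \<subseteq> (\<lambda>h. hmult x h) -` V" using open_contains_ball by blast
  define s where "s = min 1 (e / 2)"
  have "hball x s \<subseteq> V"
  proof
    fix g assume "g \<in> hball x s"
    then have "hdist g x < s" by (simp add: hball_eq hdist_commute)
    then have n: "hnorm (hmult (hinv x) g) < s" by (simp add: hdist_def)
    define h where "h = hmult (hinv x) g"
    have "norm h \<le> norm (fst h) + norm (snd h)" by (metis norm_Pair_le prod.collapse)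
    also have "\<dots> \<le> (hnorm h)\<^sup>2 + hnorm h" by (intro add_mono norm_fst_le_hnorm norm_snd_le_hnorm)
    also have "(hnorm h)\<^sup>2 \<le> hnorm h"
      using n mult_right_mono[of "hnorm h" 1 "hnorm h"] by (simp add: power2_eq_square h_def s_def)
    finally have "norm h < e" using n by (simp add: h_def s_def)
    then have "hmult x h \<in> V" using e(2) by auto
    then show "g \<in> V" by (simp add: h_def)
  qed
  moreover have "s > 0" using e(1) by (simp add: s_def)
  ultimately show ?thesis by blast
qed

lemma open_hball: "open (hball x r)" for x :: "'m::finite heis"
  unfolding hball_eq by (intro open_Collect_less continuous_intros)

text \<open>Greedy choice: keep a ball of largest radius and discard all balls that meet it; these
  lie in its triple by the triangle inequality.\<close>

lemma finite_Vitali: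
  fixes \<rho> :: "'m::finite heis \<Rightarrow> real"
  assumes "finite I"
  shows "\<exists>J\<subseteq>I. disjoint_family_on (\<lambda>x. hball x (\<rho> x)) J \<and> (\<forall>x\<in>I. \<exists>y\<in>J. hball x (\<rho> x) \<subseteq> hball y (3 * \<rho> y))"
  using assms
proof (induction "card I" arbitrary: I rule: less_induct)
  case less
  show ?case
  proof (cases "I = {}")
    case False
    obtain y where y: "y \<in> I" "\<And>x. x \<in> I \<Longrightarrow> \<rho> x \<le> \<rho> y"
    proof -
      have "Max (\<rho> ` I) \<in> \<rho> ` I" using less.prems False by (intro Max_in) auto
      then obtain y where "y \<in> I" "\<rho> y = Max (\<rho> ` I)" by auto
      then show ?thesis using less.prems by (intro that[of y]) auto
    qed
    define I' where "I' = {x \<in> I. x \<noteq> y \<and> hball x (\<rho> x) \<inter> hball y (\<rho> y) = {}}"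
    have "I' \<subset> I" using y by (auto simp: I'_def)
    then have "card I' < card I" "finite I'" using less.prems by (auto intro: psubset_card_mono finite_subset)
    from less.hyps[OF this] obtain J where J: "J \<subseteq> I'" "disjoint_family_on (\<lambda>x. hball x (\<rho> x)) J"
      "\<And>x. x \<in> I' \<Longrightarrow> \<exists>z\<in>J. hball x (\<rho> x) \<subseteq> hball z (3 * \<rho> z)" by blast
    show ?thesis
    proof (intro exI[of _ "insert y J"] conjI ballI)
      show "insert y J \<subseteq> I" using y J(1) by (auto simp: I'_def)
      show "disjoint_family_on (\<lambda>x. hball x (\<rho> x)) (insert y J)"
        using J(1,2) by (auto simp: disjoint_family_on_def I'_def)
      fix x assume x: "x \<in> I"
      show "\<exists>z\<in>insert y J. hball x (\<rho> x) \<subseteq> hball z (3 * \<rho> z)"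
      proof (cases "x \<in> I'")
        case True
        then show ?thesis using J(3) by blast
      next
        case nI: False
        have "hball x (\<rho> x) \<subseteq> hball y (3 * \<rho> y)"
        proof (cases "hball x (\<rho> x) = {}")
          case False
          then have "hball x (\<rho> x) \<inter> hball y (\<rho> y) \<noteq> {}" using nI x unfolding I'_def by auto
          then obtain w where "w \<in> hball x (\<rho> x)" "w \<in> hball y (\<rho> y)" by blast
          then have w: "hdist x w < \<rho> x" "hdist y w < \<rho> y" by (simp_all add: hball_eq)
          show ?thesis
          proof
            fix g assume "g \<in> hball x (\<rho> x)"
            then have "hdist x g < \<rho> x" by (simp add: hball_eq)
            then have "hdist y g < 3 * \<rho> y"
              using hdist_triangle[of y g w] hdist_triangle[of w g x] w y(2)[OF x] hdist_commute[of w x] by linarith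
            then show "g \<in> hball y (3 * \<rho> y)" by (simp add: hball_eq)
          qed
        qed simp
        then show ?thesis by blast
      qed
    qed
  qed (auto simp: disjoint_family_on_def)
qed

lemma unitf_norm_le_indicator:
  assumes "unitf x r f"
  shows "norm (f g) \<le> indicator (hball x r) g"
proof -
  have "norm (f g) \<le> 1" "f g \<noteq> 0 \<Longrightarrow> g \<in> hball x r" using assms unfolding unitf_def by blast+
  then show ?thesis by (cases "f g = 0") simp_all
qed

lemma hball_indicator_integral:
  assumes "r > 0"
  shows "integrable lborel (indicator (hball x r) :: 'm::finite heis \<Rightarrow> real)"
    and "(\<integral>g. indicator (hball x r) g \<partial>lborel) \<le> vball TYPE('m) * r ^ qdim TYPE('m)"
  using hball_measure(1,2)[OF assms, of x] by (auto simp: fmeasurable_def integrable_indicator_iff)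

lemma hball_nn_integral:
  fixes x :: "'m::finite heis"
  assumes "r > 0"
  shows "(\<integral>\<^sup>+g. ennreal (indicator (hball x r) g) \<partial>lborel) \<le> ennreal (vball TYPE('m) * r ^ qdim TYPE('m))"
  using hball_indicator_integral[OF assms, of x] by (subst nn_integral_eq_integral) (auto intro: ennreal_leI)

text \<open>Chebyshev's inequality applied to the uniform L2 bound.\<close>

lemma Top_level_set:
  fixes f :: "'m::finite heis \<Rightarrow> quat"
  assumes f: "unitf x r f" and r: "r > 0" and e: "\<epsilon> > 0" and t: "t > 0"
  shows "{g. t < norm (Top \<epsilon> f g)} \<in> fmeasurable lborel"
    and "measure lborel {g. t < norm (Top \<epsilon> f g)} \<le> (conv_const TYPE('m))\<^sup>2 * (vball TYPE('m) * r ^ qdim TYPE('m)) / t\<^sup>2"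
proof -
  define V where "V = {g. t < norm (Top \<epsilon> f g)}"
  note b = unitf_bbs[OF f]
  have [measurable]: "Top \<epsilon> f \<in> borel_measurable borel" by (rule Top_measurable[OF b e])
  have [measurable]: "V \<in> sets borel" unfolding V_def by measurable
  have le: "indicator V g \<le> (norm (Top \<epsilon> f g))\<^sup>2 / t\<^sup>2" for g
    using t by (auto simp: V_def indicator_def power_mono)
  have i: "integrable lborel (\<lambda>g. (norm (Top \<epsilon> f g))\<^sup>2 / t\<^sup>2)"
    using Top_square_integrable(1)[OF b e] by simp
  have iV: "integrable lborel (indicator V :: _ \<Rightarrow> real)"
    by (rule Bochner_Integration.integrable_bound[OF i]) (use le in \<open>auto intro!: AE_I2\<close>)
  then show "{g. t < norm (Top \<epsilon> f g)} \<in> fmeasurable lborel"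
    by (auto simp: fmeasurable_def integrable_indicator_iff V_def)
  have sq: "(\<integral>h. (norm (f h))\<^sup>2 \<partial>lborel) \<le> vball TYPE('m) * r ^ qdim TYPE('m)"
  proof -
    have "(norm (f h))\<^sup>2 \<le> indicator (hball x r) h" for h
      using unitf_norm_le_indicator[OF f, of h] power_mono[of "norm (f h)" 1 2] by (auto simp: indicator_def split: if_splits)
    then have "(\<integral>h. (norm (f h))\<^sup>2 \<partial>lborel) \<le> (\<integral>h. indicator (hball x r) h \<partial>lborel)"
      by (intro integral_mono bbs_integrable(2)[OF b] hball_indicator_integral(1)[OF r])
    with hball_indicator_integral(2)[OF r, of x] show ?thesis by simp
  qed
  have "measure lborel V = (\<integral>g. indicator V g \<partial>lborel)" by simp
  also have "\<dots> \<le> (\<integral>g. (norm (Top \<epsilon> f g))\<^sup>2 / t\<^sup>2 \<partial>lborel)"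
    by (rule integral_mono[OF iV i le])
  also have "\<dots> \<le> (conv_const TYPE('m))\<^sup>2 * (\<integral>h. (norm (f h))\<^sup>2 \<partial>lborel) / t\<^sup>2"
    using Top_L2_bound[OF b e] by (simp add: divide_right_mono)
  also have "\<dots> \<le> (conv_const TYPE('m))\<^sup>2 * (vball TYPE('m) * r ^ qdim TYPE('m)) / t\<^sup>2"
    by (intro divide_right_mono mult_left_mono sq) auto
  finally show "measure lborel {g. t < norm (Top \<epsilon> f g)} \<le> (conv_const TYPE('m))\<^sup>2 * (vball TYPE('m) * r ^ qdim TYPE('m)) / t\<^sup>2"
    by (simp add: V_def)
qed

section \<open>Self-improvement of the local bounds\<close>

lemma powr_add_le: "(a + b) powr p \<le> 2 powr p * (a powr p + b powr p)" if "a \<ge> 0" "b \<ge> 0" "p > 0" for a b p :: real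
proof -
  have "(a + b) powr p \<le> (2 * max a b) powr p" using that by (intro powr_mono2) auto
  also have "\<dots> = 2 powr p * (max a b) powr p" using that by (intro powr_mult)
  also have "(max a b) powr p \<le> a powr p + b powr p" by (auto simp: max_def)
  finally show ?thesis by simp
qed

text \<open>Among the radii \<open>r / 2 ^ k\<close>, some give a ball half filled by
  \<open>V\<close> because \<open>V\<close> is open, and only small ones do because \<open>V\<close>
  has small measure. The largest of them works, since its double is again in the list and
  fails.\<close>

lemma dense_ball:
  fixes V :: "'m::finite heis set"
  assumes r: "r > 0" and y: "y \<in> V" and V: "open V" "V \<in> fmeasurable lborel"
    and small: "2 * 180 ^ qdim TYPE('m) * measure lborel V < vball TYPE('m) * r ^ qdim TYPE('m)"
  shows "\<exists>\<rho>>0. 90 * \<rho> \<le> r \<and> measure lborel (hball y \<rho>) \<le> 2 * measure lborel (hball y \<rho> \<inter> V)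
    \<and> 2 * measure lborel (hball y (2 * \<rho>) \<inter> V) < measure lborel (hball y (2 * \<rho>))"
proof -
  define Q where "Q = qdim TYPE('m)"
  define S where "S k \<longleftrightarrow> measure lborel (hball y (r / 2 ^ k)) \<le> 2 * measure lborel (hball y (r / 2 ^ k) \<inter> V)" for k :: nat
  have Q: "Q > 0" by (simp add: Q_def qdim_def)
  \<comment> \<open>A half-filled ball has volume at most twice that of \<open>V\<close>, while its
    volume is at least \<open>vball * (\<rho> / 2) ^ Q\<close>; the 180 of the smallness condition
    is 90 times this 2.\<close>
  have sm: "90 * (r / 2 ^ k) < r" if "S k" for k
  proof -
    define \<rho> where "\<rho> = r / 2 ^ k"
    have \<rho>: "\<rho> > 0" using r by (simp add: \<rho>_def)
    have "vball TYPE('m) / 2 ^ Q * \<rho> ^ Q \<le> 2 * measure lborel (hball y \<rho> \<inter> V)"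
      using hball_measure(3)[OF \<rho>, of y] that by (simp add: S_def Q_def \<rho>_def)
    also have "measure lborel (hball y \<rho> \<inter> V) \<le> measure lborel V"
      using V(2) by (intro measure_mono_fmeasurable) auto
    finally have "2 ^ Q * (vball TYPE('m) / 2 ^ Q * \<rho> ^ Q) \<le> 2 ^ Q * (2 * measure lborel V)"
      by (intro mult_left_mono) auto
    then have "vball TYPE('m) * \<rho> ^ Q \<le> 2 * 2 ^ Q * measure lborel V" by simp
    then have "90 ^ Q * (vball TYPE('m) * \<rho> ^ Q) \<le> 90 ^ Q * (2 * 2 ^ Q * measure lborel V)"
      by (rule mult_left_mono) simp
    also have "\<dots> = 2 * 180 ^ Q * measure lborel V"
      using power_mult_distrib[of "90::real" 2 Q] by simp
    also have "\<dots> < vball TYPE('m) * r ^ Q" using small by (simp add: Q_def)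
    also have "90 ^ Q * (vball TYPE('m) * \<rho> ^ Q) = vball TYPE('m) * (90 * \<rho>) ^ Q"
      unfolding power_mult_distrib by simp
    finally have "(90 * \<rho>) ^ Q < r ^ Q" by (simp only: mult_less_cancel_left_pos[OF vball_pos])
    then show ?thesis unfolding \<rho>_def[symmetric] by (rule power_less_imp_less_base) (use r in simp)
  qed
  have "\<exists>k. S k"
  proof -
    obtain s where s: "s > 0" "hball y s \<subseteq> V" using open_contains_hball[OF V(1) y] by blast
    obtain k where "r / s < 2 ^ k" using real_arch_pow[of 2 "r / s"] by auto
    then have "r / 2 ^ k \<le> s" using s r by (simp add: field_simps)
    then have "hball y (r / 2 ^ k) \<subseteq> hball y s" unfolding hball_eq by auto
    then have "hball y (r / 2 ^ k) \<inter> V = hball y (r / 2 ^ k)" using s(2) by blast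
    then have "S k" unfolding S_def by simp
    then show ?thesis ..
  qed
  define k where "k = (LEAST k. S k)"
  have k: "S k" unfolding k_def using \<open>\<exists>k. S k\<close> by (rule LeastI_ex)
  have "\<not> S 0" using sm[of 0] r by auto
  then obtain j where j: "k = Suc j" using k by (cases k) auto
  have nS: "\<not> S j" using not_less_Least[of j S] j unfolding k_def by simp
  have eq: "2 * (r / 2 ^ k) = r / 2 ^ j" by (simp add: j)
  show ?thesis
  proof (intro exI[of _ "r / 2 ^ k"] conjI)
    show "measure lborel (hball y (r / 2 ^ k)) \<le> 2 * measure lborel (hball y (r / 2 ^ k) \<inter> V)"
      using k unfolding S_def .
    show "2 * measure lborel (hball y (2 * (r / 2 ^ k)) \<inter> V) < measure lborel (hball y (2 * (r / 2 ^ k)))"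
      using nS unfolding S_def eq by simp
  qed (use sm[OF k] r in auto)
qed

lemma Top_split:
  assumes "bbs f1" "bbs f2" "\<epsilon> > 0" "\<And>h. f h = f1 h + f2 h"
  shows "Top \<epsilon> f g = Top \<epsilon> f1 g + Top \<epsilon> f2 g"
  unfolding Top_def assms(4) distrib_left
  by (rule Bochner_Integration.integral_add) (intro Top_integrable assms)+

text \<open>The condition \<open>\<eta> * r^2 \<le> \<epsilon>\<close> passes to smaller balls at
  the same height, so the bound may be applied to them. For positive \<open>\<eta>\<close> it bounds
  the kernel at the scale of the ball, which yields a first finite \<open>M\<close>.\<close>

definition local_bound :: "real \<Rightarrow> real \<Rightarrow> real \<Rightarrow> 'm::finite itself \<Rightarrow> bool" where
  "local_bound p \<eta> M m \<longleftrightarrow> (\<forall>\<epsilon>>0. \<forall>r>0. \<forall>x. \<forall>f :: 'm heis \<Rightarrow> quat. \<eta> * r\<^sup>2 \<le> \<epsilon> \<longrightarrow> unitf x r f \<longrightarrow>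
     (\<integral>\<^sup>+g. ennreal (indicator (hball x r) g * norm (Top \<epsilon> f g) powr p) \<partial>lborel) \<le> ennreal (M * r ^ qdim TYPE('m)))"

text \<open>\<open>f\<close> is cut at radius \<open>90 * \<rho>\<close>. The image of the outer
  part oscillates by at most \<open>K\<close> on the ball of radius \<open>3 * \<rho>\<close>,
  whence 90 = 30 * 3, and it is at most \<open>2 * t\<close> at a point where the images of
  \<open>f\<close> and of the inner part are both at most \<open>t\<close>. The inner part is left
  to the assumed bound.\<close>

lemma local_bound_dense_ball:
  fixes f :: "'m::finite heis \<Rightarrow> quat"
  assumes p: "p > 0" and \<eta>: "\<eta> \<ge> 0" and M: "M \<ge> 0" "local_bound p \<eta> M TYPE('m)"
    and f: "unitf x r f" and e: "\<epsilon> > 0" "\<eta> * r\<^sup>2 \<le> \<epsilon>" and t: "t > 0"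
    and big: "2 * 90 ^ qdim TYPE('m) * (conv_const TYPE('m))\<^sup>2 \<le> t\<^sup>2"
    and K: "K > 0" "\<And>\<epsilon> R x u v (f :: 'm heis \<Rightarrow> quat). \<epsilon> > 0 \<Longrightarrow> R > 0 \<Longrightarrow> bbs f \<Longrightarrow> (\<forall>g. norm (f g) \<le> 1) \<Longrightarrow>
     (\<forall>g. hdist x g < 30 * R \<longrightarrow> f g = 0) \<Longrightarrow> hdist x u < R \<Longrightarrow> hdist x v < R \<Longrightarrow> norm (Top \<epsilon> f u - Top \<epsilon> f v) \<le> K"
    and \<rho>: "\<rho> > 0" "90 * \<rho> \<le> r"
      "2 * measure lborel (hball y (2 * \<rho>) \<inter> {g. t < norm (Top \<epsilon> f g)}) < measure lborel (hball y (2 * \<rho>))"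
  shows "(\<integral>\<^sup>+g. ennreal (indicator (hball y (3 * \<rho>)) g * norm (Top \<epsilon> f g) powr p) \<partial>lborel)
    \<le> ennreal (2 powr p * (M * 90 ^ qdim TYPE('m) + (2 * t + K) powr p * (vball TYPE('m) * 3 ^ qdim TYPE('m))) * \<rho> ^ qdim TYPE('m))"
proof -
  define Q where "Q = qdim TYPE('m)"
  define v where "v = vball TYPE('m)"
  define D where "D = (conv_const TYPE('m))\<^sup>2"
  have v: "v > 0" by (simp add: v_def vball_pos)
  define f1 where "f1 g = indicator (hball y (90 * \<rho>)) g *\<^sub>R f g" for g
  define f2 where "f2 g = indicator (- hball y (90 * \<rho>)) g *\<^sub>R f g" for g
  have [measurable]: "f \<in> borel_measurable borel" using f by (simp add: unitf_def)
  have fn: "norm (f g) \<le> 1" for g using f unfolding unitf_def by blast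
  have u1: "unitf y (90 * \<rho>) f1"
    unfolding unitf_def f1_def[abs_def] using fn by (auto simp: indicator_def)
  have u2: "unitf x r f2"
    unfolding unitf_def
  proof (intro conjI allI impI)
    show "f2 \<in> borel_measurable borel" unfolding f2_def[abs_def] by measurable
    show "norm (f2 g) \<le> 1" for g using fn[of g] by (simp add: f2_def indicator_def)
    show "g \<in> hball x r" if "f2 g \<noteq> 0" for g
    proof -
      have "f g \<noteq> 0" using that by (auto simp: f2_def)
      then show ?thesis using f unfolding unitf_def by blast
    qed
  qed
  note b1 = unitf_bbs[OF u1] and b2 = unitf_bbs[OF u2]
  have spl: "Top \<epsilon> f g = Top \<epsilon> f1 g + Top \<epsilon> f2 g" for g
    by (rule Top_split[OF b1 b2 e(1)]) (auto simp: f1_def f2_def indicator_def)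
  have \<rho>90: "90 * \<rho> > 0" using \<rho> by simp
  define W where "W = {g. t < norm (Top \<epsilon> f1 g)}"
  define V where "V = {g. t < norm (Top \<epsilon> f g)}"
  note W = Top_level_set[OF u1 \<rho>90 e(1) t, folded W_def Q_def D_def v_def]
  \<comment> \<open>The level set of the whole image fills less than half of the doubled ball, and
    by \<open>big\<close> that of the inner part has at most half its measure, so they do not cover
    it.\<close>
  have "\<exists>v0. hdist y v0 < 2 * \<rho> \<and> norm (Top \<epsilon> f v0) \<le> t \<and> norm (Top \<epsilon> f1 v0) \<le> t"
  proof (rule ccontr)
    assume "\<not> ?thesis"
    then have sub: "hball y (2 * \<rho>) \<subseteq> (hball y (2 * \<rho>) \<inter> V) \<union> W"
      by (auto simp: hball_eq V_def W_def not_le)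
    have [measurable]: "Top \<epsilon> f \<in> borel_measurable borel" by (rule Top_measurable[OF unitf_bbs[OF f] e(1)])
    have Vm: "V \<in> sets lborel" unfolding V_def by measurable
    have fm: "hball y (2 * \<rho>) \<inter> V \<in> fmeasurable lborel"
      using hball_measure(1)[of "2 * \<rho>" y] \<rho>(1) Vm by (intro fmeasurable_Int_fmeasurable) auto
    have "measure lborel (hball y (2 * \<rho>)) \<le> measure lborel ((hball y (2 * \<rho>) \<inter> V) \<union> W)"
      using sub fm W(1) by (intro measure_mono_fmeasurable) auto
    also have "\<dots> \<le> measure lborel (hball y (2 * \<rho>) \<inter> V) + measure lborel W"
      using fm W(1) by (intro measure_Un_le) auto
    finally have 1: "measure lborel (hball y (2 * \<rho>)) < 2 * measure lborel W"
      using \<rho>(3) by (simp add: V_def)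
    have "2 * (D * (v * (90 * \<rho>) ^ Q)) = (2 * 90 ^ Q * D) * (v * \<rho> ^ Q)" by (simp add: power_mult_distrib mult_ac)
    also have "\<dots> \<le> t\<^sup>2 * (v * \<rho> ^ Q)"
      using big v \<rho>(1) by (intro mult_right_mono) (auto simp: Q_def D_def)
    finally have "2 * (D * (v * (90 * \<rho>) ^ Q) / t\<^sup>2) \<le> v * \<rho> ^ Q" using t by (simp add: field_simps)
    then have "2 * measure lborel W \<le> v * \<rho> ^ Q" using W(2) by linarith
    also have "v * \<rho> ^ Q \<le> measure lborel (hball y (2 * \<rho>))"
      using hball_measure(3)[of "2 * \<rho>" y] \<rho>(1) by (simp add: v_def Q_def power_mult_distrib)
    finally show False using 1 by simp
  qed
  then obtain v0 where v0: "hdist y v0 < 2 * \<rho>" "norm (Top \<epsilon> f v0) \<le> t" "norm (Top \<epsilon> f1 v0) \<le> t" by blast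
  have F2: "norm (Top \<epsilon> f2 g) \<le> 2 * t + K" if "hdist y g < 3 * \<rho>" for g
  proof -
    have "norm (Top \<epsilon> f2 g - Top \<epsilon> f2 v0) \<le> K"
    proof (rule K(2)[of \<epsilon> "3 * \<rho>" f2 y])
      show "\<forall>g. norm (f2 g) \<le> 1" using u2 unfolding unitf_def by blast
      show "\<forall>g. hdist y g < 30 * (3 * \<rho>) \<longrightarrow> f2 g = 0" by (auto simp: f2_def hball_eq indicator_def)
    qed (use that v0 \<rho> e b2 in auto)
    moreover have "norm (Top \<epsilon> f2 v0) \<le> t + t"
      using norm_triangle_ineq4[of "Top \<epsilon> f v0" "Top \<epsilon> f1 v0"] v0(2,3) by (simp add: spl)
    ultimately show ?thesis using norm_triangle_ineq2[of "Top \<epsilon> f2 g" "Top \<epsilon> f2 v0"] by linarith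
  qed
  define c where "c = (2 * t + K) powr p"
  have pt: "indicator (hball y (3 * \<rho>)) g * norm (Top \<epsilon> f g) powr p
    \<le> 2 powr p * (indicator (hball y (90 * \<rho>)) g * norm (Top \<epsilon> f1 g) powr p) + 2 powr p * c * indicator (hball y (3 * \<rho>)) g" for g
  proof (cases "hdist y g < 3 * \<rho>")
    case True
    have "norm (Top \<epsilon> f g) \<le> norm (Top \<epsilon> f1 g) + (2 * t + K)"
      unfolding spl using F2[OF True] norm_triangle_ineq[of "Top \<epsilon> f1 g" "Top \<epsilon> f2 g"] by linarith
    then have "norm (Top \<epsilon> f g) powr p \<le> (norm (Top \<epsilon> f1 g) + (2 * t + K)) powr p" using p by (intro powr_mono2) auto
    also have "\<dots> \<le> 2 powr p * (norm (Top \<epsilon> f1 g) powr p + c)"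
      unfolding c_def using t K(1) p by (intro powr_add_le) auto
    finally show ?thesis using True \<rho>(1) by (simp add: hball_eq algebra_simps)
  qed (auto simp: hball_eq indicator_def)
  have [measurable]: "Top \<epsilon> f1 \<in> borel_measurable borel" by (rule Top_measurable[OF b1 e(1)])
  have "(\<integral>\<^sup>+g. ennreal (indicator (hball y (3 * \<rho>)) g * norm (Top \<epsilon> f g) powr p) \<partial>lborel)
    \<le> (\<integral>\<^sup>+g. ennreal (2 powr p) * ennreal (indicator (hball y (90 * \<rho>)) g * norm (Top \<epsilon> f1 g) powr p)
        + ennreal (2 powr p * c) * ennreal (indicator (hball y (3 * \<rho>)) g) \<partial>lborel)"
    using pt by (intro nn_integral_mono) (simp add: ennreal_mult[symmetric] ennreal_plus[symmetric] c_def ennreal_leI del: ennreal_plus)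
  also have "\<dots> = ennreal (2 powr p) * (\<integral>\<^sup>+g. ennreal (indicator (hball y (90 * \<rho>)) g * norm (Top \<epsilon> f1 g) powr p) \<partial>lborel)
        + ennreal (2 powr p * c) * (\<integral>\<^sup>+g. ennreal (indicator (hball y (3 * \<rho>)) g) \<partial>lborel)"
    by (subst nn_integral_add) (auto simp: nn_integral_cmult)
  also have "\<dots> \<le> ennreal (2 powr p) * ennreal (M * (90 * \<rho>) ^ Q) + ennreal (2 powr p * c) * ennreal (v * (3 * \<rho>) ^ Q)"
  proof (intro add_mono mult_left_mono)
    have "\<eta> * (90 * \<rho>)\<^sup>2 \<le> \<eta> * r\<^sup>2" using \<eta> \<rho> by (intro mult_left_mono power_mono) auto
    then have "\<eta> * (90 * \<rho>)\<^sup>2 \<le> \<epsilon>" using e(2) by linarith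
    from M(2)[unfolded local_bound_def, rule_format, OF e(1) \<rho>90 this u1]
    show "(\<integral>\<^sup>+g. ennreal (indicator (hball y (90 * \<rho>)) g * norm (Top \<epsilon> f1 g) powr p) \<partial>lborel) \<le> ennreal (M * (90 * \<rho>) ^ Q)"
      unfolding Q_def .
    show "(\<integral>\<^sup>+g. ennreal (indicator (hball y (3 * \<rho>)) g) \<partial>lborel) \<le> ennreal (v * (3 * \<rho>) ^ Q)"
      unfolding v_def Q_def using \<rho>(1) by (intro hball_nn_integral) auto
  qed auto
  also have "\<dots> = ennreal (2 powr p * (M * (90 * \<rho>) ^ Q) + 2 powr p * c * (v * (3 * \<rho>) ^ Q))"
    using M(1) v \<rho>(1) by (simp add: ennreal_mult[symmetric] ennreal_plus[symmetric] c_def del: ennreal_plus)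
  also have "2 powr p * (M * (90 * \<rho>) ^ Q) + 2 powr p * c * (v * (3 * \<rho>) ^ Q) = 2 powr p * (M * 90 ^ Q + c * (v * 3 ^ Q)) * \<rho> ^ Q"
    by (simp add: power_mult_distrib algebra_simps)
  finally show ?thesis by (simp add: c_def Q_def v_def)
qed

text \<open>
  Stopping time: every point where \<open>Top \<epsilon> f\<close> exceeds \<open>t\<close> is the centre of a ball which the level set
  fills by half, but whose double it does not. On such a ball the part of \<open>f\<close> far away oscillates little and is
  small somewhere, and the local part obeys the bound assumed. A Vitali subfamily of these balls
  covers little, which gives the factor \<open>1 / 2\<close>.
\<close>

lemma local_bound_step:
  assumes p: "p > 0"
  shows "\<exists>K0>0. \<forall>\<eta>\<ge>0. \<forall>M\<ge>0. local_bound p \<eta> M TYPE('m::finite) \<longrightarrow> local_bound p \<eta> (M / 2 + K0) TYPE('m)"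
proof -
  define Q where "Q = qdim TYPE('m)"
  define v where "v = vball TYPE('m)"
  define D where "D = (conv_const TYPE('m))\<^sup>2"
  have v: "v > 0" by (simp add: v_def vball_pos)
  have D: "D \<ge> 0" by (simp add: D_def)
  obtain K where K: "K > 0" "\<And>\<epsilon> R x u v (f :: 'm heis \<Rightarrow> quat). \<epsilon> > 0 \<Longrightarrow> R > 0 \<Longrightarrow> bbs f \<Longrightarrow> (\<forall>g. norm (f g) \<le> 1) \<Longrightarrow>
     (\<forall>g. hdist x g < 30 * R \<longrightarrow> f g = 0) \<Longrightarrow> hdist x u < R \<Longrightarrow> hdist x v < R \<Longrightarrow> norm (Top \<epsilon> f u - Top \<epsilon> f v) \<le> K"
    using Top_oscillation[where 'm = 'm] by metis
  \<comment> \<open>Chosen so that the Vitali balls, whose total volume is of order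
    \<open>1 / t^2\<close>, contribute at most \<open>M / 2\<close>. The \<open>D + 1\<close> makes
    \<open>t\<close> positive also when \<open>D = 0\<close>.\<close>
  define t where "t = sqrt (4 * 2 powr p * 180 ^ Q * (D + 1))"
  have t2: "t\<^sup>2 = 4 * 2 powr p * 180 ^ Q * (D + 1)" using D by (simp add: t_def)
  have t: "t > 0" using D by (simp add: t_def)
  have p1: "1 \<le> 2 powr p" using p by (simp add: ge_one_powr_ge_zero)
  have final: "4 * 2 powr p * 180 ^ Q * D \<le> t\<^sup>2" unfolding t2 by (intro mult_left_mono) auto
  have small: "4 * 180 ^ Q * D < t\<^sup>2"
  proof -
    have "D * 1 \<le> D * 2 powr p" using D p1 by (intro mult_left_mono) auto
    also have "\<dots> < 2 powr p * (D + 1)" by (simp add: algebra_simps)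
    finally have "(4 * 180 ^ Q) * D < (4 * 180 ^ Q) * (2 powr p * (D + 1))" by (intro mult_strict_left_mono) auto
    then show ?thesis by (simp only: t2 mult_ac)
  qed
  have big: "2 * 90 ^ Q * D \<le> t\<^sup>2"
  proof -
    have "2 * 90 ^ Q * D \<le> 4 * 180 ^ Q * D" using D by (intro mult_mono mult_right_mono power_mono) auto
    with small show ?thesis by (rule order_trans[OF _ less_imp_le, rotated])
  qed
  define c where "c = (2 * t + K) powr p"
  define K0 where "K0 = (2 * t) powr p * v + c * v + 1"
  have c: "c \<ge> 0" by (simp add: c_def)
  show ?thesis
  proof (intro exI[of _ K0] conjI allI impI)
    show "K0 > 0" using c v by (simp add: K0_def add_nonneg_pos)
    fix \<eta> M :: real assume \<eta>: "\<eta> \<ge> 0" and M: "M \<ge> 0" and lb: "local_bound p \<eta> M TYPE('m)"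
    show "local_bound p \<eta> (M / 2 + K0) TYPE('m)"
      unfolding local_bound_def
    proof (intro allI impI)
      fix \<epsilon> r :: real and x and f :: "'m heis \<Rightarrow> quat"
      assume e: "\<epsilon> > 0" and r: "r > 0" and er: "\<eta> * r\<^sup>2 \<le> \<epsilon>" and f: "unitf x r f"
      define V where "V = {g. t < norm (Top \<epsilon> f g)}"
      note b = unitf_bbs[OF f]
      note cont = Top_continuous[OF b e]
      have [measurable]: "Top \<epsilon> f \<in> borel_measurable borel" by (rule Top_measurable[OF b e])
      note Vm = Top_level_set[OF f r e t, folded V_def Q_def D_def v_def]
      have Vo: "open V" unfolding V_def by (intro open_Collect_less continuous_intros cont)
      have Vs: "2 * 180 ^ Q * measure lborel V < v * r ^ Q"
      proof -
        have "2 * 180 ^ Q * measure lborel V \<le> 2 * 180 ^ Q * (D * (v * r ^ Q) / t\<^sup>2)"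
          using Vm(2) by (intro mult_left_mono) auto
        also have "\<dots> = (2 * 180 ^ Q * D) / t\<^sup>2 * (v * r ^ Q)" by simp
        also have "\<dots> < 1 * (v * r ^ Q)"
        proof (rule mult_strict_right_mono)
          have "0 \<le> 2 * 180 ^ Q * D" using D by simp
          then have "2 * 180 ^ Q * D < t\<^sup>2" using small by linarith
          then show "(2 * 180 ^ Q * D) / t\<^sup>2 < 1" using t by simp
        qed (use v r in simp)
        finally show ?thesis by simp
      qed
      have "\<forall>y\<in>V. \<exists>\<rho>>0. 90 * \<rho> \<le> r \<and> measure lborel (hball y \<rho>) \<le> 2 * measure lborel (hball y \<rho> \<inter> V)
        \<and> 2 * measure lborel (hball y (2 * \<rho>) \<inter> V) < measure lborel (hball y (2 * \<rho>))"
        using dense_ball[OF r _ Vo Vm(1) Vs[unfolded Q_def v_def]] by blast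
      from bchoice[OF this] obtain \<rho> where "\<forall>y\<in>V. \<rho> y > 0 \<and> 90 * \<rho> y \<le> r
        \<and> measure lborel (hball y (\<rho> y)) \<le> 2 * measure lborel (hball y (\<rho> y) \<inter> V)
        \<and> 2 * measure lborel (hball y (2 * \<rho> y) \<inter> V) < measure lborel (hball y (2 * \<rho> y))" ..
      then have \<rho>: "\<And>y. y \<in> V \<Longrightarrow> \<rho> y > 0" "\<And>y. y \<in> V \<Longrightarrow> 90 * \<rho> y \<le> r"
        "\<And>y. y \<in> V \<Longrightarrow> measure lborel (hball y (\<rho> y)) \<le> 2 * measure lborel (hball y (\<rho> y) \<inter> V)"
        "\<And>y. y \<in> V \<Longrightarrow> 2 * measure lborel (hball y (2 * \<rho> y) \<inter> V) < measure lborel (hball y (2 * \<rho> y))"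
        by blast+
      \<comment> \<open>Two levels are played against each other: the points of the closed ball with
        value at least \<open>2 * t\<close> form a compact set inside the open level set
        \<open>V\<close>, so finitely many of the balls cover it. Points below \<open>2 * t\<close>
        contribute only to \<open>K0\<close>.\<close>
      define C where "C = {g. hdist x g \<le> r} \<inter> {g. 2 * t \<le> norm (Top \<epsilon> f g)}"
      have comp: "compact C" unfolding C_def
        by (intro compact_Int_closed compact_hdist_ball closed_Collect_le continuous_intros cont)
      have CV: "C \<subseteq> V" using t by (auto simp: C_def V_def)
      have "C \<subseteq> (\<Union>y\<in>C. hball y (\<rho> y))"
      proof
        fix y assume y: "y \<in> C"
        then have "y \<in> hball y (\<rho> y)" using \<rho>(1)[OF subsetD[OF CV y]] by (simp add: hball_eq)
        with y show "y \<in> (\<Union>y\<in>C. hball y (\<rho> y))" by blast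
      qed
      then obtain I where I: "I \<subseteq> C" "finite I" "C \<subseteq> (\<Union>y\<in>I. hball y (\<rho> y))"
        by (rule compactE_image[OF comp open_hball])
      obtain J where J: "J \<subseteq> I" "disjoint_family_on (\<lambda>y. hball y (\<rho> y)) J"
        "\<And>y. y \<in> I \<Longrightarrow> \<exists>z\<in>J. hball y (\<rho> y) \<subseteq> hball z (3 * \<rho> z)"
        using finite_Vitali[OF I(2), of \<rho>] by (elim exE conjE) (rule that, auto)
      have JV: "y \<in> V" if "y \<in> J" for y using that J(1) I(1) CV by blast
      have Jf: "finite J" using J(1) I(2) finite_subset by blast
      define k where "k = 2 powr p * (M * 90 ^ Q + c * (v * 3 ^ Q))"
      have k: "k \<ge> 0" using M c v by (simp add: k_def)
      have pt: "indicator (hball x r) g * norm (Top \<epsilon> f g) powr p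
        \<le> (2 * t) powr p * indicator (hball x r) g + (\<Sum>y\<in>J. indicator (hball y (3 * \<rho> y)) g * norm (Top \<epsilon> f g) powr p)" for g
      proof (cases "g \<in> hball x r")
        case True
        have s: "0 \<le> (\<Sum>y\<in>J. indicator (hball y (3 * \<rho> y)) g * norm (Top \<epsilon> f g) powr p)" by (intro sum_nonneg) auto
        show ?thesis
        proof (cases "2 * t \<le> norm (Top \<epsilon> f g)")
          case False
          then have "norm (Top \<epsilon> f g) powr p \<le> (2 * t) powr p" using p by (intro powr_mono2) auto
          then show ?thesis using True s by simp
        next
          case big: True
          then have "g \<in> C" using True by (simp add: C_def hball_eq)
          then obtain z where z: "z \<in> J" "g \<in> hball z (3 * \<rho> z)" using I(3) J(3) by blast
          have "norm (Top \<epsilon> f g) powr p = indicator (hball z (3 * \<rho> z)) g * norm (Top \<epsilon> f g) powr p" using z by simp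
          also have "\<dots> \<le> (\<Sum>y\<in>J. indicator (hball y (3 * \<rho> y)) g * norm (Top \<epsilon> f g) powr p)"
            using z Jf by (intro member_le_sum) auto
          also have "\<dots> \<le> (2 * t) powr p * indicator (hball x r) g + \<dots>" by simp
          finally show ?thesis using True by simp
        qed
      next
        case False
        then show ?thesis by (simp add: sum_nonneg)
      qed
      \<comment> \<open>The balls are disjoint and each is at least half filled by \<open>V\<close>,
        so their total volume is at most twice that of \<open>V\<close>.\<close>
      have sumV: "(\<Sum>y\<in>J. \<rho> y ^ Q) \<le> 2 * 2 ^ Q * D * r ^ Q / t\<^sup>2"
      proof -
        have "(\<Sum>y\<in>J. measure lborel (hball y (\<rho> y) \<inter> V)) = measure lborel (\<Union>y\<in>J. hball y (\<rho> y) \<inter> V)"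
        proof (rule measure_finite_Union[symmetric])
          show "disjoint_family_on (\<lambda>y. hball y (\<rho> y) \<inter> V) J" using J(2) unfolding disjoint_family_on_def by blast
          show "(\<lambda>y. hball y (\<rho> y) \<inter> V) ` J \<subseteq> sets lborel" using Vo by auto
          show "emeasure lborel (hball y (\<rho> y) \<inter> V) \<noteq> \<infinity>" if "y \<in> J" for y
          proof -
            have "hball y (\<rho> y) \<inter> V \<in> fmeasurable lborel" using fmeasurable_Int_fmeasurable[OF Vm(1), of "hball y (\<rho> y)"] by (simp add: Int_commute)
            then show ?thesis by (auto simp: fmeasurable_def)
          qed
        qed (use Jf in auto)
        also have "\<dots> \<le> measure lborel V"
          using Vm(1) Vo Jf by (intro measure_mono_fmeasurable) auto
        finally have 1: "(\<Sum>y\<in>J. measure lborel (hball y (\<rho> y) \<inter> V)) \<le> D * (v * r ^ Q) / t\<^sup>2" using Vm(2) by simp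
        have "v * (\<Sum>y\<in>J. \<rho> y ^ Q) = 2 ^ Q * (\<Sum>y\<in>J. v / 2 ^ Q * \<rho> y ^ Q)" by (simp add: sum_distrib_left)
        also have "\<dots> \<le> 2 ^ Q * (\<Sum>y\<in>J. 2 * measure lborel (hball y (\<rho> y) \<inter> V))"
        proof (intro mult_left_mono sum_mono)
          fix y assume "y \<in> J"
          then have y: "y \<in> V" by (rule JV)
          show "v / 2 ^ Q * \<rho> y ^ Q \<le> 2 * measure lborel (hball y (\<rho> y) \<inter> V)"
            using hball_measure(3)[OF \<rho>(1)[OF y], of y] \<rho>(3)[OF y] unfolding v_def Q_def by (rule order_trans)
        qed simp
        also have "\<dots> \<le> 2 ^ Q * (2 * (D * (v * r ^ Q) / t\<^sup>2))"
          unfolding sum_distrib_left[symmetric] using 1 by (intro mult_left_mono) auto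
        finally have "v * (\<Sum>y\<in>J. \<rho> y ^ Q) \<le> v * (2 * 2 ^ Q * D * r ^ Q / t\<^sup>2)" by (simp add: mult_ac)
        then show ?thesis by (simp only: mult_le_cancel_left_pos[OF v])
      qed
      have each: "(\<integral>\<^sup>+g. ennreal (indicator (hball y (3 * \<rho> y)) g * norm (Top \<epsilon> f g) powr p) \<partial>lborel) \<le> ennreal (k * \<rho> y ^ Q)" if y: "y \<in> J" for y
        using local_bound_dense_ball[OF p \<eta> M lb f e er t big[unfolded Q_def D_def] K \<rho>(1,2)[OF JV[OF y]] \<rho>(4)[OF JV[OF y], unfolded V_def]]
        unfolding k_def c_def Q_def v_def .
      have "(\<integral>\<^sup>+g. ennreal (indicator (hball x r) g * norm (Top \<epsilon> f g) powr p) \<partial>lborel)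
        \<le> (\<integral>\<^sup>+g. ennreal ((2 * t) powr p) * ennreal (indicator (hball x r) g) + (\<Sum>y\<in>J. ennreal (indicator (hball y (3 * \<rho> y)) g * norm (Top \<epsilon> f g) powr p)) \<partial>lborel)"
        using pt by (intro nn_integral_mono) (simp add: ennreal_mult[symmetric] sum_ennreal ennreal_plus[symmetric] sum_nonneg ennreal_leI del: ennreal_plus)
      also have "\<dots> = ennreal ((2 * t) powr p) * (\<integral>\<^sup>+g. ennreal (indicator (hball x r) g) \<partial>lborel)
         + (\<Sum>y\<in>J. \<integral>\<^sup>+g. ennreal (indicator (hball y (3 * \<rho> y)) g * norm (Top \<epsilon> f g) powr p) \<partial>lborel)"
        by (subst nn_integral_add) (auto simp: nn_integral_cmult nn_integral_sum simp del: sum_ennreal)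
      also have "\<dots> \<le> ennreal ((2 * t) powr p) * ennreal (v * r ^ Q) + (\<Sum>y\<in>J. ennreal (k * \<rho> y ^ Q))"
        unfolding v_def Q_def by (intro add_mono mult_left_mono sum_mono hball_nn_integral r each[unfolded Q_def]) auto
      also have "\<dots> = ennreal ((2 * t) powr p * (v * r ^ Q) + k * (\<Sum>y\<in>J. \<rho> y ^ Q))"
      proof -
        have "k * \<rho> y ^ Q \<ge> 0" if "y \<in> J" for y using k \<rho>(1)[OF JV[OF that]] by simp
        then have "(\<Sum>y\<in>J. ennreal (k * \<rho> y ^ Q)) = ennreal (\<Sum>y\<in>J. k * \<rho> y ^ Q)" "0 \<le> (\<Sum>y\<in>J. k * \<rho> y ^ Q)"
          by (auto intro: sum_nonneg sum_ennreal)
        then show ?thesis using v r by (simp add: ennreal_mult[symmetric] ennreal_plus[symmetric] sum_distrib_left del: ennreal_plus)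
      qed
      also have "\<dots> \<le> ennreal ((M / 2 + K0) * r ^ Q)"
      proof (rule ennreal_leI)
        have rQ: "r ^ Q > 0" using r by simp
        \<comment> \<open>This quotient is the coefficient of \<open>M\<close>; the choice of
          \<open>t\<close> makes it at most one half, because 2 * 90 = 180.\<close>
        have z: "2 powr p * (2 * 2 ^ Q * 90 ^ Q * D) / t\<^sup>2 \<le> 1 / 2"
        proof -
          have "2 ^ Q * 90 ^ Q = (180::real) ^ Q" using power_mult_distrib[of 2 "90::real" Q] by simp
          then have "2 * (2 powr p * (2 * 2 ^ Q * 90 ^ Q * D)) \<le> t\<^sup>2" using final by (simp add: mult_ac)
          then show ?thesis using t by (simp add: field_simps)
        qed
        have z': "2 powr p * (2 * 2 ^ Q * 3 ^ Q * D) / t\<^sup>2 \<le> 1"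
        proof -
          have "2 powr p * (2 * 2 ^ Q * 3 ^ Q * D) / t\<^sup>2 \<le> 2 powr p * (2 * 2 ^ Q * 90 ^ Q * D) / t\<^sup>2"
            using D by (intro divide_right_mono mult_left_mono mult_right_mono power_mono) auto
          with z show ?thesis by linarith
        qed
        have "k * (\<Sum>y\<in>J. \<rho> y ^ Q) \<le> k * (2 * 2 ^ Q * D * r ^ Q / t\<^sup>2)" using sumV k by (rule mult_left_mono)
        also have "\<dots> = M * (2 powr p * (2 * 2 ^ Q * 90 ^ Q * D) / t\<^sup>2) * r ^ Q + c * v * (2 powr p * (2 * 2 ^ Q * 3 ^ Q * D) / t\<^sup>2) * r ^ Q"
          using t by (simp add: k_def field_simps)
        also have "\<dots> \<le> M * (1 / 2) * r ^ Q + c * v * 1 * r ^ Q"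
          using M c v rQ by (intro add_mono mult_right_mono mult_left_mono z z') auto
        finally show "(2 * t) powr p * (v * r ^ Q) + k * (\<Sum>y\<in>J. \<rho> y ^ Q) \<le> (M / 2 + K0) * r ^ Q"
          using rQ by (simp add: K0_def algebra_simps)
      qed
      finally show "(\<integral>\<^sup>+g. ennreal (indicator (hball x r) g * norm (Top \<epsilon> f g) powr p) \<partial>lborel) \<le> ennreal ((M / 2 + K0) * r ^ qdim TYPE('m))"
        by (simp add: Q_def)
    qed
  qed
qed

text \<open>
  Iterating \<open>local_bound_step\<close> makes the bound independent of \<open>\<eta>\<close>; it starts from a trivial bound
  that degenerates as \<open>\<eta>\<close> tends to \<open>0\<close>.
\<close>

lemma Top_local_Lp:
  assumes p: "p > 0"
  shows "\<exists>M>0. \<forall>\<epsilon>>0. \<forall>r>0. \<forall>x. \<forall>f :: 'm::finite heis \<Rightarrow> quat. unitf x r f \<longrightarrow>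
     (\<integral>\<^sup>+g. ennreal (indicator (hball x r) g * norm (Top \<epsilon> f g) powr p) \<partial>lborel) \<le> ennreal (M * r ^ qdim TYPE('m))"
proof -
  define Q where "Q = qdim TYPE('m)"
  define v where "v = vball TYPE('m)"
  have v: "v > 0" by (simp add: v_def vball_pos)
  obtain K0 where K0: "K0 > 0" "\<And>\<eta> M. \<eta> \<ge> 0 \<Longrightarrow> M \<ge> 0 \<Longrightarrow> local_bound p \<eta> M TYPE('m) \<Longrightarrow> local_bound p \<eta> (M / 2 + K0) TYPE('m)"
    using local_bound_step[OF p, where 'm = 'm] by blast
  obtain C where C: "C > 0" "\<And>\<epsilon> (h::'m heis). \<epsilon> > 0 \<Longrightarrow> norm (ker \<epsilon> h) \<le> C * (sqrt \<epsilon> + hnorm h) powr (- real Q)"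
    using ker_bound[where 'm = 'm] unfolding Q_def by blast
  \<comment> \<open>For \<open>\<epsilon> \<ge> \<eta> * r^2\<close> the kernel is at most a
    multiple of \<open>r powr (- Q)\<close>, which cancels the volume of the ball, so the image is
    bounded by a constant free of \<open>r\<close>.\<close>
  have base: "\<exists>M\<ge>0. local_bound p \<eta> M TYPE('m)" if \<eta>: "\<eta> > 0" for \<eta>
  proof -
    define b where "b = C * sqrt \<eta> powr (- real Q) * v"
    have b: "b \<ge> 0" using C v by (simp add: b_def)
    show ?thesis unfolding local_bound_def
    proof (intro exI[of _ "b powr p * v"] conjI allI impI)
      fix \<epsilon> r :: real and x and f :: "'m heis \<Rightarrow> quat"
      assume e: "\<epsilon> > 0" and r: "r > 0" and er: "\<eta> * r\<^sup>2 \<le> \<epsilon>" and f: "unitf x r f"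
      note bf = unitf_bbs[OF f]
      have kb: "norm (ker \<epsilon> h) \<le> C * (sqrt \<eta> powr (- real Q) * r powr (- real Q))" for h :: "'m heis"
      proof -
        have "sqrt (\<eta> * r\<^sup>2) \<le> sqrt \<epsilon>" using er by (rule real_sqrt_le_mono)
        then have "sqrt \<eta> * r \<le> sqrt \<epsilon> + hnorm h" using r by (simp add: real_sqrt_mult add_increasing2)
        then have "(sqrt \<epsilon> + hnorm h) powr (- real Q) \<le> (sqrt \<eta> * r) powr (- real Q)"
          using \<eta> r by (intro powr_mono2') auto
        also have "\<dots> = sqrt \<eta> powr (- real Q) * r powr (- real Q)" using \<eta> r by (intro powr_mult)
        finally show ?thesis using C(2)[OF e, of h] C(1) by (meson less_imp_le mult_left_mono order_trans)
      qed
      have Tb: "norm (Top \<epsilon> f g) \<le> b" for g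
      proof -
        define k where "k = C * (sqrt \<eta> powr (- real Q) * r powr (- real Q))"
        have k: "k \<ge> 0" using C by (simp add: k_def)
        have "norm (Top \<epsilon> f g) \<le> (\<integral>h. norm (ker \<epsilon> (hmult (hinv h) g) * f h) \<partial>lborel)"
          unfolding Top_def by (rule integral_norm_bound)
        also have "\<dots> \<le> (\<integral>h. k * indicator (hball x r) h \<partial>lborel)"
        proof (rule integral_mono)
          show "norm (ker \<epsilon> (hmult (hinv h) g) * f h) \<le> k * indicator (hball x r) h" for h
            unfolding norm_mult by (intro mult_mono kb[folded k_def] unitf_norm_le_indicator[OF f]) (use k in auto)
        qed (intro integrable_norm integrable_mult_right Top_integrable[OF bf e] hball_indicator_integral(1)[OF r])+
        also have "\<dots> = k * (\<integral>h. indicator (hball x r) h \<partial>lborel)"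
          by simp
        also have "\<dots> \<le> k * (v * r ^ Q)"
          using hball_indicator_integral(2)[OF r, of x] k unfolding v_def Q_def by (intro mult_left_mono) auto
        also have "\<dots> = b * (r powr (- real Q) * r ^ Q)" by (simp add: k_def b_def)
        also have "r powr (- real Q) * r ^ Q = 1" using r by (simp add: powr_minus powr_realpow)
        finally show ?thesis by simp
      qed
      have "(\<integral>\<^sup>+g. ennreal (indicator (hball x r) g * norm (Top \<epsilon> f g) powr p) \<partial>lborel)
        \<le> (\<integral>\<^sup>+g. ennreal (b powr p) * ennreal (indicator (hball x r) g) \<partial>lborel)"
        using Tb p by (intro nn_integral_mono) (auto simp: ennreal_mult[symmetric] indicator_def intro!: ennreal_leI powr_mono2)
      also have "\<dots> = ennreal (b powr p) * (\<integral>\<^sup>+g. ennreal (indicator (hball x r) g) \<partial>lborel)"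
        by (rule nn_integral_cmult) measurable
      also have "\<dots> \<le> ennreal (b powr p) * ennreal (v * r ^ Q)"
        unfolding v_def Q_def by (intro mult_left_mono hball_nn_integral r) auto
      also have "\<dots> = ennreal (b powr p * v * r ^ Q)" using v r by (simp add: ennreal_mult[symmetric])
      finally show "(\<integral>\<^sup>+g. ennreal (indicator (hball x r) g * norm (Top \<epsilon> f g) powr p) \<partial>lborel) \<le> ennreal (b powr p * v * r ^ qdim TYPE('m))"
        by (simp add: Q_def)
    qed (use v in auto)
  qed
  show ?thesis
  proof (intro exI[of _ "2 * K0 + 1"] conjI allI impI)
    fix \<epsilon> r :: real and x and f :: "'m heis \<Rightarrow> quat"
    assume e: "\<epsilon> > 0" and r: "r > 0" and f: "unitf x r f"
    define \<eta> where "\<eta> = \<epsilon> / r\<^sup>2"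
    have \<eta>: "\<eta> > 0" "\<eta> * r\<^sup>2 \<le> \<epsilon>" using e r by (simp_all add: \<eta>_def)
    obtain M0 where M0: "M0 \<ge> 0" "local_bound p \<eta> M0 TYPE('m)" using base[OF \<eta>(1)] by blast
    have it: "\<exists>M. 0 \<le> M \<and> M \<le> 2 * K0 + M0 / 2 ^ n \<and> local_bound p \<eta> M TYPE('m)" for n
    proof (induction n)
      case 0
      then show ?case using M0 K0(1) by (intro exI[of _ M0]) auto
    next
      case (Suc n)
      then obtain M where "0 \<le> M" "M \<le> 2 * K0 + M0 / 2 ^ n" "local_bound p \<eta> M TYPE('m)" by blast
      then show ?case using K0(2)[of \<eta> M] K0(1) \<eta>(1) by (intro exI[of _ "M / 2 + K0"]) auto
    qed
    \<comment> \<open>\<open>M0\<close> depends on \<open>\<epsilon> / r^2\<close>, but so may the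
      number of iterations; the bound therefore ends within 1 of \<open>2 * K0\<close> in all
      cases.\<close>
    obtain n where "M0 < 2 ^ n" using real_arch_pow[of 2 M0] by auto
    then have n: "M0 / 2 ^ n \<le> 1" by simp
    obtain M where M': "M \<le> 2 * K0 + M0 / 2 ^ n" and M: "local_bound p \<eta> M TYPE('m)" using it[of n] by blast
    have "M \<le> 2 * K0 + 1" using M' n by linarith
    note M = this M
    have "(\<integral>\<^sup>+g. ennreal (indicator (hball x r) g * norm (Top \<epsilon> f g) powr p) \<partial>lborel) \<le> ennreal (M * r ^ qdim TYPE('m))"
      using M(2) e r \<eta>(2) f unfolding local_bound_def by blast
    also have "\<dots> \<le> ennreal ((2 * K0 + 1) * r ^ qdim TYPE('m))"
      using M(1) r by (intro ennreal_leI mult_right_mono) auto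
    finally show "(\<integral>\<^sup>+g. ennreal (indicator (hball x r) g * norm (Top \<epsilon> f g) powr p) \<partial>lborel) \<le> ennreal ((2 * K0 + 1) * r ^ qdim TYPE('m))" .
  qed (use K0 in auto)
qed

section \<open>Expansion of the kernel in homogeneous polynomials\<close>

lemma hpolys_monom: "int (hdeg i) \<le> \<alpha> \<Longrightarrow> (\<lambda>g. hmonom i g *\<^sub>R c) \<in> hpolys \<alpha>"
  unfolding hpolys_def by (intro CollectI exI[of _ "{i}"] exI[of _ "\<lambda>_. c"]) simp

lemma hpolys_0: "(\<lambda>g. 0) \<in> hpolys \<alpha>"
  unfolding hpolys_def by (intro CollectI exI[of _ "{}"]) simp

lemma hpolys_mono: "P \<in> hpolys \<alpha> \<Longrightarrow> \<alpha> \<le> \<beta> \<Longrightarrow> P \<in> hpolys \<beta>"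
  unfolding hpolys_def by (blast intro: order_trans)

lemma hpolys_add:
  assumes "P \<in> hpolys \<alpha>" "P' \<in> hpolys \<alpha>"
  shows "(\<lambda>g. P g + P' g) \<in> hpolys \<alpha>"
proof -
  obtain I c where I: "finite I" "\<forall>i\<in>I. int (hdeg i) \<le> \<alpha>" "P = (\<lambda>g. \<Sum>i\<in>I. hmonom i g *\<^sub>R c i)"
    using assms(1) unfolding hpolys_def by blast
  obtain I' c' where I': "finite I'" "\<forall>i\<in>I'. int (hdeg i) \<le> \<alpha>" "P' = (\<lambda>g. \<Sum>i\<in>I'. hmonom i g *\<^sub>R c' i)"
    using assms(2) unfolding hpolys_def by blast
  have "(\<Sum>i\<in>I. hmonom i g *\<^sub>R c i) = (\<Sum>i\<in>I \<union> I'. hmonom i g *\<^sub>R (if i \<in> I then c i else 0))"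
    "(\<Sum>i\<in>I'. hmonom i g *\<^sub>R c' i) = (\<Sum>i\<in>I \<union> I'. hmonom i g *\<^sub>R (if i \<in> I' then c' i else 0))" for g
    by (rule sum.mono_neutral_cong_left; use I(1) I'(1) in auto)+
  then have "(\<lambda>g. P g + P' g) = (\<lambda>g. \<Sum>i\<in>I \<union> I'. hmonom i g *\<^sub>R ((if i \<in> I then c i else 0) + (if i \<in> I' then c' i else 0)))"
    unfolding I(3) I'(3) by (simp only: scaleR_add_right sum.distrib)
  moreover have "finite (I \<union> I')" "\<forall>i\<in>I \<union> I'. int (hdeg i) \<le> \<alpha>" using I(1,2) I'(1,2) by blast+
  ultimately show ?thesis unfolding hpolys_def
    by (intro CollectI exI[of _ "I \<union> I'"] exI[of _ "\<lambda>i. (if i \<in> I then c i else 0) + (if i \<in> I' then c' i else 0)"]) simp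
qed

lemma hpolys_sum:
  assumes "\<And>i. i \<in> A \<Longrightarrow> P i \<in> hpolys \<alpha>"
  shows "(\<lambda>g. \<Sum>i\<in>A. P i g) \<in> hpolys \<alpha>"
  using assms by (induction A rule: infinite_finite_induct) (auto intro!: hpolys_add hpolys_0)

lemma hpolys_linear:
  assumes "linear L" "P \<in> hpolys \<alpha>"
  shows "(\<lambda>g. L (P g)) \<in> hpolys \<alpha>"
proof -
  obtain I c where I: "finite I" "\<forall>i\<in>I. int (hdeg i) \<le> \<alpha>" "P = (\<lambda>g. \<Sum>i\<in>I. hmonom i g *\<^sub>R c i)"
    using assms(2) unfolding hpolys_def by blast
  then show ?thesis by (simp add: linear_sum[OF assms(1)] linear_scale[OF assms(1)] hpolys_sum hpolys_monom)
qed

lemma hpolys_qcnj: "P \<in> hpolys \<alpha> \<Longrightarrow> (\<lambda>g. qcnj (P g)) \<in> hpolys \<alpha>"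
  by (rule hpolys_linear[OF bounded_linear.linear[OF bounded_linear_qcnj]])

lemma hpolys_mult_const: "P \<in> hpolys \<alpha> \<Longrightarrow> (\<lambda>g. q * P g) \<in> hpolys \<alpha>"
  by (rule hpolys_linear[OF bounded_linear.linear[OF bounded_linear_mult_right]])

lemma hpolys_scaleR: "P \<in> hpolys \<alpha> \<Longrightarrow> (\<lambda>g. r *\<^sub>R P g) \<in> hpolys \<alpha>"
  by (rule hpolys_linear[OF bounded_linear.linear[OF bounded_linear_scaleR_right]])

lemma hpolys_minus: "P \<in> hpolys \<alpha> \<Longrightarrow> (\<lambda>g. - P g) \<in> hpolys \<alpha>"
  using hpolys_scaleR[of P \<alpha> "-1"] by simp

lemma hpolys_diff: "P \<in> hpolys \<alpha> \<Longrightarrow> P' \<in> hpolys \<alpha> \<Longrightarrow> (\<lambda>g. P g - P' g) \<in> hpolys \<alpha>"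
  using hpolys_add[of P \<alpha> "\<lambda>g. - P' g"] hpolys_minus[of P' \<alpha>] by simp

lemma hmonom_mult: "\<exists>k. hdeg k = hdeg i + hdeg j \<and> (\<forall>g. hmonom k g = hmonom i g * hmonom j g)"
proof -
  obtain a b where i: "i = (a, b)" by (cases i)
  obtain a' b' where j: "j = (a', b')" by (cases j)
  show ?thesis
    by (rule exI[of _ "(\<lambda>l k. a l k + a' l k, \<lambda>\<beta>. b \<beta> + b' \<beta>)"])
       (simp add: i j hdeg_def hmonom_def sum.distrib power_add prod.distrib mult_ac split: prod.splits)
qed

lemma hpolys_mult:
  assumes "P \<in> hpolys \<alpha>" "P' \<in> hpolys \<beta>"
  shows "(\<lambda>g. P g * P' g) \<in> hpolys (\<alpha> + \<beta>)"
proof -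
  obtain I c where I: "finite I" "\<forall>i\<in>I. int (hdeg i) \<le> \<alpha>" "P = (\<lambda>g. \<Sum>i\<in>I. hmonom i g *\<^sub>R c i)"
    using assms(1) unfolding hpolys_def by blast
  obtain I' c' where I': "finite I'" "\<forall>i\<in>I'. int (hdeg i) \<le> \<beta>" "P' = (\<lambda>g. \<Sum>i\<in>I'. hmonom i g *\<^sub>R c' i)"
    using assms(2) unfolding hpolys_def by blast
  have "(\<lambda>g. P g * P' g) = (\<lambda>g. \<Sum>i\<in>I. \<Sum>j\<in>I'. (hmonom i g * hmonom j g) *\<^sub>R (c i * c' j))"
    unfolding I(3) I'(3) by (simp add: sum_product mult_ac)
  moreover have "(\<lambda>g. (hmonom i g * hmonom j g) *\<^sub>R (c i * c' j)) \<in> hpolys (\<alpha> + \<beta>)" if "i \<in> I" "j \<in> I'" for i j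
  proof -
    obtain k where k: "hdeg k = hdeg i + hdeg j" "\<And>g. hmonom k g = hmonom i g * hmonom j g" using hmonom_mult by blast
    have "int (hdeg k) \<le> \<alpha> + \<beta>" using I(2) I'(2) that by (simp add: k(1) add_mono)
    from hpolys_monom[OF this, of "c i * c' j"] show ?thesis by (simp add: k(2))
  qed
  ultimately show ?thesis by (simp add: hpolys_sum)
qed

lemma hpolys_const: "0 \<le> \<alpha> \<Longrightarrow> (\<lambda>g. c) \<in> hpolys \<alpha>"
  using hpolys_monom[of "(\<lambda>_ _. 0, \<lambda>_. 0)" \<alpha> c] by (simp add: hdeg_def hmonom_def case_prod_beta')

lemma hpolys_y: "(\<lambda>g. (snd g $ l $ k) *\<^sub>R c) \<in> hpolys 1"
proof -
  define i where "i = ((\<lambda>l' k'. if l' = l then (if k' = k then 1 else 0) else 0) :: 'a \<Rightarrow> 4 \<Rightarrow> nat, (\<lambda>_. 0) :: 3 \<Rightarrow> nat)"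
  have "hdeg i = 1" by (simp add: i_def hdeg_def sum.delta if_distrib[of "sum _"] cong: if_cong)
    (simp add: sum.delta' sum.If_cases)?
  moreover have "hmonom i g = snd g $ l $ k" for g
  proof -
    have "(\<Prod>k'\<in>UNIV. (snd g $ l' $ k') ^ (if l' = l then (if k' = k then 1 else 0) else 0)) = (if l' = l then snd g $ l $ k else 1)" for l'
    proof (cases "l' = l")
      case True
      have "(\<Prod>k'\<in>UNIV. (snd g $ l' $ k') ^ (if l' = l then (if k' = k then 1 else 0) else 0)) = (\<Prod>k'\<in>UNIV. if k' = k then snd g $ l $ k' else 1)"
        by (intro prod.cong) (auto simp: True)
      then show ?thesis by (simp add: True prod.delta)
    qed simp
    then show ?thesis by (simp add: i_def hmonom_def case_prod_beta' prod.delta)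
  qed
  ultimately show ?thesis using hpolys_monom[of i 1 c] by simp
qed

lemma hpolys_t: "(\<lambda>g. (fst g $ \<beta>) *\<^sub>R c) \<in> hpolys 2"
proof -
  define i where "i = ((\<lambda>_ _. 0) :: 'a \<Rightarrow> 4 \<Rightarrow> nat, (\<lambda>\<beta>'. if \<beta>' = \<beta> then 1 else 0) :: 3 \<Rightarrow> nat)"
  have "hdeg i = 2" by (simp add: i_def hdeg_def sum.delta)
  moreover have "hmonom i g = fst g $ \<beta>" for g
  proof -
    have "(\<Prod>\<beta>'\<in>UNIV. (fst g $ \<beta>') ^ (if \<beta>' = \<beta> then 1 else 0)) = (\<Prod>\<beta>'\<in>UNIV. if \<beta>' = \<beta> then fst g $ \<beta>' else 1)"
      by (intro prod.cong) auto
    then show ?thesis by (simp add: i_def hmonom_def case_prod_beta' prod.delta)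
  qed
  ultimately show ?thesis using hpolys_monom[of i 2 c] by simp
qed

lemma hpolys_continuous: "P \<in> hpolys \<alpha> \<Longrightarrow> continuous_on UNIV P"
  unfolding hpolys_def hmonom_def case_prod_beta' by (auto intro!: continuous_intros)

lemma hpolys_linear_y:
  fixes L :: "real^4^'m::finite \<Rightarrow> quat"
  assumes "linear L"
  shows "(\<lambda>g. L (snd g)) \<in> hpolys 1"
proof -
  have eq: "(\<lambda>g. L (snd g)) = (\<lambda>g. \<Sum>l\<in>UNIV. \<Sum>j\<in>UNIV. (snd g $ l $ j) *\<^sub>R L (ybasis l j))"
    by (subst ybasis_expand) (simp only: linear_sum[OF assms] linear_scale[OF assms])
  show ?thesis unfolding eq by (intro hpolys_sum hpolys_y)
qed

section \<open>Translated coordinates as polynomials\<close>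

lemma linear_hip: "linear (\<lambda>y. hip y x)" "linear (\<lambda>y. hip x y)"
  by (rule bounded_linear.linear bounded_linear_hip_left bounded_linear_hip_right)+

lemma hpolys_hip_translate:
  fixes x :: "'m::finite heis"
  shows "(\<lambda>g. hip (snd (hmult x g)) v) \<in> hpolys 1" "(\<lambda>g. hip v (snd (hmult x g))) \<in> hpolys 1"
  unfolding hmult_def snd_conv hip_add_left hip_add_right
  by (intro hpolys_add hpolys_const hpolys_linear_y linear_hip; simp)+

text \<open>Left translation adds to the central coordinates a constant and a term linear in the
  horizontal ones, of degree 1, so the degree stays at most 2. The squared norm is written as a sum
  of products of polynomials of degree 1 in order to use closure under products.\<close>

lemma hpolys_wq_translate:
  fixes x :: "'m::finite heis"
  shows "(\<lambda>g. wq (hmult x g)) \<in> hpolys 2"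
proof -
  let ?y = "\<lambda>g. snd (hmult x g)"
  have "((norm y)\<^sup>2) *\<^sub>R 1 = (\<Sum>l\<in>UNIV. \<Sum>j\<in>UNIV. (qRe (hip (ybasis l j) y) *\<^sub>R 1) * hip (ybasis l j) y)" for y :: "real^4^'m"
  proof -
    have "((norm y)\<^sup>2) *\<^sub>R 1 = hip y y" by (simp add: hip_self of_real_def)
    also have "\<dots> = hip (\<Sum>l\<in>UNIV. \<Sum>j\<in>UNIV. (y $ l $ j) *\<^sub>R ybasis l j) y" by (subst ybasis_expand[symmetric]) simp
    also have "\<dots> = (\<Sum>l\<in>UNIV. \<Sum>j\<in>UNIV. (y $ l $ j) *\<^sub>R hip (ybasis l j) y)"
      by (simp only: linear_sum[OF linear_hip(1)] linear_scale[OF linear_hip(1)])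
    finally show ?thesis by (simp add: qRe_hip inner_commute[of "ybasis _ _"] inner_ybasis)
  qed
  then have n: "(\<lambda>g. ((norm (?y g))\<^sup>2) *\<^sub>R 1) = (\<lambda>g. \<Sum>l\<in>UNIV. \<Sum>j\<in>UNIV. (qRe (hip (ybasis l j) (?y g)) *\<^sub>R 1) * hip (ybasis l j) (?y g))" by simp
  have lin: "linear (\<lambda>q. qRe q *\<^sub>R (1::quat))" by (rule linearI) (simp_all add: algebra_simps)
  have "(\<lambda>g. ((norm (?y g))\<^sup>2) *\<^sub>R 1) \<in> hpolys (1 + 1)"
    unfolding n by (intro hpolys_sum hpolys_mult hpolys_linear[OF lin] hpolys_hip_translate)
  moreover have "(\<lambda>g. quat_of_t (fst (hmult x g))) \<in> hpolys 2"
  proof -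
    have t: "quat_of_t s = (s $ 1) *\<^sub>R qi + (s $ 2) *\<^sub>R qj + (s $ 3) *\<^sub>R qk" for s
      by (simp add: quat_of_t_def quat_eq_iff)
    have "(\<lambda>g::'m heis. quat_of_t (fst g)) \<in> hpolys 2"
      unfolding t by (intro hpolys_add hpolys_t)
    moreover have "(\<lambda>g. hip (snd x) (snd g) - hip (snd g) (snd x)) \<in> hpolys 2"
      by (intro hpolys_mono[OF hpolys_diff[OF hpolys_linear_y hpolys_linear_y]] linear_hip) simp
    ultimately show ?thesis by (simp add: hmult_def quat_of_t_hform hpolys_add hpolys_const)
  qed
  ultimately show ?thesis unfolding wq_def by (simp add: hpolys_add)
qed

text \<open>\<open>L\<close> measures the argument of the kernel and \<open>\<rho>\<close> the
  relative size of the set \<open>B\<close>; each \<open>P j\<close> has degree at most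
  \<open>j\<close>. The coefficients are a parameter because they may depend only on the expression
  expanded. The remainder of order 0 is \<open>F\<close> itself, so a bound on \<open>F\<close> is
  included.\<close>

definition expansion :: "(nat \<Rightarrow> real) \<Rightarrow> nat \<Rightarrow> real \<Rightarrow> real \<Rightarrow> 'm::finite heis set \<Rightarrow> ('m heis \<Rightarrow> quat) \<Rightarrow> bool" where
  "expansion C d \<rho> L B F \<longleftrightarrow> (\<exists>P. (\<forall>j. P j \<in> hpolys (int j)) \<and>
     (\<forall>n. \<forall>g\<in>B. norm (P n g) \<le> C n * \<rho> ^ n * inverse L ^ d \<and> norm (F g - (\<Sum>j<n. P j g)) \<le> C n * \<rho> ^ n * inverse L ^ d))"

text \<open>The recursion of \<open>inverse_terms\<close> with \<open>u\<close> of relative size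
  \<rho> and \<open>v\<close> of relative size \<rho>^2; the starting values 2 and 4 bound the
  remainders of order 0 and 1.\<close>

fun inverse_coeff :: "nat \<Rightarrow> real" where
  "inverse_coeff 0 = 2"
| "inverse_coeff (Suc 0) = 4"
| "inverse_coeff (Suc (Suc n)) = inverse_coeff (Suc n) + inverse_coeff n"

lemma inverse_coeff_nonneg: "inverse_coeff n \<ge> 0"
  by (induction n rule: inverse_coeff.induct) auto

text \<open>The components of the Neumann series of \<open>inverse (s + u + v)\<close> when
  \<open>u\<close> has weight 1 and \<open>v\<close> has weight 2. The recursion says that the
  product with \<open>s + u + v\<close> is 1 in each weight; the component of weight -1 counts as 0,
  whence the second clause.\<close>

fun inverse_terms :: "quat \<Rightarrow> ('a \<Rightarrow> quat) \<Rightarrow> ('a \<Rightarrow> quat) \<Rightarrow> nat \<Rightarrow> 'a \<Rightarrow> quat" where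
  "inverse_terms s u v 0 g = inverse s"
| "inverse_terms s u v (Suc 0) g = - inverse s * (u g * inverse s)"
| "inverse_terms s u v (Suc (Suc n)) g = - inverse s * (u g * inverse_terms s u v (Suc n) g + v g * inverse_terms s u v n g)"

lemma inverse_terms_hpolys:
  fixes u v :: "'m::finite heis \<Rightarrow> quat"
  assumes u: "u \<in> hpolys 1" and v: "v \<in> hpolys 2"
  shows "inverse_terms s u v n \<in> hpolys (int n)"
proof (induction n rule: inverse_coeff.induct)
  case 1
  show ?case using hpolys_const[of 0 "inverse s"] by (simp add: fun_eq_iff[symmetric] inverse_terms.simps(1)[abs_def])
next
  case 2
  have "(\<lambda>g. - inverse s * (u g * inverse s)) \<in> hpolys (1 + 0)"
    by (intro hpolys_mult_const hpolys_mult u hpolys_const) simp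
  moreover have "inverse_terms s u v (Suc 0) = (\<lambda>g. - inverse s * (u g * inverse s))" by (rule ext) simp
  ultimately show ?case by simp
next
  case (3 n)
  have "(\<lambda>g. u g * inverse_terms s u v (Suc n) g) \<in> hpolys (1 + int (Suc n))" "(\<lambda>g. v g * inverse_terms s u v n g) \<in> hpolys (2 + int n)"
    using 3 by (intro hpolys_mult u v; simp)+
  then have "(\<lambda>g. - inverse s * (u g * inverse_terms s u v (Suc n) g + v g * inverse_terms s u v n g)) \<in> hpolys (2 + int n)"
    by (intro hpolys_mult_const hpolys_add) (simp_all add: add.commute)
  moreover have "inverse_terms s u v (Suc (Suc n)) = (\<lambda>g. - inverse s * (u g * inverse_terms s u v (Suc n) g + v g * inverse_terms s u v n g))" by (rule ext) simp
  ultimately show ?case by simp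
qed

text \<open>Both the terms and the remainders satisfy \<open>X (n + 2) = - inverse s * (u * X (n + 1) + v * X n)\<close>.\<close>

lemma inverse_recursion_bound:
  fixes X :: "nat \<Rightarrow> quat"
  assumes L: "0 < L" "L \<le> norm s" and \<rho>: "0 \<le> \<rho>" and uv: "norm u \<le> \<rho> * L" "norm v \<le> \<rho>\<^sup>2 * L"
    and X: "norm (X 0) \<le> 2 * inverse L" "norm (X (Suc 0)) \<le> 4 * \<rho> * inverse L"
    and rec: "\<And>n. X (Suc (Suc n)) = - inverse s * (u * X (Suc n) + v * X n)"
  shows "norm (X n) \<le> inverse_coeff n * \<rho> ^ n * inverse L"
proof (induction n rule: inverse_coeff.induct)
  case (3 n)
  have isb: "norm (inverse s) \<le> inverse L" using L by (simp add: norm_inverse le_imp_inverse_le)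
  have "norm (u * X (Suc n) + v * X n) \<le> (\<rho> * L) * (inverse_coeff (Suc n) * \<rho> ^ Suc n * inverse L) + (\<rho>\<^sup>2 * L) * (inverse_coeff n * \<rho> ^ n * inverse L)"
    using \<rho> L by (intro order_trans[OF norm_triangle_ineq] add_mono) (auto simp only: norm_mult intro!: mult_mono uv 3 mult_nonneg_nonneg zero_le_power2 norm_ge_zero)
  also have "\<dots> = inverse_coeff (Suc (Suc n)) * \<rho> ^ Suc (Suc n)"
    using L by (simp add: power2_eq_square inverse_eq_divide field_simps)
  finally have "norm (X (Suc (Suc n))) \<le> inverse L * (inverse_coeff (Suc (Suc n)) * \<rho> ^ Suc (Suc n))"
    unfolding rec norm_mult norm_minus_cancel using isb L by (intro mult_mono) auto
  then show ?case by (simp only: mult_ac)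
qed (use X in auto)

text \<open>The bound 1/4 on \<open>\<rho>\<close> makes \<open>u + v\<close> at most half of
  \<open>L\<close>, which keeps the inverse below \<open>2 / L\<close>; terms and remainders are
  then both instances of \<open>inverse_recursion_bound\<close>.\<close>

lemma expansion_inverse:
  fixes u v :: "'m::finite heis \<Rightarrow> quat"
  assumes L: "0 < L" "L \<le> norm s" and \<rho>: "0 \<le> \<rho>" "\<rho> \<le> 1/4" and u: "u \<in> hpolys 1" and v: "v \<in> hpolys 2"
    and uv: "\<And>g. g \<in> B \<Longrightarrow> norm (u g) \<le> \<rho> * L" "\<And>g. g \<in> B \<Longrightarrow> norm (v g) \<le> \<rho>\<^sup>2 * L"
  shows "expansion inverse_coeff 1 \<rho> L B (\<lambda>g. inverse (s + u g + v g))"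
  unfolding expansion_def
proof (intro exI[of _ "inverse_terms s u v"] conjI allI ballI)
  show "inverse_terms s u v j \<in> hpolys (int j)" for j by (rule inverse_terms_hpolys[OF u v])
  fix n g assume g: "g \<in> B"
  have s: "s \<noteq> 0" using L by auto
  have isb: "norm (inverse s) \<le> inverse L" using L by (simp add: norm_inverse le_imp_inverse_le)
  have r2: "\<rho>\<^sup>2 \<le> \<rho> / 4" using \<rho> mult_left_mono[of \<rho> "1/4" \<rho>] by (simp add: power2_eq_square)
  define X where "X = inverse (s + u g + v g)"
  have w: "norm (u g + v g) \<le> 2 * \<rho> * L"
  proof -
    have "\<rho>\<^sup>2 * L \<le> \<rho> * L" using r2 \<rho> L by (intro mult_right_mono) auto
    then show ?thesis using norm_triangle_ineq[of "u g" "v g"] uv[OF g] by linarith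
  qed
  have "2 * \<rho> * L \<le> 1/2 * L" using \<rho> L by (intro mult_right_mono) auto
  then have low: "L / 2 \<le> norm (s + u g + v g)"
    using norm_triangle_ineq4[of "s + u g + v g" "u g + v g"] w L(2) by simp
  then have nz: "s + u g + v g \<noteq> 0" using L by auto
  have nX: "norm X \<le> 2 * inverse L"
  proof -
    have "norm X \<le> inverse (L / 2)" unfolding X_def norm_inverse using low L by (intro le_imp_inverse_le) auto
    then show ?thesis by (simp add: inverse_eq_divide)
  qed
  \<comment> \<open>The resolvent identity; it yields the bound on the remainder of order 1 and the
    first instance of the recursion.\<close>
  have eqX: "X - inverse s = - inverse s * ((u g + v g) * X)"
  proof -
    have "s * X + (u g + v g) * X = 1" using nz unfolding X_def by (simp add: add.assoc flip: distrib_right)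
    then have "inverse s * (s * X) = inverse s * (1 - (u g + v g) * X)" by (simp add: eq_diff_eq)
    then show ?thesis using s by (simp add: algebra_simps flip: mult.assoc)
  qed
  define R where "R n = X - (\<Sum>j<n. inverse_terms s u v j g)" for n
  have R1: "norm (R (Suc 0)) \<le> 4 * \<rho> * inverse L"
  proof -
    have "R (Suc 0) = - inverse s * ((u g + v g) * X)" unfolding eqX[symmetric] by (simp add: R_def)
    then have "norm (R (Suc 0)) = norm (inverse s) * (norm (u g + v g) * norm X)" by (simp add: norm_mult)
    also have "\<dots> \<le> inverse L * ((2 * \<rho> * L) * (2 * inverse L))"
      by (intro mult_mono[OF isb mult_mono[OF w nX]]) (use L \<rho> in auto)
    also have "\<dots> = 4 * \<rho> * inverse L" using L by simp
    finally show ?thesis .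
  qed
  have Rrec: "R (Suc (Suc n)) = - inverse s * (u g * R (Suc n) + v g * R n)" for n
  proof (induction n)
    case 0
    have "R (Suc (Suc 0)) = (X - inverse s) + inverse s * (u g * inverse s)" by (simp add: R_def lessThan_Suc algebra_simps)
    then show ?case unfolding eqX by (simp add: R_def algebra_simps)
  next
    case (Suc n)
    have "R (Suc (Suc (Suc n))) = R (Suc (Suc n)) - inverse_terms s u v (Suc (Suc n)) g" by (simp add: R_def algebra_simps)
    also have "\<dots> = - inverse s * (u g * (R (Suc n) - inverse_terms s u v (Suc n) g) + v g * (R n - inverse_terms s u v n g))"
      unfolding Suc.IH by (simp add: algebra_simps)
    also have "R (Suc n) - inverse_terms s u v (Suc n) g = R (Suc (Suc n))" by (simp add: R_def algebra_simps)
    also have "R n - inverse_terms s u v n g = R (Suc n)" by (simp add: R_def algebra_simps)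
    finally show ?case .
  qed
  have "norm (R n) \<le> inverse_coeff n * \<rho> ^ n * inverse L"
    using nX by (intro inverse_recursion_bound[OF L \<rho>(1) uv[OF g] _ R1 Rrec]) (simp add: R_def)
  then show "norm (inverse (s + u g + v g) - (\<Sum>j<n. inverse_terms s u v j g)) \<le> inverse_coeff n * \<rho> ^ n * inverse L ^ 1"
    by (simp add: R_def X_def)
  have "norm (inverse_terms s u v n g) \<le> inverse_coeff n * \<rho> ^ n * inverse L"
  proof (rule inverse_recursion_bound[OF L \<rho>(1) uv[OF g]])
    show "norm (inverse_terms s u v 0 g) \<le> 2 * inverse L" using isb L by (simp add: order_trans[OF isb])
    have "norm (inverse s) * (norm (u g) * norm (inverse s)) \<le> inverse L * ((\<rho> * L) * inverse L)"
      using L \<rho> isb uv[OF g] by (intro mult_mono) auto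
    also have "\<dots> \<le> 4 * \<rho> * inverse L" using L \<rho> by simp
    finally show "norm (inverse_terms s u v (Suc 0) g) \<le> 4 * \<rho> * inverse L" by (simp add: norm_mult)
  qed simp
  then show "norm (inverse_terms s u v n g) \<le> inverse_coeff n * \<rho> ^ n * inverse L ^ 1" by simp
qed

text \<open>Both sides collect the products \<open>A k * B m\<close> with \<open>k + m < N\<close>,
  with the order of the factors kept.\<close>

lemma sum_convolution:
  fixes A B :: "nat \<Rightarrow> quat"
  shows "(\<Sum>k<N. A k * (\<Sum>m<N - k. B m)) = (\<Sum>n<N. \<Sum>k\<le>n. A k * B (n - k))"
proof (induction N)
  case (Suc N)
  have "(\<Sum>k<Suc N. A k * (\<Sum>m<Suc N - k. B m)) = (\<Sum>k<Suc N. A k * (\<Sum>m<N - k. B m) + A k * B (N - k))"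
    by (intro sum.cong) (auto simp: Suc_diff_le algebra_simps)
  also have "\<dots> = (\<Sum>k<N. A k * (\<Sum>m<N - k. B m)) + (\<Sum>k\<le>N. A k * B (N - k))"
    by (simp add: sum.distrib lessThan_Suc_atMost[symmetric])
  finally show ?case by (simp add: Suc)
qed simp

text \<open>The remainder of the product is the remainder of \<open>F\<close> times
  \<open>G\<close>, plus each term of \<open>F\<close> times the remainder of \<open>G\<close> of
  complementary order. The first summand accounts for \<open>C n * C' 0\<close>, since
  \<open>C' 0\<close> bounds \<open>G\<close> itself.\<close>

lemma expansion_mult:
  assumes F: "expansion C d \<rho> L B F" and G: "expansion C' d' \<rho> L B G" and L: "0 < L" and \<rho>: "0 \<le> \<rho>"
    and C: "\<And>n. C n \<ge> 0" "\<And>n. C' n \<ge> 0"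
  shows "expansion (\<lambda>n. C n * C' 0 + (\<Sum>k\<le>n. C k * C' (n - k))) (d + d') \<rho> L B (\<lambda>g. F g * G g)"
proof -
  obtain P where P: "\<And>j. P j \<in> hpolys (int j)" "\<And>n g. g \<in> B \<Longrightarrow> norm (P n g) \<le> C n * \<rho> ^ n * inverse L ^ d"
    "\<And>n g. g \<in> B \<Longrightarrow> norm (F g - (\<Sum>j<n. P j g)) \<le> C n * \<rho> ^ n * inverse L ^ d" using F unfolding expansion_def by blast
  obtain P' where P': "\<And>j. P' j \<in> hpolys (int j)" "\<And>n g. g \<in> B \<Longrightarrow> norm (P' n g) \<le> C' n * \<rho> ^ n * inverse L ^ d'"
    "\<And>n g. g \<in> B \<Longrightarrow> norm (G g - (\<Sum>j<n. P' j g)) \<le> C' n * \<rho> ^ n * inverse L ^ d'" using G unfolding expansion_def by blast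
  define E where "E n = \<rho> ^ n * inverse L ^ (d + d')" for n
  have E0: "E n \<ge> 0" for n using L \<rho> by (simp add: E_def)
  have nn: "C n * \<rho> ^ n * inverse L ^ d \<ge> 0" "C' n * \<rho> ^ n * inverse L ^ d' \<ge> 0" for n using C L \<rho> by simp_all
  have Ee: "(C k * \<rho> ^ k * inverse L ^ d) * (C' (n - k) * \<rho> ^ (n - k) * inverse L ^ d') = C k * C' (n - k) * E n" if "k \<le> n" for k n
  proof -
    have "\<rho> ^ n = \<rho> ^ k * \<rho> ^ (n - k)" using that by (simp flip: power_add)
    then show ?thesis by (simp add: E_def power_add)
  qed
  show ?thesis
    unfolding expansion_def
  proof (intro exI[of _ "\<lambda>n g. \<Sum>k\<le>n. P k g * P' (n - k) g"] conjI allI ballI)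
    fix n
    show "(\<lambda>g. \<Sum>k\<le>n. P k g * P' (n - k) g) \<in> hpolys (int n)"
    proof (rule hpolys_sum)
      fix k assume "k \<in> {..n}"
      then show "(\<lambda>g. P k g * P' (n - k) g) \<in> hpolys (int n)"
        using hpolys_mult[OF P(1)[of k] P'(1)[of "n - k"]] by simp
    qed
    fix g assume g: "g \<in> B"
    have c0: "C n * C' 0 * E n \<ge> 0" using C E0 by simp
    have s: "(\<Sum>k\<le>n. (C k * \<rho> ^ k * inverse L ^ d) * (C' (n - k) * \<rho> ^ (n - k) * inverse L ^ d')) = (\<Sum>k\<le>n. C k * C' (n - k)) * E n"
      by (simp add: Ee sum_distrib_right)
    have "norm (\<Sum>k\<le>n. P k g * P' (n - k) g) \<le> (\<Sum>k\<le>n. (C k * \<rho> ^ k * inverse L ^ d) * (C' (n - k) * \<rho> ^ (n - k) * inverse L ^ d'))"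
      by (intro sum_norm_le) (simp only: norm_mult, rule mult_mono[OF P(2)[OF g] P'(2)[OF g] nn(1) norm_ge_zero])
    with s c0 show "norm (\<Sum>k\<le>n. P k g * P' (n - k) g) \<le> (C n * C' 0 + (\<Sum>k\<le>n. C k * C' (n - k))) * \<rho> ^ n * inverse L ^ (d + d')"
      by (simp add: E_def distrib_right mult.assoc)
    have id: "F g * G g - (\<Sum>j<n. \<Sum>k\<le>j. P k g * P' (j - k) g)
      = (F g - (\<Sum>j<n. P j g)) * G g + (\<Sum>k<n. P k g * (G g - (\<Sum>m<n - k. P' m g)))"
    proof -
      have conv: "(\<Sum>j<n. \<Sum>k\<le>j. P k g * P' (j - k) g) = (\<Sum>k<n. P k g * (\<Sum>m<n - k. P' m g))"
        by (rule sum_convolution[symmetric])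
      show ?thesis unfolding conv by (simp add: left_diff_distrib right_diff_distrib sum_subtractf sum_distrib_right)
    qed
    have G0: "norm (G g) \<le> C' 0 * \<rho> ^ 0 * inverse L ^ d'" using P'(3)[OF g, of 0] by simp
    have a: "norm ((F g - (\<Sum>j<n. P j g)) * G g) \<le> (C n * \<rho> ^ n * inverse L ^ d) * (C' 0 * \<rho> ^ 0 * inverse L ^ d')"
      unfolding norm_mult by (rule mult_mono[OF P(3)[OF g] G0 nn(1) norm_ge_zero])
    have b: "norm (P k g * (G g - (\<Sum>m<n - k. P' m g))) \<le> (C k * \<rho> ^ k * inverse L ^ d) * (C' (n - k) * \<rho> ^ (n - k) * inverse L ^ d')" for k
      unfolding norm_mult by (rule mult_mono[OF P(2)[OF g] P'(3)[OF g] nn(1) norm_ge_zero])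
    have "norm (F g * G g - (\<Sum>j<n. \<Sum>k\<le>j. P k g * P' (j - k) g))
      \<le> (C n * \<rho> ^ n * inverse L ^ d) * (C' 0 * \<rho> ^ 0 * inverse L ^ d') + (\<Sum>k<n. (C k * \<rho> ^ k * inverse L ^ d) * (C' (n - k) * \<rho> ^ (n - k) * inverse L ^ d'))"
      unfolding id by (intro order_trans[OF norm_triangle_ineq] add_mono sum_norm_le a b)
    also have "(\<Sum>k<n. (C k * \<rho> ^ k * inverse L ^ d) * (C' (n - k) * \<rho> ^ (n - k) * inverse L ^ d'))
      \<le> (\<Sum>k\<le>n. (C k * \<rho> ^ k * inverse L ^ d) * (C' (n - k) * \<rho> ^ (n - k) * inverse L ^ d'))"
      by (intro sum_mono2 mult_nonneg_nonneg C zero_le_power) (use L \<rho> in auto)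
    also have "(C n * \<rho> ^ n * inverse L ^ d) * (C' 0 * \<rho> ^ 0 * inverse L ^ d') = C n * C' 0 * E n"
      by (simp add: E_def power_add)
    finally show "norm (F g * G g - (\<Sum>j<n. \<Sum>k\<le>j. P k g * P' (j - k) g)) \<le> (C n * C' 0 + (\<Sum>k\<le>n. C k * C' (n - k))) * \<rho> ^ n * inverse L ^ (d + d')"
      unfolding s by (simp add: E_def distrib_right mult.assoc)
  qed
qed

lemma expansion_add:
  assumes "expansion C d \<rho> L B F" "expansion C' d \<rho> L B G"
  shows "expansion (\<lambda>n. C n + C' n) d \<rho> L B (\<lambda>g. F g + G g)"
proof -
  obtain P where P: "\<And>j. P j \<in> hpolys (int j)" "\<And>n g. g \<in> B \<Longrightarrow> norm (P n g) \<le> C n * \<rho> ^ n * inverse L ^ d"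
    "\<And>n g. g \<in> B \<Longrightarrow> norm (F g - (\<Sum>j<n. P j g)) \<le> C n * \<rho> ^ n * inverse L ^ d" using assms(1) unfolding expansion_def by blast
  obtain P' where P': "\<And>j. P' j \<in> hpolys (int j)" "\<And>n g. g \<in> B \<Longrightarrow> norm (P' n g) \<le> C' n * \<rho> ^ n * inverse L ^ d"
    "\<And>n g. g \<in> B \<Longrightarrow> norm (G g - (\<Sum>j<n. P' j g)) \<le> C' n * \<rho> ^ n * inverse L ^ d" using assms(2) unfolding expansion_def by blast
  show ?thesis unfolding expansion_def
  proof (intro exI[of _ "\<lambda>n g. P n g + P' n g"] conjI allI ballI hpolys_add P(1) P'(1))
    fix n g assume g: "g \<in> B"
    show "norm (P n g + P' n g) \<le> (C n + C' n) * \<rho> ^ n * inverse L ^ d"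
      using norm_triangle_ineq[of "P n g" "P' n g"] P(2)[OF g, of n] P'(2)[OF g, of n] by (simp only: distrib_right)
    have "F g + G g - (\<Sum>j<n. P j g + P' j g) = (F g - (\<Sum>j<n. P j g)) + (G g - (\<Sum>j<n. P' j g))" by (simp add: sum.distrib)
    then show "norm (F g + G g - (\<Sum>j<n. P j g + P' j g)) \<le> (C n + C' n) * \<rho> ^ n * inverse L ^ d"
      using norm_triangle_ineq[of "F g - (\<Sum>j<n. P j g)" "G g - (\<Sum>j<n. P' j g)"] P(3)[OF g, of n] P'(3)[OF g, of n] by (simp only: distrib_right)
  qed
qed

text \<open>Structural induction over the expression. The coefficients are chosen before
  \<open>s\<close>, \<open>\<rho>\<close>, \<open>L\<close>, \<open>B\<close>, \<open>u\<close> and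
  \<open>v\<close>, so they are uniform in the height, the point and the ball. The conjugate inverse
  reduces to the inverse, as \<open>qcnj\<close> preserves degrees and norms.\<close>

lemma ev_expansion:
  assumes "hom e d"
  shows "\<exists>C. (\<forall>n. C n \<ge> 0) \<and> (\<forall>s \<rho> L B. \<forall>u v :: 'm::finite heis \<Rightarrow> quat. 0 < L \<longrightarrow> L \<le> norm s \<longrightarrow> 0 \<le> \<rho> \<longrightarrow> \<rho> \<le> 1/4 \<longrightarrow> u \<in> hpolys 1 \<longrightarrow> v \<in> hpolys 2 \<longrightarrow>
     (\<forall>g\<in>B. norm (u g) \<le> \<rho> * L) \<longrightarrow> (\<forall>g\<in>B. norm (v g) \<le> \<rho>\<^sup>2 * L) \<longrightarrow> expansion C d \<rho> L B (\<lambda>g. ev e (s + u g + v g)))"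
  using assms
proof (induction e arbitrary: d)
  case (RC c)
  define C where "C n = (if n = 0 then norm c else 0)" for n :: nat
  show ?case
  proof (intro exI[of _ C] conjI allI impI)
    fix s \<rho> L B and u v :: "'m heis \<Rightarrow> quat" assume L: "0 < (L::real)"
    show "expansion C d \<rho> L B (\<lambda>g. ev (RC c) (s + u g + v g))"
      unfolding expansion_def
    proof (intro exI[of _ "\<lambda>n g. if n = 0 then c else 0"] conjI allI ballI)
      show "(\<lambda>g. if j = 0 then c else 0) \<in> hpolys (int j)" for j by (rule hpolys_const) simp
      fix n :: nat and g
      have "(\<Sum>j<n. if j = 0 then c else 0) = (if n = 0 then 0 else c)" by (subst sum.delta) auto
      then show "norm (ev (RC c) (s + u g + v g) - (\<Sum>j<n. if j = 0 then c else 0)) \<le> C n * \<rho> ^ n * inverse L ^ d"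
        "norm (if n = 0 then c else 0) \<le> C n * \<rho> ^ n * inverse L ^ d"
        using RC by (auto simp: C_def)
    qed
  qed (simp add: C_def)
next
  case RI
  then have d: "d = 1" by simp
  show ?case unfolding d
  proof (intro exI[of _ inverse_coeff] conjI allI impI)
    fix s :: quat and \<rho> L :: real and B and u v :: "'m heis \<Rightarrow> quat"
    assume a: "0 < L" "L \<le> norm s" "0 \<le> \<rho>" "\<rho> \<le> 1/4" "u \<in> hpolys 1" "v \<in> hpolys 2" "\<forall>g\<in>B. norm (u g) \<le> \<rho> * L" "\<forall>g\<in>B. norm (v g) \<le> \<rho>\<^sup>2 * L"
    show "expansion inverse_coeff 1 \<rho> L B (\<lambda>g. ev RI (s + u g + v g))"
      using expansion_inverse[OF a(1-6), of B] a(7,8) by simp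
  qed (rule inverse_coeff_nonneg)
next
  case RJ
  then have d: "d = 1" by simp
  show ?case unfolding d
  proof (intro exI[of _ inverse_coeff] conjI allI impI)
    fix s :: quat and \<rho> L :: real and B and u v :: "'m heis \<Rightarrow> quat"
    assume a: "0 < L" "L \<le> norm s" "0 \<le> \<rho>" "\<rho> \<le> 1/4" "u \<in> hpolys 1" "v \<in> hpolys 2" "\<forall>g\<in>B. norm (u g) \<le> \<rho> * L" "\<forall>g\<in>B. norm (v g) \<le> \<rho>\<^sup>2 * L"
    show "expansion inverse_coeff 1 \<rho> L B (\<lambda>g. ev RJ (s + u g + v g))"
      using expansion_inverse[OF a(1) _ a(3,4) hpolys_qcnj[OF a(5)] hpolys_qcnj[OF a(6)], of "qcnj s" B] a(2,7,8) by simp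
  qed (rule inverse_coeff_nonneg)
next
  case (RM a b)
  then obtain i j where d: "d = i + j" "hom a i" "hom b j" by auto
  obtain C where C: "\<And>n. C n \<ge> 0" "\<And>s \<rho> L B (u :: 'm heis \<Rightarrow> quat) v. 0 < L \<Longrightarrow> L \<le> norm s \<Longrightarrow> 0 \<le> \<rho> \<Longrightarrow> \<rho> \<le> 1/4 \<Longrightarrow> u \<in> hpolys 1 \<Longrightarrow> v \<in> hpolys 2 \<Longrightarrow>
     (\<forall>g\<in>B. norm (u g) \<le> \<rho> * L) \<Longrightarrow> (\<forall>g\<in>B. norm (v g) \<le> \<rho>\<^sup>2 * L) \<Longrightarrow> expansion C i \<rho> L B (\<lambda>g. ev a (s + u g + v g))"
    using RM.IH(1)[OF d(2)] by blast
  obtain C' where C': "\<And>n. C' n \<ge> 0" "\<And>s \<rho> L B (u :: 'm heis \<Rightarrow> quat) v. 0 < L \<Longrightarrow> L \<le> norm s \<Longrightarrow> 0 \<le> \<rho> \<Longrightarrow> \<rho> \<le> 1/4 \<Longrightarrow> u \<in> hpolys 1 \<Longrightarrow> v \<in> hpolys 2 \<Longrightarrow>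
     (\<forall>g\<in>B. norm (u g) \<le> \<rho> * L) \<Longrightarrow> (\<forall>g\<in>B. norm (v g) \<le> \<rho>\<^sup>2 * L) \<Longrightarrow> expansion C' j \<rho> L B (\<lambda>g. ev b (s + u g + v g))"
    using RM.IH(2)[OF d(3)] by blast
  show ?case unfolding d(1) ev.simps
  proof (intro exI[of _ "\<lambda>n. C n * C' 0 + (\<Sum>k\<le>n. C k * C' (n - k))"] conjI allI impI)
    show "0 \<le> C n * C' 0 + (\<Sum>k\<le>n. C k * C' (n - k))" for n using C(1) C'(1) by (intro add_nonneg_nonneg mult_nonneg_nonneg sum_nonneg) auto
    fix s :: quat and \<rho> L :: real and B and u v :: "'m heis \<Rightarrow> quat"
    assume a: "0 < L" "L \<le> norm s" "0 \<le> \<rho>" "\<rho> \<le> 1/4" "u \<in> hpolys 1" "v \<in> hpolys 2" "\<forall>g\<in>B. norm (u g) \<le> \<rho> * L" "\<forall>g\<in>B. norm (v g) \<le> \<rho>\<^sup>2 * L"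
    show "expansion (\<lambda>n. C n * C' 0 + (\<Sum>k\<le>n. C k * C' (n - k))) (i + j) \<rho> L B (\<lambda>g. ev a (s + u g + v g) * ev b (s + u g + v g))"
      by (rule expansion_mult[OF C(2)[OF a] C'(2)[OF a] a(1,3) C(1) C'(1)])
  qed
next
  case (RA a b)
  then have d: "hom a d" "hom b d" by auto
  obtain C where C: "\<And>n. C n \<ge> 0" "\<And>s \<rho> L B (u :: 'm heis \<Rightarrow> quat) v. 0 < L \<Longrightarrow> L \<le> norm s \<Longrightarrow> 0 \<le> \<rho> \<Longrightarrow> \<rho> \<le> 1/4 \<Longrightarrow> u \<in> hpolys 1 \<Longrightarrow> v \<in> hpolys 2 \<Longrightarrow>
     (\<forall>g\<in>B. norm (u g) \<le> \<rho> * L) \<Longrightarrow> (\<forall>g\<in>B. norm (v g) \<le> \<rho>\<^sup>2 * L) \<Longrightarrow> expansion C d \<rho> L B (\<lambda>g. ev a (s + u g + v g))"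
    using RA.IH(1)[OF d(1)] by blast
  obtain C' where C': "\<And>n. C' n \<ge> 0" "\<And>s \<rho> L B (u :: 'm heis \<Rightarrow> quat) v. 0 < L \<Longrightarrow> L \<le> norm s \<Longrightarrow> 0 \<le> \<rho> \<Longrightarrow> \<rho> \<le> 1/4 \<Longrightarrow> u \<in> hpolys 1 \<Longrightarrow> v \<in> hpolys 2 \<Longrightarrow>
     (\<forall>g\<in>B. norm (u g) \<le> \<rho> * L) \<Longrightarrow> (\<forall>g\<in>B. norm (v g) \<le> \<rho>\<^sup>2 * L) \<Longrightarrow> expansion C' d \<rho> L B (\<lambda>g. ev b (s + u g + v g))"
    using RA.IH(2)[OF d(2)] by blast
  show ?case unfolding ev.simps
  proof (intro exI[of _ "\<lambda>n. C n + C' n"] conjI allI impI)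
    show "0 \<le> C n + C' n" for n using C(1) C'(1) by (intro add_nonneg_nonneg) auto
    fix s :: quat and \<rho> L :: real and B and u v :: "'m heis \<Rightarrow> quat"
    assume a: "0 < L" "L \<le> norm s" "0 \<le> \<rho>" "\<rho> \<le> 1/4" "u \<in> hpolys 1" "v \<in> hpolys 2" "\<forall>g\<in>B. norm (u g) \<le> \<rho> * L" "\<forall>g\<in>B. norm (v g) \<le> \<rho>\<^sup>2 * L"
    show "expansion (\<lambda>n. C n + C' n) d \<rho> L B (\<lambda>g. ev a (s + u g + v g) + ev b (s + u g + v g))"
      by (rule expansion_add[OF C(2)[OF a] C'(2)[OF a]])
  qed
qed

section \<open>Decay away from the support\<close>

text \<open>In coordinates centred at \<open>x\<close> the argument of the kernel is
  \<open>s + u h + v h\<close>, with \<open>u\<close> of degree 1 and \<open>v\<close> of degree 2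
  in \<open>h\<close>. The moments remove the first \<open>N\<close> terms of its expansion, and the
  remainder is integrated over the ball.\<close>

lemma Top_far:
  "\<exists>C>0. \<forall>\<epsilon>>0. \<forall>r>0. \<forall>x g. \<forall>f :: 'm::finite heis \<Rightarrow> quat. unitf x r f \<longrightarrow>
     (\<forall>P\<in>hpolys (int N - 1). (\<integral>h. P h * f h \<partial>lborel) = 0) \<longrightarrow> 16 * r \<le> hdist x g \<longrightarrow>
     norm (Top \<epsilon> f g) \<le> C * (r / hdist x g) ^ (qdim TYPE('m) + N)"
proof -
  define k where "k = 2 * CARD('m)"
  define Q where "Q = qdim TYPE('m)"
  have Qd: "Q = 2 * (3 + k)" by (simp add: Q_def k_def qdim_def)
  obtain C where C0: "\<And>n. C n \<ge> 0" and C: "\<And>s \<rho> L B (u :: 'm heis \<Rightarrow> quat) v. 0 < L \<Longrightarrow> L \<le> norm s \<Longrightarrow> 0 \<le> \<rho> \<Longrightarrow> \<rho> \<le> 1/4 \<Longrightarrow> u \<in> hpolys 1 \<Longrightarrow> v \<in> hpolys 2 \<Longrightarrow>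
     (\<forall>g\<in>B. norm (u g) \<le> \<rho> * L) \<Longrightarrow> (\<forall>g\<in>B. norm (v g) \<le> \<rho>\<^sup>2 * L) \<Longrightarrow> expansion C (3 + k) \<rho> L B (\<lambda>g. kE k (s + u g + v g))"
    using ev_expansion[OF hom_Ex[of k], where 'm = 'm] unfolding kE_def by blast
  define c where "c = C N * 4 ^ N * 2 ^ (3 + k) * vball TYPE('m)"
  have c: "c \<ge> 0" using C0[of N] vball_pos[of "TYPE('m)"] by (simp add: c_def)
  show ?thesis
  proof (intro exI[of _ "c + 1"] conjI allI impI)
    fix \<epsilon> r :: real and x g and f :: "'m heis \<Rightarrow> quat"
    assume e: "\<epsilon> > 0" and r: "r > 0" and f: "unitf x r f" and mom: "\<forall>P\<in>hpolys (int N - 1). (\<integral>h. P h * f h \<partial>lborel) = 0"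
      and far: "16 * r \<le> hdist x g"
    define D where "D = hdist x g"
    have D: "D > 0" "16 * r \<le> D" using far r by (auto simp: D_def)
    define w where "w = hmult (hinv x) g"
    have "hnorm w = hdist g x" by (simp add: w_def hdist_def)
    then have nw: "hnorm w = D" by (simp add: D_def hdist_commute)
    define s where "s = \<epsilon> *\<^sub>R 1 + wq w"
    define u where "u h = - (2 *\<^sub>R hip (snd (hmult (hinv x) h)) (snd w))" for h
    define v where "v h = qcnj (wq (hmult (hinv x) h))" for h
    \<comment> \<open>\<open>D^2 / 2\<close> is a lower bound for the norm of \<open>s\<close>. The
      next definition makes \<open>\<rho> * L = 2 * r * D\<close>, which bounds \<open>u\<close>,
      and \<open>16 * r \<le> D\<close> makes \<open>\<rho>\<close> at most 1/4.\<close>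
    define L where "L = D\<^sup>2 / 2"
    define \<rho> where "\<rho> = 4 * r / D"
    have ker: "ker \<epsilon> (hmult (hinv h) g) = kE k (s + u h + v h)" for h
    proof -
      have "hmult (hinv h) g = hmult (hinv (hmult (hinv x) h)) w" by (simp add: w_def hinv_hmult hmult_assoc)
      then have eq: "wq (hmult (hinv h) g) = qcnj (wq (hmult (hinv x) h)) + wq w + 2 *\<^sub>R hip (snd (hinv (hmult (hinv x) h))) (snd w)"
        by (simp only: wq_hmult wq_hinv)
      show ?thesis unfolding ker_def k_def
        by (rule arg_cong[of _ _ "kE (2 * CARD('m))"]) (simp add: eq s_def u_def v_def hinv_def[of "hmult _ _"] algebra_simps)
    qed
    have L: "0 < L" "L \<le> norm s" using D eps_wq_lower(1)[OF e, of w] e by (simp_all add: L_def s_def nw)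
    have \<rho>: "0 \<le> \<rho>" "\<rho> \<le> 1/4" using D r by (simp_all add: \<rho>_def field_simps)
    have nb: "hnorm (hmult (hinv x) h) \<le> r" if "h \<in> hball x r" for h
    proof -
      have "hdist h x < r" using that by (simp add: hball_eq hdist_commute)
      then show ?thesis by (simp add: hdist_def)
    qed
    have "expansion C (3 + k) \<rho> L (hball x r) (\<lambda>h. kE k (s + u h + v h))"
    proof (rule C[OF L \<rho>])
      show "u \<in> hpolys 1" unfolding u_def[abs_def] by (intro hpolys_minus hpolys_scaleR hpolys_hip_translate)
      show "v \<in> hpolys 2" unfolding v_def[abs_def] by (intro hpolys_qcnj hpolys_wq_translate)
      show "\<forall>h\<in>hball x r. norm (u h) \<le> \<rho> * L"
      proof
        fix h assume h: "h \<in> hball x r"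
        have "norm (hip (snd (hmult (hinv x) h)) (snd w)) \<le> r * D"
          using norm_hip_le[of "snd (hmult (hinv x) h)" "snd w"] norm_snd_le_hnorm[of w] norm_snd_le_hnorm[of "hmult (hinv x) h"] nb[OF h] r
          by (elim order_trans) (intro mult_mono, auto simp: nw)
        then show "norm (u h) \<le> \<rho> * L" using D by (simp add: u_def \<rho>_def L_def power2_eq_square mult.commute)
      qed
      show "\<forall>h\<in>hball x r. norm (v h) \<le> \<rho>\<^sup>2 * L"
      proof
        fix h assume h: "h \<in> hball x r"
        have "norm (v h) \<le> r\<^sup>2" using nb[OF h] by (simp add: v_def norm_wq power_mono)
        also have "\<dots> \<le> 8 * r\<^sup>2" by simp
        also have "\<dots> = \<rho>\<^sup>2 * L" using D by (simp add: \<rho>_def L_def power2_eq_square)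
        finally show "norm (v h) \<le> \<rho>\<^sup>2 * L" .
      qed
    qed
    then obtain P where P: "\<And>j. P j \<in> hpolys (int j)"
      "\<And>n h. h \<in> hball x r \<Longrightarrow> norm (P n h) \<le> C n * \<rho> ^ n * inverse L ^ (3 + k)"
      "\<And>n h. h \<in> hball x r \<Longrightarrow> norm (kE k (s + u h + v h) - (\<Sum>j<n. P j h)) \<le> C n * \<rho> ^ n * inverse L ^ (3 + k)"
      unfolding expansion_def by blast
    have [measurable]: "f \<in> borel_measurable borel" using f by (simp add: unitf_def)
    have iP: "integrable lborel (\<lambda>h. P j h * f h)" for j
    proof (rule Bochner_Integration.integrable_bound)
      show "integrable lborel (\<lambda>h. (C j * \<rho> ^ j * inverse L ^ (3 + k)) * indicator (hball x r) h)"
        by (intro integrable_mult_right hball_indicator_integral(1)[OF r])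
      have [measurable]: "P j \<in> borel_measurable borel" by (rule borel_measurable_continuous_onI[OF hpolys_continuous[OF P(1)]])
      show "(\<lambda>h. P j h * f h) \<in> borel_measurable lborel" by measurable
      show "AE h in lborel. norm (P j h * f h) \<le> norm ((C j * \<rho> ^ j * inverse L ^ (3 + k)) * indicator (hball x r) h)"
      proof (rule AE_I2)
        fix h
        show "norm (P j h * f h) \<le> norm ((C j * \<rho> ^ j * inverse L ^ (3 + k)) * indicator (hball x r) h)"
        proof (cases "h \<in> hball x r")
          case True
          have "norm (P j h) * norm (f h) \<le> (C j * \<rho> ^ j * inverse L ^ (3 + k)) * 1"
            using P(2)[OF True, of j] unitf_norm_le_indicator[OF f, of h] True C0[of j] \<rho> L by (intro mult_mono) auto
          then show ?thesis using True by (simp add: norm_mult)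
        next
          case False
          then have "f h = 0" using unitf_norm_le_indicator[OF f, of h] by simp
          then show ?thesis by simp
        qed
      qed
    qed
    have z: "(\<integral>h. P j h * f h \<partial>lborel) = 0" if "j < N" for j
      using mom hpolys_mono[OF P(1)[of j], of "int N - 1"] that by simp
    define R where "R h = (kE k (s + u h + v h) - (\<Sum>j<N. P j h)) * f h" for h
    have R_eq: "R h = ker \<epsilon> (hmult (hinv h) g) * f h - (\<Sum>j<N. P j h * f h)" for h
      by (simp add: R_def ker left_diff_distrib sum_distrib_right)
    have iR: "integrable lborel R"
      unfolding R_eq by (intro Bochner_Integration.integrable_diff Top_integrable unitf_bbs[OF f] e Bochner_Integration.integrable_sum iP)
    have "(\<integral>h. R h \<partial>lborel) = Top \<epsilon> f g"
    proof -
      have "(\<integral>h. R h \<partial>lborel) = (\<integral>h. ker \<epsilon> (hmult (hinv h) g) * f h \<partial>lborel) - (\<integral>h. (\<Sum>j<N. P j h * f h) \<partial>lborel)"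
        unfolding R_eq by (intro Bochner_Integration.integral_diff Top_integrable unitf_bbs[OF f] e Bochner_Integration.integrable_sum iP)
      also have "(\<integral>h. (\<Sum>j<N. P j h * f h) \<partial>lborel) = 0"
        by (subst Bochner_Integration.integral_sum) (auto simp: iP z)
      finally show ?thesis by (simp add: Top_def)
    qed
    define E where "E = C N * \<rho> ^ N * inverse L ^ (3 + k)"
    have E: "E \<ge> 0" using C0[of N] \<rho> L by (simp add: E_def)
    have "norm (Top \<epsilon> f g) \<le> (\<integral>h. norm (R h) \<partial>lborel)"
      unfolding \<open>(\<integral>h. R h \<partial>lborel) = Top \<epsilon> f g\<close>[symmetric] by (rule integral_norm_bound)
    also have "\<dots> \<le> (\<integral>h. E * indicator (hball x r) h \<partial>lborel)"
    proof (rule integral_mono)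
      show "norm (R h) \<le> E * indicator (hball x r) h" for h
      proof (cases "h \<in> hball x r")
        case True
        have "norm (R h) \<le> E * 1"
          unfolding R_def norm_mult E_def using P(3)[OF True, of N] unitf_norm_le_indicator[OF f, of h] True C0[of N] \<rho> L by (intro mult_mono) auto
        then show ?thesis using True by simp
      next
        case False
        then have "f h = 0" using unitf_norm_le_indicator[OF f, of h] by simp
        then show ?thesis using False by (simp add: R_def)
      qed
    qed (intro integrable_norm iR integrable_mult_right hball_indicator_integral(1)[OF r])+
    also have "\<dots> \<le> E * (vball TYPE('m) * r ^ Q)"
      using hball_indicator_integral(2)[OF r, of x] E by (simp add: Q_def mult_left_mono)
    also have "\<dots> = c * (r / D) ^ (Q + N)"
    proof -
      have iL: "inverse L = 2 * (inverse D)\<^sup>2" using D by (simp add: L_def field_simps)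
      have "inverse L ^ (3 + k) = 2 ^ (3 + k) * inverse D ^ Q"
        unfolding iL power_mult_distrib Qd power_mult by simp
      moreover have "\<rho> ^ N = 4 ^ N * (r ^ N * inverse D ^ N)"
        unfolding \<rho>_def divide_inverse power_mult_distrib by (simp only: mult.assoc)
      moreover have "(r / D) ^ (Q + N) = r ^ Q * inverse D ^ Q * (r ^ N * inverse D ^ N)"
        unfolding divide_inverse power_add power_mult_distrib ..
      ultimately show ?thesis
        unfolding E_def c_def by (simp only: mult_ac)
    qed
    also have "\<dots> \<le> (c + 1) * (r / D) ^ (Q + N)" using D r by (intro mult_right_mono) auto
    finally show "norm (Top \<epsilon> f g) \<le> (c + 1) * (r / hdist x g) ^ (qdim TYPE('m) + N)" by (simp add: D_def Q_def)
  qed (use c in auto)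
qed

text \<open>The ball of radius \<open>16 * r\<close> also contains the support, so the local bound
  covers it. Outside, the power of the image decays with exponent \<open>p * (Q + N)\<close>, whose
  excess over \<open>Q\<close> makes the integral converge. Both contributions scale like
  \<open>r ^ Q\<close>.\<close>

lemma Top_Lp:
  assumes p: "p > 0" and N: "p * real (qdim TYPE('m::finite) + N) > real (qdim TYPE('m))"
  shows "\<exists>C>0. \<forall>\<epsilon>>0. \<forall>r>0. \<forall>x. \<forall>f :: 'm heis \<Rightarrow> quat. unitf x r f \<longrightarrow>
     (\<forall>P\<in>hpolys (int N - 1). (\<integral>h. P h * f h \<partial>lborel) = 0) \<longrightarrow>
     (\<integral>\<^sup>+g. ennreal (norm (Top \<epsilon> f g) powr p) \<partial>lborel) \<le> ennreal (C * r ^ qdim TYPE('m))"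
proof -
  define Q where "Q = qdim TYPE('m)"
  define s where "s = p * real (Q + N)"
  define \<delta> where "\<delta> = s - real Q"
  have \<delta>: "\<delta> > 0" using N by (simp add: \<delta>_def s_def Q_def)
  obtain M where M: "M > 0" "\<forall>\<epsilon>>0. \<forall>r>0. \<forall>x. \<forall>f :: 'm heis \<Rightarrow> quat. unitf x r f \<longrightarrow>
     (\<integral>\<^sup>+g. ennreal (indicator (hball x r) g * norm (Top \<epsilon> f g) powr p) \<partial>lborel) \<le> ennreal (M * r ^ Q)"
    using Top_local_Lp[OF p, where 'm = 'm] unfolding Q_def[symmetric] by (elim exE conjE) rule
  obtain C where C: "C > 0" "\<forall>\<epsilon>>0. \<forall>r>0. \<forall>x g. \<forall>f :: 'm heis \<Rightarrow> quat. unitf x r f \<longrightarrow>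
     (\<forall>P\<in>hpolys (int N - 1). (\<integral>h. P h * f h \<partial>lborel) = 0) \<longrightarrow> 16 * r \<le> hdist x g \<longrightarrow>
     norm (Top \<epsilon> f g) \<le> C * (r / hdist x g) ^ (Q + N)"
    using Top_far[of N, where 'm = 'm] unfolding Q_def[symmetric] by (elim exE conjE) rule
  obtain K where K: "K > 0" "\<forall>x::'m heis. \<forall>\<rho>>0. (\<integral>\<^sup>+g. ennreal ((\<rho> + hdist x g) powr (-(real Q + \<delta>))) \<partial>lborel) \<le> ennreal (K * \<rho> powr (- \<delta>))"
    using nn_integral_hnorm_decay[OF \<delta>, where 'm = 'm] unfolding Q_def[symmetric] by (elim exE conjE) rule
  define c where "c = C powr p * 2 powr s"
  have c: "c > 0" using C(1) by (simp add: c_def)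
  show ?thesis
  proof (intro exI[of _ "M * 16 ^ Q + c * K"] conjI allI impI)
    show "M * 16 ^ Q + c * K > 0" using M(1) K(1) c by (intro add_pos_pos mult_pos_pos) auto
    fix \<epsilon> r :: real and x and f :: "'m heis \<Rightarrow> quat"
    assume e: "\<epsilon> > 0" and r: "r > 0" and f: "unitf x r f" and mom: "\<forall>P\<in>hpolys (int N - 1). (\<integral>h. P h * f h \<partial>lborel) = 0"
    have r16: "16 * r > 0" using r by simp
    have f16: "unitf x (16 * r) f"
    proof -
      have "hball x r \<subseteq> hball x (16 * r)" unfolding hball_eq using r by auto
      then show ?thesis using f unfolding unitf_def by blast
    qed
    have [measurable]: "Top \<epsilon> f \<in> borel_measurable borel" by (rule Top_measurable[OF unitf_bbs[OF f] e])
    have pt: "norm (Top \<epsilon> f g) powr p \<le> indicator (hball x (16 * r)) g * norm (Top \<epsilon> f g) powr p + c * r powr s * (r + hdist x g) powr (-(real Q + \<delta>))" for g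
    proof (cases "g \<in> hball x (16 * r)")
      case False
      define D where "D = hdist x g"
      have D: "16 * r \<le> D" "D > 0" using False r by (auto simp: hball_eq D_def not_less)
      have "norm (Top \<epsilon> f g) powr p \<le> (C * (r / D) ^ (Q + N)) powr p"
      proof (rule powr_mono2)
        show "norm (Top \<epsilon> f g) \<le> C * (r / D) ^ (Q + N)"
          unfolding D_def by (rule C(2)[rule_format, OF e r f _ D(1)[unfolded D_def]]) (use mom in blast)
      qed (use p in auto)
      also have "\<dots> = C powr p * ((r / D) ^ (Q + N)) powr p" using C(1) D r by (intro powr_mult)
      also have "((r / D) ^ (Q + N)) powr p = (r / D) powr s"
      proof -
        have "(r / D) ^ (Q + N) = (r / D) powr real (Q + N)" by (rule powr_realpow[symmetric]) (use D r in simp)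
        then show ?thesis by (simp only: powr_powr s_def mult.commute[of p])
      qed
      \<comment> \<open>Passes from \<open>D\<close> to \<open>r + D\<close>, the form in which the
        decay integral is available on the whole group.\<close>
      also have "\<dots> \<le> (2 * r / (r + D)) powr s"
      proof (rule powr_mono2)
        have "r / D \<le> r / ((r + D) / 2)" by (rule divide_left_mono) (use D r in auto)
        then show "r / D \<le> 2 * r / (r + D)" by (simp add: mult.commute)
        show "0 \<le> s" using p by (simp add: s_def)
      qed (use D r in simp)
      also have "\<dots> = 2 powr s * r powr s * (r + D) powr (- s)"
        using D r by (simp add: powr_divide powr_mult powr_minus_divide)
      also have "s = real Q + \<delta>" by (simp add: \<delta>_def)
      finally have "norm (Top \<epsilon> f g) powr p \<le> C powr p * (2 powr (real Q + \<delta>) * r powr (real Q + \<delta>) * (r + D) powr (-(real Q + \<delta>)))"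
        using C(1) by simp
      then show ?thesis using False by (simp add: c_def D_def \<delta>_def mult_ac)
    qed (use c in simp)
    have "(\<integral>\<^sup>+g. ennreal (norm (Top \<epsilon> f g) powr p) \<partial>lborel)
      \<le> (\<integral>\<^sup>+g. ennreal (indicator (hball x (16 * r)) g * norm (Top \<epsilon> f g) powr p) + ennreal (c * r powr s) * ennreal ((r + hdist x g) powr (-(real Q + \<delta>))) \<partial>lborel)"
      using pt c by (intro nn_integral_mono) (simp add: ennreal_mult[symmetric] ennreal_plus[symmetric] ennreal_leI del: ennreal_plus)
    also have "\<dots> = (\<integral>\<^sup>+g. ennreal (indicator (hball x (16 * r)) g * norm (Top \<epsilon> f g) powr p) \<partial>lborel)
       + ennreal (c * r powr s) * (\<integral>\<^sup>+g. ennreal ((r + hdist x g) powr (-(real Q + \<delta>))) \<partial>lborel)"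
      by (subst nn_integral_add) (auto simp: nn_integral_cmult)
    also have "\<dots> \<le> ennreal (M * (16 * r) ^ Q) + ennreal (c * r powr s) * ennreal (K * r powr (- \<delta>))"
      by (intro add_mono mult_left_mono M(2)[rule_format, OF e r16 f16] K(2)[rule_format, OF r]) auto
    also have "\<dots> = ennreal (M * (16 * r) ^ Q + c * r powr s * (K * r powr (- \<delta>)))"
      using M(1) c K(1) r by (simp add: ennreal_mult[symmetric] ennreal_plus[symmetric] del: ennreal_plus)
    also have "c * r powr s * (K * r powr (- \<delta>)) = c * K * (r powr s * r powr (- \<delta>))" by simp
    also have "r powr s * r powr (- \<delta>) = r ^ Q" using r by (simp add: \<delta>_def powr_realpow flip: powr_add)
    finally show "(\<integral>\<^sup>+g. ennreal (norm (Top \<epsilon> f g) powr p) \<partial>lborel) \<le> ennreal ((M * 16 ^ Q + c * K) * r ^ qdim TYPE('m))"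
      by (simp add: Q_def power_mult_distrib algebra_simps)
  qed
qed

section \<open>Regularity\<close>

definition sarg :: "'m::finite siegel \<Rightarrow> 'm heis \<Rightarrow> quat" where
  "sarg x h = fst x *\<^sub>R 1 + wq (hmult (hinv h) (snd x))"

definition Dsarg :: "'m::finite siegel \<Rightarrow> 'm heis \<Rightarrow> 'm siegel \<Rightarrow> quat" where
  "Dsarg x h v = (fst v + 2 * inner (snd (snd x)) (snd (snd v))) *\<^sub>R 1 + quat_of_t (fst (snd v)) - 2 *\<^sub>R hip (snd h) (snd (snd v))"

lemma siegel_iff: "x \<in> siegel \<longleftrightarrow> fst x > 0"
  by (simp add: siegel_def mem_Times_iff)

lemma open_siegel: "open (siegel :: 'm::finite siegel set)"
proof -
  have "open {x :: 'm siegel. 0 < fst x}"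
    by (intro open_Collect_less continuous_intros)
  also have "{x :: 'm siegel. 0 < fst x} = siegel" by (rule set_eqI) (simp add: siegel_iff del: split_paired_All)
  finally show ?thesis .
qed

lemma sarg_nonzero: "x \<in> siegel \<Longrightarrow> sarg x h \<noteq> 0"
  unfolding sarg_def siegel_iff by (rule eps_wq_lower(2))

lemma sarg_has_derivative: "((\<lambda>x. sarg x h) has_derivative Dsarg x h) (at x within S)"
proof -
  have eq: "sarg x h = fst x *\<^sub>R 1 + (qcnj (wq h) + (inner (snd (snd x)) (snd (snd x)) *\<^sub>R 1 + quat_of_t (fst (snd x))) - 2 *\<^sub>R hip (snd h) (snd (snd x)))" for x
    unfolding sarg_def wq_hmult wq_hinv by (simp add: wq_def[of "snd x"] hinv_def power2_norm_eq_inner)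
  show ?thesis unfolding eq Dsarg_def[abs_def]
    by (auto intro!: derivative_eq_intros simp: inner_commute algebra_simps)
qed

lemma continuous_on_sarg [continuous_intros]:
  "continuous_on S f \<Longrightarrow> continuous_on S g \<Longrightarrow> continuous_on S (\<lambda>z. sarg (f z) (g z))"
  unfolding sarg_def by (intro continuous_intros)

lemma continuous_on_dE_both:
  assumes "continuous_on S w" "continuous_on S \<sigma>" "\<And>s. s \<in> S \<Longrightarrow> \<sigma> s \<noteq> 0"
  shows "continuous_on S (\<lambda>s. dE k (w s) (\<sigma> s))"
proof -
  have "dE k (w s) (\<sigma> s) = (\<Sum>b\<in>Basis. inner (w s) b *\<^sub>R dE k b (\<sigma> s))" if "s \<in> S" for s
    by (subst (1) euclidean_representation[of "w s", symmetric])
       (simp only: linear_sum[OF linear_dE[OF assms(3)[OF that]]] linear_scale[OF linear_dE[OF assms(3)[OF that]]])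
  then show ?thesis
    by (simp only: cong: continuous_on_cong) (intro continuous_intros continuous_on_kE_comp(2) assms)
qed

lemma continuous_on_Dsarg:
  "continuous_on S f \<Longrightarrow> continuous_on S g \<Longrightarrow> continuous_on S (\<lambda>z. Dsarg (f z) (g z) v)"
  unfolding Dsarg_def by (intro continuous_intros)

text \<open>Near \<open>x0\<close> the height stays above half its value, which keeps the argument
  of the kernel away from 0, and the bounded support of \<open>f\<close> controls the growth in
  \<open>h\<close> of the derivative of the argument. One majorant for a whole neighbourhood serves
  differentiability and continuity of the derivative.\<close>

lemma Top_derivative_bound:
  fixes f :: "'m::finite heis \<Rightarrow> quat" and x0 :: "'m siegel"
  assumes f: "bbs f" and x0: "x0 \<in> siegel"
  obtains \<delta> G where "\<delta> > 0" "ball x0 \<delta> \<subseteq> siegel" "integrable lborel G"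
    "\<And>x h v. x \<in> ball x0 \<delta> \<Longrightarrow> norm (dE (2 * CARD('m)) (Dsarg x h v) (sarg x h) * f h) \<le> G h * norm v"
proof -
  define k where "k = 2 * CARD('m)"
  obtain C where C: "C > 0" "\<And>\<sigma> v. \<sigma> \<noteq> 0 \<Longrightarrow> norm (dE k v \<sigma>) \<le> C * norm v * inverse (norm \<sigma>) ^ (4 + k)"
    using dE_bound[of k] by blast
  obtain R where R: "\<And>h. f h \<noteq> 0 \<Longrightarrow> hnorm h \<le> R" using f unfolding bbs_def by blast
  define e where "e = fst x0"
  define Y where "Y = norm (snd (snd x0)) + 1"
  define K where "K = 2 + 2 * Y + 2 * \<bar>R\<bar>"
  define \<delta> where "\<delta> = min (e / 2) 1"
  define G where "G h = C * K * inverse (e / 4) ^ (4 + k) * norm (f h)" for h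
  have e: "e > 0" using x0 by (simp add: e_def siegel_iff)
  have near: "fst x \<ge> e / 2" "norm (snd (snd x)) \<le> Y" if "x \<in> ball x0 \<delta>" for x
  proof -
    have "norm (fst (x0 - x)) \<le> norm (x0 - x)" by (metis norm_fst_le prod.collapse)
    moreover have d: "norm (x0 - x) < \<delta>" using that by (simp add: dist_norm)
    ultimately have "\<bar>fst x0 - fst x\<bar> < e / 2" by (simp add: \<delta>_def)
    then show "fst x \<ge> e / 2" unfolding e_def by linarith
    have "norm (snd (snd (x0 - x))) \<le> norm (snd (x0 - x))" by (metis norm_snd_le prod.collapse)
    also have "\<dots> \<le> norm (x0 - x)" by (metis norm_snd_le prod.collapse)
    finally have "norm (snd (snd x0) - snd (snd x)) < 1" using d by (simp add: \<delta>_def)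
    then show "norm (snd (snd x)) \<le> Y" using norm_triangle_ineq2[of "snd (snd x)" "snd (snd x0)"] by (simp add: Y_def norm_minus_commute)
  qed
  have Y: "Y \<ge> 0" by (simp add: Y_def)
  show ?thesis
  proof (rule that)
    show "\<delta> > 0" using e by (simp add: \<delta>_def)
    show "ball x0 \<delta> \<subseteq> siegel"
    proof
      fix x assume "x \<in> ball x0 \<delta>"
      from near(1)[OF this] e show "x \<in> siegel" by (simp add: siegel_iff)
    qed
    show "integrable lborel G" unfolding G_def[abs_def] using bbs_integrable(1)[OF f] by simp
    fix x h v assume x: "x \<in> ball x0 \<delta>"
    have ex: "fst x > 0" using near(1)[OF x] e by simp
    have low: "e / 4 \<le> norm (sarg x h)"
    proof -
      have "fst x / 2 \<le> (fst x + (hnorm (hmult (hinv h) (snd x)))\<^sup>2) / 2" by simp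
      also have "\<dots> \<le> norm (sarg x h)" unfolding sarg_def by (rule eps_wq_lower(1)[OF ex])
      finally show ?thesis using near(1)[OF x] by simp
    qed
    show "norm (dE (2 * CARD('m)) (Dsarg x h v) (sarg x h) * f h) \<le> G h * norm v"
    proof (cases "f h = 0")
      case False
      have yh: "norm (snd h) \<le> \<bar>R\<bar>" using R[OF False] norm_snd_le_hnorm[of h] by linarith
      have v1: "\<bar>fst v\<bar> \<le> norm v" "norm (snd v) \<le> norm v" using norm_fst_le[of "fst v" "snd v"] norm_snd_le[of "snd v" "fst v"] by auto
      have v2: "norm (fst (snd v)) \<le> norm v" "norm (snd (snd v)) \<le> norm v"
        using v1(2) norm_fst_le[of "fst (snd v)" "snd (snd v)"] norm_snd_le[of "snd (snd v)" "fst (snd v)"] by auto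
      have "\<bar>inner (snd (snd x)) (snd (snd v))\<bar> \<le> Y * norm v"
        using Cauchy_Schwarz_ineq2[of "snd (snd x)" "snd (snd v)"] mult_mono[OF near(2)[OF x] v2(2) Y norm_ge_zero] by linarith
      moreover have "norm (hip (snd h) (snd (snd v))) \<le> \<bar>R\<bar> * norm v"
        using norm_hip_le[of "snd h" "snd (snd v)"] mult_mono[OF yh v2(2) abs_ge_zero norm_ge_zero] by linarith
      moreover have "norm (Dsarg x h v) \<le> (\<bar>fst v\<bar> + 2 * \<bar>inner (snd (snd x)) (snd (snd v))\<bar>) + norm (fst (snd v)) + 2 * norm (hip (snd h) (snd (snd v)))"
        unfolding Dsarg_def
        by (intro order_trans[OF norm_triangle_ineq4] add_mono order_trans[OF norm_triangle_ineq]) (simp_all add: abs_triangle_ineq[THEN order_trans])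
      ultimately have Dv: "norm (Dsarg x h v) \<le> K * norm v"
        using v1(1) v2(1) by (simp add: K_def algebra_simps)
      have "norm (dE k (Dsarg x h v) (sarg x h)) \<le> C * norm (Dsarg x h v) * inverse (norm (sarg x h)) ^ (4 + k)"
        using low e by (intro C(2)) auto
      also have "\<dots> \<le> C * (K * norm v) * inverse (e / 4) ^ (4 + k)"
        using low e C(1) Dv Y by (intro mult_mono power_mono le_imp_inverse_le) (auto simp: K_def)
      finally have "norm (dE k (Dsarg x h v) (sarg x h)) * norm (f h) \<le> (C * (K * norm v) * inverse (e / 4) ^ (4 + k)) * norm (f h)"
        by (rule mult_right_mono) simp
      then show ?thesis unfolding norm_mult G_def k_def[symmetric] by (simp only: mult_ac)
    qed (simp add: G_def)
  qed
qed

definition dTop :: "('m::finite heis \<Rightarrow> quat) \<Rightarrow> 'm siegel \<Rightarrow> 'm siegel \<Rightarrow> quat" where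
  "dTop f x v = (\<integral>h. dE (2 * CARD('m)) (Dsarg x h v) (sarg x h) * f h \<partial>lborel)"

lemma dTop_measurable:
  fixes f :: "'m::finite heis \<Rightarrow> quat"
  assumes f: "bbs f" and x: "x \<in> siegel"
  shows "(\<lambda>h. dE (2 * CARD('m)) (Dsarg x h v) (sarg x h) * f h) \<in> borel_measurable lborel"
proof -
  have [measurable]: "f \<in> borel_measurable borel" using f by (simp add: bbs_def)
  have "continuous_on UNIV (\<lambda>h. dE (2 * CARD('m)) (Dsarg x h v) (sarg x h))"
    by (intro continuous_on_dE_both continuous_on_Dsarg continuous_intros sarg_nonzero x)
  then have [measurable]: "(\<lambda>h. dE (2 * CARD('m)) (Dsarg x h v) (sarg x h)) \<in> borel_measurable borel"
    by (rule borel_measurable_continuous_onI)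
  show ?thesis by measurable
qed

lemma dTop_integrable:
  fixes f :: "'m::finite heis \<Rightarrow> quat"
  assumes f: "bbs f" and x: "x \<in> siegel"
  shows "integrable lborel (\<lambda>h. dE (2 * CARD('m)) (Dsarg x h v) (sarg x h) * f h)"
proof -
  obtain \<delta> G where G: "\<delta> > 0" "ball x \<delta> \<subseteq> siegel" "integrable lborel G"
    "\<And>x' h v. x' \<in> ball x \<delta> \<Longrightarrow> norm (dE (2 * CARD('m)) (Dsarg x' h v) (sarg x' h) * f h) \<le> G h * norm v"
    by (rule Top_derivative_bound[OF f x]) blast
  have xb: "x \<in> ball x \<delta>" using G(1) by simp
  show ?thesis
    by (rule Bochner_Integration.integrable_bound[of lborel "\<lambda>h. G h * norm v"])
       (use G(3) dTop_measurable[OF f x] order_trans[OF G(4)[OF xb] abs_ge_self] in \<open>auto intro!: AE_I2\<close>)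
qed

lemma Top_has_derivative:
  fixes f :: "'m::finite heis \<Rightarrow> quat"
  assumes f: "bbs f" and x: "x \<in> siegel"
  shows "((\<lambda>x. Top (fst x) f (snd x)) has_derivative dTop f x) (at x)"
proof -
  define k where "k = 2 * CARD('m)"
  obtain \<delta> G where G: "\<delta> > 0" "ball x \<delta> \<subseteq> siegel" "integrable lborel G"
    "\<And>x' h v. x' \<in> ball x \<delta> \<Longrightarrow> norm (dE (2 * CARD('m)) (Dsarg x' h v) (sarg x' h) * f h) \<le> G h * norm v"
    by (rule Top_derivative_bound[OF f x]) blast
  have eq: "ker (fst x) (hmult (hinv h) (snd x)) = kE k (sarg x h)" for x :: "'m siegel" and h
    by (simp add: ker_def sarg_def k_def)
  have "((\<lambda>x. \<integral>h. kE k (sarg x h) * f h \<partial>lborel) has_derivative (\<lambda>v. \<integral>h. dE k (Dsarg x h v) (sarg x h) * f h \<partial>lborel)) (at x within ball x \<delta>)"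
  proof (rule has_derivative_integral_param[OF _ _ _ G(3)])
    show "convex (ball x \<delta>)" "x \<in> ball x \<delta>" using G(1) by auto
    show "integrable lborel (\<lambda>h. dE k (Dsarg x h v) (sarg x h) * f h)" for v
      unfolding k_def by (rule dTop_integrable[OF f x])
    fix x' h assume x': "x' \<in> ball x \<delta>"
    then have sx: "x' \<in> siegel" using G(2) by blast
    show "integrable lborel (\<lambda>h. kE k (sarg x' h) * f h)"
      unfolding eq[symmetric] by (rule Top_integrable[OF f]) (use sx in \<open>simp add: siegel_iff\<close>)
    show "((\<lambda>x. kE k (sarg x h) * f h) has_derivative (\<lambda>v. dE k (Dsarg x' h v) (sarg x' h) * f h)) (at x' within ball x \<delta>)"
      by (intro has_derivative_mult_left kE_compose_derivative sarg_has_derivative sarg_nonzero sx)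
    show "norm (dE k (Dsarg x' h v) (sarg x' h) * f h) \<le> G h * norm v" for v
      unfolding k_def by (rule G(4)[OF x'])
  qed
  then show ?thesis
    using G(1) unfolding Top_def eq dTop_def[abs_def] k_def by (simp add: at_within_open[of _ "ball x \<delta>"])
qed

lemma dTop_continuous:
  fixes f :: "'m::finite heis \<Rightarrow> quat"
  assumes f: "bbs f"
  shows "continuous_on siegel (\<lambda>x. dTop f x v)"
  unfolding continuous_on_sequentially
proof (intro allI ballI impI)
  fix X :: "nat \<Rightarrow> 'm siegel" and a assume a: "a \<in> siegel" and X: "(\<forall>n. X n \<in> siegel) \<and> X \<longlonglongrightarrow> a"
  obtain \<delta> G where G: "\<delta> > 0" "ball a \<delta> \<subseteq> siegel" "integrable lborel G"
    "\<And>x' h v. x' \<in> ball a \<delta> \<Longrightarrow> norm (dE (2 * CARD('m)) (Dsarg x' h v) (sarg x' h) * f h) \<le> G h * norm v"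
    by (rule Top_derivative_bound[OF f a]) blast
  have "eventually (\<lambda>n. X n \<in> ball a \<delta>) sequentially"
    using X G(1) by (intro topological_tendstoD[of X a]) auto
  then obtain N where N: "\<And>n. n \<ge> N \<Longrightarrow> X n \<in> ball a \<delta>" unfolding eventually_sequentially by blast
  have "(\<lambda>n. \<integral>h. dE (2 * CARD('m)) (Dsarg (X (n + N)) h v) (sarg (X (n + N)) h) * f h \<partial>lborel)
     \<longlonglongrightarrow> (\<integral>h. dE (2 * CARD('m)) (Dsarg a h v) (sarg a h) * f h \<partial>lborel)"
  proof (rule integral_dominated_convergence[where w = "\<lambda>h. G h * norm v"])
    show "AE h in lborel. (\<lambda>n. dE (2 * CARD('m)) (Dsarg (X (n + N)) h v) (sarg (X (n + N)) h) * f h)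
      \<longlonglongrightarrow> dE (2 * CARD('m)) (Dsarg a h v) (sarg a h) * f h"
    proof (rule AE_I2)
      fix h
      have c: "continuous_on siegel (\<lambda>x. dE (2 * CARD('m)) (Dsarg x h v) (sarg x h) * f h)"
        by (intro continuous_intros continuous_on_dE_both continuous_on_Dsarg sarg_nonzero)
      have l: "(\<lambda>n. X (n + N)) \<longlonglongrightarrow> a" using X by (intro LIMSEQ_ignore_initial_segment) blast
      show "(\<lambda>n. dE (2 * CARD('m)) (Dsarg (X (n + N)) h v) (sarg (X (n + N)) h) * f h)
        \<longlonglongrightarrow> dE (2 * CARD('m)) (Dsarg a h v) (sarg a h) * f h"
        by (rule continuous_on_tendsto_compose[OF c l a]) (intro always_eventually allI, use X in blast)
    qed
    show "AE h in lborel. norm (dE (2 * CARD('m)) (Dsarg (X (n + N)) h v) (sarg (X (n + N)) h) * f h) \<le> G h * norm v" for n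
      by (intro AE_I2 G(4) N) simp
    show "integrable lborel (\<lambda>h. G h * norm v)" using G(3) by simp
    show "(\<lambda>h. dE (2 * CARD('m)) (Dsarg (X (n + N)) h v) (sarg (X (n + N)) h) * f h) \<in> borel_measurable lborel" for n
      using X by (intro dTop_measurable[OF f]) blast
  qed (rule dTop_measurable[OF f a])
  then have "(\<lambda>n. dTop f (X (n + N)) v) \<longlonglongrightarrow> dTop f a v" by (simp add: dTop_def)
  then have "(\<lambda>n. dTop f (X n) v) \<longlonglongrightarrow> dTop f a v" by (rule LIMSEQ_offset)
  then show "((\<lambda>x. dTop f x v) \<circ> X) \<longlonglongrightarrow> dTop f a v" by (simp add: comp_def)
qed

text \<open>In coordinates the rotated operator is \<open>qcnj p\<close> times the original one. It
  is the form that occurs along horizontal fields, which move the argument of the kernel by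
  \<open>p * e\<close> for a unit \<open>e\<close>, with \<open>p\<close> depending on the
  point.\<close>

lemma rotated_regular:
  fixes D :: "quat \<Rightarrow> quat"
  assumes lin: "linear D" and reg: "D 1 + qi * D qi + qj * D qj + qk * D qk = 0"
  shows "D (p * 1) + qi * D (p * qi) + qj * D (p * qj) + qk * D (p * qk) = 0"
proof -
  have e: "D w = qRe w *\<^sub>R D 1 + qIm1 w *\<^sub>R D qi + qIm2 w *\<^sub>R D qj + qIm3 w *\<^sub>R D qk" for w by (rule linear_quat_expand[OF lin])
  have "D (p * 1) + qi * D (p * qi) + qj * D (p * qj) + qk * D (p * qk) = qcnj p * (D 1 + qi * D qi + qj * D qj + qk * D qk)"
    unfolding e[of "p * _"] by (simp add: quat_eq_iff algebra_simps)
  then show ?thesis by (simp add: reg)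
qed

lemma hform_ybasis: "hform y (ybasis l j) $ \<alpha> = 2 * (\<Sum>k\<in>UNIV. bmat \<alpha> $ k $ j * y $ l $ k)"
proof -
  have "(\<Sum>l'\<in>UNIV. \<Sum>j'\<in>UNIV. \<Sum>k\<in>UNIV. bmat \<alpha> $ k $ j' * y $ l' $ k * ybasis l j $ l' $ j')
     = (\<Sum>l'\<in>UNIV. \<Sum>j'\<in>UNIV. if l' = l then (if j' = j then (\<Sum>k\<in>UNIV. bmat \<alpha> $ k $ j * y $ l $ k) else 0) else 0)"
    by (intro sum.cong) (auto simp: ybasis_def axis_def)
  also have "\<dots> = (\<Sum>l'\<in>UNIV. if l' = l then (\<Sum>k\<in>UNIV. bmat \<alpha> $ k $ j * y $ l $ k) else 0)"
    by (intro sum.cong) (auto simp: sum.delta)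
  also have "\<dots> = (\<Sum>k\<in>UNIV. bmat \<alpha> $ k $ j * y $ l $ k)" by (simp add: sum.delta)
  finally show ?thesis by (simp add: hform_def)
qed

text \<open>The derivative of the squared norm is a Hermitian product plus its conjugate, and the
  twist in the field is the product minus its conjugate; they add up to twice the product. Hence the
  result is a left multiple of the unit belonging to \<open>j\<close>.\<close>

lemma Dsarg_Y: "Dsarg x h (0, hform (snd (snd x)) (ybasis l j), ybasis l j)
   = 2 *\<^sub>R qcnj (quat_of_vec (snd (snd x) $ l - snd h $ l)) * quat_of_vec (axis j 1)"
proof -
  have hy: "hip y (ybasis l j) = qcnj (quat_of_vec (y $ l)) * quat_of_vec (axis j 1)" for y
    using qcnj_hip[of "ybasis l j" y] unfolding hip_ybasis by simp
  let ?y = "snd (snd x)"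
  have "(2 * inner ?y (ybasis l j)) *\<^sub>R 1 = hip ?y (ybasis l j) + hip (ybasis l j) ?y"
  proof -
    have "q + qcnj q = (2 * qRe q) *\<^sub>R 1" for q by (simp add: quat_eq_iff)
    from this[of "hip ?y (ybasis l j)"] show ?thesis by (simp add: qcnj_hip qRe_hip)
  qed
  then have "Dsarg x h (0, hform ?y (ybasis l j), ybasis l j) = 2 *\<^sub>R hip ?y (ybasis l j) - 2 *\<^sub>R hip (snd h) (ybasis l j)"
    by (simp add: Dsarg_def quat_of_t_hform scaleR_2)
  then show ?thesis unfolding hy by (simp add: algebra_simps)
qed

text \<open>The operators multiply derivatives from the left and \<open>f\<close> stands on the
  right of the kernel, so they pass under the integral and meet the left regularity of the kernel,
  in rotated form for the horizontal fields.\<close>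

lemma regular_Top:
  fixes f :: "'m::finite heis \<Rightarrow> quat" and F :: "'m siegel \<Rightarrow> quat"
  assumes f: "bbs f" and F: "\<And>x. x \<in> siegel \<Longrightarrow> F x = d *\<^sub>R Top (fst x) f (snd x)"
  shows "regular F"
proof -
  define k where "k = 2 * CARD('m)"
  have der: "(F has_derivative (\<lambda>v. d *\<^sub>R dTop f x v)) (at x)" if x: "x \<in> siegel" for x
    by (rule has_derivative_transform_within_open[OF has_derivative_scaleR_right[OF Top_has_derivative[OF f x]] open_siegel x])
       (simp add: F)
  have bl: "bounded_linear (\<lambda>v. d *\<^sub>R dTop f x v)" if x: "x \<in> siegel" for x
    using der[OF x] by (rule has_derivative_bounded_linear)
  have "C1_on F siegel"
    unfolding C1_on_def
  proof (intro exI[of _ "\<lambda>x. Blinfun (\<lambda>v. d *\<^sub>R dTop f x v)"] conjI ballI)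
    show "(F has_derivative blinfun_apply (Blinfun (\<lambda>v. d *\<^sub>R dTop f x v))) (at x)" if x: "x \<in> siegel" for x
      using der[OF x] by (simp add: bounded_linear_Blinfun_apply[OF bl[OF x]])
    show "continuous_on siegel (\<lambda>x. Blinfun (\<lambda>v. d *\<^sub>R dTop f x v))"
    proof (rule continuous_on_blinfun_componentwise)
      fix i :: "'m siegel"
      have "continuous_on siegel (\<lambda>x. d *\<^sub>R dTop f x i)" by (intro continuous_intros dTop_continuous[OF f])
      then show "continuous_on siegel (\<lambda>x. blinfun_apply (Blinfun (\<lambda>v. d *\<^sub>R dTop f x v)) i)"
        by (rule continuous_on_eq) (simp add: bounded_linear_Blinfun_apply[OF bl])
    qed
  qed
  moreover have "Qbar0 F x = 0 \<and> (\<forall>l. Qbar l F x = 0)" if x: "x \<in> siegel" for x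
  proof -
    define I where "I v = (\<lambda>h. dE k (Dsarg x h v) (sarg x h) * f h)" for v
    have iI: "integrable lborel (I v)" for v unfolding I_def k_def by (rule dTop_integrable[OF f x])
    have dT: "dTop f x v = (\<integral>h. I v h \<partial>lborel)" for v by (simp add: dTop_def I_def k_def)
    have pd: "pd v F x = d *\<^sub>R (\<integral>h. I v h \<partial>lborel)" for v
      unfolding pd_def frechet_derivative_at[OF der[OF x], symmetric] dT ..
    note nz = sarg_nonzero[OF x]
    have comb: "(\<integral>h. I v1 h \<partial>lborel) + qi * (\<integral>h. I v2 h \<partial>lborel) + qj * (\<integral>h. I v3 h \<partial>lborel) + qk * (\<integral>h. I v4 h \<partial>lborel) = 0"
      if z: "\<And>h. dE k (Dsarg x h v1) (sarg x h) + qi * dE k (Dsarg x h v2) (sarg x h) + qj * dE k (Dsarg x h v3) (sarg x h) + qk * dE k (Dsarg x h v4) (sarg x h) = 0"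
      for v1 v2 v3 v4
    proof -
      have iq: "integrable lborel (\<lambda>h. q * I v h)" "(\<integral>h. q * I v h \<partial>lborel) = q * (\<integral>h. I v h \<partial>lborel)" for q v
        using integrable_bounded_linear[OF bounded_linear_mult_right iI] integral_bounded_linear[OF bounded_linear_mult_right iI] by auto
      have "(\<integral>h. I v1 h \<partial>lborel) + qi * (\<integral>h. I v2 h \<partial>lborel) + qj * (\<integral>h. I v3 h \<partial>lborel) + qk * (\<integral>h. I v4 h \<partial>lborel)
        = (\<integral>h. I v1 h + qi * I v2 h + qj * I v3 h + qk * I v4 h \<partial>lborel)"
        using iI iq(1) by (simp add: iq(2))
      also have "(\<lambda>h. I v1 h + qi * I v2 h + qj * I v3 h + qk * I v4 h) = (\<lambda>h. 0)"
      proof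
        fix h
        have "I v1 h + qi * I v2 h + qj * I v3 h + qk * I v4 h = (dE k (Dsarg x h v1) (sarg x h) + qi * dE k (Dsarg x h v2) (sarg x h) + qj * dE k (Dsarg x h v3) (sarg x h) + qk * dE k (Dsarg x h v4) (sarg x h)) * f h"
          by (simp add: I_def algebra_simps)
        then show "I v1 h + qi * I v2 h + qj * I v3 h + qk * I v4 h = 0" by (simp add: z)
      qed
      finally show ?thesis by simp
    qed
    have pull: "d *\<^sub>R a + qi * (d *\<^sub>R b) + qj * (d *\<^sub>R c) + qk * (d *\<^sub>R e) = d *\<^sub>R (a + qi * b + qj * c + qk * e)" for a b c e :: quat
      by (simp add: algebra_simps)
    have "Qbar0 F x = 0"
      unfolding Qbar0_def pd_t_def pd_tt_def pd pull
    proof (subst comb)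
      fix h
      have "Dsarg x h (1, 0, 0) = 1" "Dsarg x h (0, axis 1 1, 0) = qi" "Dsarg x h (0, axis 2 1, 0) = qj" "Dsarg x h (0, axis 3 1, 0) = qk"
        by (simp_all add: Dsarg_def)
      then show "dE k (Dsarg x h (1, 0, 0)) (sarg x h) + qi * dE k (Dsarg x h (0, axis 1 1, 0)) (sarg x h)
        + qj * dE k (Dsarg x h (0, axis 2 1, 0)) (sarg x h) + qk * dE k (Dsarg x h (0, axis 3 1, 0)) (sarg x h) = 0"
        using kE_left_regular[OF nz, of k h] by simp
    qed simp
    moreover have "Qbar l F x = 0" for l
    proof -
      let ?Y = "\<lambda>j. (0, hform (snd (snd x)) (ybasis l j), ybasis l j) :: 'm siegel"
      \<comment> \<open>By \<open>hform_ybasis\<close> the central coefficients of the field are the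
        components of \<open>hform y (ybasis l j)\<close>, so the field is a single directional
        derivative.\<close>
      have Y: "Yfield l j F x = d *\<^sub>R (\<integral>h. I (?Y j) h \<partial>lborel)" for j
      proof -
        define Ld where "Ld = (\<lambda>v. d *\<^sub>R dTop f x v)"
        have twice: "2 * (\<Sum>\<alpha>\<in>UNIV. \<Sum>k\<in>UNIV. c \<alpha> k *\<^sub>R V \<alpha>) = (\<Sum>\<alpha>\<in>UNIV. (2 * (\<Sum>k\<in>UNIV. c \<alpha> k)) *\<^sub>R V \<alpha>)"
          for c :: "3 \<Rightarrow> 4 \<Rightarrow> real" and V :: "3 \<Rightarrow> quat"
        proof -
          have "2 * q = 2 *\<^sub>R q" for q :: quat by (simp only: scaleR_2 mult_2)
          then show ?thesis by (simp only: scaleR_sum_left[symmetric]) (simp only: scaleR_sum_right scaleR_scaleR)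
        qed
        have lin: "linear Ld" using bl[OF x] unfolding Ld_def by (rule bounded_linear.linear)
        have "?Y j = (0, 0, ybasis l j) + (\<Sum>\<alpha>\<in>UNIV. (hform (snd (snd x)) (ybasis l j) $ \<alpha>) *\<^sub>R (0, axis \<alpha> 1, 0))"
        proof -
          have "(\<Sum>\<alpha>\<in>UNIV. (t $ \<alpha>) *\<^sub>R (0, axis \<alpha> 1, 0)) = ((0, t, 0) :: 'm siegel)" for t :: "real^3"
            by (simp add: sum_3 vec_eq_iff axis_def forall_3)
          from this[of "hform (snd (snd x)) (ybasis l j)"] show ?thesis by (simp only: add_Pair add_0_left add_0_right)
        qed
        then have "Ld (?Y j) = Ld (0, 0, ybasis l j) + (\<Sum>\<alpha>\<in>UNIV. (hform (snd (snd x)) (ybasis l j) $ \<alpha>) *\<^sub>R Ld (0, axis \<alpha> 1, 0))"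
          by (simp only: linear_add[OF lin] linear_sum[OF lin] linear_scale[OF lin])
        also have "\<dots> = Yfield l j F x"
          unfolding Yfield_def twice pd_y_def pd_tt_def pd_def frechet_derivative_at[OF der[OF x], symmetric] hform_ybasis Ld_def by (simp only: ybasis_def)
        finally show ?thesis by (simp add: Ld_def dT)
      qed
      show ?thesis
        unfolding Qbar_def Y pull
      proof (subst comb)
        fix h :: "'m heis"
        have lin: "linear (\<lambda>w. dE k w (sarg x h))" by (rule linear_dE[OF nz])
        have reg: "dE k 1 (sarg x h) + qi * dE k qi (sarg x h) + qj * dE k qj (sarg x h) + qk * dE k qk (sarg x h) = 0"
          by (rule kE_left_regular[OF nz])
        define p where "p = 2 *\<^sub>R qcnj (quat_of_vec (snd (snd x) $ l - snd h $ l))"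
        have "Dsarg x h (?Y 1) = p * 1" "Dsarg x h (?Y 2) = p * qi" "Dsarg x h (?Y 3) = p * qj" "Dsarg x h (?Y 4) = p * qk"
          unfolding Dsarg_Y p_def by simp_all
        then show "dE k (Dsarg x h (?Y 1)) (sarg x h) + qi * dE k (Dsarg x h (?Y 2)) (sarg x h) + qj * dE k (Dsarg x h (?Y 3)) (sarg x h) + qk * dE k (Dsarg x h (?Y 4)) (sarg x h) = 0"
          using rotated_regular[OF lin reg, of p] by (simp only:)
      qed simp
    qed
    ultimately show ?thesis by blast
  qed
  ultimately show ?thesis by (auto simp: regular_def)
qed

section \<open>Atoms\<close>

text \<open>The argument formed by \<open>szego_S\<close> is
  \<open>\<epsilon> + qcnj (wq h) + wq g\<close> minus twice the Hermitian product, which the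
  product formula for \<open>wq\<close> identifies with
  \<open>\<epsilon> + wq (hmult (hinv h) g)\<close>.\<close>

lemma szego_K_eq:
  fixes g h :: "'m::finite heis"
  assumes "\<epsilon> > 0"
  shows "szego_K c (\<epsilon>, g) h = c *\<^sub>R ker \<epsilon> (hmult (hinv h) g)"
proof -
  define \<sigma> where "\<sigma> = \<epsilon> *\<^sub>R 1 + wq (hmult (hinv h) g)"
  have w: "wq (hmult (hinv h) g) = qcnj (wq h) + wq g - 2 *\<^sub>R hip (snd h) (snd g)"
    unfolding wq_hmult wq_hinv by (simp add: hinv_def)
  have "2 * (\<Sum>k\<in>UNIV. qcnj (quat_of_y (snd h) $ k) * quat_of_y (snd g) $ k) = 2 *\<^sub>R hip (snd h) (snd g)"
    by (simp add: hip_def scaleR_2 mult_2)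
  then have \<sigma>: "of_real (\<epsilon> + (norm (snd g))\<^sup>2) + quat_of_t (fst g) + qcnj (of_real ((norm (snd h))\<^sup>2) + quat_of_t (fst h))
     - 2 * (\<Sum>k\<in>UNIV. qcnj (quat_of_y (snd h) $ k) * quat_of_y (snd g) $ k) = \<sigma>"
    unfolding \<sigma>_def w by (simp add: wq_def of_real_def scaleR_add_left)
  have "szego_K c (\<epsilon>, g) h = szego_S c (of_real (\<epsilon> + (norm (snd g))\<^sup>2) + quat_of_t (fst g), quat_of_y (snd g))
     (of_real ((norm (snd h))\<^sup>2) + quat_of_t (fst h), quat_of_y (snd h))"
    by (simp add: szego_K_def case_prod_beta)
  also have "\<dots> = szego_s TYPE('m) c \<sigma>" unfolding szego_S_def fst_conv snd_conv \<sigma> ..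
  also have "\<dots> = c *\<^sub>R kE (2 * CARD('m)) \<sigma>"
    by (rule szego_s_eq) (unfold \<sigma>_def, rule eps_wq_lower(2)[OF assms])
  finally show ?thesis by (simp add: ker_def \<sigma>_def)
qed

lemma szego_op_eq:
  fixes a f :: "'m::finite heis \<Rightarrow> quat"
  assumes f: "bbs f" and a: "a \<in> borel_measurable lebesgue" and af: "AE h in lebesgue. a h = m *\<^sub>R f h" and e: "\<epsilon> > 0"
  shows "szego_op c a (\<epsilon>, g) = (c * m) *\<^sub>R Top \<epsilon> f g"
proof -
  have "continuous_on UNIV (\<lambda>h. kE (2 * CARD('m)) (sarg (\<epsilon>, g) h))"
    by (intro continuous_intros sarg_nonzero) (simp add: siegel_iff e)
  then have "continuous_on UNIV (\<lambda>h. ker \<epsilon> (hmult (hinv h) g))"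
    by (simp add: ker_def sarg_def)
  then have k: "(\<lambda>h. ker \<epsilon> (hmult (hinv h) g)) \<in> borel_measurable borel"
    by (rule borel_measurable_continuous_onI)
  then have k': "(\<lambda>h. ker \<epsilon> (hmult (hinv h) g)) \<in> borel_measurable lebesgue" by (intro measurable_completion) simp
  have fb: "f \<in> borel_measurable borel" using f by (simp add: bbs_def)
  have kf: "(\<lambda>h. ker \<epsilon> (hmult (hinv h) g) * f h) \<in> borel_measurable lborel"
    using borel_measurable_times[OF k fb] by simp
  have "szego_op c a (\<epsilon>, g) = (\<integral>h. c *\<^sub>R ker \<epsilon> (hmult (hinv h) g) * a h \<partial>lebesgue)"
    by (simp add: szego_op_def szego_K_eq[OF e])
  also have "\<dots> = (\<integral>h. (c * m) *\<^sub>R (ker \<epsilon> (hmult (hinv h) g) * f h) \<partial>lebesgue)"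
  proof (rule integral_cong_AE)
    show "(\<lambda>h. c *\<^sub>R ker \<epsilon> (hmult (hinv h) g) * a h) \<in> borel_measurable lebesgue"
      by (intro borel_measurable_times borel_measurable_scaleR borel_measurable_const k' a)
    show "(\<lambda>h. (c * m) *\<^sub>R (ker \<epsilon> (hmult (hinv h) g) * f h)) \<in> borel_measurable lebesgue"
      by (intro borel_measurable_scaleR borel_measurable_const measurable_completion kf)
    show "AE h in lebesgue. c *\<^sub>R ker \<epsilon> (hmult (hinv h) g) * a h = (c * m) *\<^sub>R (ker \<epsilon> (hmult (hinv h) g) * f h)"
      using af by eventually_elim simp
  qed
  also have "\<dots> = (c * m) *\<^sub>R (\<integral>h. ker \<epsilon> (hmult (hinv h) g) * f h \<partial>lebesgue)" by (rule integral_scaleR_right)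
  also have "(\<integral>h. ker \<epsilon> (hmult (hinv h) g) * f h \<partial>lebesgue) = Top \<epsilon> f g"
    unfolding Top_def by (rule integral_completion[OF kf])
  finally show ?thesis .
qed

text \<open>The real-valued statement is applied in each of the four coordinates. It bridges atoms,
  which are Lebesgue measurable, and the Fubini arguments, which are carried out for Borel
  functions.\<close>

lemma lebesgue_AE_eq_borel:
  fixes a :: "'m::finite heis \<Rightarrow> quat"
  assumes a: "a \<in> borel_measurable lebesgue"
  obtains b where "b \<in> borel_measurable borel" "AE h in lebesgue. a h = b h"
proof -
  have "\<forall>i\<in>Basis. \<exists>g\<in>borel_measurable lborel. AE h in lborel. inner (a h) i = (g h :: real)"
    by (intro ballI completion_ex_borel_measurable_real borel_measurable_inner a borel_measurable_const)
  then obtain B where B: "\<forall>i\<in>Basis. B i \<in> borel_measurable lborel \<and> (AE h in lborel. inner (a h) i = (B i h :: real))"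
    unfolding Bex_def by (metis (no_types))
  define b where "b h = (\<Sum>i\<in>Basis. B i h *\<^sub>R i)" for h
  show ?thesis
  proof (rule that[of b])
    show "b \<in> borel_measurable borel" unfolding b_def[abs_def]
      using B by (intro borel_measurable_sum borel_measurable_scaleR borel_measurable_const) simp
    have "AE h in lborel. \<forall>i\<in>Basis. inner (a h) i = B i h"
      using B by (intro AE_finite_allI finite_Basis) blast
    then have "AE h in lborel. a h = b h"
    proof eventually_elim
      case (elim h)
      have "b h = (\<Sum>i\<in>Basis. inner (a h) i *\<^sub>R i)" unfolding b_def using elim by (intro sum.cong) auto
      then show ?case by (simp only: euclidean_representation)
    qed
    then show "AE h in lebesgue. a h = b h" by (rule AE_completion)
  qed
qed

lemma atom_unitf:
  fixes a :: "'m::finite heis \<Rightarrow> quat"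
  assumes "atom p \<alpha> a"
  obtains x r m f where "r > 0" "m = measure lebesgue (hball x r) powr (- 1 / p)" "unitf x r f"
    "a \<in> borel_measurable lebesgue" "AE h in lebesgue. a h = m *\<^sub>R f h" "\<forall>P\<in>hpolys \<alpha>. (\<integral>h. P h * f h \<partial>lborel) = 0"
proof -
  obtain x r where r: "0 < r" and supp: "closure {g. a g \<noteq> 0} \<subseteq> hball x r" and aL: "a \<in> Linf"
    and aN: "Linf_norm a \<le> ennreal (measure lebesgue (hball x r) powr (- 1 / p))"
    and mom: "\<forall>P\<in>hpolys \<alpha>. (LINT g|lebesgue. P g * a g) = 0"
    using assms unfolding atom_def by blast
  define m where "m = measure lebesgue (hball x r) powr (- 1 / p)"
  have "measure lebesgue (hball x r) = measure lborel (hball x r)" by (rule measure_completion) simp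
  moreover have "measure lborel (hball x r) > 0"
    using hball_measure(3)[OF r, of x] vball_pos[of "TYPE('m)"] r by (intro less_le_trans[OF _ hball_measure(3)[OF r, of x]] mult_pos_pos divide_pos_pos) auto
  ultimately have m: "m > 0" by (simp add: m_def)
  have am: "a \<in> borel_measurable lebesgue" using aL by (simp add: Linf_def)
  obtain b where b: "b \<in> borel_measurable borel" and ab: "AE h in lebesgue. a h = b h"
    using lebesgue_AE_eq_borel[OF am] by blast
  \<comment> \<open>The Borel representative may leave the ball or exceed \<open>m\<close> on a null
    set; cutting it there makes the bounds hold everywhere and changes nothing almost
    everywhere.\<close>
  define S where "S = hball x r \<inter> {h. norm (b h) \<le> m}"
  have S: "S \<in> sets borel" unfolding S_def using b by measurable
  define f where "f h = indicator S h *\<^sub>R (b h /\<^sub>R m)" for h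
  have fb: "f \<in> borel_measurable borel" unfolding f_def[abs_def] using S b by measurable
  have unit: "unitf x r f"
    unfolding unitf_def
  proof (intro conjI allI impI fb)
    show "norm (f h) \<le> 1" for h using m by (auto simp: f_def S_def indicator_def divide_simps)
    show "h \<in> hball x r" if "f h \<noteq> 0" for h using that by (auto simp: f_def S_def indicator_def split: if_splits)
  qed
  have "AE h in lebesgue. ennreal (norm (a h)) \<le> Linf_norm a" unfolding Linf_norm_def by (rule esssup_AE)
  then have le: "AE h in lebesgue. norm (a h) \<le> m"
  proof eventually_elim
    case (elim h)
    then have "ennreal (norm (a h)) \<le> ennreal m" using aN unfolding m_def by (rule order_trans)
    then show ?case using m by (simp add: ennreal_le_iff)
  qed
  have af: "AE h in lebesgue. a h = m *\<^sub>R f h"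
    using ab le
  proof eventually_elim
    case (elim h)
    show ?case
    proof (cases "h \<in> hball x r")
      case True
      then have "h \<in> S" using elim by (simp add: S_def)
      then show ?thesis using elim(1) m by (simp add: f_def)
    next
      case False
      then have "a h = 0" using supp closure_subset[of "{g. a g \<noteq> 0}"] by blast
      then show ?thesis using False by (simp add: f_def S_def)
    qed
  qed
  have "\<forall>P\<in>hpolys \<alpha>. (\<integral>h. P h * f h \<partial>lborel) = 0"
  proof
    fix P :: "'m heis \<Rightarrow> quat" assume P: "P \<in> hpolys \<alpha>"
    have Pb: "P \<in> borel_measurable borel" by (rule borel_measurable_continuous_onI[OF hpolys_continuous[OF P]])
    then have Pl: "P \<in> borel_measurable lebesgue" by (intro measurable_completion) simp
    have Pf: "(\<lambda>h. P h * f h) \<in> borel_measurable lborel" using borel_measurable_times[OF Pb fb] by simp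
    have "0 = (\<integral>h. P h * a h \<partial>lebesgue)" using mom P by simp
    also have "\<dots> = (\<integral>h. m *\<^sub>R (P h * f h) \<partial>lebesgue)"
    proof (rule integral_cong_AE)
      show "(\<lambda>h. P h * a h) \<in> borel_measurable lebesgue" by (intro borel_measurable_times Pl am)
      show "(\<lambda>h. m *\<^sub>R (P h * f h)) \<in> borel_measurable lebesgue"
        by (intro borel_measurable_scaleR borel_measurable_const measurable_completion Pf)
      show "AE h in lebesgue. P h * a h = m *\<^sub>R (P h * f h)" using af by eventually_elim simp
    qed
    also have "\<dots> = m *\<^sub>R (\<integral>h. P h * f h \<partial>lborel)"
      by (simp only: integral_scaleR_right integral_completion[OF Pf])
    finally show "(\<integral>h. P h * f h \<partial>lborel) = 0" using m by simp
  qed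
  then show ?thesis using that[OF r m_def unit am af] by blast
qed

text \<open>No monomial has negative degree. Thus for negative \<open>\<alpha>\<close>, which the
  theorem admits only when \<open>p > 1\<close>, the moment condition is empty.\<close>

lemma hpolys_neg: "\<alpha> < 0 \<Longrightarrow> P \<in> hpolys \<alpha> \<Longrightarrow> P = (\<lambda>g. 0)"
proof -
  assume "\<alpha> < 0" "P \<in> hpolys \<alpha>"
  then obtain I c where I: "\<forall>i\<in>I. int (hdeg i) \<le> \<alpha>" and P: "P = (\<lambda>g. \<Sum>i\<in>I. hmonom i g *\<^sub>R c i)"
    unfolding hpolys_def by blast
  have "I = {}"
  proof (rule equals0I)
    fix i assume "i \<in> I"
    then have "int (hdeg i) \<le> \<alpha>" using I by blast
    then show False using \<open>\<alpha> < 0\<close> by linarith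
  qed
  then show "P = (\<lambda>g. 0)" by (simp add: P)
qed

theorem proposition1p1:
  fixes n :: nat and p :: real and \<alpha> :: int
  assumes "n \<ge> 2" and "CARD('m::finite) = n - 1"
    and "0 < p"
    and "\<alpha> \<ge> \<lfloor>real (4 * n + 2) * (1 / p - 1)\<rfloor>"
  shows "\<exists>C. \<forall>a :: 'm heis \<Rightarrow> quat. atom p \<alpha> a \<longrightarrow>
           cauchy_szego a \<in> hardy_space p \<and> hardy_norm p (cauchy_szego a) \<le> C"
proof -
  define Q where "Q = qdim TYPE('m)"
  define d where "d = szego_const TYPE('m)"
  have Q: "real Q = real (4 * n + 2)" using assms(1,2) by (simp add: Q_def qdim_def)
  \<comment> \<open>For \<open>\<alpha> \<ge> 0\<close> moments of degree at most
    \<open>N - 1 = \<alpha>\<close> vanish; for negative \<open>\<alpha>\<close> it is 0. As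
    \<open>\<alpha>\<close> is an integer, the floor condition becomes the strict inequality
    \<open>Q * (1 / p - 1) < \<alpha> + 1\<close>, which gives
    \<open>p * (Q + N) > Q\<close>.\<close>
  define N where "N = nat (\<alpha> + 1)"
  have N: "p * real (Q + N) > real Q"
  proof -
    have "real Q * (1 / p - 1) < real_of_int (\<alpha> + 1)" unfolding Q using assms(4) by linarith
    also have "\<dots> \<le> real N" by (simp add: N_def)
    finally have "p * (real Q * (1 / p - 1)) < p * real N" using assms(3) by (rule mult_strict_left_mono)
    moreover have "p * (real Q * (1 / p - 1)) = real Q - p * real Q" using assms(3) by (simp add: algebra_simps)
    ultimately show ?thesis by (simp add: algebra_simps)
  qed
  obtain C where C: "C > 0" "\<forall>\<epsilon>>0. \<forall>r>0. \<forall>x. \<forall>f :: 'm heis \<Rightarrow> quat. unitf x r f \<longrightarrow>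
     (\<forall>P\<in>hpolys (int N - 1). (\<integral>h. P h * f h \<partial>lborel) = 0) \<longrightarrow>
     (\<integral>\<^sup>+g. ennreal (norm (Top \<epsilon> f g) powr p) \<partial>lborel) \<le> ennreal (C * r ^ Q)"
    using Top_Lp[OF assms(3), of N, where 'm = 'm] N unfolding Q_def[symmetric] by blast
  define v where "v = vball TYPE('m) / 2 ^ Q"
  have v: "v > 0" using vball_pos[of "TYPE('m)"] by (simp add: v_def)
  \<comment> \<open>\<open>d\<close> is the normalising constant, a real number that depends on
    \<open>n\<close> only. The quotient \<open>C / v\<close> comes from the height of the atom: its
    p-th power is one over the measure of the ball and cancels the \<open>r ^ Q\<close> of the
    integral, so \<open>M\<close> is independent of the ball.\<close>
  define M where "M = \<bar>d\<bar> powr p * C / v"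
  have "M \<ge> 0" using C(1) v by (simp add: M_def)
  show ?thesis
  proof (intro exI[of _ "M powr (1 / p)"] allI impI)
    fix a :: "'m heis \<Rightarrow> quat" assume "atom p \<alpha> a"
    then obtain x r m f where r: "r > 0" and m: "m = measure lebesgue (hball x r) powr (- 1 / p)" and f: "unitf x r f"
      and a: "a \<in> borel_measurable lebesgue" "AE h in lebesgue. a h = m *\<^sub>R f h"
      and mom: "\<forall>P\<in>hpolys \<alpha>. (\<integral>h. P h * f h \<partial>lborel) = 0"
      by (rule atom_unitf) blast
    note bf = unitf_bbs[OF f]
    have mom': "\<forall>P\<in>hpolys (int N - 1). (\<integral>h. P h * f h \<partial>lborel) = 0"
    proof (cases "\<alpha> \<ge> 0")
      case True
      then show ?thesis using mom by (simp add: N_def)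
    next
      case False
      then have neg: "int N - 1 < 0" by (simp add: N_def)
      show ?thesis
      proof
        fix P :: "'m heis \<Rightarrow> quat" assume "P \<in> hpolys (int N - 1)"
        then have "P = (\<lambda>g. 0)" by (rule hpolys_neg[OF neg])
        then show "(\<integral>h. P h * f h \<partial>lborel) = 0" by simp
      qed
    qed
    define F where "F = cauchy_szego a"
    have F: "F (\<epsilon>, g) = (d * m) *\<^sub>R Top \<epsilon> f g" if "\<epsilon> > 0" for \<epsilon> g
      unfolding F_def cauchy_szego_def d_def[symmetric] by (rule szego_op_eq[OF bf a that])
    have reg: "regular F"
    proof (rule regular_Top[OF bf])
      fix z :: "'m siegel" assume "z \<in> siegel"
      then show "F z = (d * m) *\<^sub>R Top (fst z) f (snd z)" using F[of "fst z" "snd z"] by (simp add: siegel_iff)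
    qed
    have mp: "m powr p * (C * r ^ Q) \<le> C / v"
    proof -
      define \<mu> where "\<mu> = measure lborel (hball x r)"
      have \<mu>: "v * r ^ Q \<le> \<mu>" using hball_measure(3)[OF r, of x] by (simp add: \<mu>_def v_def Q_def)
      have vr: "v * r ^ Q > 0" using v r by simp
      have "m = \<mu> powr (- 1 / p)" unfolding m \<mu>_def by (subst measure_completion) simp_all
      then have "m powr p = \<mu> powr (- 1)" using assms(3) by (simp add: powr_powr)
      also have "\<dots> = 1 / \<mu>" using \<mu> vr by (simp add: powr_minus_divide)
      also have "\<dots> \<le> 1 / (v * r ^ Q)" using \<mu> vr by (intro divide_left_mono) auto
      finally have "m powr p * (C * r ^ Q) \<le> 1 / (v * r ^ Q) * (C * r ^ Q)" using C(1) r by (intro mult_right_mono) auto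
      also have "\<dots> = C / v" using v r by simp
      finally show ?thesis .
    qed
    have sup: "hardy_sup p F \<le> ennreal M"
      unfolding hardy_sup_def
    proof (rule SUP_least)
      fix \<epsilon> :: real assume "\<epsilon> \<in> {0<..}"
      then have e: "\<epsilon> > 0" by simp
      have meas: "(\<lambda>g. ennreal (norm (Top \<epsilon> f g) powr p)) \<in> borel_measurable lborel"
      proof -
        have [measurable]: "Top \<epsilon> f \<in> borel_measurable borel" by (rule Top_measurable[OF bf e])
        show ?thesis by measurable
      qed
      have "(\<integral>\<^sup>+g. ennreal (norm (F (\<epsilon>, g)) powr p) \<partial>lebesgue)
        = (\<integral>\<^sup>+g. ennreal (\<bar>d * m\<bar> powr p) * ennreal (norm (Top \<epsilon> f g) powr p) \<partial>lborel)"
        unfolding nn_integral_completion by (simp add: F[OF e] powr_mult ennreal_mult)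
      also have "\<dots> = ennreal (\<bar>d * m\<bar> powr p) * (\<integral>\<^sup>+g. ennreal (norm (Top \<epsilon> f g) powr p) \<partial>lborel)"
        by (rule nn_integral_cmult[OF meas])
      also have "\<dots> \<le> ennreal (\<bar>d * m\<bar> powr p) * ennreal (C * r ^ Q)"
        by (intro mult_left_mono C(2)[rule_format, OF e r f]) (use mom' in auto)
      also have "\<dots> = ennreal (\<bar>d\<bar> powr p * (m powr p * (C * r ^ Q)))"
        using C(1) r by (simp add: m abs_mult powr_mult ennreal_mult[symmetric] mult.assoc)
      also have "\<dots> \<le> ennreal M"
        using mult_left_mono[OF mp, of "\<bar>d\<bar> powr p"] by (intro ennreal_leI) (simp add: M_def)
      finally show "(\<integral>\<^sup>+g. ennreal (norm (F (\<epsilon>, g)) powr p) \<partial>lebesgue) \<le> ennreal M" .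
    qed
    have "enn2real (hardy_sup p F) \<le> M" by (rule enn2real_leI[OF \<open>M \<ge> 0\<close> sup])
    then have "hardy_norm p F \<le> M powr (1 / p)"
      unfolding hardy_norm_def using assms(3) by (intro powr_mono2) auto
    moreover have "F \<in> hardy_space p"
      using reg le_less_trans[OF sup ennreal_less_top] by (simp add: hardy_space_def)
    ultimately show "cauchy_szego a \<in> hardy_space p \<and> hardy_norm p (cauchy_szego a) \<le> M powr (1 / p)"
      by (simp add: F_def)
  qed
qed

end
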